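(* Assume that $g\in C^1(\mathbb R)$, $g(0)=0$; that there exists $\lambda\ge 0$ such that $g'(r)\ge-\lambda$ for all $r\in\mathbb R$; and that $\liminf_{|r|\to\infty}\big(g(r)r+(\lambda_1-\kappa)r^2\big)>0$ for some $\kappa>0$. Set $\beta(r):=g(r)+\lambda r$ and let $\widehat\beta$ be a primitive of $\beta$. Let $u_0\in\mathcal X_{\sigma0}$ with $\widehat\beta(u_0)\in L^1(\Omega)$. Then there exists one and only one weak solution $(u,w)$ of the fractional Cahn-Hilliard system on $(0,\infty)$ with initial datum $u_0$. Moreover, the function $t\mapsto \mathbb E_\sigma(u(t))$ is non-increasing and right-continuous in $[0,\infty)$ and differentiable a.e. in $(0,\infty)$. The function $t\mapsto u(t)$ is right-continuous on $[0,\infty)$ in the strong topology of $\mathcal X_{\sigma0}$. Furthermore, the following energy inequalities hold: $$\|w(t)\|_{\mathcal X_{s0}}^2+\frac{d}{dt}\mathbb E_\sigma(u(t))\le0\quad\text{for a.a. }t\in(0,\infty),$$ $$\langle u_t(t),\mathfrak A_\sigma u(t)+g(u(t))\rangle_{\mathcal X_{s0}}\ge\frac{d}{dt}\mathbb E_\sigma(u(t))\quad\text{for a.a. }t\in(0,\infty),$$ $$\int_\tau^t\|w(r)\|_{\mathcal X_{s0}}^2\,dr+\mathbb E_\sigma(u(t))\le\mathbb E_\sigma(u(\tau))\quad\text{for all }0\le\tau\le t.$$ Finally, for any $T>0$ there exists a constant $C_T>0$ such that $$\sup_{t\ge0}\int_t^{t+T}\|\beta(u(\tau))\|_{L^2(\Omega)}^2\,d\tau\le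 C_T.$$
   Context: $\Omega\subset\mathbb R^N$ is a bounded domain with smooth boundary and $s,\sigma\in(0,1)$. Functions in $L^p(\Omega)$ are identified with their extensions by zero to $\mathbb R^N$. For $a\in(0,1)$, $C_a>0$ denotes the normalization constant (depending only on $N$ and $a$) in the singular-integral definition $(-\Delta)^a u(x)=C_a\,\mathrm{p.v.}\int_{\mathbb R^N}\frac{u(x)-u(y)}{|x-y|^{N+2a}}dy$, and $$\mathcal X_{a0}:=\{v\in H^a(\mathbb R^N): v=0\text{ a.e. in }\mathbb R^N\setminus\Omega\},\qquad \|v\|_{\mathcal X_{a0}}^2:=\frac{C_a}{2}\iint_{\mathbb R^{2N}}\frac{|v(x)-v(y)|^2}{|x-y|^{N+2a}}\,dx\,dy,$$ a Hilbert space with dual $\mathcal X_{a0}'$; $\mathcal X_{a0}\hookrightarrow L^2(\Omega)\simeq L^2(\Omega)'\hookrightarrow\mathcal X_{a0}'$. The operator $\mathfrak A_a:\mathcal X_{a0}\to\mathcal X_{a0}'$ is defined by $$\langle\mathfrak A_a u,v\rangle_{\mathcal X_{a0}}=\frac{C_a}{2}\iint_{\mathbb R^{2N}}\frac{(u(x)-u(y))(v(x)-v(y))}{|x-y|^{N+2a}}\,dx\,dy .$$ $\lambda_1=\inf_{v\in\mathcal X_{\sigma0}\setminus\{0\}}\|v\|_{\mathcal X_{\sigma0}}^2/\|v\|_{L^2(\Omega)}^2>0$ is the first eigenvalue of the fractional Dirichlet Laplacian of order $\sigma$. Energy: with $\widehat g$ a fixed primitive of $g$, $\mathbb E_\sigma(v):=\frac12\|v\|_{\mathcal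 X_{\sigma0}}^2+\int_\Omega\widehat g(v(x))\,dx$ for $v\in\mathcal X_{\sigma0}$ with $\widehat g(v)^-\in L^1(\Omega)$ ($(\cdot)^-$ is the negative part). The fractional Cahn-Hilliard system is $u_t+(-\Delta)^s w=0$, $w=(-\Delta)^\sigma u+g(u)$ in $\Omega\times(0,\infty)$, $u|_{t=0}=u_0$ in $\Omega$, $u=w=0$ in $\mathbb R^N\setminus\Omega$. Weak solution: for $0\le S<T\le\infty$, $(u,w)$ is a weak solution on $(S,T)$ if $u\in C_w([S,T);\mathcal X_{\sigma0})$ (weakly continuous), $u_t\in L^2(S,T;\mathcal X_{s0}')$, $w\in L^2(S,T;\mathcal X_{s0})$, $g(u)\in L^2_{\rm loc}(S,T;L^2(\Omega))$, and for a.e. $t\in(S,T)$: $u_t(t)+\mathfrak A_s w(t)=0$ in $\mathcal X_{s0}'$ and $w(t)=\mathfrak A_\sigma u(t)+g(u(t))$ in $\mathcal X_{\sigma0}'$; if $S=0$, having initial datum $u_0$ means $u(0)=u_0$. Here $L^p_{\rm loc}(S,T;X)$ means $L^p(S,T;X)$ if $T<\infty$ and $L^p_{\rm loc}([S,\infty);X)$ if $T=\infty$. In the second energy inequality, $\mathfrak A_\sigma u(t)+g(u(t))$ is identified with $w(t)\in\mathcal X_{s0}$. *)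

theory Defs
  imports "HOL-Analysis.Analysis"
begin

primrec Ck :: "nat \<Rightarrow> ('a::euclidean_space \<Rightarrow> real) \<Rightarrow> bool" where
  "Ck 0 f = continuous_on UNIV f"
| "Ck (Suc k) f =
     ((\<forall>x. f differentiable (at x)) \<and> (\<forall>h. Ck k (\<lambda>x. frechet_derivative f (at x) h)))"

definition smooth :: "('a::euclidean_space \<Rightarrow> real) \<Rightarrow> bool" where
  "smooth f \<longleftrightarrow> (\<forall>k. Ck k f)"

text \<open>
  Near each boundary point the set is the strict epigraph, in some unit direction \<open>e\<close>, of a
  smooth function of the remaining coordinates. The latter is written as a function on the whole
  space that is evaluated only at the projection of \<open>x\<close> to the hyperplane orthogonal to \<open>e\<close>.
\<close>
definition smooth_boundary :: "'a::euclidean_space set \<Rightarrow> bool" where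
  "smooth_boundary \<Omega> \<longleftrightarrow>
     (\<forall>p\<in>frontier \<Omega>. \<exists>r>0. \<exists>e \<gamma>. norm e = 1 \<and> smooth \<gamma> \<and>
        \<Omega> \<inter> ball p r = {x \<in> ball p r. \<gamma> (x - (x \<bullet> e) *\<^sub>R e) < x \<bullet> e})"

definition bounded_smooth_domain :: "'a::euclidean_space set \<Rightarrow> bool" where
  "bounded_smooth_domain \<Omega> \<longleftrightarrow>
     open \<Omega> \<and> connected \<Omega> \<and> \<Omega> \<noteq> {} \<and> bounded \<Omega> \<and> smooth_boundary \<Omega>"

text \<open>
  A normed space whose elements are classes of functions (modulo equality almost everywhere) is
  represented by the set \<open>X\<close> of all representatives together with the induced seminorm \<open>nrm\<close>.
  Functionals are compared on \<open>X\<close> only. The dual of such a space is again of this form.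
\<close>

definition dual_space :: "('b \<Rightarrow> real) set \<Rightarrow> (('b \<Rightarrow> real) \<Rightarrow> real) \<Rightarrow> (('b \<Rightarrow> real) \<Rightarrow> real) set" where
  "dual_space X nrm =
     {F. (\<forall>u\<in>X. \<forall>v\<in>X. \<forall>a b. F (\<lambda>x. a * u x + b * v x) = a * F u + b * F v) \<and>
         (\<exists>C. \<forall>v\<in>X. \<bar>F v\<bar> \<le> C * nrm v)}"

definition dual_norm :: "('b \<Rightarrow> real) set \<Rightarrow> (('b \<Rightarrow> real) \<Rightarrow> real) \<Rightarrow> (('b \<Rightarrow> real) \<Rightarrow> real) \<Rightarrow> real" where
  "dual_norm X nrm F = (SUP v \<in> {v \<in> X. nrm v \<le> 1}. \<bar>F v\<bar>)"

definition weakly_continuous_on ::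
    "('b \<Rightarrow> real) set \<Rightarrow> (('b \<Rightarrow> real) \<Rightarrow> real) \<Rightarrow> real set \<Rightarrow> (real \<Rightarrow> 'b \<Rightarrow> real) \<Rightarrow> bool" where
  "weakly_continuous_on X nrm J u \<longleftrightarrow>
     (\<forall>t\<in>J. u t \<in> X) \<and> (\<forall>F \<in> dual_space X nrm. continuous_on J (\<lambda>t. F (u t)))"

text \<open>Strong measurability: almost everywhere limit, in norm, of simple functions.\<close>
definition bochner_measurable ::
    "('b \<Rightarrow> real) set \<Rightarrow> (('b \<Rightarrow> real) \<Rightarrow> real) \<Rightarrow> real set \<Rightarrow> (real \<Rightarrow> 'b \<Rightarrow> real) \<Rightarrow> bool" where
  "bochner_measurable X nrm I f \<longleftrightarrow>
     (\<exists>\<phi>. (\<forall>n::nat. simple_function (lebesgue_on I) (\<phi> n) \<and> \<phi> n ` I \<subseteq> X) \<and>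
          (AE t in lebesgue_on I. (\<lambda>n. nrm (\<lambda>x. \<phi> n t x - f t x)) \<longlonglongrightarrow> 0))"

definition bochner_L2 ::
    "('b \<Rightarrow> real) set \<Rightarrow> (('b \<Rightarrow> real) \<Rightarrow> real) \<Rightarrow> real set \<Rightarrow> (real \<Rightarrow> 'b \<Rightarrow> real) \<Rightarrow> bool" where
  "bochner_L2 X nrm I f \<longleftrightarrow>
     (AE t in lebesgue_on I. f t \<in> X) \<and> bochner_measurable X nrm I f \<and>
     integrable (lebesgue_on I) (\<lambda>t. (nrm (f t))\<^sup>2)"

definition open_itv :: "real \<Rightarrow> ereal \<Rightarrow> real set" where
  "open_itv S T = {t. S < t \<and> ereal t < T}"

definition right_open_itv :: "real \<Rightarrow> ereal \<Rightarrow> real set" where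
  "right_open_itv S T = {t. S \<le> t \<and> ereal t < T}"

text \<open>
  Localization is only at infinity: for finite \<open>T\<close> this is the global space on \<open>(S,T)\<close>, and for
  infinite \<open>T\<close> it is the local space on the half-line closed at \<open>S\<close>.
\<close>
definition bochner_L2_loc ::
    "('b \<Rightarrow> real) set \<Rightarrow> (('b \<Rightarrow> real) \<Rightarrow> real) \<Rightarrow> real \<Rightarrow> ereal \<Rightarrow> (real \<Rightarrow> 'b \<Rightarrow> real) \<Rightarrow> bool" where
  "bochner_L2_loc X nrm S T f \<longleftrightarrow>
     (if T = \<infinity> then \<forall>R>S. bochner_L2 X nrm {S<..<R} f
      else bochner_L2 X nrm (open_itv S T) f)"

text \<open>Values outside \<open>\<Omega>\<close> are ignored, so functions on the whole space are restricted implicitly.\<close>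
definition L2 :: "'a::euclidean_space set \<Rightarrow> ('a \<Rightarrow> real) set" where
  "L2 \<Omega> = {v \<in> borel_measurable (lebesgue_on \<Omega>). integrable (lebesgue_on \<Omega>) (\<lambda>x. (v x)\<^sup>2)}"

definition L2_norm :: "'a::euclidean_space set \<Rightarrow> ('a \<Rightarrow> real) \<Rightarrow> real" where
  "L2_norm \<Omega> v = sqrt (\<integral>x. (v x)\<^sup>2 \<partial>lebesgue_on \<Omega>)"

definition L2_embed :: "'a::euclidean_space set \<Rightarrow> ('a \<Rightarrow> real) \<Rightarrow> ('a \<Rightarrow> real) \<Rightarrow> real" where
  "L2_embed \<Omega> f v = (\<integral>x. f x * v x \<partial>lebesgue_on \<Omega>)"

text \<open>
  The constant for which the singular integral is the Fourier multiplier \<open>|\<xi>|\<close> to the power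
  \<open>2 * a\<close>. The type parameter only provides the dimension.
\<close>
definition frac_const :: "'a::euclidean_space itself \<Rightarrow> real \<Rightarrow> real" where
  "frac_const _ a =
     a * 4 powr a * Gamma (real DIM('a) / 2 + a) / (pi powr (real DIM('a) / 2) * Gamma (1 - a))"

definition gagliardo :: "real \<Rightarrow> ('a::euclidean_space \<Rightarrow> real) \<Rightarrow> ('a \<Rightarrow> real) \<Rightarrow> 'a \<times> 'a \<Rightarrow> real" where
  "gagliardo a u v =
     (\<lambda>(x, y). (u x - u y) * (v x - v y) / norm (x - y) powr (real DIM('a) + 2 * a))"

definition H_frac :: "real \<Rightarrow> ('a::euclidean_space \<Rightarrow> real) set" where
  "H_frac a = {v \<in> borel_measurable lebesgue.
     integrable lebesgue (\<lambda>x. (v x)\<^sup>2) \<and> integrable lebesgue (gagliardo a v v)}"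

definition X0 :: "'a::euclidean_space set \<Rightarrow> real \<Rightarrow> ('a \<Rightarrow> real) set" where
  "X0 \<Omega> a = {v \<in> H_frac a. AE x in lebesgue. x \<notin> \<Omega> \<longrightarrow> v x = 0}"

definition frac_op :: "real \<Rightarrow> ('a::euclidean_space \<Rightarrow> real) \<Rightarrow> ('a \<Rightarrow> real) \<Rightarrow> real" where
  "frac_op a u v = frac_const TYPE('a) a / 2 * (\<integral>z. gagliardo a u v z \<partial>lebesgue)"

definition X0_norm :: "real \<Rightarrow> ('a::euclidean_space \<Rightarrow> real) \<Rightarrow> real" where
  "X0_norm a v = sqrt (frac_const TYPE('a) a / 2 *
     (\<integral>(x, y). \<bar>v x - v y\<bar>\<^sup>2 / norm (x - y) powr (real DIM('a) + 2 * a) \<partial>lebesgue))"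

definition first_eigenvalue :: "'a::euclidean_space set \<Rightarrow> real \<Rightarrow> real" where
  "first_eigenvalue \<Omega> a =
     (INF v \<in> {v \<in> X0 \<Omega> a. \<not> (AE x in lebesgue. v x = 0)}. (X0_norm a v)\<^sup>2 / (L2_norm \<Omega> v)\<^sup>2)"

text \<open>Meaningful when \<open>ghat \<circ> v\<close> is integrable on the domain, that is, when the energy is finite.\<close>
definition energy ::
    "'a::euclidean_space set \<Rightarrow> real \<Rightarrow> (real \<Rightarrow> real) \<Rightarrow> ('a \<Rightarrow> real) \<Rightarrow> real" where
  "energy \<Omega> a ghat v = (X0_norm a v)\<^sup>2 / 2 + (\<integral>x. ghat (v x) \<partial>lebesgue_on \<Omega>)"

definition test_function :: "real set \<Rightarrow> (real \<Rightarrow> real) \<Rightarrow> bool" where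
  "test_function I \<phi> \<longleftrightarrow> smooth \<phi> \<and> (\<exists>K. compact K \<and> K \<subseteq> I \<and> (\<forall>t. t \<notin> K \<longrightarrow> \<phi> t = 0))"

text \<open>
  Distributional derivative on \<open>I\<close> of a function with values in the dual of \<open>X0 \<Omega> a\<close>, the values of
  \<open>u\<close> being embedded in that dual. Integrals of dual-valued functions are evaluated at each \<open>v\<close>.
\<close>
definition weak_time_derivative ::
    "'a::euclidean_space set \<Rightarrow> real \<Rightarrow> real set \<Rightarrow> (real \<Rightarrow> 'a \<Rightarrow> real) \<Rightarrow>
     (real \<Rightarrow> ('a \<Rightarrow> real) \<Rightarrow> real) \<Rightarrow> bool" where
  "weak_time_derivative \<Omega> a I u u' \<longleftrightarrow>
     (\<forall>\<phi>. test_function I \<phi> \<longrightarrow> (\<forall>v \<in> X0 \<Omega> a.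
        (\<integral>t. deriv \<phi> t * L2_embed \<Omega> (u t) v \<partial>lebesgue_on I) =
        - (\<integral>t. \<phi> t * u' t v \<partial>lebesgue_on I)))"

definition L2_time_derivative ::
    "'a::euclidean_space set \<Rightarrow> real \<Rightarrow> real set \<Rightarrow> (real \<Rightarrow> 'a \<Rightarrow> real) \<Rightarrow>
     (real \<Rightarrow> ('a \<Rightarrow> real) \<Rightarrow> real) \<Rightarrow> bool" where
  "L2_time_derivative \<Omega> a I u u' \<longleftrightarrow>
     bochner_L2 (dual_space (X0 \<Omega> a) (X0_norm a)) (dual_norm (X0 \<Omega> a) (X0_norm a)) I u' \<and>
     weak_time_derivative \<Omega> a I u u'"

definition weak_solution ::
    "'a::euclidean_space set \<Rightarrow> real \<Rightarrow> real \<Rightarrow> (real \<Rightarrow> real) \<Rightarrow> real \<Rightarrow> ereal \<Rightarrow>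
     (real \<Rightarrow> 'a \<Rightarrow> real) \<Rightarrow> (real \<Rightarrow> 'a \<Rightarrow> real) \<Rightarrow> bool" where
  "weak_solution \<Omega> s \<sigma> g S T u w \<longleftrightarrow>
     weakly_continuous_on (X0 \<Omega> \<sigma>) (X0_norm \<sigma>) (right_open_itv S T) u \<and>
     bochner_L2 (X0 \<Omega> s) (X0_norm s) (open_itv S T) w \<and>
     bochner_L2_loc (L2 \<Omega>) (L2_norm \<Omega>) S T (\<lambda>t x. g (u t x)) \<and>
     (\<exists>u'. L2_time_derivative \<Omega> s (open_itv S T) u u' \<and>
        (AE t in lebesgue_on (open_itv S T).
           (\<forall>v \<in> X0 \<Omega> s. u' t v + frac_op s (w t) v = 0) \<and>
           (\<forall>v \<in> X0 \<Omega> \<sigma>. L2_embed \<Omega> (w t) v =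
              frac_op \<sigma> (u t) v + L2_embed \<Omega> (\<lambda>x. g (u t x)) v)))"

definition weak_solution_from ::
    "'a::euclidean_space set \<Rightarrow> real \<Rightarrow> real \<Rightarrow> (real \<Rightarrow> real) \<Rightarrow> ereal \<Rightarrow> ('a \<Rightarrow> real) \<Rightarrow>
     (real \<Rightarrow> 'a \<Rightarrow> real) \<Rightarrow> (real \<Rightarrow> 'a \<Rightarrow> real) \<Rightarrow> bool" where
  "weak_solution_from \<Omega> s \<sigma> g T u0 u w \<longleftrightarrow>
     weak_solution \<Omega> s \<sigma> g 0 T u w \<and> (AE x in lebesgue. u 0 x = u0 x)"

end

theory Submission
 imports Defs "HOL-Analysis.Analysis"
begin

text \<open>The system is the gradient flow of the energy \<open>\<Phi>\<close> in the dual of \<open>X0 \<Omega> s\<close>: with the Riesz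
 representative \<open>U\<close> of \<open>u\<close> it reads \<open>U' = - W\<close>, \<open>W\<close> a subgradient of \<open>\<Phi>\<close> at \<open>U\<close>. Since \<open>g' \<ge> -\<lambda>\<close>, Ehrling's
 inequality (\<open>L\<^sup>2\<close> lies compactly between \<open>X0 \<Omega> \<sigma>\<close> and the dual) makes \<open>\<Phi>\<close> semiconvex in the dual norm,
 and the condition on \<open>\<kappa>\<close> makes it bounded below. The flow of the Moreau-Yosida regularization converges,
 and its limit dissipates energy. Testing with truncations of \<open>\<beta> \<circ> u\<close> identifies subgradients with the Euler
 equation \<open>w = A u + g u\<close> and bounds \<open>\<beta> \<circ> u\<close> in \<open>L\<^sup>2\<close>. Two solutions are compared by Gronwall; hence any weak
 solution is the constructed one and inherits its properties.\<close>

text \<open>No growth bound on \<open>g\<close> is assumed, so the energy is neither finite on all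
  of \<open>X0 \<Omega> \<sigma>\<close> nor differentiable there, and \<beta> composed with
  \<open>u\<close> has no integrability a priori: the equation can only be read off from
  subgradients, tested where \<open>u\<close> is bounded. The dual of \<open>X0 \<Omega> s\<close>
  is not built as a space of its own. The map \<open>emb\<close> sends \<open>v\<close> to its
  normalized difference quotient in L2 over pairs of points, isometrically onto a closed subspace,
  and functionals are represented by elements of this subspace. One complete type of square
  integrable classes thus carries both fractional spaces and the flow. Density of Lipschitz test
  functions makes the subgradient unique; this turns cluster points of subgradients into weak limits
  and makes \<open>W\<close> weakly continuous. The almost decreasing norm of \<open>W\<close> then
  gives strong right-continuity, the time regularity behind Bochner measurability and the energy
  balance. For a competing weak solution no chain rule for the squared dual norm is at hand, so the
  comparison works with increments over short intervals instead of derivatives.\<close>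

abbreviation (input) LIMSEQ_ascii (infixr "---->" 60)
 where "f ----> l == f \<longlonglongrightarrow> l"

section \<open>Convexity and Riesz representation in Hilbert spaces\<close>

lemma le_of_square_le_mult: "(a::real)^2 <= K * a ==> 0 <= K ==> 0 <= a ==> a <= K"
 by (cases "a = 0") (auto simp: power2_eq_square)

lemma parallelogram_diff:
 fixes x y :: "'h::real_inner"
 shows "(norm (x - y))^2 = 2 * (norm x)^2 + 2 * (norm y)^2 - (norm (x + y))^2"
 by (simp add: power2_norm_eq_inner inner_add_left inner_add_right inner_diff_left inner_diff_right inner_commute)

text \<open>This replaces weak compactness of balls. The point is the limit of almost minimal elements of
 the convex hulls of the tails, which are nested.\<close>
lemma bounded_seq_convex_cluster:
 fixes w :: "nat => 'h::{real_inner,banach}"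
 assumes bd: "!!n. norm (w n) <= M"
 obtains p where "!!S. closed S ==> convex S ==> eventually (%n. w n \<in> S) sequentially ==> p \<in> S"
proof -
 define K where "K n = convex hull (w ` {n..})" for n
 have cK: "convex (K n)" for n by (simp add: K_def)
 have KM: "m >= n ==> K m \<subseteq> K n" for m n
  unfolding K_def by (intro hull_mono image_mono) auto
 have wK: "w n \<in> K n" for n unfolding K_def by (meson atLeast_iff hull_inc imageI order_refl)
 define e where "e n = (INF x\<in>K n. (norm x)^2)" for n
 have bb: "bdd_below ((%x. (norm x)^2) ` K n)" for n by (rule bdd_belowI[of _ 0]) auto
 have le: "x \<in> K n ==> e n <= (norm x)^2" for x n
  unfolding e_def by (rule cINF_lower[OF bb])
 have ex: "\<exists>x\<in>K n. (norm x)^2 < e n + 1 / real (Suc n)" for n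
 proof -
  have "e n < e n + 1 / real (Suc n)" by simp
  moreover have "K n \<noteq> {}" using wK by auto
  ultimately show ?thesis using cINF_less_iff[OF _ bb, of n "e n + 1 / real (Suc n)"] unfolding e_def[symmetric] by blast
 qed
 then obtain p where pK: "!!n. p n \<in> K n" and pe: "!!n. (norm (p n))^2 < e n + 1 / real (Suc n)"
  by metis
 have em: "incseq e"
  unfolding incseq_def e_def by (intro allI impI cINF_superset_mono bb KM) (use wK in auto)
 have "e n <= M^2" for n
  using le[OF wK, of n] bd[of n] by (meson norm_ge_zero order_trans power_mono)
 then obtain E where E: "e ----> E" and eE: "!!n. e n <= E"
  using incseq_convergent[OF em] by blast
 \<comment> \<open>The midpoint of \<open>p n\<close> and \<open>p m\<close> stays in
   \<open>K n\<close>, so its squared norm is at least \<open>e n\<close>; the parallelogram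
   identity turns this into a bound on the distance.\<close>
 have est: "(norm (p n - p m))^2 <= 2 * (E - e n) + 4 / real (Suc n)" if "n <= m" for n m
 proof -
  have "p m \<in> K n" using KM[OF that] pK by auto
  hence "(1/2) *\<^sub>R p n + (1/2) *\<^sub>R p m \<in> K n" using cK[of n] pK[of n] by (auto intro: convexD)
  from le[OF this] have "e n <= (norm ((1/2) *\<^sub>R (p n + p m)))^2" by (simp add: scaleR_add_right)
  hence 1: "4 * e n <= (norm (p n + p m))^2" by (simp add: power_divide)
  have "1 / real (Suc m) <= 1 / real (Suc n)" using that by (simp add: frac_le)
  moreover have "4 / real (Suc n) = 4 * (1 / real (Suc n))" by simp
  moreover define a b where "a = 1 / real (Suc n)" and "b = 1 / real (Suc m)"
  ultimately show ?thesis using 1 pe[of n] pe[of m] eE[of m]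
   unfolding parallelogram_diff a_def[symmetric] b_def[symmetric] by argo
 qed
 have "Cauchy p"
 proof (rule metric_CauchyI)
  fix r :: real assume r: "r > 0"
  have "(%n. 2 * (E - e n) + 4 / real (Suc n)) ----> 2 * (E - E) + 4 * 0"
   using E LIMSEQ_inverse_real_of_nat by (intro tendsto_intros) (auto simp: divide_inverse intro!: tendsto_intros)
  hence "eventually (%n. 2 * (E - e n) + 4 / real (Suc n) < (r/2)^2) sequentially"
   using r by (intro order_tendstoD(2)) auto
  then obtain N where N: "2 * (E - e N) + 4 / real (Suc N) < (r/2)^2"
   using eventually_happens trivial_limit_sequentially by blast
  have d: "dist (p N) (p m) < r/2" if "m >= N" for m
  proof -
   have "(norm (p N - p m))^2 < (r/2)^2" using est[OF that] N by (rule order_le_less_trans)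
   thus ?thesis unfolding dist_norm by (rule power2_less_imp_less) (use r in simp)
  qed
  show "EX N. \<forall>m\<ge>N. \<forall>n\<ge>N. dist (p m) (p n) < r"
   using d by (metis dist_commute dist_triangle_half_r)
 qed
 then obtain q where q: "p ----> q" using Cauchy_convergent convergent_def by blast
 show thesis
 proof (rule that)
  fix S assume S: "closed S" "convex S" "eventually (%n. w n \<in> S) sequentially"
  then obtain N where N: "!!n. n >= N ==> w n \<in> S" unfolding eventually_sequentially by blast
  have "K n \<subseteq> S" if "n >= N" for n
   unfolding K_def using that N S(2) by (intro hull_minimal) auto
  hence "eventually (%n. p n \<in> S) sequentially"
   using pK by (auto simp: eventually_sequentially intro!: exI[of _ N])
  thus "q \<in> S" using Lim_in_closed_set[OF S(1) _ trivial_limit_sequentially q] by blast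
 qed
qed

text \<open>A midpoint gains \<open>\<gamma> * (norm (u - v))^2\<close>, so near-minimizers are
  close to each other and every minimizing sequence is Cauchy; compactness does not enter. The last
  assumption joins closedness of \<open>S\<close> to lower semicontinuity of \<open>Q\<close> along
  sublevels. The lemma serves both Riesz representatives and the resolvent of the energy.\<close>

lemma uniformly_midpoint_convex_minimizer:
 fixes Q :: "'h::banach => real"
 assumes ne: "S \<noteq> {}" and lb: "!!v. v \<in> S ==> b <= Q v" and g: "\<gamma> > 0"
  and mid: "!!u v. u \<in> S ==> v \<in> S ==> (1/2) *\<^sub>R (u + v) \<in> S &
        Q ((1/2) *\<^sub>R (u + v)) <= (Q u + Q v) / 2 - \<gamma> * (norm (u - v))^2"
  and closed: "!!x l c. (!!n. x n \<in> S) ==> x ----> l ==> (!!n::nat. Q (x n) <= c) ==> l \<in> S & Q l <= c"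
 obtains p where "p \<in> S" "!!v. v \<in> S ==> Q p <= Q v"
proof -
 define q where "q = (INF v\<in>S. Q v)"
 have bb: "bdd_below (Q ` S)" by (rule bdd_belowI[of _ b]) (use lb in auto)
 have qle: "v \<in> S ==> q <= Q v" for v unfolding q_def by (rule cINF_lower[OF bb])
 have "\<exists>x\<in>S. Q x < q + 1 / real (Suc n)" for n
 proof -
  have "q < q + 1 / real (Suc n)" by simp
  thus ?thesis using cINF_less_iff[OF ne bb, of "q + 1 / real (Suc n)"] unfolding q_def[symmetric] by blast
 qed
 then obtain x where xS: "!!n. x n \<in> S" and xq: "!!n. Q (x n) < q + 1 / real (Suc n)" by metis
 have est: "\<gamma> * (norm (x n - x m))^2 <= 1 / real (Suc n)" if "n <= m" for n m
 proof -
  have "1 / real (Suc m) <= 1 / real (Suc n)" using that by (simp add: frac_le)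
  moreover define a b where "a = 1 / real (Suc n)" and "b = 1 / real (Suc m)"
  ultimately show ?thesis using mid[OF xS xS, of n m] qle[of "(1/2) *\<^sub>R (x n + x m)"] xq[of n] xq[of m]
   unfolding a_def[symmetric] b_def[symmetric] by argo
 qed
 have "Cauchy x"
 proof (rule metric_CauchyI)
  fix r :: real assume r: "r > 0"
  hence "\<gamma> * (r/2)^2 > 0" using g by simp
  then obtain N where N: "1 / real (Suc N) < \<gamma> * (r/2)^2" using nat_approx_posE by blast
  have d: "dist (x N) (x m) < r/2" if "m >= N" for m
  proof -
   have "\<gamma> * (norm (x N - x m))^2 < \<gamma> * (r/2)^2" using est[OF that] N by (rule order_le_less_trans)
   hence "(norm (x N - x m))^2 < (r/2)^2" using g by simp
   thus ?thesis unfolding dist_norm by (rule power2_less_imp_less) (use r in simp)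
  qed
  show "EX N. \<forall>m\<ge>N. \<forall>n\<ge>N. dist (x m) (x n) < r"
   using d by (metis dist_commute dist_triangle_half_r)
 qed
 then obtain p where p: "x ----> p" using Cauchy_convergent convergent_def by blast
 have *: "p \<in> S & Q p <= q + 1 / real (Suc k)" for k
 proof (rule closed[of "%n. x (n + k)"])
  show "(%n. x (n + k)) ----> p" using p by (rule LIMSEQ_ignore_initial_segment)
  fix n have "1 / real (Suc (n + k)) <= 1 / real (Suc k)" by (simp add: frac_le)
  thus "Q (x (n + k)) <= q + 1 / real (Suc k)" using xq[of "n + k"] by linarith
 qed (rule xS)
 have "Q p <= q"
 proof (rule field_le_epsilon)
  fix e :: real assume "e > 0"
  then obtain k where "1 / real (Suc k) < e" using nat_approx_posE by blast
  thus "Q p <= q + e" using *[of k] by linarith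
 qed
 thus thesis using that[of p] * qle by (meson order_trans)
qed

text \<open>The representative minimizes \<open>(norm v)^2 / 2 - f v\<close>: the parallelogram
  identity supplies the modulus 1/8, completing the square the lower bound. Linearity of
  \<open>f\<close> is asked for on \<open>V\<close> only, because later functionals are defined
  through a choice on a subspace of a larger type.\<close>

lemma Riesz_representation_subspace:
 fixes V :: "'h::{real_inner,banach} set" and f :: "'h => real"
 assumes V: "subspace V" "closed V"
  and lin: "!!u v a b. u \<in> V ==> v \<in> V ==> f (a *\<^sub>R u + b *\<^sub>R v) = a * f u + b * f v"
  and bd: "!!v. v \<in> V ==> \<bar>f v\<bar> <= K * norm v"
 obtains U where "U \<in> V" "!!v. v \<in> V ==> f v = U \<bullet> v"
proof -
 define Q where "Q v = (norm v)^2 / 2 - f v" for v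
 have "V \<noteq> {}" using V(1) subspace_0 by blast
 then obtain p where p: "p \<in> V" "!!v. v \<in> V ==> Q p <= Q v"
 proof (rule uniformly_midpoint_convex_minimizer[of V "- K\<^sup>2 / 2" Q "1/8"])
  fix v assume v: "v \<in> V"
  have "f v <= K * norm v" using bd[OF v] by linarith
  moreover have "0 <= (norm v - K)^2" by simp
  ultimately show "- K\<^sup>2 / 2 <= Q v" unfolding Q_def by (simp add: power2_eq_square algebra_simps)
 next
  fix u v assume u: "u \<in> V" and v: "v \<in> V"
  have "f ((1/2) *\<^sub>R (u + v)) = (f u + f v) / 2"
   using lin[OF u v, of "1/2" "1/2"] by (simp add: scaleR_add_right)
  moreover have "(norm ((1/2) *\<^sub>R (u + v)))^2 = (norm (u + v))^2 / 4" by (simp add: power_divide)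
  moreover have "(1/2) *\<^sub>R (u + v) \<in> V" using u v V(1) by (simp add: subspace_add subspace_mul)
  ultimately show "(1/2) *\<^sub>R (u + v) \<in> V & Q ((1/2) *\<^sub>R (u + v)) <= (Q u + Q v) / 2 - 1/8 * (norm (u - v))^2"
   unfolding Q_def parallelogram_diff by (simp add: field_simps)
 next
  fix x l c assume x: "!!n::nat. x n \<in> V" "x ----> l" "!!n::nat. Q (x n) <= c"
  have l: "l \<in> V" using closed_sequentially[OF V(2)] x by blast
  have "(%n. f (x n)) ----> f l"
  proof (rule LIM_zero_cancel, rule Lim_null_comparison)
   show "\<forall>\<^sub>F n in sequentially. norm (f (x n) - f l) <= K * norm (x n - l)"
   proof (intro always_eventually allI)
    fix n
    have "f (x n - l) = f (x n) - f l" using lin[OF x(1)[of n] l, of 1 "-1"] by simp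
    thus "norm (f (x n) - f l) <= K * norm (x n - l)"
     using bd[of "x n - l"] x(1) l V(1) by (simp add: subspace_diff)
   qed
   have "(%n. norm (x n - l)) ----> 0" using x(2) by (simp add: LIM_zero tendsto_norm_zero)
   thus "(%n. K * norm (x n - l)) ----> 0" using tendsto_mult_right_zero by blast
  qed
  hence "(%n. Q (x n)) ----> Q l" unfolding Q_def using x(2) by (intro tendsto_intros) auto
  thus "l \<in> V & Q l <= c" using l x(3) LIMSEQ_le_const2 by blast
 qed auto
 have "f v = p \<bullet> v" if v: "v \<in> V" for v
 proof -
  have h: "h * (p \<bullet> v - f v) + h^2 * (norm v)^2 / 2 >= 0" for h
  proof -
   have "p + h *\<^sub>R v \<in> V" using p v V(1) by (simp add: subspace_add subspace_mul)
   moreover have "f (p + h *\<^sub>R v) = f p + h * f v" using lin[OF p(1) v, of 1 h] by simp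
   moreover have "(norm (p + h *\<^sub>R v))^2 = (norm p)^2 + 2 * h * (p \<bullet> v) + h^2 * (norm v)^2"
    unfolding power2_norm_eq_inner
    by (simp add: inner_add_left inner_add_right inner_commute power2_eq_square algebra_simps)
   ultimately show ?thesis using p(2)[of "p + h *\<^sub>R v"] unfolding Q_def by (simp add: field_simps)
  qed
  have "p \<bullet> v - f v = 0"
  proof (rule ccontr)
   assume ne: "p \<bullet> v - f v \<noteq> 0"
   define d where "d = p \<bullet> v - f v"
   define A where "A = (norm v)^2 + 1"
   have A: "A > 0" unfolding A_def by (simp add: add_nonneg_pos)
   \<comment> \<open>The step \<open>h = - d / A\<close> makes the linear term win over the
     quadratic one; \<open>A\<close> exceeds the squared norm of \<open>v\<close> by one, so it is
     positive also for \<open>v = 0\<close>.\<close>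
   have "(-d/A) * d + (-d/A)^2 * (A - 1) / 2 >= 0" using h[of "-d/A"] unfolding d_def A_def by simp
   moreover have "(-d/A) * d + (-d/A)^2 * (A - 1) / 2 = - (d^2 * (A + 1)) / (2 * A^2)"
    using A by (simp add: field_simps power2_eq_square)
   moreover have "d^2 * (A + 1) / (2 * A^2) > 0" using A ne d_def by simp
   ultimately show False by simp
  qed
  thus ?thesis by simp
 qed
 thus thesis using that p(1) by blast
qed

lemma orthogonal_projection_subspace:
 fixes V :: "'h::{real_inner,banach} set"
 assumes "subspace V" "closed V"
 obtains p where "p \<in> V" "!!v. v \<in> V ==> x \<bullet> v = p \<bullet> v"
proof (rule Riesz_representation_subspace[OF assms, of "%v. x \<bullet> v" "norm x"])
 show "\<bar>x \<bullet> v\<bar> <= norm x * norm v" for v by (rule Cauchy_Schwarz_ineq2)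
qed (auto simp: inner_add_right that)

section \<open>Lipschitz differential equations in Banach spaces\<close>

text \<open>Picard iteration in the norm weighted by \<open>exp (- 2 * L * t)\<close>, for which the
  integral operator has Lipschitz constant 1/2 on the whole half-line at once. The fixed point
  \<open>g\<close> is the weighted solution: \<open>U t\<close> is \<open>exp (2 * L * t)\<close>
  times \<open>g t\<close>.\<close>

lemma Lipschitz_ode_solution:
 fixes F :: "'h::banach => 'h"
 assumes lip: "!!x y. norm (F x - F y) <= L * norm (x - y)" and L: "L > 0"
 obtains U where "U 0 = x0" "!!t. t >= 0 ==> (U has_vector_derivative F (U t)) (at t within {0..})"
proof -
 have Fc: "continuous_on UNIV F"
  by (rule lipschitz_on_continuous_on[of L]) (use lip L in \<open>auto simp: lipschitz_on_def dist_norm\<close>)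
 define h where "h g r = F (exp (2 * L * r) *\<^sub>R apply_bcontfun g r)" for g :: "real \<Rightarrow>\<^sub>C 'h" and r
 have hc: "continuous_on S (h g)" for g S
 proof -
  have "continuous_on UNIV (%r. exp (2 * L * r) *\<^sub>R apply_bcontfun g r)" by (intro continuous_intros continuous_on_apply_bcontfun)
  hence "continuous_on UNIV (F \<circ> (%r. exp (2 * L * r) *\<^sub>R apply_bcontfun g r))"
   by (intro continuous_on_compose) (auto intro: continuous_on_subset[OF Fc])
  thus ?thesis unfolding h_def o_def by (rule continuous_on_subset) auto
 qed
 have hi: "h g integrable_on {a..b}" for g a b by (rule integrable_continuous_real[OF hc])
 have expi: "((%r. exp (2 * L * r)) has_integral (exp (2 * L * s) / (2 * L) - exp (2 * L * 0) / (2 * L))) {0..s}"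
  if "s >= 0" for s
  using that L by (intro fundamental_theorem_of_calculus)
   (auto intro!: derivative_eq_intros simp flip: has_real_derivative_iff_has_vector_derivative)
 have Gb: "norm (integral {0..s} f) <= B * exp (2 * L * s) / (2 * L)"
  if "s >= 0" "f integrable_on {0..s}" "!!r. r \<in> {0..s} ==> norm (f r) <= B * exp (2 * L * r)" "B >= 0" for s B and f :: "real => 'h"
 proof -
  have "norm (integral {0..s} f) <= integral {0..s} (%r. B * exp (2 * L * r))"
   using that expi[OF that(1)] by (intro integral_norm_bound_integral) (auto intro!: integrable_on_mult_right)
  also have "... = B * (exp (2 * L * s) / (2 * L) - exp (2 * L * 0) / (2 * L))"
   using expi[OF that(1)] by (simp add: integral_unique)
  also have "... <= B * exp (2 * L * s) / (2 * L)" using that L by (simp add: field_simps)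
  finally show ?thesis .
 qed
 have Gc: "continuous_on {0..} (%s. integral {0..s} (h g))" for g
 proof (rule continuous_on_eq_continuous_within[THEN iffD2, OF ballI])
  fix t :: real assume t: "t \<in> {0..}"
  have "continuous (at t within {0..t+1}) (%s. integral {0..s} (h g))"
   using indefinite_integral_continuous_1[OF hi[of g 0 "t+1"]] t by (simp add: continuous_on_eq_continuous_within)
  moreover have "at t within {0..t+1} = at t within {0..}"
   by (rule at_within_nhd[where S="{..<t+1}"]) auto
  ultimately show "continuous (at t within {0..}) (%s. integral {0..s} (h g))" by simp
 qed
 \<comment> \<open>Bounded continuous functions live on the whole line here, so
   \<open>max 0 t\<close> extends the operator constantly to negative times.\<close>
 define T0 where "T0 g t = exp (- (2 * L * max 0 t)) *\<^sub>R (x0 + integral {0..max 0 t} (h g))" for g t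
 have mx: "continuous_on UNIV (%t::real. max 0 t)" by (intro continuous_intros)
 have T0c: "T0 g \<in> bcontfun" for g
 proof (rule bcontfun_normI)
  have "continuous_on UNIV ((%s. integral {0..s} (h g)) \<circ> (%t. max 0 t))"
   by (rule continuous_on_compose[OF mx continuous_on_subset[OF Gc]]) (auto simp: le_max_iff_disj)
  thus "continuous_on UNIV (T0 g)" unfolding T0_def o_def by (intro continuous_intros mx)
  fix t :: real define s where "s = max 0 t"
  have s: "s >= 0" by (simp add: s_def le_max_iff_disj)
  define B where "B = norm (F 0) + L * norm g"
  have B: "B >= 0" using L by (simp add: B_def)
  have "norm (h g r) <= B * exp (2 * L * r)" if "r \<in> {0..s}" for r
  proof -
   have "norm (h g r) <= norm (F 0) + norm (h g r - F 0)" by norm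
   also have "norm (h g r - F 0) <= L * (exp (2 * L * r) * norm (apply_bcontfun g r))"
    using lip[of "exp (2 * L * r) *\<^sub>R apply_bcontfun g r" 0] unfolding h_def by simp
   also have "... <= L * (exp (2 * L * r) * norm g)"
    using L by (intro mult_left_mono norm_bounded) auto
   also have "norm (F 0) <= norm (F 0) * exp (2 * L * r)"
    using that L by (intro mult_le_cancel_left1[THEN iffD2]) auto
   finally show ?thesis unfolding B_def by (simp add: algebra_simps)
  qed
  from Gb[OF s hi this B] have "norm (integral {0..s} (h g)) <= B * exp (2 * L * s) / (2 * L)" .
  moreover have "norm (T0 g t) <= exp (- (2 * L * s)) * (norm x0 + norm (integral {0..s} (h g)))"
   unfolding T0_def s_def[symmetric] by (simp add: norm_triangle_ineq)
  ultimately have "norm (T0 g t) <= exp (- (2 * L * s)) * (norm x0 + B * exp (2 * L * s) / (2 * L))"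
   by (meson add_left_mono exp_ge_zero mult_left_mono order_trans)
  also have "... = exp (- (2 * L * s)) * norm x0 + B / (2 * L)"
   by (simp add: distrib_left exp_minus field_simps)
  also have "... <= norm x0 + B / (2 * L)" using s L by (simp add: mult_left_le_one_le)
  finally show "norm (T0 g t) <= norm x0 + B / (2 * L)" .
 qed
 define T where "T g = Bcontfun (T0 g)" for g
 have Tapp: "apply_bcontfun (T g) = T0 g" for g unfolding T_def by (rule Bcontfun_inverse[OF T0c])
 have "\<exists>!g. T g = g"
 proof (rule banach_fix_type[of "1/2"])
  show "ALL g k. dist (T g) (T k) <= 1/2 * dist g k"
  proof (intro allI dist_bound)
   fix g k and t :: real define s where "s = max 0 t"
   have s: "s >= 0" by (simp add: s_def le_max_iff_disj)
   have b: "norm (h g r - h k r) <= (L * dist g k) * exp (2 * L * r)" if "r \<in> {0..s}" for r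
   proof -
    have "norm (h g r - h k r) <= L * (exp (2 * L * r) * norm (apply_bcontfun g r - apply_bcontfun k r))"
     using lip[of "exp (2 * L * r) *\<^sub>R apply_bcontfun g r" "exp (2 * L * r) *\<^sub>R apply_bcontfun k r"]
     unfolding h_def by (simp flip: scaleR_diff_right)
    also have "... <= L * (exp (2 * L * r) * dist g k)"
     using L dist_bounded[of g r k] by (intro mult_left_mono) (auto simp: dist_norm)
    finally show ?thesis by (simp add: algebra_simps)
   qed
   have "norm (integral {0..s} (%r. h g r - h k r)) <= (L * dist g k) * exp (2 * L * s) / (2 * L)"
    using L by (intro Gb[OF s _ b] integrable_diff hi) auto
   hence n: "norm (integral {0..s} (h g) - integral {0..s} (h k)) <= (L * dist g k) * exp (2 * L * s) / (2 * L)"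
    by (subst (asm) integral_diff[OF hi hi])
   have "dist (T0 g t) (T0 k t) = exp (- (2 * L * s)) * norm (integral {0..s} (h g) - integral {0..s} (h k))"
    unfolding T0_def s_def[symmetric] dist_norm by (simp flip: scaleR_diff_right)
   also have "... <= exp (- (2 * L * s)) * ((L * dist g k) * exp (2 * L * s) / (2 * L))"
    using n by (intro mult_left_mono) auto
   also have "... = 1/2 * dist g k" using L by (simp add: exp_minus field_simps)
   finally show "dist (apply_bcontfun (T g) t) (apply_bcontfun (T k) t) <= 1/2 * dist g k" by (simp add: Tapp)
  qed
 qed auto
 then obtain g where g: "T g = g" by blast
 define U where "U t = x0 + integral {0..t} (h g)" for t
 have gU: "exp (2 * L * t) *\<^sub>R apply_bcontfun g t = U t" if "t >= 0" for t
 proof -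
  have "apply_bcontfun g t = T0 g t" using Tapp[of g] g by simp
  thus ?thesis using that by (simp add: T0_def U_def exp_minus)
 qed
 show thesis
 proof (rule that[of U])
  show "U 0 = x0" by (simp add: U_def)
  fix t :: real assume t: "t >= 0"
  have "((%s. integral {0..s} (h g)) has_vector_derivative h g t) (at t within {0..t+1})"
   using t by (intro integral_has_vector_derivative hc) auto
  moreover have "at t within {0..t+1} = at t within {0..}"
   by (rule at_within_nhd[where S="{..<t+1}"]) auto
  moreover have "h g t = F (U t)" by (simp add: h_def gU[OF t])
  ultimately show "(U has_vector_derivative F (U t)) (at t within {0..})"
   unfolding U_def by (auto intro!: derivative_eq_intros)
 qed
qed

section \<open>Gradient flows of semiconvex functionals: Yosida regularization\<close>

text \<open>A first-order condition: \<open>a\<close> is the first variation and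
  \<open>\<theta> * b\<close> the quadratic remainder after division by the step. It yields the
  subgradient inequality for resolvents and the Euler equation.\<close>

lemma affine_nonneg_at_0:
 fixes a b :: real
 assumes "!!\<theta>. 0 < \<theta> ==> \<theta> <= 1 ==> 0 <= a + \<theta> * b"
 shows "0 <= a"
proof (rule ccontr)
 assume "\<not> 0 <= a"
 hence a: "a < 0" by simp
 define \<theta> where "\<theta> = min 1 (- a / (2 * (\<bar>b\<bar> + 1)))"
 have "\<theta> > 0" "\<theta> <= 1" using a unfolding \<theta>_def by (auto simp: field_simps)
 moreover have "\<theta> * b <= - a / 2"
 proof -
  have "\<theta> * b <= \<theta> * (\<bar>b\<bar> + 1)" using \<open>\<theta> > 0\<close> by (intro mult_left_mono) auto
  also have "... <= (- a / (2 * (\<bar>b\<bar> + 1))) * (\<bar>b\<bar> + 1)" unfolding \<theta>_def by (intro mult_right_mono) auto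
  also have "... = - a / 2" by (simp add: field_simps)
  finally show ?thesis .
 qed
 ultimately show False using assms[of \<theta>] a by linarith
qed

lemma at_within_atLeast_eq: "t > 0 ==> at t within {0..} = at (t::real)"
 by (rule at_within_interior) auto

lemma has_real_derivative_inner:
 assumes "(f has_vector_derivative f') (at t within S)" "(g has_vector_derivative g') (at t within S)"
 shows "((%t. f t \<bullet> g t) has_real_derivative (f t \<bullet> g' + f' \<bullet> g t)) (at t within S)"
proof -
 have "(%h. f t \<bullet> (h *\<^sub>R g') + h *\<^sub>R f' \<bullet> g t) = (*) (f t \<bullet> g' + f' \<bullet> g t)"
  by (simp add: fun_eq_iff algebra_simps)
 thus ?thesis
  using has_derivative_inner[OF assms[unfolded has_vector_derivative_def]]
  by (simp only: has_field_derivative_def)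
qed

lemma DERIV_exp_mult:
 assumes "(N has_real_derivative N') (at s within S)"
 shows "((%s. exp (- (k * s)) * N s) has_real_derivative (exp (- (k * s)) * N' + exp (- (k * s)) * (- k) * N s)) (at s within S)"
 using assms by (auto intro!: derivative_eq_intros simp: algebra_simps)

lemma norm_add_scaleR_square:
 fixes a b :: "'h::real_inner"
 shows "(norm (a + t *\<^sub>R b))^2 = (norm a)^2 + 2 * t * (a \<bullet> b) + t^2 * (norm b)^2"
 unfolding power2_norm_eq_inner
 by (simp add: inner_add_left inner_add_right inner_commute power2_eq_square algebra_simps)

lemma has_real_derivative_norm_square:
 assumes "(f has_vector_derivative f') (at t within S)"
 shows "((%t. (norm (f t))^2) has_real_derivative (2 * (f' \<bullet> f t))) (at t within S)"
 using has_real_derivative_inner[OF assms assms] by (simp add: power2_norm_eq_inner inner_commute)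

lemma has_vector_derivative_right_quotient:
 assumes "(f has_vector_derivative f') (at t within {t..})"
 shows "((%h. (f (t + h) - f t) /\<^sub>R h) \<longlongrightarrow> f') (at_right 0)"
proof -
 have "((%y. (f y - f t) /\<^sub>R (y - t)) \<longlongrightarrow> f') (at t within {t..})"
  using assms unfolding has_vector_derivative_def has_derivative_within
 proof -
  assume "bounded_linear (%x. x *\<^sub>R f') & ((%y. (1 / norm (y - t)) *\<^sub>R (f y - (f t + (y - t) *\<^sub>R f'))) \<longlongrightarrow> 0) (at t within {t..})"
  hence "((%y. (1 / norm (y - t)) *\<^sub>R (f y - (f t + (y - t) *\<^sub>R f')) + f') \<longlongrightarrow> 0 + f') (at t within {t..})"
   by (intro tendsto_intros) auto
  hence "((%y. (1 / norm (y - t)) *\<^sub>R (f y - (f t + (y - t) *\<^sub>R f')) + f') \<longlongrightarrow> f') (at t within {t..})"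
   by simp
  thus ?thesis
  proof (rule Lim_transform_within[where d=1])
   fix y assume "y \<in> {t..}" "0 < dist y t"
   hence y: "y > t" by auto
   have "f y - (f t + (y - t) *\<^sub>R f') = (f y - f t) - (y - t) *\<^sub>R f'" by simp
   with y show "(1 / norm (y - t)) *\<^sub>R (f y - (f t + (y - t) *\<^sub>R f')) + f' = (f y - f t) /\<^sub>R (y - t)"
    by (simp only: scaleR_diff_right) (simp add: inverse_eq_divide)
  qed auto
 qed
 hence "((%y. (f y - f t) /\<^sub>R (y - t)) \<longlongrightarrow> f') (at_right t)"
  by (rule tendsto_within_subset) auto
 thus ?thesis by (simp add: at_right_to_0[of t] filterlim_filtermap add.commute)
qed

text \<open>The subdifferential suited to functionals that become convex after adding
  \<open>C / 2\<close> times the squared norm. Requiring \<open>w \<in> V\<close> removes components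
  orthogonal to \<open>V\<close>, which the inequality cannot see when
  \<open>D \<subseteq> V\<close>; without it a subgradient would be determined only up to such
  components.\<close>

definition subgradient :: "'h::real_inner set => 'h set => ('h => real) => real => 'h => 'h => bool" where
 "subgradient V D \<Phi> C x w \<longleftrightarrow>
   x \<in> D & w \<in> V & (\<forall>v\<in>D. \<Phi> x + w \<bullet> (v - x) - C / 2 * (norm (v - x))^2 <= \<Phi> v)"

text \<open>\<open>closed_sublevel\<close> is lower semicontinuity together with closedness of
  sublevel sets, without giving \<Phi> a value off \<open>D\<close>. The assumption
  \<open>unique\<close> is unusual for gradient flows; it makes cluster points of bounded
  subgradients weak limits, so that no subgradient of minimal norm has to be selected.\<close>

locale gradient_flow =
 fixes V D :: "'h::{real_inner,banach} set" and \<Phi> :: "'h => real" and C m :: real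
 assumes V: "subspace V" "closed V" and DV: "D \<subseteq> V" and C0: "0 <= C" and ne: "D \<noteq> {}"
  and semiconvex: "!!x y \<theta>. x \<in> D ==> y \<in> D ==> 0 <= \<theta> ==> \<theta> <= 1 ==>
   (1 - \<theta>) *\<^sub>R x + \<theta> *\<^sub>R y \<in> D &
   \<Phi> ((1 - \<theta>) *\<^sub>R x + \<theta> *\<^sub>R y) <= (1 - \<theta>) * \<Phi> x + \<theta> * \<Phi> y + C / 2 * \<theta> * (1 - \<theta>) * (norm (x - y))^2"
  and closed_sublevel: "!!X l c. (!!n. X n \<in> D) ==> X ----> l ==> (!!n. \<Phi> (X n) <= c) ==> l \<in> D & \<Phi> l <= c"
  and lower: "!!x. x \<in> D ==> m <= \<Phi> x"
  and unique: "!!x w w'. subgradient V D \<Phi> C x w ==> subgradient V D \<Phi> C x w' ==> w = w'"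
begin

abbreviation "SG \<equiv> subgradient V D \<Phi> C"

lemma lsc:
 assumes "eventually (%n. X n \<in> D) sequentially" "X ----> l"
  and "eventually (%n. \<Phi> (X n) <= a n) sequentially" "a ----> b"
 shows "l \<in> D" "\<Phi> l <= b"
proof -
 have *: "l \<in> D & \<Phi> l <= b + e" if e: "e > 0" for e
 proof -
  have "eventually (%n. a n < b + e) sequentially" using assms(4) e by (intro order_tendstoD) auto
  with assms(1,3) have "eventually (%n. X n \<in> D & \<Phi> (X n) <= b + e) sequentially"
   by eventually_elim auto
  then obtain N where N: "!!n. n >= N ==> X n \<in> D & \<Phi> (X n) <= b + e"
   unfolding eventually_sequentially by blast
  show ?thesis
   by (rule closed_sublevel[of "%n. X (n + N)"]) (use N LIMSEQ_ignore_initial_segment[OF assms(2)] in auto)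
 qed
 show "l \<in> D" using *[of 1] by simp
 show "\<Phi> l <= b" by (rule field_le_epsilon) (use * in blast)
qed

text \<open>For \<open>\<epsilon> * C <= 1/2\<close> the penalty dominates the nonconvexity: at a
  midpoint it gains \<open>1 / (8 * \<epsilon>)\<close> times the squared distance, while
  semiconvexity loses \<open>C / 8\<close> times it. The difference is the modulus
  \<open>(1/\<epsilon> - C)/8\<close>.\<close>

lemma prox_exists:
 assumes e: "\<epsilon> > 0" "\<epsilon> * C <= 1/2"
 shows "EX p. p \<in> D & (\<forall>v\<in>D. \<Phi> p + (norm (p - x))^2 / (2 * \<epsilon>) <= \<Phi> v + (norm (v - x))^2 / (2 * \<epsilon>))"
proof -
 define Q where "Q v = \<Phi> v + (norm (v - x))^2 / (2 * \<epsilon>)" for v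
 have "\<exists>p\<in>D. \<forall>v\<in>D. Q p <= Q v"
 proof (rule uniformly_midpoint_convex_minimizer[of D m Q "(1/\<epsilon> - C)/8"])
  show "D \<noteq> {}" by (rule ne)
  show "m <= Q v" if "v \<in> D" for v using lower[OF that] e unfolding Q_def by (simp add: add_increasing2)
  show "(1/\<epsilon> - C)/8 > 0" using e by (simp add: field_simps)
  show "(1/2) *\<^sub>R (u + v) \<in> D & Q ((1/2) *\<^sub>R (u + v)) <= (Q u + Q v) / 2 - (1/\<epsilon> - C)/8 * (norm (u - v))^2"
   if u: "u \<in> D" and v: "v \<in> D" for u v
  proof -
   have eq: "(1 - 1/2) *\<^sub>R u + (1/2) *\<^sub>R v = (1/2) *\<^sub>R (u + v)" by (simp add: scaleR_add_right)
   have "norm ((1/2) *\<^sub>R (u + v) - x) = norm ((1/2) *\<^sub>R ((u - x) + (v - x)))"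
    by (rule arg_cong[where f=norm]) (simp add: algebra_simps flip: scaleR_add_left)
   hence "norm ((1/2) *\<^sub>R (u + v) - x) = norm ((u - x) + (v - x)) / 2" by simp
   hence "(norm ((1/2) *\<^sub>R (u + v) - x))^2 = (norm ((u - x) + (v - x)))^2 / 4"
    by (simp only: power_divide) simp
   also have "... = (2 * (norm (u - x))^2 + 2 * (norm (v - x))^2 - (norm (u - v))^2) / 4"
    using parallelogram_diff[of "u - x" "v - x"] by simp
   finally have M: "(norm ((1/2) *\<^sub>R (u + v) - x))^2 = (2 * (norm (u - x))^2 + 2 * (norm (v - x))^2 - (norm (u - v))^2) / 4" .
   have "(norm ((1/2) *\<^sub>R (u + v) - x))^2 / (2 * \<epsilon>) = ((norm (u - x))^2 / (2 * \<epsilon>) + (norm (v - x))^2 / (2 * \<epsilon>)) / 2 - (norm (u - v))^2 / (8 * \<epsilon>)"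
    unfolding M using e by (simp add: field_simps)
   moreover have "(1/\<epsilon> - C)/8 * (norm (u - v))^2 = (norm (u - v))^2 / (8 * \<epsilon>) - C / 8 * (norm (u - v))^2"
    using e by (simp add: field_simps)
   moreover have "(1/2) *\<^sub>R (u + v) \<in> D & \<Phi> ((1/2) *\<^sub>R (u + v)) <= \<Phi> u / 2 + \<Phi> v / 2 + C / 8 * (norm (u - v))^2"
    using semiconvex[OF u v, of "1/2"] unfolding eq by simp
   ultimately show ?thesis unfolding Q_def by argo
  qed
  show "l \<in> D & Q l <= c" if "!!n::nat. X n \<in> D" "X ----> l" "!!n. Q (X n) <= c" for X l c
  proof -
   have "(%n. c - (norm (X n - x))^2 / (2 * \<epsilon>)) ----> c - (norm (l - x))^2 / (2 * \<epsilon>)"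
    using e by (intro tendsto_intros that) auto
   from lsc[OF _ that(2) _ this] show ?thesis using that unfolding Q_def by (simp add: algebra_simps)
  qed
 qed blast
 thus ?thesis unfolding Q_def by blast
qed

text \<open>\<open>J\<close>, \<open>A\<close> and \<open>env\<close> are the resolvent, the Yosida
  approximation and the Moreau envelope of \<Phi> at scale \<epsilon>.\<close>

definition J where
 "J \<epsilon> x = (SOME p. p \<in> D & (\<forall>v\<in>D. \<Phi> p + (norm (p - x))^2 / (2 * \<epsilon>) <= \<Phi> v + (norm (v - x))^2 / (2 * \<epsilon>)))"
definition A where "A \<epsilon> x = (x - J \<epsilon> x) /\<^sub>R \<epsilon>"
definition env where "env \<epsilon> x = \<Phi> (J \<epsilon> x) + (norm (x - J \<epsilon> x))^2 / (2 * \<epsilon>)"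

context
 fixes \<epsilon> :: real
 assumes e: "\<epsilon> > 0" "\<epsilon> * C <= 1/2"
begin

lemma J_D: "J \<epsilon> x \<in> D"
 and J_min: "v \<in> D ==> env \<epsilon> x <= \<Phi> v + (norm (x - v))^2 / (2 * \<epsilon>)"
proof -
 have *: "J \<epsilon> x \<in> D & (\<forall>v\<in>D. \<Phi> (J \<epsilon> x) + (norm (J \<epsilon> x - x))^2 / (2 * \<epsilon>) <= \<Phi> v + (norm (v - x))^2 / (2 * \<epsilon>))"
  unfolding J_def by (rule someI_ex[OF prox_exists[OF e]])
 show "J \<epsilon> x \<in> D" using * by blast
 show "v \<in> D ==> env \<epsilon> x <= \<Phi> v + (norm (x - v))^2 / (2 * \<epsilon>)"
  using * unfolding env_def by (simp add: norm_minus_commute)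
qed

lemma A_eq: "x - J \<epsilon> x = \<epsilon> *\<^sub>R A \<epsilon> x"
 using e by (simp add: A_def)

text \<open>The resolvent point is compared with points at fraction \<theta> of the way to
  \<open>v\<close>. The resulting inequality, divided by \<theta>, is affine in \<theta>, and its
  value at zero is the subgradient inequality with the same \<open>C\<close>.\<close>

lemma J_subgradient:
 assumes v: "v \<in> D"
 shows "\<Phi> (J \<epsilon> x) + A \<epsilon> x \<bullet> (v - J \<epsilon> x) - C / 2 * (norm (v - J \<epsilon> x))^2 <= \<Phi> v"
proof -
 define p where "p = J \<epsilon> x"
 define N where "N = (norm (v - p))^2"
 define a where "a = \<Phi> v - \<Phi> p + C / 2 * N - A \<epsilon> x \<bullet> (v - p)"
 define b where "b = N / (2 * \<epsilon>) - C / 2 * N"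
 have "0 <= a"
 proof (rule affine_nonneg_at_0)
  fix \<theta> :: real assume th: "0 < \<theta>" "\<theta> <= 1"
  define z where "z = (1 - \<theta>) *\<^sub>R p + \<theta> *\<^sub>R v"
  have z: "z \<in> D" "\<Phi> z <= (1 - \<theta>) * \<Phi> p + \<theta> * \<Phi> v + C / 2 * \<theta> * (1 - \<theta>) * N"
   using semiconvex[OF J_D[of x] v, of \<theta>] th unfolding z_def p_def N_def by (auto simp: norm_minus_commute)
  have "x - z = (x - p) + (- \<theta>) *\<^sub>R (v - p)" by (simp add: z_def algebra_simps)
  hence "(norm (x - z))^2 = (norm (x - p))^2 - 2 * \<theta> * ((x - p) \<bullet> (v - p)) + \<theta>^2 * N"
   unfolding N_def by (simp only: norm_add_scaleR_square) simp
  also have "(x - p) \<bullet> (v - p) = \<epsilon> * (A \<epsilon> x \<bullet> (v - p))" unfolding p_def A_eq by simp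
  finally have n: "(norm (x - z))^2 / (2 * \<epsilon>) = (norm (x - p))^2 / (2 * \<epsilon>) - \<theta> * (A \<epsilon> x \<bullet> (v - p)) + \<theta>^2 * N / (2 * \<epsilon>)"
   using e by (simp add: field_simps)
  have "\<theta> * (a + \<theta> * b) = \<theta> * \<Phi> v - \<theta> * \<Phi> p + C / 2 * \<theta> * (1 - \<theta>) * N - \<theta> * (A \<epsilon> x \<bullet> (v - p)) + \<theta>^2 * N / (2 * \<epsilon>)"
   unfolding a_def b_def using e by (simp add: power2_eq_square field_simps)
  moreover have "(1 - \<theta>) * \<Phi> p = \<Phi> p - \<theta> * \<Phi> p" by (simp add: algebra_simps)
  ultimately have "0 <= \<theta> * (a + \<theta> * b)"
   using J_min[OF z(1), of x] z(2) n unfolding env_def p_def[symmetric] by argo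
  thus "0 <= a + \<theta> * b" using th by (simp add: zero_le_mult_iff)
 qed
 thus ?thesis unfolding a_def N_def p_def by simp
qed

lemma A_in_V: "x \<in> V ==> A \<epsilon> x \<in> V"
 unfolding A_def using J_D DV V(1) by (meson subsetD subspace_diff subspace_mul)

lemma J_SG: "x \<in> V ==> SG (J \<epsilon> x) (A \<epsilon> x)"
 unfolding subgradient_def using J_D A_in_V J_subgradient by blast

lemma A_J_mono: "- C * (norm (J \<epsilon> x - J \<epsilon> y))^2 <= (A \<epsilon> x - A \<epsilon> y) \<bullet> (J \<epsilon> x - J \<epsilon> y)"
 using J_subgradient[OF J_D, of x y] J_subgradient[OF J_D, of y x]
 by (simp add: inner_diff_left inner_diff_right norm_minus_commute)

text \<open>Since \<open>x - y\<close> is \<open>d\<close> plus \<epsilon> times the difference of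
  the Yosida approximations, which is monotone along \<open>J\<close> up to \<open>C\<close>, the
  inner product with \<open>d\<close> gives
  \<open>(1 - \<epsilon> * C) * (norm d)^2 <= norm (x - y) * norm d\<close>. The restriction on
  \<epsilon> makes the factor at least 1/2.\<close>

lemma J_lip: "norm (J \<epsilon> x - J \<epsilon> y) <= 2 * norm (x - y)"
proof -
 define d where "d = J \<epsilon> x - J \<epsilon> y"
 have "x - y = d + \<epsilon> *\<^sub>R (A \<epsilon> x - A \<epsilon> y)"
  unfolding d_def scaleR_diff_right A_eq[symmetric] by simp
 hence "(x - y) \<bullet> d = (norm d)^2 + \<epsilon> * ((A \<epsilon> x - A \<epsilon> y) \<bullet> d)"
  by (simp add: inner_add_left power2_norm_eq_inner)
 moreover have "\<epsilon> * (- C * (norm d)^2) <= \<epsilon> * ((A \<epsilon> x - A \<epsilon> y) \<bullet> d)"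
  using A_J_mono[of x y] e unfolding d_def by (intro mult_left_mono) auto
 moreover have "(\<epsilon> * C) * (norm d)^2 <= 1/2 * (norm d)^2" using e by (intro mult_right_mono) auto
 moreover have "(x - y) \<bullet> d <= norm (x - y) * norm d" by (rule norm_cauchy_schwarz)
 ultimately have "1/2 * (norm d)^2 <= norm (x - y) * norm d" by (simp add: algebra_simps)
 hence "norm d * norm d <= (2 * norm (x - y)) * norm d" by (simp add: power2_eq_square)
 thus ?thesis unfolding d_def[symmetric]
  by (cases "norm d = 0") (auto simp: mult_le_cancel_right)
qed

text \<open>The Yosida approximation is no longer than any subgradient at the same point, up to a
  factor tending to 1. This bounds the initial speed of regularized flows started where a
  subgradient is known.\<close>

lemma A_bound:
 assumes "SG x w"
 shows "(1 - \<epsilon> * C) * norm (A \<epsilon> x) <= norm w"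
proof -
 define a where "a = A \<epsilon> x"
 have x: "x \<in> D" using assms by (simp add: subgradient_def)
 have "\<Phi> x + w \<bullet> (J \<epsilon> x - x) - C / 2 * (norm (J \<epsilon> x - x))^2 <= \<Phi> (J \<epsilon> x)"
  using assms J_D unfolding subgradient_def by blast
 hence "(a - w) \<bullet> (x - J \<epsilon> x) <= C * (norm (x - J \<epsilon> x))^2"
  using J_subgradient[OF x, of x] unfolding a_def by (simp add: inner_diff_left inner_diff_right norm_minus_commute)
 hence "\<epsilon> * (a \<bullet> a - w \<bullet> a) <= \<epsilon> * (\<epsilon> * C * (a \<bullet> a))"
  unfolding A_eq a_def[symmetric] by (simp add: inner_diff_left power_mult_distrib power2_norm_eq_inner[symmetric] power2_eq_square mult_ac)
 hence "(1 - \<epsilon> * C) * (a \<bullet> a) <= w \<bullet> a" using e(1) by (simp add: left_diff_distrib)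
 hence "((1 - \<epsilon> * C) * norm a) * norm a <= norm w * norm a"
  using norm_cauchy_schwarz[of w a] by (simp add: power2_norm_eq_inner[symmetric] power2_eq_square)
 thus ?thesis unfolding a_def[symmetric] by (cases "norm a = 0") (auto simp: mult_le_cancel_right)
qed

lemma A_lip: "norm (A \<epsilon> x - A \<epsilon> y) <= 3 / \<epsilon> * norm (x - y)"
proof -
 have "A \<epsilon> x - A \<epsilon> y = ((x - y) - (J \<epsilon> x - J \<epsilon> y)) /\<^sub>R \<epsilon>" by (simp add: A_def algebra_simps)
 hence "norm (A \<epsilon> x - A \<epsilon> y) = \<bar>inverse \<epsilon>\<bar> * norm ((x - y) - (J \<epsilon> x - J \<epsilon> y))"
  by (simp only: norm_scaleR)
 also have "... = norm ((x - y) - (J \<epsilon> x - J \<epsilon> y)) / \<epsilon>"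
  using e(1) by (simp add: inverse_eq_divide)
 also have "... <= (norm (x - y) + norm (J \<epsilon> x - J \<epsilon> y)) / \<epsilon>"
  using e by (intro divide_right_mono norm_triangle_ineq4) auto
 also have "... <= (norm (x - y) + 2 * norm (x - y)) / \<epsilon>" using e J_lip[of x y] by (intro divide_right_mono) auto
 finally show ?thesis by simp
qed

text \<open>The constant is \<open>C\<close> times the square of the Lipschitz constant 2 of
  \<open>J\<close>; the part \<epsilon> times the squared difference of the approximations has a
  good sign and is dropped.\<close>

lemma A_mono: "- (4 * C) * (norm (x - y))^2 <= (A \<epsilon> x - A \<epsilon> y) \<bullet> (x - y)"
proof -
 define d where "d = J \<epsilon> x - J \<epsilon> y"
 have "x - y = d + \<epsilon> *\<^sub>R (A \<epsilon> x - A \<epsilon> y)"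
  unfolding d_def scaleR_diff_right A_eq[symmetric] by simp
 hence "(A \<epsilon> x - A \<epsilon> y) \<bullet> (x - y) = (A \<epsilon> x - A \<epsilon> y) \<bullet> d + \<epsilon> * (norm (A \<epsilon> x - A \<epsilon> y))^2"
  by (simp add: inner_add_right power2_norm_eq_inner)
 moreover have "- C * (norm d)^2 <= (A \<epsilon> x - A \<epsilon> y) \<bullet> d" using A_J_mono unfolding d_def .
 moreover have "C * (norm d)^2 <= C * (2 * norm (x - y))^2"
  using J_lip[of x y] C0 unfolding d_def by (intro mult_left_mono power_mono) auto
 moreover have "0 <= \<epsilon> * (norm (A \<epsilon> x - A \<epsilon> y))^2" using e by simp
 ultimately show ?thesis by (simp add: power_mult_distrib)
qed

lemma env_le: "x \<in> D ==> env \<epsilon> x <= \<Phi> x"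
 using J_min[of x x] by simp

lemma J_le_env: "\<Phi> (J \<epsilon> x) <= env \<epsilon> x" and env_lower: "m <= env \<epsilon> x"
proof -
 have "0 <= (norm (x - J \<epsilon> x))^2 / (2 * \<epsilon>)" using e by simp
 thus "\<Phi> (J \<epsilon> x) <= env \<epsilon> x" "m <= env \<epsilon> x"
  using lower[OF J_D[of x]] unfolding env_def by linarith+
qed

text \<open>\<open>J \<epsilon> x\<close> is an admissible competitor in the minimization at
  \<open>y\<close>. Used also with \<open>x\<close> and \<open>y\<close> exchanged, this one-sided
  bound identifies \<open>A\<close> as the gradient of the envelope.\<close>

lemma env_upper: "env \<epsilon> y - env \<epsilon> x <= A \<epsilon> x \<bullet> (y - x) + (norm (y - x))^2 / (2 * \<epsilon>)"
proof -
 have "y - J \<epsilon> x = (y - x) + \<epsilon> *\<^sub>R A \<epsilon> x" unfolding A_eq[symmetric] by simp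
 hence "(norm (y - J \<epsilon> x))^2 = (norm (y - x))^2 + 2 * \<epsilon> * (A \<epsilon> x \<bullet> (y - x)) + (norm (x - J \<epsilon> x))^2"
  by (simp only: norm_add_scaleR_square A_eq[of x]) (simp add: inner_commute power_mult_distrib)
 hence "(norm (y - J \<epsilon> x))^2 / (2 * \<epsilon>) = (norm (y - x))^2 / (2 * \<epsilon>) + A \<epsilon> x \<bullet> (y - x) + (norm (x - J \<epsilon> x))^2 / (2 * \<epsilon>)"
  using e by (simp add: field_simps)
 thus ?thesis using J_min[OF J_D[of x], of y] unfolding env_def[of _ x] by simp
qed

lemma env_deriv: "(env \<epsilon> has_derivative (%h. A \<epsilon> x \<bullet> h)) (at x)"
proof (rule has_derivativeI)
 show "bounded_linear (%h. A \<epsilon> x \<bullet> h)" by (rule bounded_linear_inner_right)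
 define K where "K = 3 / \<epsilon> + 1 / (2 * \<epsilon>)"
 have K: "\<bar>env \<epsilon> y - env \<epsilon> x - A \<epsilon> x \<bullet> (y - x)\<bar> <= K * (norm (y - x))^2" for y
 proof -
  have "(A \<epsilon> x - A \<epsilon> y) \<bullet> (y - x) <= norm (A \<epsilon> x - A \<epsilon> y) * norm (y - x)" by (rule norm_cauchy_schwarz)
  also have "... <= (3 / \<epsilon> * norm (x - y)) * norm (y - x)" by (intro mult_right_mono A_lip) auto
  finally have "(A \<epsilon> x - A \<epsilon> y) \<bullet> (y - x) <= 3 / \<epsilon> * (norm (y - x))^2" by (simp add: norm_minus_commute power2_eq_square)
  moreover have "0 <= 3 / \<epsilon> * (norm (y - x))^2" using e by simp
  ultimately show ?thesis using env_upper[of y x] env_upper[of x y] unfolding K_def distrib_right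
   by (simp add: inner_diff_left inner_diff_right norm_minus_commute)
 qed
 show "((%y. (env \<epsilon> y - env \<epsilon> x - A \<epsilon> x \<bullet> (y - x)) /\<^sub>R norm (y - x)) \<longlongrightarrow> 0) (at x)"
 proof (rule Lim_null_comparison)
  show "\<forall>\<^sub>F y in at x. norm ((env \<epsilon> y - env \<epsilon> x - A \<epsilon> x \<bullet> (y - x)) /\<^sub>R norm (y - x)) <= K * norm (y - x)"
  proof (intro always_eventually allI)
   fix y
   show "norm ((env \<epsilon> y - env \<epsilon> x - A \<epsilon> x \<bullet> (y - x)) /\<^sub>R norm (y - x)) <= K * norm (y - x)"
    using K[of y] by (cases "y = x") (auto simp: field_simps power2_eq_square)
  qed
  have "((%y. K * norm (y - x)) \<longlongrightarrow> K * norm (x - x)) (at x)" by (intro tendsto_intros)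
  thus "((%y. K * norm (y - x)) \<longlongrightarrow> 0) (at x)" by simp
 qed
qed

section \<open>Flows of the Yosida approximation\<close>

definition "flow x0 U \<longleftrightarrow> U 0 = x0 & (\<forall>t\<ge>0. (U has_vector_derivative - A \<epsilon> (U t)) (at t within {0..}))"

lemma flow_exists: "EX U. flow x0 U"
proof (rule Lipschitz_ode_solution[of "%x. - A \<epsilon> x" "3 / \<epsilon>" x0])
 show "norm (- A \<epsilon> x - - A \<epsilon> y) <= 3 / \<epsilon> * norm (x - y)" for x y
  using A_lip[of x y] by (simp add: norm_minus_commute)
 show "0 < 3 / \<epsilon>" using e by simp
 fix U assume U: "U 0 = x0" "!!t. 0 <= t ==> (U has_vector_derivative - A \<epsilon> (U t)) (at t within {0..})"
 show "EX U. flow x0 U" unfolding flow_def by (rule exI[of _ U]) (simp add: U)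
qed

context
 fixes x0 U assumes fl: "flow x0 U"
begin

lemma flow_0: "U 0 = x0" using fl by (simp add: flow_def)

lemma flow_deriv: "t >= 0 ==> (U has_vector_derivative - A \<epsilon> (U t)) (at t within {0..})"
 using fl by (simp add: flow_def)

lemma flow_deriv': "t > 0 ==> (U has_vector_derivative - A \<epsilon> (U t)) (at t)"
 using flow_deriv[of t] by (simp add: at_within_atLeast_eq)

lemma flow_cont: "continuous_on {0..} U"
 using flow_deriv by (meson atLeast_iff continuous_on_eq_continuous_within has_vector_derivative_continuous)

text \<open>Because \<open>J\<close> takes values in \<open>V\<close>, the component of the solution
  in a direction orthogonal to \<open>V\<close> satisfies \<open>y' = - y / \<epsilon>\<close> and
  vanishes initially. The direction used is the residual of projecting \<open>U t\<close>
  itself.\<close>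

lemma flow_in_V:
 assumes x0: "x0 \<in> V" and t: "t >= 0"
 shows "U t \<in> V"
proof -
 obtain p where p: "p \<in> V" "!!v. v \<in> V ==> U t \<bullet> v = p \<bullet> v"
  using orthogonal_projection_subspace[OF V] by metis
 define k where "k = U t - p"
 have k: "v \<bullet> k = 0" if "v \<in> V" for v using p(2)[OF that] unfolding k_def by (simp add: inner_diff_right inner_commute)
 have "((%t. exp (t / \<epsilon>) * (U t \<bullet> k)) has_vector_derivative 0) (at s within {0..})" if s: "s \<in> {0..}" for s
 proof -
  have "A \<epsilon> (U s) \<bullet> k = (U s \<bullet> k) / \<epsilon>"
   using k[of "J \<epsilon> (U s)"] J_D[of "U s"] DV by (auto simp: A_def inner_diff_left inverse_eq_divide)
  moreover have "((%t. U t \<bullet> k) has_real_derivative (- A \<epsilon> (U s) \<bullet> k)) (at s within {0..})"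
   using has_real_derivative_inner[OF flow_deriv[of s] has_vector_derivative_const[of k]] s by simp
  ultimately have "((%t. exp (t / \<epsilon>) * (U t \<bullet> k)) has_real_derivative 0) (at s within {0..})"
   using e by (auto intro!: derivative_eq_intros)
  thus ?thesis by (simp add: has_real_derivative_iff_has_vector_derivative)
 qed
 then obtain c where c: "!!s. s \<in> {0..} ==> exp (s / \<epsilon>) * (U s \<bullet> k) = c"
  using has_vector_derivative_zero_constant[of "{0..}" "%t. exp (t / \<epsilon>) * (U t \<bullet> k)"] by auto
 have "c = 0" using c[of 0] k[OF x0] flow_0 by simp
 hence "U t \<bullet> k = 0" using c[of t] t by simp
 hence "k \<bullet> k = 0" using k[OF p(1)] by (simp add: k_def inner_diff_left)
 thus ?thesis using p(1) by (simp add: k_def)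
qed

lemma flow_energy_deriv: "t > 0 ==> ((%t. env \<epsilon> (U t)) has_real_derivative - (norm (A \<epsilon> (U t)))\<^sup>2) (at t)"
proof -
 assume t: "t > 0"
 have "(%h. A \<epsilon> (U t) \<bullet> (h *\<^sub>R - A \<epsilon> (U t))) = (*) (- (norm (A \<epsilon> (U t)))\<^sup>2)"
  by (simp add: fun_eq_iff power2_norm_eq_inner)
 thus ?thesis
  using has_derivative_compose[OF flow_deriv'[OF t, unfolded has_vector_derivative_def] env_deriv]
  by (simp only: has_field_derivative_def)
qed

lemma flow_energy_cont: "continuous_on {0..} (%t. env \<epsilon> (U t))"
proof -
 have "continuous_on UNIV (env \<epsilon>)"
  using env_deriv by (meson continuous_at_imp_continuous_on has_derivative_continuous)
 thus ?thesis using continuous_on_compose2 flow_cont by blast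
qed

end

text \<open>\<open>A_mono\<close> gives a differential inequality with rate \<open>8 * C\<close> for
  the squared distance. An arbitrary starting time \<open>r\<close> is kept, since flows are later
  compared with their own translates.\<close>

lemma flow_contract:
 assumes X: "flow x X" and Y: "flow y Y" and rt: "0 <= r" "r <= t"
 shows "norm (X t - Y t) <= exp (4 * C * (t - r)) * norm (X r - Y r)"
proof -
 define f where "f s = exp (- (8 * C * s)) * (norm (X s - Y s))^2" for s
 have "f t <= f r"
 proof (rule DERIV_nonpos_imp_decreasing_open[OF rt(2)])
  fix s assume s: "r < s" "s < t"
  hence s0: "s > 0" using rt by simp
  have d: "((%s. X s - Y s) has_vector_derivative (- A \<epsilon> (X s) - - A \<epsilon> (Y s))) (at s)"
   by (intro has_vector_derivative_diff flow_deriv'[OF X s0] flow_deriv'[OF Y s0])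
  have "(f has_real_derivative (exp (- (8 * C * s)) * (2 * ((- A \<epsilon> (X s) - - A \<epsilon> (Y s)) \<bullet> (X s - Y s)))
    + exp (- (8 * C * s)) * (- (8 * C)) * (norm (X s - Y s))^2)) (at s)"
   unfolding f_def using DERIV_exp_mult[OF has_real_derivative_norm_square[OF d], of "8 * C"] .
  moreover have "exp (- (8 * C * s)) * (2 * ((- A \<epsilon> (X s) - - A \<epsilon> (Y s)) \<bullet> (X s - Y s)))
    + exp (- (8 * C * s)) * (- (8 * C)) * (norm (X s - Y s))^2
    = - 2 * exp (- (8 * C * s)) * ((A \<epsilon> (X s) - A \<epsilon> (Y s)) \<bullet> (X s - Y s) - - (4 * C) * (norm (X s - Y s))^2)"
   by (simp add: algebra_simps inner_diff_left)
  moreover have "... <= 0" using A_mono[of "X s" "Y s"] by (intro mult_nonpos_nonneg) auto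
  ultimately show "EX y. (f has_real_derivative y) (at s) & y <= 0" by metis
 next
  show "continuous_on {r..t} f" unfolding f_def
   using rt by (intro continuous_intros continuous_on_subset[OF flow_cont[OF X]] continuous_on_subset[OF flow_cont[OF Y]]) auto
 qed
 hence "(norm (X t - Y t))^2 <= exp (8 * C * (t - r)) * (norm (X r - Y r))^2"
  unfolding f_def by (simp add: exp_minus exp_diff field_simps)
 also have "... = (exp (4 * C * (t - r)) * norm (X r - Y r))^2"
  by (simp add: power_mult_distrib flip: exp_of_nat_mult)
 finally show ?thesis by (rule power2_le_imp_le) auto
qed

lemma flow_shift: "flow x U ==> h >= 0 ==> flow (U h) (%t. U (t + h))"
 unfolding flow_def
proof (intro conjI allI impI)
 fix t :: real assume a: "U 0 = x & (\<forall>t\<ge>0. (U has_vector_derivative - A \<epsilon> (U t)) (at t within {0..}))" "h >= 0" "t >= 0"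
 hence "(U has_vector_derivative - A \<epsilon> (U (t + h))) (at (t + h) within {0..})" by simp
 hence "(U has_vector_derivative - A \<epsilon> (U (t + h))) (at (t + h) within (%t. t + h) ` {0..})"
  by (rule has_vector_derivative_within_subset) (use a in auto)
 moreover have "((%t. t + h) has_vector_derivative 1) (at t within {0..})"
  by (auto intro!: derivative_eq_intros)
 ultimately show "((%t. U (t + h)) has_vector_derivative - A \<epsilon> (U (t + h))) (at t within {0..})"
  using vector_diff_chain_within[of "%t. t + h" 1 t "{0..}" U] by (simp add: o_def)
qed auto

text \<open>A flow and its translate by \<open>h\<close> separate at most exponentially; divided by
  \<open>h\<close>, with \<open>h\<close> tending to zero from the right, this compares speeds at
  two times.\<close>

lemma flow_speed:
 assumes U: "flow x U" and rt: "0 <= r" "r <= t"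
 shows "norm (A \<epsilon> (U t)) <= exp (4 * C * (t - r)) * norm (A \<epsilon> (U r))"
proof -
 have q: "((%h. norm ((U (s + h) - U s) /\<^sub>R h)) \<longlongrightarrow> norm (A \<epsilon> (U s))) (at_right 0)" if "s >= 0" for s
 proof -
  have "(U has_vector_derivative - A \<epsilon> (U s)) (at s within {s..})"
   by (rule has_vector_derivative_within_subset[OF flow_deriv[OF U that]]) (use that in auto)
  from tendsto_norm[OF has_vector_derivative_right_quotient[OF this]] show ?thesis by simp
 qed
 show ?thesis
 proof (rule tendsto_le[OF _ tendsto_mult_left[OF q[OF rt(1)]] q])
  show "\<forall>\<^sub>F h in at_right 0. norm ((U (t + h) - U t) /\<^sub>R h) <= exp (4 * C * (t - r)) * norm ((U (r + h) - U r) /\<^sub>R h)"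
   unfolding eventually_at_right_field
  proof (intro exI[of _ 1] conjI allI impI)
   fix h :: real assume h: "0 < h" "h < 1"
   have "norm (U (t + h) - U t) <= exp (4 * C * (t - r)) * norm (U (r + h) - U r)"
    using flow_contract[OF flow_shift[OF U] U rt, of h] h by simp
   from mult_left_mono[OF this, of "\<bar>inverse h\<bar>"]
   show "norm ((U (t + h) - U t) /\<^sub>R h) <= exp (4 * C * (t - r)) * norm ((U (r + h) - U r) /\<^sub>R h)"
    unfolding norm_scaleR by (simp add: mult_ac)
  qed simp
 qed (use rt in auto)
qed

text \<open>The regularizing effect: the dissipated energy is at most \<open>\<Phi> x - m\<close>,
  and earlier speeds dominate the final one up to an exponential, so the speed at \<open>t\<close>
  is of order \<open>1 / sqrt t\<close> uniformly in \<epsilon>. It holds for initial points of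
  finite energy, which may have no subgradient.\<close>

lemma flow_energy_bound:
 assumes U: "flow x U" and x: "x \<in> D" and t: "t >= 0"
 shows "env \<epsilon> (U t) <= \<Phi> x" "t * exp (- (8 * C * t)) * (norm (A \<epsilon> (U t)))^2 <= \<Phi> x - m"
proof -
 define H where "H r = env \<epsilon> (U r) + r * (exp (- (8 * C * t)) * (norm (A \<epsilon> (U t)))^2)" for r
 have "H t <= H 0"
 proof (rule DERIV_nonpos_imp_decreasing_open[OF t])
  fix s assume s: "0 < s" "s < t"
  have "(H has_real_derivative (- (norm (A \<epsilon> (U s)))\<^sup>2 + exp (- (8 * C * t)) * (norm (A \<epsilon> (U t)))^2)) (at s)"
   unfolding H_def using flow_energy_deriv[OF U s(1)] by (auto intro!: derivative_eq_intros)
  moreover have "exp (- (8 * C * t)) * (norm (A \<epsilon> (U t)))^2 <= (norm (A \<epsilon> (U s)))^2"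
  proof -
   have "norm (A \<epsilon> (U t)) <= exp (4 * C * (t - s)) * norm (A \<epsilon> (U s))" using flow_speed[OF U] s by simp
   also have "... <= exp (4 * C * t) * norm (A \<epsilon> (U s))"
    using s C0 by (intro mult_right_mono) (auto intro!: mult_left_mono)
   finally have "(norm (A \<epsilon> (U t)))^2 <= (exp (4 * C * t) * norm (A \<epsilon> (U s)))^2" by (intro power_mono) auto
   also have "... = exp (8 * C * t) * (norm (A \<epsilon> (U s)))^2"
    by (simp add: power_mult_distrib flip: exp_of_nat_mult)
   finally show ?thesis by (simp add: exp_minus field_simps)
  qed
  ultimately show "EX y. (H has_real_derivative y) (at s) & y <= 0" by (intro exI conjI) auto
 next
  show "continuous_on {0..t} H" unfolding H_def
   by (intro continuous_intros continuous_on_subset[OF flow_energy_cont[OF U]]) auto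
 qed
 hence H: "env \<epsilon> (U t) + t * (exp (- (8 * C * t)) * (norm (A \<epsilon> (U t)))^2) <= \<Phi> x"
  unfolding H_def using env_le[OF x] flow_0[OF U] by simp
 moreover have "0 <= t * (exp (- (8 * C * t)) * (norm (A \<epsilon> (U t)))^2)" using t by simp
 ultimately show "env \<epsilon> (U t) <= \<Phi> x" by linarith
 show "t * exp (- (8 * C * t)) * (norm (A \<epsilon> (U t)))^2 <= \<Phi> x - m"
  using H env_lower[of "U t"] by (simp add: mult.assoc)
qed

end

text \<open>Pairing the velocities with the resolvent points, semiconvexity costs
  \<open>2 * C * (norm (p - q))^2\<close>; bounding this by three squares gives the rate
  \<open>6 * C\<close>. The remaining errors \<open>\<epsilon> * (norm a)^2\<close> and
  \<open>\<delta> * (norm b)^2\<close> are not small at each time, but they are absorbed by the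
  decay of the two envelopes, which enter \<open>G\<close> with weight
  \<open>4 * (\<epsilon> + \<delta>)\<close>.\<close>

lemma flow_compare:
 assumes e: "\<epsilon> > 0" "\<epsilon> * C <= 1/2" and d: "\<delta> > 0" "\<delta> * C <= 1/2"
  and U: "flow \<epsilon> x U" and X: "flow \<delta> x X" and x: "x \<in> D" and t: "t >= 0"
 shows "(norm (U t - X t))^2 <= 8 * exp (6 * C * t) * (\<epsilon> + \<delta>) * (\<Phi> x - m)"
proof -
 define G where "G s = exp (- (6 * C * s)) * (norm (U s - X s))^2 + 4 * (\<epsilon> + \<delta>) * (env \<epsilon> (U s) + env \<delta> (X s))" for s
 have "G t <= G 0"
 proof (rule DERIV_nonpos_imp_decreasing_open[OF t])
  fix s assume s: "0 < s" "s < t"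
  define a b where "a = A \<epsilon> (U s)" and "b = A \<delta> (X s)"
  define p q where "p = J \<epsilon> (U s)" and "q = J \<delta> (X s)"
  define N where "N = (norm (U s - X s))^2"
  have dd: "((%s. U s - X s) has_vector_derivative (- a - - b)) (at s)"
   unfolding a_def b_def by (intro has_vector_derivative_diff flow_deriv'[OF e U s(1)] flow_deriv'[OF d X s(1)])
  have D: "(G has_real_derivative (exp (- (6 * C * s)) * (2 * ((- a - - b) \<bullet> (U s - X s)))
    + exp (- (6 * C * s)) * (- (6 * C)) * N + 4 * (\<epsilon> + \<delta>) * (- (norm a)\<^sup>2 + - (norm b)\<^sup>2))) (at s)"
   unfolding G_def N_def
   using DERIV_add[OF DERIV_exp_mult[OF has_real_derivative_norm_square[OF dd], of "6 * C"]
    DERIV_cmult[OF DERIV_add[OF flow_energy_deriv[OF e U s(1), folded a_def] flow_energy_deriv[OF d X s(1), folded b_def]], of "4 * (\<epsilon> + \<delta>)"]] .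
  have UX: "U s - X s = (p - q) + (\<epsilon> *\<^sub>R a - \<delta> *\<^sub>R b)"
   unfolding p_def q_def a_def b_def A_eq[OF e, symmetric] A_eq[OF d, symmetric] by simp
  have mono: "- C * (norm (p - q))^2 <= (a - b) \<bullet> (p - q)"
   using J_subgradient[OF e J_D[OF d], of "U s" "X s"] J_subgradient[OF d J_D[OF e], of "X s" "U s"]
   unfolding p_def q_def a_def b_def
   by (simp add: inner_diff_left inner_diff_right norm_minus_commute)
  have pq: "(norm (p - q))^2 <= 3 * (N + \<epsilon>^2 * (norm a)^2 + \<delta>^2 * (norm b)^2)"
  proof -
   have "p - q = (U s - X s) + (\<delta> *\<^sub>R b - \<epsilon> *\<^sub>R a)" using UX by (simp add: algebra_simps)
   hence "norm (p - q) <= norm (U s - X s) + (\<delta> * norm b + \<epsilon> * norm a)"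
    using norm_triangle_ineq[of "U s - X s" "\<delta> *\<^sub>R b - \<epsilon> *\<^sub>R a"] norm_triangle_ineq4[of "\<delta> *\<^sub>R b" "\<epsilon> *\<^sub>R a"] e d by simp
   hence "(norm (p - q))^2 <= (norm (U s - X s) + (\<delta> * norm b + \<epsilon> * norm a))^2" by (intro power_mono) auto
   also have "... <= 3 * ((norm (U s - X s))^2 + (\<epsilon> * norm a)^2 + (\<delta> * norm b)^2)"
   proof -
    have "0 <= (u - v)^2 + (v - w)^2 + (u - w)^2" for u v w :: real by simp
    from this[of "norm (U s - X s)" "\<delta> * norm b" "\<epsilon> * norm a"] show ?thesis
     by (simp add: power2_eq_square algebra_simps)
   qed
   finally show ?thesis unfolding N_def by (simp add: power_mult_distrib)
  qed
  have "2 * ((- a - - b) \<bullet> (U s - X s)) <= 6 * C * N + 4 * (\<epsilon> + \<delta>) * ((norm a)^2 + (norm b)^2)"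
  proof -
   have ab: "2 * (a \<bullet> b) <= (norm a)^2 + (norm b)^2"
   proof -
    have "0 <= (norm (a - b))^2" by simp
    thus ?thesis unfolding power2_norm_eq_inner by (simp add: inner_diff_left inner_diff_right inner_commute)
   qed
   have "2 * ((- a - - b) \<bullet> (U s - X s)) = - 2 * ((a - b) \<bullet> (p - q)) - 2 * \<epsilon> * (norm a)^2 - 2 * \<delta> * (norm b)^2 + (\<epsilon> + \<delta>) * (2 * (a \<bullet> b))"
    unfolding UX power2_norm_eq_inner
    by (simp add: inner_diff_left inner_diff_right inner_add_right inner_commute algebra_simps)
   also have "... <= 2 * C * (norm (p - q))^2 + (\<epsilon> + \<delta>) * ((norm a)^2 + (norm b)^2)"
   proof -
    have "0 <= 2 * \<epsilon> * (norm a)^2" "0 <= 2 * \<delta> * (norm b)^2" using e d by auto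
    moreover have "(\<epsilon> + \<delta>) * (2 * (a \<bullet> b)) <= (\<epsilon> + \<delta>) * ((norm a)^2 + (norm b)^2)"
     using ab e d by (intro mult_left_mono) auto
    ultimately show ?thesis using mono by linarith
   qed
   also have "2 * C * (norm (p - q))^2 <= 2 * C * (3 * (N + \<epsilon>^2 * (norm a)^2 + \<delta>^2 * (norm b)^2))"
    using pq C0 by (intro mult_left_mono) auto
   also have "... = 6 * C * N + 6 * (\<epsilon> * C) * (\<epsilon> * (norm a)^2) + 6 * (\<delta> * C) * (\<delta> * (norm b)^2)"
    by (simp add: power2_eq_square algebra_simps)
   also have "... <= 6 * C * N + 6 * (1/2) * (\<epsilon> * (norm a)^2) + 6 * (1/2) * (\<delta> * (norm b)^2)"
    using e d by (intro add_mono mult_right_mono mult_left_mono order_refl) auto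
   also have "... <= 6 * C * N + 3 * (\<epsilon> + \<delta>) * ((norm a)^2 + (norm b)^2)"
    using e d by (simp add: algebra_simps)
   finally show ?thesis by (simp add: algebra_simps)
  qed
  hence i: "exp (- (6 * C * s)) * (2 * ((- a - - b) \<bullet> (U s - X s))) <= exp (- (6 * C * s)) * (6 * C * N + 4 * (\<epsilon> + \<delta>) * ((norm a)^2 + (norm b)^2))"
   by (intro mult_left_mono) auto
  have "exp (- (6 * C * s)) * (4 * (\<epsilon> + \<delta>) * ((norm a)^2 + (norm b)^2)) <= 4 * (\<epsilon> + \<delta>) * ((norm a)^2 + (norm b)^2)"
   using e d s C0 by (intro mult_left_le_one_le) auto
  with i have "exp (- (6 * C * s)) * (2 * ((- a - - b) \<bullet> (U s - X s)))
    + exp (- (6 * C * s)) * (- (6 * C)) * N + 4 * (\<epsilon> + \<delta>) * (- (norm a)\<^sup>2 + - (norm b)\<^sup>2) <= 0"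
   by (simp add: algebra_simps)
  with D show "EX y. (G has_real_derivative y) (at s) & y <= 0" by blast
 next
  show "continuous_on {0..t} G" unfolding G_def
   by (intro continuous_intros continuous_on_subset[OF flow_energy_cont[OF e U]] continuous_on_subset[OF flow_energy_cont[OF d X]]
     continuous_on_subset[OF flow_cont[OF e U]] continuous_on_subset[OF flow_cont[OF d X]]) auto
 qed
 moreover have "G 0 <= 4 * (\<epsilon> + \<delta>) * (2 * \<Phi> x)"
  unfolding G_def using flow_0[OF e U] flow_0[OF d X] env_le[OF e x] env_le[OF d x] e d by simp
 moreover have "4 * (\<epsilon> + \<delta>) * (2 * m) <= 4 * (\<epsilon> + \<delta>) * (env \<epsilon> (U t) + env \<delta> (X t))"
  using env_lower[OF e, of "U t"] env_lower[OF d, of "X t"] e d by (intro mult_left_mono) auto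
 ultimately have "exp (- (6 * C * t)) * (norm (U t - X t))^2 <= 8 * (\<epsilon> + \<delta>) * (\<Phi> x - m)"
  unfolding G_def by (simp add: algebra_simps)
 thus ?thesis by (simp add: exp_minus field_simps)
qed

end

section \<open>Gradient flows of semiconvex functionals: passage to the limit\<close>

text \<open>\<open>W\<close> will be strongly continuous from the right only, so the energy balance
  must come from right derivatives. The proof takes the last point where \<open>f\<close> lies below
  a line of small slope; the vanishing right derivative would produce a later one.\<close>

lemma right_derivative_zero_le:
 fixes f :: "real => real"
 assumes ab: "a <= b" and c: "continuous_on {a..b} f"
  and d: "!!t. a <= t ==> t < b ==> ((%s. (f s - f t) / (s - t)) \<longlongrightarrow> 0) (at_right t)"
 shows "f b <= f a"
proof (rule field_le_epsilon)
 fix e :: real assume e: "e > 0"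
 define \<eta> where "\<eta> = e / (b - a + 1)"
 have \<eta>: "\<eta> > 0" using e ab by (simp add: \<eta>_def)
 define S where "S = {x \<in> {a..b}. f x <= f a + \<eta> * (x - a)}"
 have Sc: "closed S"
 proof -
  have "continuous_on {a..b} (%x. f x - (f a + \<eta> * (x - a)))" by (intro continuous_intros c)
  hence "closed ({a..b} \<inter> (%x. f x - (f a + \<eta> * (x - a))) -` {..0})"
   by (intro continuous_closed_preimage) auto
  moreover have "{a..b} \<inter> (%x. f x - (f a + \<eta> * (x - a))) -` {..0} = S" by (auto simp: S_def)
  ultimately show ?thesis by simp
 qed
 have aS: "a \<in> S" using ab by (simp add: S_def)
 have bdd: "bdd_above S" by (rule bdd_aboveI[of _ b]) (auto simp: S_def)
 define x where "x = Sup S"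
 have xS: "x \<in> S" unfolding x_def using aS by (intro closed_contains_Sup Sc bdd) auto
 have "x = b"
 proof (rule ccontr)
  assume "x \<noteq> b"
  hence x: "a <= x" "x < b" using xS by (auto simp: S_def)
  have "eventually (%s. (f s - f x) / (s - x) < \<eta>) (at_right x)"
   using d[OF x] \<eta> by (intro order_tendstoD(2)) auto
  moreover have "eventually (%s. s \<in> {x<..<b}) (at_right x)" by (rule eventually_at_right_real[OF x(2)])
  ultimately have "eventually (%s. (f s - f x) / (s - x) < \<eta> & s \<in> {x<..<b}) (at_right x)"
   by (rule eventually_conj)
  then obtain s where s: "(f s - f x) / (s - x) < \<eta>" "x < s" "s < b"
   using eventually_happens[of _ "at_right x"] by (auto simp: trivial_limit_at_right_real)
  have "f s - f x <= \<eta> * (s - x)" using s by (simp add: pos_divide_less_eq)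
  moreover have "f x <= f a + \<eta> * (x - a)" using xS by (simp add: S_def)
  moreover have "\<eta> * (s - x) + \<eta> * (x - a) = \<eta> * (s - a)" by (simp add: algebra_simps)
  ultimately have "s \<in> S" using s x by (simp add: S_def)
  hence "s <= x" unfolding x_def by (rule cSup_upper[OF _ bdd])
  thus False using s by simp
 qed
 hence "f b <= f a + \<eta> * (b - a)" using xS by (simp add: S_def)
 also have "\<eta> * (b - a) <= e" using e ab by (simp add: \<eta>_def field_simps)
 finally show "f b <= f a + e" by simp
qed

lemma right_derivative_zero_eq:
 fixes f :: "real => real"
 assumes "a <= b" "continuous_on {a..b} f"
  and d: "!!t. a <= t ==> t < b ==> ((%s. (f s - f t) / (s - t)) \<longlongrightarrow> 0) (at_right t)"
 shows "f b = f a"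
proof (rule antisym)
 show "f b <= f a" by (rule right_derivative_zero_le[OF assms])
 have "- f b <= - f a"
 proof (rule right_derivative_zero_le[of a b "%s. - f s"])
  show "((%s. (- f s - - f t) / (s - t)) \<longlongrightarrow> 0) (at_right t)" if "a <= t" "t < b" for t
  proof -
   have "(%s. (- f s - - f t) / (s - t)) = (%s. - ((f s - f t) / (s - t)))"
    by (simp add: fun_eq_iff minus_divide_left)
   thus ?thesis using tendsto_minus[OF d[OF that]] by simp
  qed
 qed (intro assms continuous_intros)+
 thus "f a <= f b" by simp
qed

lemma continuous_on_atLeast_0I:
 fixes f :: "real => 'b::topological_space"
 assumes "!!T. 0 <= T ==> continuous_on {0..T} f"
 shows "continuous_on {0..} f"
proof (rule continuous_on_eq_continuous_within[THEN iffD2, OF ballI])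
 fix t :: real assume t: "t \<in> {0..}"
 have "continuous (at t within {0..t+1}) f"
  using assms[of "t+1"] t by (simp add: continuous_on_eq_continuous_within)
 moreover have "at t within {0..t+1} = at t within {0..}"
  by (rule at_within_nhd[where S="{..<t+1}"]) auto
 ultimately show "continuous (at t within {0..}) f" by simp
qed

lemma decreasing_integrable_on:
 fixes q :: "real => real"
 assumes q: "!!r s. a <= r ==> r <= s ==> s <= b ==> q s <= q r"
  and q0: "!!r. 0 <= q r" and k: "continuous_on {a..b} k" "!!r. 0 <= k r"
 shows "(%r. k r * q r) integrable_on {a..b}"
proof (rule measurable_bounded_by_integrable_imp_integrable)
 have "mono_on {a..b} (%r. - q r)" using q by (auto simp: mono_on_def)
 hence "integrable (lebesgue_on {a..b}) (%r. - (- q r))" by (intro Bochner_Integration.integrable_minus integrable_mono_on)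
 thus "(%r. k r * q r) \<in> borel_measurable (lebesgue_on {a..b})"
  using borel_measurable_integrable[OF continuous_imp_integrable_real[OF k(1)]] by (auto intro: borel_measurable_times borel_measurable_integrable)
 show "(%r. k r * q a) integrable_on {a..b}" by (intro integrable_continuous_real continuous_intros k)
 show "norm (k r * q r) <= k r * q a" if "r \<in> {a..b}" for r
  using that k q0 q[of a r] by (auto simp: abs_mult intro!: mult_left_mono)
qed auto

context gradient_flow
begin

lemma lsc_eventually:
 assumes X: "!!n. X n \<in> D" "X ----> l" and a: "a < \<Phi> l"
 shows "eventually (%n. a < \<Phi> (X n)) sequentially"
proof (rule ccontr)
 assume "\<not> ?thesis"
 hence "infinite {n. \<Phi> (X n) <= a}"
  unfolding cofinite_eq_sequentially[symmetric] eventually_cofinite by (simp add: not_less)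
 from infinite_enumerate[OF this] obtain r :: "nat => nat" where r: "strict_mono r" "!!n. \<Phi> (X (r n)) <= a" by auto
 have "\<Phi> l <= a"
  using closed_sublevel[of "%n. X (r n)" l a] X(1) LIMSEQ_subseq_LIMSEQ[OF X(2) r(1)] r(2) by (auto simp: o_def)
 thus False using a by simp
qed

text \<open>For fixed \<open>v\<close> the subgradient inequality places \<open>w n\<close>, up to a
  slack, eventually in a closed half-space, so the convex cluster point inherits it. That
  \<open>l\<close> lies in \<open>D\<close> follows from bounding \<open>\<Phi> (x n)\<close> by a
  competitor.\<close>

lemma SG_cluster:
 assumes sg: "!!n::nat. SG (x n) (w n)" and x: "x ----> l" and M: "!!n. norm (w n) <= M"
 obtains p where "SG l p" "!!S. closed S ==> convex S ==> eventually (%n. w n \<in> S) sequentially ==> p \<in> S"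
proof -
 obtain p where p: "!!S. closed S ==> convex S ==> eventually (%n. w n \<in> S) sequentially ==> p \<in> S"
  using bounded_seq_convex_cluster[of w M] M by metis
 have xD: "x n \<in> D" for n using sg by (simp add: subgradient_def)
 have M0: "M >= 0" using M norm_ge_zero order_trans by blast
 have nx: "(%n. norm (v - x n)) ----> norm (v - l)" for v using x by (intro tendsto_intros)
 have lD: "l \<in> D"
 proof -
  obtain v where v: "v \<in> D" using ne by blast
  have bnd: "\<Phi> (x n) <= \<Phi> v + M * norm (v - x n) + C / 2 * (norm (v - x n))^2" for n
  proof -
   have "- (w n \<bullet> (v - x n)) <= norm (w n) * norm (v - x n)" using Cauchy_Schwarz_ineq2[of "w n" "v - x n"] by linarith
   also have "... <= M * norm (v - x n)" by (intro mult_right_mono M) auto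
   finally show ?thesis using sg[of n] v unfolding subgradient_def by fastforce
  qed
  have lim: "(%n. \<Phi> v + M * norm (v - x n) + C / 2 * (norm (v - x n))^2) ----> \<Phi> v + M * norm (v - l) + C / 2 * (norm (v - l))^2"
   by (intro tendsto_intros nx)
  show ?thesis
   by (rule lsc(1)[OF always_eventually[OF allI, OF xD] x always_eventually[OF allI, OF bnd] lim])
 qed
 have "SG l p"
  unfolding subgradient_def
 proof (intro conjI ballI lD)
  show "p \<in> V"
   by (rule p) (use V sg in \<open>auto simp: subgradient_def subspace_imp_convex\<close>)
  fix v assume v: "v \<in> D"
  have "p \<bullet> (v - l) <= \<Phi> v - \<Phi> l + C / 2 * (norm (v - l))^2 + e" if e: "e > 0" for e
  proof -
   let ?S = "{z. (v - l) \<bullet> z <= \<Phi> v - \<Phi> l + C / 2 * (norm (v - l))^2 + e}"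
   have "(%n. C / 2 * (norm (v - x n))^2 + M * norm (l - x n)) ----> C / 2 * (norm (v - l))^2 + M * norm (l - l)"
    by (intro tendsto_intros nx)
   hence "eventually (%n. C / 2 * (norm (v - x n))^2 + M * norm (l - x n) < C / 2 * (norm (v - l))^2 + e/2) sequentially"
    using e by (intro order_tendstoD(2)) auto
   hence "eventually (%n. w n \<in> ?S) sequentially"
    using lsc_eventually[OF xD x, of "\<Phi> l - e / 2", simplified, OF e]
   proof (eventually_elim)
    case (elim n)
    have "w n \<bullet> (x n - l) <= norm (w n) * norm (x n - l)" by (rule norm_cauchy_schwarz)
    also have "... <= M * norm (l - x n)" unfolding norm_minus_commute[of "x n"] by (intro mult_right_mono M) auto
    finally have "w n \<bullet> (x n - l) <= M * norm (l - x n)" .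
    moreover have "\<Phi> (x n) + w n \<bullet> (v - x n) - C / 2 * (norm (v - x n))^2 <= \<Phi> v"
     using sg[of n] v by (simp add: subgradient_def)
    moreover have "(v - l) \<bullet> w n = w n \<bullet> (v - x n) + w n \<bullet> (x n - l)" by (simp add: inner_diff_right inner_commute)
    ultimately show ?case using elim e by auto
   qed
   from p[OF closed_halfspace_le convex_halfspace_le this] show ?thesis by (simp add: inner_commute)
  qed
  hence "p \<bullet> (v - l) <= \<Phi> v - \<Phi> l + C / 2 * (norm (v - l))^2" by (rule field_le_epsilon)
  thus "\<Phi> l + p \<bullet> (v - l) - C / 2 * (norm (v - l))^2 <= \<Phi> v" by simp
 qed
 thus thesis using that p by blast
qed

text \<open>Uniqueness upgrades the cluster point to a weak limit of the whole sequence: a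
  subsequence staying on the wrong side of a half-space would have a cluster point that is another
  subgradient at \<open>l\<close>.\<close>

lemma SG_closure:
 assumes sg: "!!n::nat. SG (x n) (w n)" and x: "x ----> l" and M: "!!n. norm (w n) <= M"
 obtains p where "SG l p" "norm p <= M" "!!h. (%n. w n \<bullet> h) ----> p \<bullet> h"
proof -
 obtain p where p: "SG l p" "!!S. closed S ==> convex S ==> eventually (%n. w n \<in> S) sequentially ==> p \<in> S"
  using SG_cluster[OF assms] by metis
 have "p \<in> cball 0 M" by (rule p(2)) (use M in auto)
 hence pM: "norm p <= M" by simp
 have below: "eventually (%n. c < w n \<bullet> h) sequentially" if c: "c < p \<bullet> h" for c h
 proof (rule ccontr)
  assume "\<not> ?thesis"
  hence "infinite {n. w n \<bullet> h <= c}"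
   unfolding cofinite_eq_sequentially[symmetric] eventually_cofinite by (simp add: not_less)
  from infinite_enumerate[OF this] obtain r :: "nat => nat" where r: "strict_mono r" "!!n. w (r n) \<bullet> h <= c" by auto
  obtain q where q: "SG l q" "!!S. closed S ==> convex S ==> eventually (%n. w (r n) \<in> S) sequentially ==> q \<in> S"
   using SG_cluster[of "%n. x (r n)" "%n. w (r n)" l M] sg M LIMSEQ_subseq_LIMSEQ[OF x r(1)] unfolding o_def by metis
  have "q = p" using unique q(1) p(1) by blast
  moreover have "q \<in> {z. h \<bullet> z <= c}"
   by (rule q(2)[OF closed_halfspace_le convex_halfspace_le]) (use r in \<open>auto simp: inner_commute\<close>)
  ultimately show False using c by (simp add: inner_commute)
 qed
 have "(%n. w n \<bullet> h) ----> p \<bullet> h" for h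
 proof (rule order_tendstoI)
  show "!!a. a < p \<bullet> h ==> eventually (%n. a < w n \<bullet> h) sequentially" by (rule below)
  show "eventually (%n. w n \<bullet> h < a) sequentially" if "p \<bullet> h < a" for a
   using below[of "- a" "- h"] that by simp
 qed
 thus thesis using that p(1) pM by blast
qed

end

context gradient_flow
begin

text \<open>The regularized flows converge locally uniformly with squared error of order \<epsilon>,
  but their speeds are bounded only away from time zero. Hence the assertions on \<open>W\<close>
  concern positive times, and the energy balance reaches zero by monotone convergence.\<close>

theorem gradient_flow_exists:
 assumes x0: "x0 \<in> D"
 obtains U W where "U 0 = x0" "continuous_on {0..} U" "!!t. t >= 0 ==> U t \<in> D"
  "!!t. t > 0 ==> SG (U t) (W t)"
  "!!t h. t > 0 ==> ((%r. U r \<bullet> h) has_real_derivative - (W t \<bullet> h)) (at t)"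
  "!!t. t > 0 ==> (W \<longlongrightarrow> W t) (at_right t)"
  "!!r t. 0 < r ==> r <= t ==> norm (W t) <= exp (4 * C * (t - r)) * norm (W r)"
  "continuous_on {0..} (%t. \<Phi> (U t))"
  "!!\<tau> t. 0 <= \<tau> ==> \<tau> <= t ==> ((%r. (norm (W r))^2) has_integral (\<Phi> (U \<tau>) - \<Phi> (U t))) {\<tau>..t}"
proof -
 define B where "B = \<Phi> x0 - m"
 have B0: "B >= 0" using lower[OF x0] by (simp add: B_def)
 have x0V: "x0 \<in> V" using x0 DV by auto
 \<comment> \<open>The summand 1 in \<open>C + 1\<close> covers \<open>C = 0\<close>; the factor 2
   yields the bound 1/2 on \<open>eps n * C\<close>.\<close>
 define eps where "eps n = 1 / (2 * (C + 1) * real (Suc n))" for n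
 have e1: "eps n > 0" for n using C0 by (simp add: eps_def)
 have e2: "eps n * C <= 1/2" for n
 proof -
  have "C * 2 <= 2 * (C + 1) * real (Suc n)"
  proof -
   have "C * 2 <= 2 * (C + 1) * 1" by simp
   also have "... <= 2 * (C + 1) * real (Suc n)" using C0 by (intro mult_left_mono) auto
   finally show ?thesis .
  qed
  thus ?thesis using C0 unfolding eps_def by (simp add: divide_le_eq)
 qed
 have eps0: "eps ----> 0"
 proof -
  have "(%n. (1 / (2 * (C + 1))) * inverse (real (Suc n))) ----> (1 / (2 * (C + 1))) * 0"
   by (intro tendsto_intros LIMSEQ_inverse_real_of_nat)
  moreover have "eps = (%n. (1 / (2 * (C + 1))) * inverse (real (Suc n)))" by (simp add: eps_def fun_eq_iff inverse_eq_divide)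
  ultimately show ?thesis by simp
 qed
 have "ALL n. EX U. flow (eps n) x0 U" by (intro allI flow_exists[OF e1 e2])
 from choice[OF this] obtain Us where fl: "!!n. flow (eps n) x0 (Us n)" by blast
 have cmp: "(norm (Us n t - Us k t))^2 <= 8 * exp (6 * C * t) * (eps n + eps k) * B" if "t >= 0" for n k t
  unfolding B_def by (rule flow_compare[OF e1 e2 e1 e2 fl fl x0 that])
 have "EX u. (%n. Us n t) ----> u" if t: "t >= 0" for t
 proof -
  have "Cauchy (%n. Us n t)"
  proof (rule metric_CauchyI)
   fix r :: real assume r: "r > 0"
   define K where "K = 8 * exp (6 * C * t) * B"
   have K0: "K >= 0" using B0 by (simp add: K_def)
   have "(%n. K * (2 * eps n)) ----> K * (2 * 0)" by (intro tendsto_intros eps0)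
   hence "eventually (%n. K * (2 * eps n) < r^2) sequentially" using r by (intro order_tendstoD(2)) auto
   then obtain N where N: "!!n. n >= N ==> K * (2 * eps n) < r^2" unfolding eventually_sequentially by blast
   have "dist (Us n t) (Us k t) < r" if "n >= N" "k >= N" for n k
   proof -
    have "(norm (Us n t - Us k t))^2 <= K * (eps n + eps k)" using cmp[OF t, of n k] by (simp add: K_def mult_ac)
    also have "... = (K * (2 * eps n) + K * (2 * eps k)) / 2" by (simp add: algebra_simps)
    also have "... < r^2" using N[OF that(1)] N[OF that(2)] by simp
    finally show ?thesis unfolding dist_norm by (rule power2_less_imp_less) (use r in simp)
   qed
   thus "EX N. \<forall>m\<ge>N. \<forall>n\<ge>N. dist (Us m t) (Us n t) < r" by blast
  qed
  thus ?thesis using Cauchy_convergent convergent_def by blast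
 qed
 then obtain U where Ulim: "!!t. t >= 0 ==> (%n. Us n t) ----> U t" by metis
 have U0: "U 0 = x0"
 proof -
  have "(%n. Us n 0) ----> x0" using flow_0[OF e1 e2 fl] by simp
  thus ?thesis using LIMSEQ_unique[OF Ulim[of 0]] by simp
 qed
 have rate: "(norm (Us n t - U t))^2 <= 8 * exp (6 * C * t) * (eps n + 0) * B" if t: "t >= 0" for n t
 proof (rule LIMSEQ_le)
  show "(%k. (norm (Us n t - Us k t))^2) ----> (norm (Us n t - U t))\<^sup>2" by (intro tendsto_intros Ulim t)
  show "(%k. 8 * exp (6 * C * t) * (eps n + eps k) * B) ----> 8 * exp (6 * C * t) * (eps n + 0) * B"
   by (intro tendsto_intros eps0)
 qed (use cmp[OF t] in blast)
 have Uc: "continuous_on {0..} U"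
 proof (rule continuous_on_atLeast_0I)
  fix T :: real assume T: "0 <= T"
  show "continuous_on {0..T} U"
  proof (rule uniform_limit_theorem[OF _ _ trivial_limit_sequentially])
   show "\<forall>\<^sub>F n in sequentially. continuous_on {0..T} (Us n)"
    by (intro always_eventually allI continuous_on_subset[OF flow_cont[OF e1 e2 fl]]) auto
   show "uniform_limit {0..T} Us U sequentially"
   proof (rule uniform_limitI)
    fix r :: real assume r: "r > 0"
    define K where "K = 8 * exp (6 * C * T) * B"
    have "(%n. K * eps n) ----> K * 0" by (intro tendsto_intros eps0)
    hence "eventually (%n. K * eps n < r^2) sequentially" using r by (intro order_tendstoD(2)) auto
    thus "\<forall>\<^sub>F n in sequentially. \<forall>t\<in>{0..T}. dist (Us n t) (U t) < r"
    proof eventually_elim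
     case (elim n)
     show ?case
     proof
      fix t assume t: "t \<in> {0..T}"
      have "(norm (Us n t - U t))^2 <= (8 * exp (6 * C * t) * B) * eps n" using rate[of t n] t by (simp add: mult_ac)
      also have "... <= K * eps n"
       unfolding K_def using t C0 B0 e1[of n] by (intro mult_right_mono mult_left_mono) (auto intro: mult_left_mono)
      also have "... < r^2" by (rule elim)
      finally show "dist (Us n t) (U t) < r" unfolding dist_norm by (rule power2_less_imp_less) (use r in simp)
     qed
    qed
   qed
  qed
 qed
 \<comment> \<open>\<open>Mb a b\<close> bounds all regularized speeds on \<open>{a..b}\<close>: it
   comes from the second part of \<open>flow_energy_bound\<close>, with \<open>t\<close> estimated
   by the endpoints.\<close>
 define Mb where "Mb a b = exp (4 * C * b) * sqrt (B / a)" for a b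
 have Mb0: "Mb a b >= 0" if "a > 0" for a b using that B0 by (simp add: Mb_def)
 define Wn where "Wn n t = A (eps n) (Us n t)" for n t
 have Wb: "norm (Wn n t) <= Mb a b" if "0 < a" "a <= t" "t <= b" for n t a b
 proof -
  have t: "t > 0" using that by simp
  have "t * exp (- (8 * C * t)) * (norm (Wn n t))^2 <= B"
   using flow_energy_bound(2)[OF e1 e2 fl x0, of t n] t unfolding B_def Wn_def by simp
  hence "(norm (Wn n t))^2 <= exp (8 * C * t) * (B / t)" using t by (simp add: exp_minus field_simps)
  also have "... <= exp (8 * C * b) * (B / a)"
   using that B0 C0 t by (intro mult_mono frac_le) (auto intro: mult_left_mono)
  also have "... = (Mb a b)^2"
   using that B0 unfolding Mb_def by (simp add: power_mult_distrib flip: exp_of_nat_mult)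
  finally show ?thesis by (rule power2_le_imp_le) (rule Mb0[OF that(1)])
 qed
 have UsV: "Us n t \<in> V" if "t >= 0" for n t by (rule flow_in_V[OF e1 e2 fl x0V that])
 have Jt: "(%n. J (eps n) (x n)) ----> l" if "x ----> l" "!!n. norm (A (eps n) (x n)) <= M" for x l M
 proof -
  have "(%n. eps n *\<^sub>R A (eps n) (x n)) ----> 0"
  proof (rule Lim_null_comparison)
   show "\<forall>\<^sub>F n in sequentially. norm (eps n *\<^sub>R A (eps n) (x n)) <= eps n * M"
    using that(2) e1 by (intro always_eventually allI) (simp add: less_imp_le)
   show "(%n. eps n * M) ----> 0" using tendsto_mult_right[OF eps0, of M] by simp
  qed
  from tendsto_diff[OF that(1) this] show ?thesis by (simp flip: A_eq[OF e1 e2])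
 qed
 \<comment> \<open>With bounded Yosida approximations the resolvent points have the same limit as
   \<open>x\<close>, and the subgradients there converge weakly to the subgradient at the
   limit.\<close>
 have cl: "EX p. SG l p & (ALL h. (%n. A (eps n) (x n) \<bullet> h) ----> p \<bullet> h)"
  if "x ----> l" "!!n. norm (A (eps n) (x n)) <= M" "!!n. x n \<in> V" for x l M
  using SG_closure[OF J_SG[OF e1 e2 that(3)] Jt[OF that(1,2)] that(2)] by metis
 have Wt: "EX w. SG (U t) w & (ALL h. (%n. Wn n t \<bullet> h) ----> w \<bullet> h)" if t: "t > 0" for t
  unfolding Wn_def by (rule cl[OF Ulim Wb[OF t order_refl order_refl, unfolded Wn_def] UsV]) (use t in auto)
 obtain W where SGW: "!!t. t > 0 ==> SG (U t) (W t)"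
  and Wlim: "!!t h. t > 0 ==> (%n. Wn n t \<bullet> h) ----> W t \<bullet> h" using Wt by metis
 have WM: "norm (W t) <= Mb a b" if "0 < a" "a <= t" "t <= b" for t a b
 proof -
  have t: "t > 0" using that by simp
  have "(norm (W t))^2 <= Mb a b * norm (W t)"
   unfolding power2_norm_eq_inner
  proof (rule LIMSEQ_le_const2[OF Wlim[OF t]], intro exI allI impI)
   fix n :: nat
   have "Wn n t \<bullet> W t <= norm (Wn n t) * norm (W t)" by (rule norm_cauchy_schwarz)
   also have "... <= Mb a b * norm (W t)" by (intro mult_right_mono Wb that) auto
   finally show "Wn n t \<bullet> W t <= Mb a b * norm (W t)" .
  qed
  thus ?thesis by (rule le_of_square_le_mult) (use Mb0[OF that(1), of b] in auto)
 qed
 have UD: "U t \<in> D" and PhiU: "\<Phi> (U t) <= \<Phi> x0" if t: "t >= 0" for t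
 proof -
  have "U t \<in> D & \<Phi> (U t) <= \<Phi> x0"
  proof (cases "t = 0")
   case False
   hence t': "t > 0" using t by simp
   show ?thesis
   proof (rule closed_sublevel[OF _ Jt[OF Ulim[OF t] Wb[OF t' order_refl order_refl, unfolded Wn_def]]])
    show "J (eps n) (Us n t) \<in> D" for n by (rule J_D[OF e1 e2])
    show "\<Phi> (J (eps n) (Us n t)) <= \<Phi> x0" for n
     using J_le_env[OF e1 e2] flow_energy_bound(1)[OF e1 e2 fl x0 t] by (meson order_trans)
   qed
  qed (use U0 x0 in auto)
  thus "U t \<in> D" "\<Phi> (U t) <= \<Phi> x0" by auto
 qed
 have int: "((%r. W r \<bullet> h) has_integral (U \<tau> \<bullet> h - U t \<bullet> h)) {\<tau>..t}" if "0 < \<tau>" "\<tau> <= t" for \<tau> t h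
 proof (rule has_integral_dominated_convergence[where h="%_. Mb \<tau> t * norm h"])
  show "((%r. Wn n r \<bullet> h) has_integral (Us n \<tau> \<bullet> h - Us n t \<bullet> h)) {\<tau>..t}" for n
  proof -
   have "((%r. - (A (eps n) (Us n r)) \<bullet> h) has_integral (Us n t \<bullet> h - Us n \<tau> \<bullet> h)) {\<tau>..t}"
   proof (rule fundamental_theorem_of_calculus[OF that(2)])
    fix r assume "r \<in> {\<tau>..t}"
    hence "r > 0" using that by auto
    from has_real_derivative_inner[OF flow_deriv'[OF e1 e2 fl this, of n] has_vector_derivative_const[of h]]
    have "((%r. Us n r \<bullet> h) has_real_derivative (- (A (eps n) (Us n r)) \<bullet> h)) (at r)" by simp
    thus "((%r. Us n r \<bullet> h) has_vector_derivative - (A (eps n) (Us n r)) \<bullet> h) (at r within {\<tau>..t})"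
     using has_field_derivative_at_within has_real_derivative_iff_has_vector_derivative by blast
   qed
   from has_integral_neg[OF this] show ?thesis by (simp add: Wn_def)
  qed
  show "(%_. Mb \<tau> t * norm h) integrable_on {\<tau>..t}" by (intro integrable_continuous_real continuous_intros)
  show "\<forall>r\<in>{\<tau>..t}. norm (Wn n r \<bullet> h) <= Mb \<tau> t * norm h" for n
  proof
   fix r assume r: "r \<in> {\<tau>..t}"
   have "norm (Wn n r \<bullet> h) <= norm (Wn n r) * norm h" by (simp add: Cauchy_Schwarz_ineq2)
   also have "... <= Mb \<tau> t * norm h" using r that by (intro mult_right_mono Wb) auto
   finally show "norm (Wn n r \<bullet> h) <= Mb \<tau> t * norm h" .
  qed
  show "\<forall>r\<in>{\<tau>..t}. (%n. Wn n r \<bullet> h) ----> W r \<bullet> h" using Wlim that by auto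
  show "(%n. Us n \<tau> \<bullet> h - Us n t \<bullet> h) ----> U \<tau> \<bullet> h - U t \<bullet> h" using that by (intro tendsto_intros Ulim) auto
 qed
 have Ux: "(%n. U (x n)) ----> U t" if "!!n. 0 <= x n" "x ----> t" for x and t :: real
  using Uc LIMSEQ_le_const[OF that(2), of 0] that unfolding continuous_on_sequentially o_def by auto
 \<comment> \<open>Weak continuity of \<open>W\<close> does not use the equation: bounded
   subgradients along convergent points converge weakly, and uniqueness identifies the
   limit.\<close>
 have Wc: "continuous_on {a..b} (%r. W r \<bullet> h)" if a: "a > 0" for a b h
  unfolding continuous_on_sequentially
 proof (intro allI ballI impI)
  fix x :: "nat => real" and t assume "t \<in> {a..b}" and x: "(ALL n. x n \<in> {a..b}) & x ----> t"
  hence t: "t > 0" using a by auto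
  have "!!n. SG (U (x n)) (W (x n))" using x a SGW by (metis atLeastAtMost_iff less_le_trans)
  moreover have "(%n. U (x n)) ----> U t"
   by (rule Ux) (use x a in \<open>auto intro: order_trans[OF less_imp_le]\<close>)
  moreover have "!!n. norm (W (x n)) <= Mb a b" using x a WM by auto
  ultimately obtain p where p: "SG (U t) p" "!!h. (%n. W (x n) \<bullet> h) ----> p \<bullet> h"
   using SG_closure[of "%n. U (x n)" "%n. W (x n)" "U t" "Mb a b"] by metis
  have "p = W t" using unique[OF p(1) SGW[OF t]] .
  thus "((%r. W r \<bullet> h) \<circ> x) ----> W t \<bullet> h" using p(2)[of h] by (simp add: o_def)
 qed
 have der: "((%r. U r \<bullet> h) has_real_derivative - (W t \<bullet> h)) (at t)" if t: "t > 0" for t h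
 proof -
  define a b where "a = t / 2" and "b = t + 1"
  have ab: "0 < a" "a < t" "t < b" using t by (auto simp: a_def b_def)
  have "((%x. integral {a..x} (%r. W r \<bullet> h)) has_real_derivative (W t \<bullet> h)) (at t within {a..b})"
   using ab by (intro integral_has_real_derivative Wc) auto
  hence "((%x. U a \<bullet> h - integral {a..x} (%r. W r \<bullet> h)) has_real_derivative (0 - W t \<bullet> h)) (at t within {a..b})"
   by (intro DERIV_diff DERIV_const)
  hence "((%x. U x \<bullet> h) has_real_derivative (0 - W t \<bullet> h)) (at t within {a..b})"
  proof (rule has_field_derivative_transform_within[of _ _ _ _ 1])
   show "t \<in> {a..b}" using ab by auto
   show "U a \<bullet> h - integral {a..x} (%r. W r \<bullet> h) = U x \<bullet> h" if "x \<in> {a..b}" for x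
    using integral_unique[OF int[OF ab(1), of x h]] that by simp
  qed simp
  moreover have "at t within {a..b} = at t" using ab by (intro at_within_interior) auto
  ultimately show ?thesis by simp
 qed
 have lip: "norm (U s - U r) <= Mb a b * \<bar>s - r\<bar>" if "0 < a" "r \<in> {a..b}" "s \<in> {a..b}" for a b r s
 proof -
  have *: "norm (U s - U r) <= Mb a b * (s - r)" if rs: "r <= s" "r \<in> {a..b}" "s \<in> {a..b}" for r s
  proof -
   have r0: "0 < r" using rs \<open>0 < a\<close> by auto
   define h where "h = U s - U r"
   have "norm (U r \<bullet> h - U s \<bullet> h) <= (Mb a b * norm h) * measure lborel {r..s}"
   proof (rule has_integral_bound_real[OF _ finite.emptyI int[OF r0 rs(1), of h]])
    show "0 <= Mb a b * norm h" using Mb0[OF \<open>0 < a\<close>] by simp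
    show "norm (W q \<bullet> h) <= Mb a b * norm h" if "q \<in> {r..s} - {}" for q
    proof -
     have "norm (W q \<bullet> h) <= norm (W q) * norm h" by (simp add: Cauchy_Schwarz_ineq2)
     also have "... <= Mb a b * norm h" using that rs \<open>0 < a\<close> by (intro mult_right_mono WM) auto
     finally show ?thesis .
    qed
   qed
   moreover have "U r \<bullet> h - U s \<bullet> h = - (norm h)\<^sup>2" by (simp add: h_def power2_norm_eq_inner inner_diff_left inner_diff_right)
   ultimately have "(norm h)^2 <= (Mb a b * (s - r)) * norm h" using rs by (simp add: mult_ac)
   thus ?thesis using Mb0[OF \<open>0 < a\<close>, of b] rs unfolding h_def[symmetric]
    by - (rule le_of_square_le_mult, auto intro!: mult_nonneg_nonneg)
  qed
  show ?thesis using *[of r s] *[of s r] that by (cases "r <= s") (auto simp: norm_minus_commute)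
 qed
 have quot: "((%s. (U s \<bullet> h - U t \<bullet> h) / (s - t)) \<longlongrightarrow> - (W t \<bullet> h)) (at_right t)" if "t > 0" for t h
  using der[OF that, of h] unfolding has_field_derivative_iff by (rule tendsto_within_subset) auto
 \<comment> \<open>Weak convergence alone does not make the speeds of \<open>Us n\<close> at time
   \<open>r\<close> converge to \<open>norm (W r)\<close>. The regularized flows are therefore
   restarted at \<open>U r\<close>, where \<open>A_bound\<close> controls the initial speed;
   \<open>flow_contract\<close> shows that they have the same limit at time
   \<open>t\<close>.\<close>
 have dec: "norm (W t) <= exp (4 * C * (t - r)) * norm (W r)" if r: "0 < r" and rt: "r <= t" for r t
 proof -
  define E where "E = exp (4 * C * (t - r)) * norm (W r)"
  have t: "t > 0" "0 <= t - r" "0 <= r" using r rt by auto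
  have "ALL n. EX X. flow (eps n) (U r) X" by (intro allI flow_exists[OF e1 e2])
  from choice[OF this] obtain X where X: "!!n. flow (eps n) (U r) (X n)" by blast
  define x where "x n = X n (t - r)" for n
  define a where "a n = A (eps n) (x n)" for n
  have k: "0 <= 1 - eps n * C" for n using e2[of n] by simp
  have ab: "(1 - eps n * C) * norm (a n) <= E" for n
  proof -
   have "norm (a n) <= exp (4 * C * (t - r)) * norm (A (eps n) (U r))"
    using flow_speed[OF e1 e2 X order_refl t(2)] flow_0[OF e1 e2 X] by (simp add: a_def x_def)
   from mult_left_mono[OF this k] have "(1 - eps n * C) * norm (a n) <= exp (4 * C * (t - r)) * ((1 - eps n * C) * norm (A (eps n) (U r)))"
    by (simp add: mult_ac)
   also have "... <= E" unfolding E_def by (intro mult_left_mono A_bound[OF e1 e2 SGW[OF r]]) auto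
   finally show ?thesis .
  qed
  have aM: "norm (a n) <= 2 * E" for n
   using ab[of n] mult_right_mono[of "1/2" "1 - eps n * C" "norm (a n)"] e2[of n] by simp
  have "x ----> U t"
  proof (rule LIM_zero_cancel, rule Lim_null_comparison)
   let ?b = "%n. exp (4 * C * (t - r)) * norm (U r - Us n r) + norm (Us n t - U t)"
   show "\<forall>\<^sub>F n in sequentially. norm (x n - U t) <= ?b n"
   proof (intro always_eventually allI)
    fix n
    have "norm (x n - Us n t) <= exp (4 * C * (t - r)) * norm (U r - Us n r)"
     using flow_contract[OF e1 e2 X flow_shift[OF e1 e2 fl t(3)] order_refl t(2)] flow_0[OF e1 e2 X] by (simp add: x_def)
    thus "norm (x n - U t) <= ?b n" using norm_triangle_ineq[of "x n - Us n t" "Us n t - U t"] by simp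
   qed
   have "?b ----> exp (4 * C * (t - r)) * norm (U r - U r) + norm (U t - U t)" using t by (intro tendsto_intros Ulim) auto
   thus "?b ----> 0" by simp
  qed
  moreover have "x n \<in> V" for n
   unfolding x_def using flow_in_V[OF e1 e2 X _ t(2)] UD[OF t(3)] DV by auto
  ultimately obtain p where p: "SG (U t) p" "!!h. (%n. a n \<bullet> h) ----> p \<bullet> h"
   using cl[of x "U t" "2 * E"] aM unfolding a_def by blast
  have pW: "p = W t" using unique[OF p(1) SGW[OF t(1)]] .
  have "(norm (W t))^2 <= E * norm (W t)"
  proof (rule LIMSEQ_le_const2)
   have "(%n. (1 - eps n * C) * (a n \<bullet> W t)) ----> (1 - 0 * C) * (W t \<bullet> W t)"
    by (intro tendsto_mult tendsto_diff tendsto_const eps0 p(2)[unfolded pW])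
   thus "(%n. (1 - eps n * C) * (a n \<bullet> W t)) ----> (norm (W t))\<^sup>2" by (simp add: power2_norm_eq_inner)
   have "(1 - eps n * C) * (a n \<bullet> W t) <= E * norm (W t)" for n
   proof -
    have "(1 - eps n * C) * (a n \<bullet> W t) <= (1 - eps n * C) * (norm (a n) * norm (W t))"
     by (intro mult_left_mono norm_cauchy_schwarz k)
    also have "... <= E * norm (W t)" using ab[of n] by (simp add: mult_right_mono flip: mult.assoc)
    finally show ?thesis .
   qed
   thus "EX N. \<forall>n\<ge>N. (1 - eps n * C) * (a n \<bullet> W t) <= E * norm (W t)" by blast
  qed
  thus ?thesis unfolding E_def[symmetric] by (rule le_of_square_le_mult) (auto simp: E_def)
 qed
 \<comment> \<open>Weak convergence together with the upper bound of the norms from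
   \<open>dec\<close> gives strong convergence, from the right only.\<close>
 have Wr: "(W \<longlongrightarrow> W t) (at_right t)" if t: "t > 0" for t
 proof -
  have 1: "((%s. W s \<bullet> W t) \<longlongrightarrow> W t \<bullet> W t) (at_right t)"
  proof -
   have "continuous (at t within {t/2..t+1}) (%s. W s \<bullet> W t)"
    using Wc[of "t/2" "t+1" "W t"] t by (auto simp: continuous_on_eq_continuous_within)
   moreover have "at t within {t/2..t+1} = at t" using t by (intro at_within_interior) auto
   ultimately show ?thesis unfolding continuous_within by (auto intro: tendsto_within_subset)
  qed
  let ?b = "%s. (exp (4 * C * (s - t)) * norm (W t))^2 - 2 * (W s \<bullet> W t) + W t \<bullet> W t"
  have "((%s. (norm (W s - W t))^2) \<longlongrightarrow> 0) (at_right t)"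
  proof (rule Lim_null_comparison)
   show "\<forall>\<^sub>F s in at_right t. norm ((norm (W s - W t))^2) <= ?b s"
    unfolding eventually_at_right_field
   proof (intro exI[of _ "t + 1"] conjI allI impI)
    fix s assume s: "t < s"
    have "(norm (W s))^2 <= (exp (4 * C * (s - t)) * norm (W t))^2" using dec[OF t, of s] s by (intro power_mono) auto
    thus "norm ((norm (W s - W t))^2) <= ?b s"
     unfolding real_norm_def abs_power2 unfolding power2_norm_eq_inner by (simp add: inner_diff_left inner_diff_right inner_commute)
   qed simp
   have "(?b \<longlongrightarrow> (exp (4 * C * (t - t)) * norm (W t))\<^sup>2 - 2 * (W t \<bullet> W t) + W t \<bullet> W t) (at_right t)"
    by (intro tendsto_intros 1)
   thus "(?b \<longlongrightarrow> 0) (at_right t)" by (simp add: power2_norm_eq_inner)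
  qed
  from tendsto_real_sqrt[OF this] have "((%s. norm (W s - W t)) \<longlongrightarrow> 0) (at_right t)" by simp
  thus ?thesis using Lim_null[of W "W t"] tendsto_norm_zero_iff by blast
 qed
 define g where "g r = (norm (W r))^2" for r
 define P where "P t = \<Phi> (U t)" for t
 \<comment> \<open>The subgradient inequalities at \<open>s\<close> and at \<open>t\<close> enclose
   the energy increment between two first-order terms; this replaces a chain rule.\<close>
 have Pup: "P s - P t <= W s \<bullet> (U s - U t) + C / 2 * (norm (U s - U t))^2"
  and Plow: "W t \<bullet> (U s - U t) - C / 2 * (norm (U s - U t))^2 <= P s - P t" if "s > 0" "t > 0" for s t
 proof -
  show "W t \<bullet> (U s - U t) - C / 2 * (norm (U s - U t))^2 <= P s - P t"
   using SGW[OF that(2)] UD[of s] that unfolding subgradient_def P_def by force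
  have "\<Phi> (U s) + W s \<bullet> (U t - U s) - C / 2 * (norm (U t - U s))^2 <= \<Phi> (U t)"
   using SGW[OF that(1)] UD[of t] that unfolding subgradient_def by simp
  thus "P s - P t <= W s \<bullet> (U s - U t) + C / 2 * (norm (U s - U t))^2"
   unfolding P_def by (simp add: inner_diff_right norm_minus_commute)
 qed
 \<comment> \<open>From below by lower semicontinuity; from above by \<open>Pup\<close> with bounded
   \<open>W\<close> at positive times, and by \<open>PhiU\<close> at time zero.\<close>
 have Pcont: "continuous_on {0..} P"
  unfolding continuous_on_sequentially
 proof (intro allI ballI impI, elim conjE)
  fix x :: "nat => real" and t assume t: "t \<in> {0..}" and x: "ALL n. x n \<in> {0..}" "x ----> t"
  have lim: "(%n. U (x n)) ----> U t" using x by (intro Ux) auto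
  show "(P \<circ> x) ----> P t"
  proof (rule order_tendstoI)
   show "eventually (%n. a < (P \<circ> x) n) sequentially" if "a < P t" for a
    using lsc_eventually[OF _ lim] UD x(1) that by (simp add: P_def)
   show "eventually (%n. (P \<circ> x) n < a) sequentially" if a: "P t < a" for a
   proof (cases "t = 0")
    case True
    thus ?thesis using order_le_less_trans[OF PhiU] x(1) a by (auto simp: P_def U0 intro!: always_eventually)
   next
    case False
    hence t0: "t > 0" using t by simp
    let ?u = "%n. P t + Mb (t/2) (t+1) * norm (U (x n) - U t) + C / 2 * (norm (U (x n) - U t))^2"
    have "?u ----> P t + Mb (t/2) (t+1) * norm (U t - U t) + C / 2 * (norm (U t - U t))^2"
     by (intro tendsto_intros lim)
    hence "eventually (%n. ?u n < a) sequentially" using a by (intro order_tendstoD(2)) auto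
    moreover have "eventually (%n. x n \<in> {t/2<..<t+1}) sequentially"
     using x(2) t0 by (intro topological_tendstoD) auto
    ultimately show ?thesis
    proof eventually_elim
     case (elim n)
     have "W (x n) \<bullet> (U (x n) - U t) <= norm (W (x n)) * norm (U (x n) - U t)" by (rule norm_cauchy_schwarz)
     also have "... <= Mb (t/2) (t+1) * norm (U (x n) - U t)" using elim t0 by (intro mult_right_mono WM) auto
     finally show ?case using Pup[of "x n" t] elim t0 by simp
    qed
   qed
  qed
 qed
 have Pd: "((%s. (P s - P t) / (s - t)) \<longlongrightarrow> - g t) (at_right t)" if t: "t > 0" for t
 proof -
  define M where "M = Mb (t/2) (t+1)"
  let ?b = "%s. norm (W s - W t) * M + C / 2 * (M^2 * (s - t))"
  have "((%s. (P s - P t) / (s - t) - (U s \<bullet> W t - U t \<bullet> W t) / (s - t)) \<longlongrightarrow> 0) (at_right t)"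
  proof (rule Lim_null_comparison)
   have "eventually (%s. s \<in> {t<..<t+1}) (at_right t)" by (rule eventually_at_right_real) simp
   thus "eventually (%s. norm ((P s - P t) / (s - t) - (U s \<bullet> W t - U t \<bullet> W t) / (s - t)) <= ?b s) (at_right t)"
   proof eventually_elim
    case (elim s)
    hence s: "t < s" "s < t + 1" by auto
    define d where "d = U s - U t"
    have l: "norm d <= M * (s - t)" unfolding M_def d_def using lip[of "t/2" t "t+1" s] s t by simp
    have l2: "C / 2 * (norm d)^2 <= C / 2 * (M * (s - t))^2" using C0 l by (intro mult_left_mono power_mono) auto
    have "(W s - W t) \<bullet> d <= norm (W s - W t) * norm d" by (rule norm_cauchy_schwarz)
    also have "... <= norm (W s - W t) * (M * (s - t))" by (intro mult_left_mono l) auto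
    finally have "\<bar>P s - P t - W t \<bullet> d\<bar> <= norm (W s - W t) * (M * (s - t)) + C / 2 * (M * (s - t))^2"
     using Pup[of s t] Plow[of s t] s t l2 mult_nonneg_nonneg[OF norm_ge_zero order_trans[OF norm_ge_zero l], of "W s - W t"]
     unfolding d_def[symmetric] inner_diff_left abs_le_iff by linarith
    also have "... = ?b s * (s - t)" by (simp add: power_mult_distrib power2_eq_square[of "s - t"] distrib_right distrib_left mult_ac)
    finally have "\<bar>P s - P t - W t \<bullet> d\<bar> / (s - t) <= ?b s" using s by (simp add: pos_divide_le_eq)
    thus ?case using s by (simp add: d_def inner_diff_right inner_commute flip: diff_divide_distrib)
   qed
   have "(?b \<longlongrightarrow> norm (W t - W t) * M + C / 2 * (M^2 * (t - t))) (at_right t)" by (intro tendsto_intros Wr[OF t])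
   thus "(?b \<longlongrightarrow> 0) (at_right t)" by simp
  qed
  from tendsto_add[OF this quot[OF t, of "W t"]] show ?thesis by (simp add: g_def power2_norm_eq_inner)
 qed
 \<comment> \<open>An exponential weight makes the norm of \<open>W\<close> decreasing, whence
   measurability and integrability of its square.\<close>
 have gi: "g integrable_on {a..b}" if a: "a > 0" for a b
 proof -
  have "(%r. exp (8 * C * r) * (exp (- (4 * C * r)) * norm (W r))^2) integrable_on {a..b}"
  proof (rule decreasing_integrable_on)
   fix r s assume rs: "a <= r" "r <= s" "s <= b"
   have "norm (W s) <= exp (4 * C * (s - r)) * norm (W r)" using dec rs a by simp
   hence "exp (- (4 * C * s)) * norm (W s) <= exp (- (4 * C * s)) * (exp (4 * C * (s - r)) * norm (W r))" by (intro mult_left_mono) auto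
   also have "... = exp (- (4 * C * r)) * norm (W r)" by (simp add: algebra_simps flip: exp_add mult.assoc)
   finally show "(exp (- (4 * C * s)) * norm (W s))^2 <= (exp (- (4 * C * r)) * norm (W r))^2" by (intro power_mono) auto
  qed (auto intro!: continuous_intros)
  moreover have "exp (8 * C * r) * (exp (- (4 * C * r)) * norm (W r))^2 = g r" for r
  proof -
   have "exp (8 * C * r) * (exp (- (4 * C * r)))^2 = exp (8 * C * r + (- (4 * C * r) + - (4 * C * r)))"
    by (simp only: exp_add power2_eq_square)
   hence "exp (8 * C * r) * (exp (- (4 * C * r)))^2 = 1" by simp
   thus ?thesis unfolding g_def power_mult_distrib mult.assoc[symmetric] by simp
  qed
  ultimately show ?thesis by simp
 qed
 have gint: "(g has_integral (P \<tau> - P t)) {\<tau>..t}" if \<tau>: "0 < \<tau>" "\<tau> <= t" for \<tau> t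
 proof -
  define f where "f s = P s + integral {\<tau>..s} g" for s
  have "f t = f \<tau>"
  proof (rule right_derivative_zero_eq[OF \<tau>(2)])
   show "continuous_on {\<tau>..t} f" unfolding f_def
    by (intro continuous_intros continuous_on_subset[OF Pcont] indefinite_integral_continuous_1 gi) (use \<tau> in auto)
   fix r assume r: "\<tau> <= r" "r < t"
   hence r0: "r > 0" using \<tau> by simp
   have "((%u. integral {r..u} g) has_vector_derivative g r) (at r within ({r..t} - {}))"
   proof (rule integral_has_vector_derivative_continuous_at)
    have "(g \<longlongrightarrow> g r) (at_right r)" unfolding g_def by (intro tendsto_intros Wr r0)
    hence "(g \<longlongrightarrow> g r) (at r within {r..t})"
     using r(2) by (simp add: at_within_Icc_at_right)
    thus "continuous (at r within ({r..t} - {})) g" by (simp add: continuous_within)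
   qed (use r r0 gi in auto)
   hence "((%s. (integral {r..s} g - integral {r..r} g) / (s - r)) \<longlongrightarrow> g r) (at r within {r..t})"
    by (simp add: has_field_derivative_iff flip: has_real_derivative_iff_has_vector_derivative)
   hence "((%s. integral {r..s} g / (s - r)) \<longlongrightarrow> g r) (at_right r)"
    using r(2) by (simp add: at_within_Icc_at_right)
   from tendsto_add[OF Pd[OF r0] this]
   have "((%s. (P s - P r) / (s - r) + integral {r..s} g / (s - r)) \<longlongrightarrow> 0) (at_right r)" by simp
   moreover have "eventually (%s. (P s - P r) / (s - r) + integral {r..s} g / (s - r) = (f s - f r) / (s - r)) (at_right r)"
    using eventually_at_right_real[OF r(2)]
   proof eventually_elim
    case (elim s)
    hence "integral {\<tau>..r} g + integral {r..s} g = integral {\<tau>..s} g"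
     using r \<tau> gi by (intro Henstock_Kurzweil_Integration.integral_combine) auto
    thus ?case unfolding f_def by (simp flip: add_divide_distrib)
   qed
   ultimately show "((%s. (f s - f r) / (s - r)) \<longlongrightarrow> 0) (at_right r)" by (rule Lim_transform_eventually)
  qed
  hence "integral {\<tau>..t} g = P \<tau> - P t" by (simp add: f_def)
  thus ?thesis using integrable_integral[OF gi[OF \<tau>(1)], of t] by simp
 qed
 \<comment> \<open>The intervals \<open>{t / (k + 1)..t}\<close> exhaust the positive times, and the
   integrand is nonnegative; the value at 0 is corrected as a single point.\<close>
 have gint0: "(g has_integral (P 0 - P t)) {0..t}" if t: "t >= 0" for t
 proof (cases "t = 0")
  case False
  hence t0: "t > 0" using t by simp
  define a where "a k = t / real (Suc k)" for k
  have a: "0 < a k" "a k <= t" "a (Suc k) <= a k" for k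
  proof -
   show "0 < a k" "a k <= t" using t0 by (auto simp: a_def divide_le_eq)
   show "a (Suc k) <= a k" unfolding a_def by (rule divide_left_mono) (use t0 in auto)
  qed
  have alim: "a ----> 0"
  proof -
   have "(%k. t * inverse (real (Suc k))) ----> t * 0" by (intro tendsto_intros LIMSEQ_inverse_real_of_nat)
   thus ?thesis by (simp add: a_def[abs_def] divide_inverse)
  qed
  have "((%r. if r \<in> {0<..} then g r else 0) has_integral (P 0 - P t)) {0..t}"
  proof (rule has_integral_monotone_convergence_increasing[of "%k r. if r \<in> {a k..t} then g r else 0"])
   show "((%r. if r \<in> {a k..t} then g r else 0) has_integral (P (a k) - P t)) {0..t}" for k
   proof -
    have "{a k..t} \<subseteq> {0..t}" using a[of k] by auto
    from has_integral_restrict[OF this] show ?thesis using gint[OF a(1,2), of k] by blast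
   qed
   show "(if r \<in> {a k..t} then g r else 0) <= (if r \<in> {a (Suc k)..t} then g r else 0)" for k r
    using a(3)[of k] by (auto simp: g_def)
   show "(%k. if r \<in> {a k..t} then g r else 0) ----> (if r \<in> {0<..} then g r else 0)" if "r \<in> {0..t}" for r
   proof (cases "r > 0")
    case True
    have "eventually (%k. a k < r) sequentially" using alim True by (rule order_tendstoD)
    hence "eventually (%k. (if r \<in> {a k..t} then g r else 0) = g r) sequentially"
     by eventually_elim (use that in auto)
    thus ?thesis using True by (simp add: tendsto_eventually)
   next
    case False
    hence "(if r \<in> {a k..t} then g r else 0) = 0" for k using a(1)[of k] by auto
    thus ?thesis using False by simp
   qed
   show "(%k. P (a k) - P t) ----> P 0 - P t"
    using Pcont alim a(1) unfolding continuous_on_sequentially o_def by (intro tendsto_intros) (auto simp: less_imp_le)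
  qed
  thus ?thesis
   by (rule has_integral_spike_finite[of "{0}", rotated 2]) auto
 qed (use has_integral_refl(2)[of g 0] in simp)
 show thesis
 proof (rule that[of U W])
  show "((%r. (norm (W r))^2) has_integral (\<Phi> (U \<tau>) - \<Phi> (U t))) {\<tau>..t}" if "0 <= \<tau>" "\<tau> <= t" for \<tau> t
   using gint[of \<tau> t] gint0[of t] that unfolding g_def P_def by (cases "\<tau> = 0") auto
  show "continuous_on {0..} (%t. \<Phi> (U t))" using Pcont by (simp add: P_def[abs_def])
 qed (use U0 Uc UD SGW der Wr dec in auto)
qed

end

section \<open>The Hilbert space of square integrable functions\<close>

definition sq :: "('b::euclidean_space => real) set" where
 "sq = {f \<in> borel_measurable lebesgue. integrable lebesgue (%x. (f x)^2)}"

lemma sq_meas [measurable_dest]: "f \<in> sq ==> f \<in> borel_measurable lebesgue"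
 and sq_int: "f \<in> sq ==> integrable lebesgue (%x. (f x)^2)"
 by (auto simp: sq_def)

lemma sqI: "f \<in> borel_measurable lebesgue ==> integrable lebesgue (%x. (f x)^2) ==> f \<in> sq"
 by (simp add: sq_def)

lemma sq_mult_integrable:
 assumes f: "f \<in> sq" and g: "g \<in> sq"
 shows "integrable lebesgue (%x. f x * g x)"
proof (rule Bochner_Integration.integrable_bound[OF Bochner_Integration.integrable_add[OF sq_int[OF f] sq_int[OF g]]])
 show "(%x. f x * g x) \<in> borel_measurable lebesgue" using sq_meas[OF f] sq_meas[OF g] by simp
 have "norm (f x * g x) <= norm ((f x)^2 + (g x)^2)" for x
 proof -
  have "0 <= (\<bar>f x\<bar> - \<bar>g x\<bar>)^2" by simp
  hence "2 * (\<bar>f x\<bar> * \<bar>g x\<bar>) <= (f x)^2 + (g x)^2" by (simp add: power2_diff)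
  moreover have "0 <= \<bar>f x\<bar> * \<bar>g x\<bar>" by simp
  ultimately have "\<bar>f x\<bar> * \<bar>g x\<bar> <= (f x)^2 + (g x)^2" by linarith
  thus ?thesis by (simp add: abs_mult)
 qed
 thus "AE x in lebesgue. norm (f x * g x) <= norm ((f x)^2 + (g x)^2)" by simp
qed

lemma sq_bound:
 assumes g: "g \<in> sq" and f: "f \<in> borel_measurable lebesgue" and le: "AE x in lebesgue. \<bar>f x\<bar> <= \<bar>g x\<bar>"
 shows "f \<in> sq"
proof (rule sqI[OF f])
 show "integrable lebesgue (%x. (f x)^2)"
 proof (rule Bochner_Integration.integrable_bound[OF sq_int[OF g]])
  show "(%x. (f x)^2) \<in> borel_measurable lebesgue" using f by simp
  show "AE x in lebesgue. norm ((f x)^2) <= norm ((g x)^2)"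
   using le by eventually_elim (simp add: abs_le_square_iff)
 qed
qed

lemma sq_scale: "f \<in> sq ==> (%x. c * f x) \<in> sq"
 by (auto simp: sq_def power_mult_distrib)

lemma sq_0: "(%x. 0) \<in> sq"
 by (auto simp: sq_def)

lemma sq_add:
 assumes f: "f \<in> sq" and g: "g \<in> sq"
 shows "(%x. f x + g x) \<in> sq"
proof (rule sqI)
 show "(%x. f x + g x) \<in> borel_measurable lebesgue" using sq_meas[OF f] sq_meas[OF g] by simp
 have "(%x. (f x + g x)^2) = (%x. ((f x)^2 + (g x)^2) + 2 * (f x * g x))" by (auto simp: power2_sum)
 thus "integrable lebesgue (%x. (f x + g x)^2)"
  using sq_int[OF f] sq_int[OF g] sq_mult_integrable[OF f g] by simp
qed

lemma sq_diff: "f \<in> sq ==> g \<in> sq ==> (%x. f x - g x) \<in> sq"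
 using sq_add[of f "%x. (-1) * g x"] sq_scale[of g "-1"] by simp

lemma sq_cong_AE:
 assumes "f \<in> sq" "g \<in> borel_measurable lebesgue" "AE x in lebesgue. f x = g x"
 shows "g \<in> sq"
 by (rule sq_bound[OF assms(1,2)]) (use assms(3) in \<open>eventually_elim, simp\<close>)

definition l2rel :: "('b::euclidean_space => real) => ('b => real) => bool" where
 "l2rel f g \<longleftrightarrow> f \<in> sq & g \<in> sq & (AE x in lebesgue. f x = g x)"

\<comment> \<open>The relation is partial: a function outside \<open>sq\<close> is related to
  nothing, so every class consists of square integrable functions. A type, rather than a set with a
  seminorm, makes the results on \<open>real_inner\<close> and \<open>banach\<close> spaces
  applicable.\<close>
quotient_type (overloaded) 'b l2 = "'b::euclidean_space => real" / partial: l2rel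
proof (rule part_equivpI)
 show "EX f. l2rel f f" using sq_0 by (auto simp: l2rel_def)
 show "symp (l2rel :: ('b => real) => _)" unfolding symp_def l2rel_def by (auto elim: AE_mp)
 show "transp (l2rel :: ('b => real) => _)" unfolding transp_def l2rel_def by (auto elim!: AE_mp)
qed

definition mk :: "('b::euclidean_space => real) => 'b l2" where "mk = abs_l2"

lemma mk_eq_iff: "f \<in> sq ==> g \<in> sq ==> mk f = mk g \<longleftrightarrow> (AE x in lebesgue. f x = g x)"
 unfolding mk_def using Quotient3_rel[OF Quotient3_l2, of f g] by (auto simp: l2rel_def)

lemma mk_cong: "f \<in> sq ==> g \<in> sq ==> AE x in lebesgue. f x = g x ==> mk f = mk g"
 by (simp add: mk_eq_iff)

lemma mk_cases:
 obtains f where "f \<in> sq" "F = mk f"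
proof
 have "l2rel (rep_l2 F) (rep_l2 F)" using Quotient3_rep_reflp[OF Quotient3_l2] .
 thus "rep_l2 F \<in> sq" by (simp add: l2rel_def)
 show "F = mk (rep_l2 F)" unfolding mk_def using Quotient3_abs_rep[OF Quotient3_l2] by metis
qed

instantiation l2 :: (euclidean_space) real_vector
begin

lift_definition zero_l2 :: "'a l2" is "%x. 0" by (simp add: l2rel_def sq_0)
lift_definition plus_l2 :: "'a l2 => 'a l2 => 'a l2" is "%f g x. f x + g x"
 unfolding l2rel_def by (auto intro: sq_add elim!: AE_mp)
lift_definition minus_l2 :: "'a l2 => 'a l2 => 'a l2" is "%f g x. f x - g x"
 unfolding l2rel_def by (auto intro: sq_diff elim!: AE_mp)
lift_definition uminus_l2 :: "'a l2 => 'a l2" is "%f x. - f x"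
 unfolding l2rel_def using sq_scale[of _ "-1"] by (auto elim!: AE_mp)
lift_definition scaleR_l2 :: "real => 'a l2 => 'a l2" is "%c f x. c * f x"
 unfolding l2rel_def by (auto intro: sq_scale elim!: AE_mp)

instance
proof
 fix F G H :: "'a l2" and a b :: real
 show "F + G + H = F + (G + H)" by transfer (auto simp: l2rel_def intro!: sq_add elim!: AE_mp)
 show "F + G = G + F" by transfer (auto simp: l2rel_def intro!: sq_add elim!: AE_mp)
 show "0 + F = F" by transfer (auto simp: l2rel_def)
 show "- F + F = 0" by transfer (auto simp: l2rel_def sq_0 elim!: AE_mp)
 show "F - G = F + - G" by transfer (auto simp: l2rel_def intro!: sq_diff elim!: AE_mp)
 show "a *\<^sub>R (F + G) = a *\<^sub>R F + a *\<^sub>R G"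
  by transfer (auto simp: l2rel_def algebra_simps intro!: sq_add sq_scale elim!: AE_mp)
 show "(a + b) *\<^sub>R F = a *\<^sub>R F + b *\<^sub>R F"
  by transfer (auto simp: l2rel_def distrib_right intro!: sq_add sq_scale)
 show "a *\<^sub>R b *\<^sub>R F = (a * b) *\<^sub>R F" by transfer (auto simp: l2rel_def mult.assoc intro!: sq_scale elim!: AE_mp)
 show "1 *\<^sub>R F = F" by transfer (auto simp: l2rel_def)
qed

end

lemma sq_mult_meas: "f \<in> sq ==> g \<in> sq ==> (%x. f x * g x) \<in> borel_measurable lebesgue"
 using sq_mult_integrable by blast

instantiation l2 :: (euclidean_space) real_inner
begin

lift_definition inner_l2 :: "'a l2 => 'a l2 => real" is "%f g. \<integral>x. f x * g x \<partial>lebesgue"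
 unfolding l2rel_def by (auto intro!: integral_cong_AE sq_mult_meas elim!: AE_mp)
definition norm_l2 :: "'a l2 => real" where "norm_l2 F = sqrt (inner F F)"
definition dist_l2 :: "'a l2 => 'a l2 => real" where "dist_l2 F G = norm (F - G)"
definition sgn_l2 :: "'a l2 => 'a l2" where "sgn_l2 F = F /\<^sub>R norm F"
definition uniformity_l2 :: "('a l2 \<times> 'a l2) filter" where
 "uniformity_l2 = (INF e\<in>{0 <..}. principal {(x, y). dist x y < e})"
definition open_l2 :: "'a l2 set => bool" where
 "open_l2 U \<longleftrightarrow> (\<forall>x\<in>U. eventually (%(x', y). x' = x --> y \<in> U) uniformity)"

instance
proof
 fix F G H :: "'a l2" and a b :: real
 show "dist F G = norm (F - G)" by (rule dist_l2_def)
 show "sgn F = F /\<^sub>R norm F" by (rule sgn_l2_def)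
 show "uniformity = (INF e\<in>{0 <..}. principal {(x, y::'a l2). dist x y < e})" by (rule uniformity_l2_def)
 show "open U \<longleftrightarrow> (\<forall>x\<in>U. eventually (%(x', y). x' = x --> y \<in> U) uniformity)" for U :: "'a l2 set"
  by (rule open_l2_def)
 show "F \<bullet> G = G \<bullet> F" by transfer (simp add: mult.commute)
 show "(F + G) \<bullet> H = F \<bullet> H + G \<bullet> H"
  by transfer (simp add: l2rel_def distrib_right sq_mult_integrable)
 show "(a *\<^sub>R F) \<bullet> G = a * (F \<bullet> G)" by transfer (simp add: l2rel_def mult.assoc)
 show "0 <= F \<bullet> F" by transfer simp
 show "F \<bullet> F = 0 \<longleftrightarrow> F = 0"
 proof transfer
  fix f :: "'a => real" assume "l2rel f f"
  hence f: "f \<in> sq" by (simp add: l2rel_def)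
  have "(LINT x|lebesgue. f x * f x) = 0 \<longleftrightarrow> (AE x in lebesgue. f x * f x = 0)"
   by (rule integral_nonneg_eq_0_iff_AE) (use sq_mult_integrable[OF f f] in auto)
  thus "((LINT x|lebesgue. f x * f x) = 0) = l2rel f (%x. 0)" by (simp add: l2rel_def f sq_0)
 qed
 show "norm F = sqrt (F \<bullet> F)" by (rule norm_l2_def)
qed

end

lemma mk_0: "mk (%x. 0) = 0"
 unfolding mk_def by (simp add: zero_l2.abs_eq)

lemma mk_add: "f \<in> sq ==> g \<in> sq ==> mk f + mk g = mk (%x. f x + g x)"
 unfolding mk_def by (rule plus_l2.abs_eq) (simp_all add: l2rel_def eq_onp_def)

lemma mk_diff: "f \<in> sq ==> g \<in> sq ==> mk f - mk g = mk (%x. f x - g x)"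
 unfolding mk_def by (rule minus_l2.abs_eq) (simp_all add: l2rel_def)

lemma mk_scaleR: "f \<in> sq ==> c *\<^sub>R mk f = mk (%x. c * f x)"
 unfolding mk_def by (rule scaleR_l2.abs_eq) (simp_all add: l2rel_def)

lemma inner_mk: "f \<in> sq ==> g \<in> sq ==> mk f \<bullet> mk g = (LINT x|lebesgue. f x * g x)"
 unfolding mk_def by (rule inner_l2.abs_eq) (simp_all add: l2rel_def)

lemma norm_mk_square: "f \<in> sq ==> (norm (mk f))^2 = (LINT x|lebesgue. (f x)^2)"
 by (simp only: power2_norm_eq_inner inner_mk) (simp only: power2_eq_square)

lemma norm_mk_mono:
 assumes "f \<in> sq" "g \<in> sq" "AE x in lebesgue. \<bar>f x\<bar> <= \<bar>g x\<bar>"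
 shows "norm (mk f) <= norm (mk g)"
proof (rule power2_le_imp_le)
 show "(norm (mk f))^2 <= (norm (mk g))^2"
  unfolding norm_mk_square[OF assms(1)] norm_mk_square[OF assms(2)]
  by (rule integral_mono_AE[OF sq_int[OF assms(1)] sq_int[OF assms(2)]])
   (use assms(3) in \<open>eventually_elim, simp add: abs_le_square_iff\<close>)
qed simp

text \<open>Fatou's lemma for squares. Bounds \<open>a n\<close> that depend on \<open>n\<close>
  give lower semicontinuity along sequences whose norms merely converge.\<close>

lemma sq_liminf:
 assumes f: "!!n. f n \<in> sq" and b: "!!n. (norm (mk (f n)))^2 <= a n" and a: "a ----> c"
  and l: "AE x in lebesgue. (%n. f n x) ----> g x" and g: "g \<in> borel_measurable lebesgue"
 shows "g \<in> sq" "(norm (mk g))^2 <= c"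
proof -
 have n: "(\<integral>\<^sup>+x. ennreal ((f n x)^2) \<partial>lebesgue) = ennreal ((norm (mk (f n)))^2)" for n
  unfolding norm_mk_square[OF f] by (rule nn_integral_eq_integral[OF sq_int[OF f]]) simp
 have "(\<integral>\<^sup>+x. ennreal ((g x)^2) \<partial>lebesgue) = (\<integral>\<^sup>+x. liminf (%n. ennreal ((f n x)^2)) \<partial>lebesgue)"
 proof (rule nn_integral_cong_AE)
  show "AE x in lebesgue. ennreal ((g x)^2) = liminf (%n. ennreal ((f n x)^2))"
   using l
  proof eventually_elim
   case (elim x)
   hence "(%n. ennreal ((f n x)^2)) ----> ennreal ((g x)^2)" by (intro tendsto_intros)
   thus ?case using lim_imp_Liminf[OF trivial_limit_sequentially] by metis
  qed
 qed
 also have "... <= liminf (%n. \<integral>\<^sup>+x. ennreal ((f n x)^2) \<partial>lebesgue)"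
  by (rule nn_integral_liminf) (use sq_meas[OF f] in simp)
 also have "... <= liminf (%n. ennreal (a n))"
  unfolding n by (intro Liminf_mono always_eventually allI ennreal_leI b)
 also have "... = ennreal c"
  using a by (intro lim_imp_Liminf[OF trivial_limit_sequentially] tendsto_ennrealI)
 finally have le: "(\<integral>\<^sup>+x. ennreal ((g x)^2) \<partial>lebesgue) <= ennreal c" .
 have c0: "0 <= c"
  by (rule LIMSEQ_le_const[OF a]) (use b in \<open>auto intro: order_trans[OF zero_le_power2]\<close>)
 have i: "integrable lebesgue (%x. (g x)^2)"
  by (rule integrableI_bounded) (use g le in \<open>auto simp: top.not_eq_extremum[symmetric] top_unique\<close>)
 thus s: "g \<in> sq" using g by (simp add: sqI)
 have "ennreal ((norm (mk g))^2) = (\<integral>\<^sup>+x. ennreal ((g x)^2) \<partial>lebesgue)"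
  unfolding norm_mk_square[OF s] by (rule nn_integral_eq_integral[OF i, symmetric]) simp
 thus "(norm (mk g))^2 <= c" using le c0 ennreal_le_iff by metis
qed

lemma l2_AE_subsequence:
 assumes f: "!!n. f n \<in> sq" and g: "g \<in> sq" and l: "(%n. mk (f n)) ----> mk g"
 obtains r :: "nat => nat" where "strict_mono r" "AE x in lebesgue. (%n. f (r n) x) ----> g x"
proof -
 have "(%n. (norm (mk (f n) - mk g))^2) ----> 0\<^sup>2"
  using l by (intro tendsto_power) (simp add: LIM_zero tendsto_norm_zero)
 moreover have "(norm (mk (f n) - mk g))^2 = (LINT x|lebesgue. norm ((f n x - g x)^2))" for n
  unfolding mk_diff[OF f g] norm_mk_square[OF sq_diff[OF f g]] by simp
 ultimately have lim: "(%n. (LINT x|lebesgue. norm ((f n x - g x)^2))) ----> 0" by simp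
 have "\<exists>r::nat => nat. strict_mono r & (AE x in lebesgue. (%n. (f (r n) x - g x)^2) ----> 0)"
  by (rule tendsto_L1_AE_subseq[OF sq_int[OF sq_diff[OF f g]] lim])
 then obtain r :: "nat => nat" where r: "strict_mono r" "AE x in lebesgue. (%n. (f (r n) x - g x)^2) ----> 0" by blast
 have "AE x in lebesgue. (%n. f (r n) x) ----> g x"
  using r(2)
 proof eventually_elim
  case (elim x)
  from tendsto_real_sqrt[OF this] have "(%n. \<bar>f (r n) x - g x\<bar>) ----> 0" by simp
  thus ?case using LIM_zero_cancel tendsto_rabs_zero_iff by blast
 qed
 thus thesis using that r(1) by blast
qed

text \<open>Riesz-Fischer: along a fast subsequence the increments are summable pointwise, the
  candidate limit is the pointwise one, and Fatou's lemma bounds the distance to it.\<close>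

instance l2 :: (euclidean_space) banach
proof
 fix F :: "nat => 'a l2" assume C: "Cauchy F"
 have "ALL n. EX f. f \<in> sq & F n = mk f" by (metis mk_cases)
 then obtain f where f: "!!n. f n \<in> sq" and F: "!!n. F n = mk (f n)" by metis
 \<comment> \<open>Increments below \<open>(1/4)^n\<close> have squares that stay summable after
   multiplication by \<open>4^n\<close>; this weight gives pointwise absolute summability through
   the inequality of \<open>2 * \<bar>d n x\<bar>\<close> with
   \<open>4^n * (d n x)^2 + (1/4)^n\<close>.\<close>
 have "ALL n. EX N. \<forall>i\<ge>N. \<forall>j\<ge>N. norm (F i - F j) < (1/4)^n"
  using C unfolding Cauchy_iff by simp
 then obtain N where N: "!!n i j. i >= N n ==> j >= N n ==> norm (F i - F j) < (1/4)^n" by metis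
 define r where "r n = (\<Sum>k\<le>n. N k) + n" for n
 have r: "strict_mono r" unfolding r_def by (intro strict_monoI_Suc) simp
 have rN: "r n >= N n" for n unfolding r_def by (cases n) auto
 have rj: "N n <= r j" if "n <= j" for n j
  using rN[of n] strict_mono_leD[OF r that] by (rule order_trans)
 define d where "d n x = f (r (Suc n)) x - f (r n) x" for n x
 have d: "d n \<in> sq" for n unfolding d_def by (intro sq_diff f)
 have dn: "(norm (mk (d n)))^2 <= (1/16)^n" for n
 proof -
  have "mk (d n) = F (r (Suc n)) - F (r n)" unfolding d_def F by (rule mk_diff[OF f f, symmetric])
  moreover have "norm (F (r (Suc n)) - F (r n)) < (1/4)^n"
   by (intro N rj) auto
  ultimately have "(norm (mk (d n)))^2 <= ((1/4)^n)^2" by (intro power_mono) auto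
  also have "... = (1/16::real)^n" by (simp add: power2_eq_square flip: power_mult_distrib)
  finally show ?thesis .
 qed
 have "(\<integral>\<^sup>+x. (\<Sum>n. ennreal (4^n * (d n x)^2)) \<partial>lebesgue) = (\<Sum>n. \<integral>\<^sup>+x. ennreal (4^n * (d n x)^2) \<partial>lebesgue)"
  by (rule nn_integral_suminf) (use sq_meas[OF d] in simp)
 also have "... <= (\<Sum>n. ennreal ((1/4)^n))"
 proof (rule suminf_le)
  fix n
  have "(\<integral>\<^sup>+x. ennreal (4^n * (d n x)^2) \<partial>lebesgue) = ennreal (LINT x|lebesgue. 4^n * (d n x)^2)"
   by (rule nn_integral_eq_integral) (use sq_int[OF d] in auto)
  also have "(LINT x|lebesgue. 4^n * (d n x)^2) = 4^n * (norm (mk (d n)))^2" by (simp add: norm_mk_square[OF d])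
  also have "... <= 4^n * (1/16)^n" using dn by (intro mult_left_mono) auto
  also have "... = (1/4)^n" by (simp flip: power_mult_distrib)
  finally show "(\<integral>\<^sup>+x. ennreal (4^n * (d n x)^2) \<partial>lebesgue) <= ennreal ((1/4)^n)" by (simp add: ennreal_leI)
 qed auto
 also have "... = ennreal (\<Sum>n. (1/4)^n)" by (rule suminf_ennreal2) (auto intro: summable_geometric)
 also have "... < \<infinity>" by simp
 finally have "AE x in lebesgue. (\<Sum>n. ennreal (4^n * (d n x)^2)) \<noteq> \<infinity>"
  using sq_meas[OF d] by (intro nn_integral_noteq_infinite) auto
 hence "AE x in lebesgue. convergent (%n. f (r n) x)"
 proof eventually_elim
  case (elim x)
  hence "summable (%n. 4^n * (d n x)^2)" by (intro summable_suminf_not_top) auto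
  hence "summable (%n. 4^n * (d n x)^2 + (1/4)^n)" by (intro summable_add summable_geometric) auto
  hence "summable (%n. d n x)"
  proof (rule summable_comparison_test'[where N=0])
   fix n
   have "0 <= (2^n * \<bar>d n x\<bar> - (1/2)^n)^2" by simp
   also have "... = 4^n * (d n x)^2 - 2 * (2^n * (1/2)^n) * \<bar>d n x\<bar> + (1/4)^n"
   proof -
    have "((2::real)^n)^2 = 4^n" "((1/2::real)^n)^2 = (1/4)^n"
     by (simp_all add: power2_eq_square flip: power_mult_distrib)
    thus ?thesis by (simp add: power2_diff power_mult_distrib)
   qed
   also have "(2::real)^n * (1/2)^n = 1" by (simp flip: power_mult_distrib)
   finally have "2 * \<bar>d n x\<bar> <= 4^n * (d n x)^2 + (1/4)^n" by simp
   thus "norm (d n x) <= 4^n * (d n x)^2 + (1/4)^n"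
    unfolding real_norm_def using abs_ge_zero[of "d n x"] by linarith
  qed
  hence "(%n. (\<Sum>k<n. d k x) + f (r 0) x) ----> (\<Sum>n. d n x) + f (r 0) x"
   by (intro tendsto_intros summable_LIMSEQ)
  moreover have "(\<Sum>k<n. d k x) + f (r 0) x = f (r n) x" for n
   unfolding d_def by (subst sum_lessThan_telescope) simp
  ultimately show ?case by (auto simp: convergent_def)
 qed
 hence lim: "AE x in lebesgue. (%n. f (r n) x) ----> lim (%n. f (r n) x)"
  by eventually_elim (simp add: convergent_LIMSEQ_iff)
 define g where "g x = lim (%n. f (r n) x)" for x
 have gm: "g \<in> borel_measurable lebesgue"
  unfolding g_def by (intro borel_measurable_lim_metric sq_meas f)
 have est: "(%x. f (r n) x - g x) \<in> sq & (norm (mk (%x. f (r n) x - g x)))^2 <= ((1/4)^n)^2" for n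
 proof -
  have *: "(%x. f (r n) x - f (r (k + n)) x) \<in> sq" for k by (intro sq_diff f)
  have "(norm (mk (%x. f (r n) x - f (r (k + n)) x)))^2 <= ((1/4)^n)^2" for k
  proof -
   have "mk (%x. f (r n) x - f (r (k + n)) x) = F (r n) - F (r (k + n))" unfolding F by (rule mk_diff[OF f f, symmetric])
   moreover have "norm (F (r n) - F (r (k + n))) < (1/4)^n"
    by (intro N rj) auto
   ultimately show ?thesis by (intro power_mono) auto
  qed
  moreover have "AE x in lebesgue. (%k. f (r n) x - f (r (k + n)) x) ----> f (r n) x - g x"
   using lim
  proof eventually_elim
   case (elim x)
   from LIMSEQ_ignore_initial_segment[OF this, of n] show ?case unfolding g_def by (intro tendsto_intros)
  qed
  ultimately show ?thesis
   using sq_liminf[of "%k x. f (r n) x - f (r (k + n)) x" "%_. ((1/4)^n)^2" "((1/4)^n)^2" "%x. f (r n) x - g x"] * gm sq_meas[OF f]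
   by auto
 qed
 have g: "g \<in> sq" using sq_diff[OF f[of "r 0"], of "%x. f (r 0) x - g x"] est[of 0] by simp
 have "(%n. mk (f (r n)) - mk g) ----> 0"
 proof (rule Lim_null_comparison)
  show "\<forall>\<^sub>F n in sequentially. norm (mk (f (r n)) - mk g) <= (1/4)^n"
   unfolding mk_diff[OF f g] using est by (intro always_eventually allI) (auto dest: power2_le_imp_le)
  show "(%n. (1/4)^n :: real) ----> 0" by (rule LIMSEQ_power_zero) simp
 qed
 hence "(F \<circ> r) ----> mk g" unfolding o_def F by (rule LIM_zero_cancel)
 hence "F ----> mk g" by (rule Cauchy_converges_subseq[OF C r])
 thus "convergent F" by (auto simp: convergent_def)
qed

section \<open>Fractional Sobolev spaces\<close>

lemma null_sets_fst_vimage: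
 assumes "N \<in> null_sets (lborel :: 'a::euclidean_space measure)"
 shows "fst -` N \<in> null_sets (lborel :: ('a \<times> 'b::euclidean_space) measure)"
proof -
 have "emeasure (lborel \<Otimes>\<^sub>M lborel) (N \<times> (UNIV :: 'b set)) = emeasure lborel N * emeasure lborel (UNIV :: 'b set)"
  using assms by (intro lborel.emeasure_pair_measure_Times) auto
 moreover have "fst -` N = N \<times> (UNIV :: 'b set)" by auto
 moreover have "N \<times> (UNIV :: 'b set) \<in> sets borel"
 proof -
  have "N \<times> (UNIV :: 'b set) \<in> sets (lborel \<Otimes>\<^sub>M lborel)" using assms by (intro pair_measureI) auto
  thus ?thesis by (simp only: lborel_prod sets_lborel)
 qed
 ultimately show ?thesis using assms unfolding null_sets_def by (simp add: lborel_prod)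
qed

lemma null_sets_snd_vimage:
 assumes "N \<in> null_sets (lborel :: 'b::euclidean_space measure)"
 shows "snd -` N \<in> null_sets (lborel :: ('a::euclidean_space \<times> 'b) measure)"
proof -
 have "emeasure (lborel \<Otimes>\<^sub>M lborel) ((UNIV :: 'a set) \<times> N) = emeasure lborel (UNIV :: 'a set) * emeasure lborel N"
  using assms by (intro lborel.emeasure_pair_measure_Times) auto
 moreover have "snd -` N = (UNIV :: 'a set) \<times> N" by auto
 moreover have "(UNIV :: 'a set) \<times> N \<in> sets borel"
 proof -
  have "(UNIV :: 'a set) \<times> N \<in> sets (lborel \<Otimes>\<^sub>M lborel)" using assms by (intro pair_measureI) auto
  thus ?thesis by (simp only: lborel_prod sets_lborel)
 qed
 ultimately show ?thesis using assms unfolding null_sets_def by (simp add: lborel_prod)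
qed

lemma AE_lebesgue_fst:
 assumes "AE x in (lebesgue :: 'a::euclidean_space measure). P x"
 shows "AE z in (lebesgue :: ('a \<times> 'b::euclidean_space) measure). P (fst z)"
proof -
 obtain N where N: "N \<in> null_sets (lborel :: 'a measure)" "{x. \<not> P x} \<subseteq> N"
  using assms[unfolded AE_completion_iff] unfolding eventually_ae_filter by auto
 show ?thesis unfolding AE_completion_iff
  by (rule AE_I'[OF null_sets_fst_vimage[OF N(1)]]) (use N(2) in auto)
qed

lemma AE_lebesgue_snd:
 assumes "AE x in (lebesgue :: 'b::euclidean_space measure). P x"
 shows "AE z in (lebesgue :: ('a::euclidean_space \<times> 'b) measure). P (snd z)"
proof -
 obtain N where N: "N \<in> null_sets (lborel :: 'b measure)" "{x. \<not> P x} \<subseteq> N"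
  using assms[unfolded AE_completion_iff] unfolding eventually_ae_filter by auto
 show ?thesis unfolding AE_completion_iff
  by (rule AE_I'[OF null_sets_snd_vimage[OF N(1)]]) (use N(2) in auto)
qed

text \<open>Lebesgue measure on pairs is the completion of the Borel one, not a product of completed
  measures; the point to check is that preimages of null sets are null.\<close>

lemma measurable_lebesgue_fst: "fst \<in> (lebesgue :: ('a::euclidean_space \<times> 'b::euclidean_space) measure) \<rightarrow>\<^sub>M lebesgue"
proof (rule completion.measurable_completion2)
 have "fst \<in> borel \<rightarrow>\<^sub>M (borel :: 'a measure)" by (simp add: borel_measurable_continuous_onI continuous_on_fst)
 hence *: "fst \<in> (lborel :: ('a \<times> 'b) measure) \<rightarrow>\<^sub>M lborel" by simp
 thus "fst \<in> (lebesgue :: ('a \<times> 'b) measure) \<rightarrow>\<^sub>M lborel" by (rule measurable_completion)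
 show "null_sets lborel \<subseteq> null_sets (distr (lebesgue :: ('a \<times> 'b) measure) lborel fst)"
  using null_sets_fst_vimage[where 'b='b] measurable_completion[OF *]
  by (force simp: null_sets_def emeasure_distr emeasure_completion main_part)
qed

lemma measurable_lebesgue_snd: "snd \<in> (lebesgue :: ('a::euclidean_space \<times> 'b::euclidean_space) measure) \<rightarrow>\<^sub>M lebesgue"
proof (rule completion.measurable_completion2)
 have "snd \<in> borel \<rightarrow>\<^sub>M (borel :: 'b measure)" by (simp add: borel_measurable_continuous_onI continuous_on_snd)
 hence *: "snd \<in> (lborel :: ('a \<times> 'b) measure) \<rightarrow>\<^sub>M lborel" by simp
 thus "snd \<in> (lebesgue :: ('a \<times> 'b) measure) \<rightarrow>\<^sub>M lborel" by (rule measurable_completion)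
 show "null_sets lborel \<subseteq> null_sets (distr (lebesgue :: ('a \<times> 'b) measure) lborel snd)"
  using null_sets_snd_vimage[where 'a='a] measurable_completion[OF *]
  by (force simp: null_sets_def emeasure_distr emeasure_completion main_part)
qed

lemma lebesgue_borel_rep:
 fixes v :: "'a::euclidean_space => real"
 assumes "v \<in> borel_measurable lebesgue"
 obtains v' where "v' \<in> borel_measurable borel" "AE x in lebesgue. v x = v' x"
 using completion_ex_borel_measurable_real[OF assms] by (auto simp: AE_completion_iff)

lemma nn_integral_lebesgue_prod:
 fixes f :: "'a::euclidean_space \<times> 'b::euclidean_space => ennreal"
 assumes "f \<in> borel_measurable borel"
 shows "(\<integral>\<^sup>+z. f z \<partial>lebesgue) = (\<integral>\<^sup>+x. \<integral>\<^sup>+y. f (x, y) \<partial>lborel \<partial>lborel)"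
proof -
 have "(\<integral>\<^sup>+z. f z \<partial>lebesgue) = (\<integral>\<^sup>+z. f z \<partial>(lborel \<Otimes>\<^sub>M lborel))" by (simp add: nn_integral_completion lborel_prod)
 also have "... = (\<integral>\<^sup>+x. \<integral>\<^sup>+y. f (x, y) \<partial>lborel \<partial>lborel)"
  by (rule lborel.nn_integral_fst[symmetric]) (use assms in \<open>simp add: lborel_prod\<close>)
 finally show ?thesis .
qed

text \<open>The square of \<open>Dq a v\<close> is the Gagliardo integrand including half of
  \<open>frac_const\<close>, so that L2 products of \<open>Dq\<close> are the values of
  \<open>frac_op\<close>. On the diagonal the quotient has the value 0.\<close>

definition Dq :: "real => ('a::euclidean_space => real) => 'a \<times> 'a => real" where
 "Dq a v z = sqrt (frac_const TYPE('a) a / 2) * (v (fst z) - v (snd z)) / norm (fst z - snd z) powr ((real DIM('a) + 2 * a) / 2)"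

definition emb :: "real => ('a::euclidean_space => real) => ('a \<times> 'a) l2" where
 "emb a v = mk (Dq a v)"

lemma frac_const_pos:
 assumes "0 < a" "a < 1"
 shows "0 < frac_const TYPE('a::euclidean_space) a"
 using assms unfolding frac_const_def
 by (intro divide_pos_pos mult_pos_pos Gamma_real_pos) (auto simp: add_pos_pos)

lemma Dq_measurable:
 fixes v :: "'a::euclidean_space => real"
 assumes "v \<in> borel_measurable lebesgue"
 shows "Dq a v \<in> borel_measurable lebesgue"
proof -
 have "(%z. v (fst z)) \<in> borel_measurable (lebesgue :: ('a \<times> 'a) measure)"
  "(%z. v (snd z)) \<in> borel_measurable (lebesgue :: ('a \<times> 'a) measure)"
  using measurable_compose[OF measurable_lebesgue_fst assms] measurable_compose[OF measurable_lebesgue_snd assms] by auto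
 moreover have "(%z::'a \<times> 'a. norm (fst z - snd z) powr p) \<in> borel_measurable lebesgue" for p
 proof -
  have "(%z::'a \<times> 'a. norm (fst z - snd z)) \<in> borel_measurable borel"
   by (intro borel_measurable_continuous_onI continuous_intros)
  hence "(%z::'a \<times> 'a. norm (fst z - snd z) powr p) \<in> borel_measurable lborel" by simp
  thus ?thesis by (rule measurable_completion)
 qed
 ultimately show ?thesis unfolding Dq_def[abs_def] by (intro borel_measurable_divide borel_measurable_times borel_measurable_diff borel_measurable_const)
qed

lemma Dq_borel:
 fixes v :: "'a::euclidean_space => real"
 assumes [measurable]: "v \<in> borel_measurable borel"
 shows "Dq a v \<in> borel_measurable borel"
proof -
 have m: "(%z::'a \<times> 'a. norm (fst z - snd z)) \<in> borel_measurable borel"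
  by (intro borel_measurable_continuous_onI continuous_intros)
 have "fst \<in> borel \<rightarrow>\<^sub>M (borel :: 'a measure)" "snd \<in> borel \<rightarrow>\<^sub>M (borel :: 'a measure)"
  by (simp_all add: borel_measurable_continuous_onI continuous_on_fst continuous_on_snd)
 note [measurable] = this m
 show ?thesis unfolding Dq_def[abs_def] by measurable
qed

lemma powr_half_square: "(x powr (p / 2))^2 = (x::real) powr p"
 by (simp add: power2_eq_square flip: powr_add)

lemma Dq_mult:
 fixes u v :: "'a::euclidean_space => real"
 assumes "0 < a" "a < 1"
 shows "Dq a u z * Dq a v z = frac_const TYPE('a) a / 2 * gagliardo a u v z"
proof -
 have "sqrt (frac_const TYPE('a) a / 2) * sqrt (frac_const TYPE('a) a / 2) = frac_const TYPE('a) a / 2"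
  using frac_const_pos[OF assms, where 'a='a] by simp
 moreover have "norm (fst z - snd z) powr ((real DIM('a) + 2 * a) / 2) * norm (fst z - snd z) powr ((real DIM('a) + 2 * a) / 2)
   = norm (fst z - snd z) powr (real DIM('a) + 2 * a)"
  using powr_half_square[of "norm (fst z - snd z)" "real DIM('a) + 2 * a"] by (simp only: power2_eq_square)
 ultimately show ?thesis
  unfolding Dq_def gagliardo_def case_prod_unfold times_divide_times_eq
  by (simp only: times_divide_eq_right) (simp add: mult_ac)
qed

lemma Dq_square:
 fixes u v :: "'a::euclidean_space => real"
 assumes "0 < a" "a < 1"
 shows "(Dq a u z)^2 = frac_const TYPE('a) a / 2 * gagliardo a u u z"
 using Dq_mult[OF assms, of u z u] by (simp add: power2_eq_square)

lemma Dq_linear: "Dq a (%x. b * u x + c * v x) z = b * Dq a u z + c * Dq a v z"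
 by (simp add: Dq_def add_divide_distrib[symmetric] algebra_simps)

lemma Dq_abs: "\<bar>Dq a v z\<bar> = \<bar>sqrt (frac_const TYPE('a) a / 2)\<bar> * \<bar>v (fst z) - v (snd z)\<bar> / norm (fst z - snd z) powr ((real DIM('a) + 2 * a) / 2)"
 for v :: "'a::euclidean_space => real"
 by (simp add: Dq_def abs_mult)

lemma Dq_mono:
 assumes "\<bar>\<psi> (fst z) - \<psi> (snd z)\<bar> <= b * \<bar>u (fst z) - u (snd z)\<bar> + c * \<bar>v (fst z) - v (snd z)\<bar>"
 shows "\<bar>Dq a \<psi> z\<bar> <= b * \<bar>Dq a u z\<bar> + c * \<bar>Dq a v z\<bar>"
proof -
 define k where "k = \<bar>sqrt (frac_const TYPE('a) a / 2)\<bar> / norm (fst z - snd z) powr ((real DIM('a) + 2 * a) / 2)"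
 have k: "k >= 0" by (simp add: k_def)
 have e: "\<bar>Dq a w z\<bar> = k * \<bar>w (fst z) - w (snd z)\<bar>" for w by (simp add: Dq_abs k_def)
 show ?thesis unfolding e using mult_left_mono[OF assms k] by (simp add: algebra_simps)
qed

lemma X0_iff:
 fixes v :: "'a::euclidean_space => real"
 assumes a: "0 < a" "a < 1"
 shows "v \<in> X0 \<Omega> a \<longleftrightarrow> v \<in> sq & Dq a v \<in> sq & (AE x in lebesgue. x \<notin> \<Omega> --> v x = 0)"
proof -
 have c: "frac_const TYPE('a) a / 2 \<noteq> 0" using frac_const_pos[OF a, where 'a='a] by simp
 have "Dq a v \<in> sq \<longleftrightarrow> integrable lebesgue (gagliardo a v v)" if "v \<in> borel_measurable lebesgue"
 proof -
  have "(%z. (Dq a v z)^2) = (%z. frac_const TYPE('a) a / 2 * gagliardo a v v z)"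
   by (intro ext Dq_square a)
  thus ?thesis unfolding sq_def using Dq_measurable[OF that, of a] c
   by (simp only: mem_Collect_eq integrable_mult_left_iff) simp
 qed
 thus ?thesis unfolding X0_def H_frac_def by (auto simp: sq_def)
qed

lemma X0_sq: "0 < a ==> a < 1 ==> v \<in> X0 \<Omega> a ==> v \<in> sq"
 and X0_Dq: "0 < a ==> a < 1 ==> v \<in> X0 \<Omega> a ==> Dq a v \<in> sq"
 and X0_out: "0 < a ==> a < 1 ==> v \<in> X0 \<Omega> a ==> AE x in lebesgue. x \<notin> \<Omega> --> v x = 0"
 by (simp_all add: X0_iff)

lemma frac_op_emb:
 assumes a: "0 < a" "a < 1" and "u \<in> X0 \<Omega> a" "v \<in> X0 \<Omega>' a"
 shows "frac_op a u v = emb a u \<bullet> emb a v"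
 unfolding emb_def inner_mk[OF X0_Dq[OF a assms(3)] X0_Dq[OF a assms(4)]] frac_op_def
 by (simp add: Dq_mult[OF a])

lemma X0_norm_emb:
 fixes v :: "'a::euclidean_space => real"
 assumes a: "0 < a" "a < 1" and "v \<in> X0 \<Omega> a"
 shows "X0_norm a v = norm (emb a v)"
proof -
 have "(X0_norm a v) = sqrt (frac_const TYPE('a) a / 2 * (LINT z|lebesgue. gagliardo a v v z))"
  unfolding X0_norm_def gagliardo_def by (simp add: case_prod_unfold power2_eq_square)
 also have "... = sqrt (emb a v \<bullet> emb a v)"
  using frac_op_emb[OF a assms(3) assms(3)] by (simp add: frac_op_def)
 finally show ?thesis by (simp add: norm_eq_sqrt_inner)
qed

lemma X0_linear:
 assumes a: "0 < a" "a < 1" and u: "u \<in> X0 \<Omega> a" and v: "v \<in> X0 \<Omega> a"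
 shows "(%x. b * u x + c * v x) \<in> X0 \<Omega> a"
  and "emb a (%x. b * u x + c * v x) = b *\<^sub>R emb a u + c *\<^sub>R emb a v"
  and "mk (%x. b * u x + c * v x) = b *\<^sub>R mk u + c *\<^sub>R mk v"
proof -
 have e: "Dq a (%x. b * u x + c * v x) = (%z. b * Dq a u z + c * Dq a v z)" by (intro ext Dq_linear)
 note uv = X0_sq[OF a u] X0_sq[OF a v] X0_Dq[OF a u] X0_Dq[OF a v]
 show "(%x. b * u x + c * v x) \<in> X0 \<Omega> a"
  unfolding X0_iff[OF a] e using X0_out[OF a u] X0_out[OF a v] uv
  by (auto intro!: sq_add sq_scale elim!: AE_mp)
 show "emb a (%x. b * u x + c * v x) = b *\<^sub>R emb a u + c *\<^sub>R emb a v"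
  unfolding emb_def e using uv by (simp add: mk_scaleR mk_add sq_scale)
 show "mk (%x. b * u x + c * v x) = b *\<^sub>R mk u + c *\<^sub>R mk v"
  using uv by (simp add: mk_scaleR mk_add sq_scale)
qed

lemma X0_diff:
 assumes a: "0 < a" "a < 1" and u: "u \<in> X0 \<Omega> a" and v: "v \<in> X0 \<Omega> a"
 shows "(%x. u x - v x) \<in> X0 \<Omega> a"
  and "emb a (%x. u x - v x) = emb a u - emb a v"
  and "mk (%x. u x - v x) = mk u - mk v"
 using X0_linear[OF a u v, of 1 "-1"] by simp_all

lemma X0_0: "0 < a ==> a < 1 ==> (%x. 0) \<in> X0 \<Omega> a"
proof -
 assume a: "0 < a" "a < 1"
 have "Dq a (%x::'a. 0) = (%z. 0)" by (simp add: Dq_def fun_eq_iff)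
 thus "(%x. 0) \<in> X0 \<Omega> a" by (simp add: X0_iff[OF a] sq_0)
qed

text \<open>Truncations and products are admissible because a pointwise bound on differences passes
  to \<open>Dq\<close> and hence to the norm. Two comparison functions are provided for products
  such as a test function times a cutoff of \<open>u\<close>.\<close>

lemma X0_bound:
 assumes a: "0 < a" "a < 1" and u: "u \<in> X0 \<Omega> a" and v: "v \<in> X0 \<Omega> a"
  and \<psi>: "\<psi> \<in> sq" "AE x in lebesgue. x \<notin> \<Omega> --> \<psi> x = 0"
  and le: "!!x y. \<bar>\<psi> x - \<psi> y\<bar> <= b * \<bar>u x - u y\<bar> + c * \<bar>v x - v y\<bar>" and bc: "b >= 0" "c >= 0"
 shows "\<psi> \<in> X0 \<Omega> a" "norm (emb a \<psi>) <= b * norm (emb a u) + c * norm (emb a v)"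
proof -
 note uv = X0_sq[OF a u] X0_sq[OF a v] X0_Dq[OF a u] X0_Dq[OF a v]
 have sqabs: "(%z. \<bar>f z\<bar>) \<in> sq" if "f \<in> sq" for f :: "'b::euclidean_space => real"
  by (rule sq_bound[OF that]) (use sq_meas[OF that] in auto)
 have s: "(%z. b * \<bar>Dq a u z\<bar> + c * \<bar>Dq a v z\<bar>) \<in> sq" by (intro sq_add sq_scale sqabs uv)
 have m: "\<bar>Dq a \<psi> z\<bar> <= \<bar>b * \<bar>Dq a u z\<bar> + c * \<bar>Dq a v z\<bar>\<bar>" for z
  using Dq_mono[of \<psi> z b u c v a, OF le] by linarith
 have D: "Dq a \<psi> \<in> sq" by (rule sq_bound[OF s Dq_measurable[OF sq_meas[OF \<psi>(1)]]]) (use m in simp)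
 thus "\<psi> \<in> X0 \<Omega> a" using \<psi> by (simp add: X0_iff[OF a])
 have nabs: "norm (mk (%z. \<bar>f z\<bar>)) = norm (mk f)" if "f \<in> sq" for f :: "'b::euclidean_space => real"
  by (rule antisym) (auto intro!: norm_mk_mono sqabs that)
 have "norm (emb a \<psi>) <= norm (mk (%z. b * \<bar>Dq a u z\<bar> + c * \<bar>Dq a v z\<bar>))"
  unfolding emb_def by (rule norm_mk_mono[OF D s]) (use m in simp)
 also have "mk (%z. b * \<bar>Dq a u z\<bar> + c * \<bar>Dq a v z\<bar>) = b *\<^sub>R mk (%z. \<bar>Dq a u z\<bar>) + c *\<^sub>R mk (%z. \<bar>Dq a v z\<bar>)"
  by (simp add: mk_scaleR mk_add sq_scale sqabs uv)
 also have "norm ... <= b * norm (emb a u) + c * norm (emb a v)"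
  using norm_triangle_ineq[of "b *\<^sub>R mk (%z. \<bar>Dq a u z\<bar>)" "c *\<^sub>R mk (%z. \<bar>Dq a v z\<bar>)"] bc
  by (simp add: nabs uv emb_def)
 finally show "norm (emb a \<psi>) <= b * norm (emb a u) + c * norm (emb a v)" .
qed

lemma Dq_tendsto:
 assumes "AE x in lebesgue. (%n. f n x) ----> g x"
 shows "AE z in lebesgue. (%n. Dq a (f n) z) ----> Dq a g z"
 using AE_lebesgue_fst[OF assms] AE_lebesgue_snd[OF assms]
proof eventually_elim
 case (elim z)
 hence "(%n. sqrt (frac_const TYPE('a) a / 2) * (f n (fst z) - f n (snd z)) * inverse (norm (fst z - snd z) powr ((real DIM('a) + 2 * a) / 2)))
   ----> sqrt (frac_const TYPE('a) a / 2) * (g (fst z) - g (snd z)) * inverse (norm (fst z - snd z) powr ((real DIM('a) + 2 * a) / 2))"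
  by (intro tendsto_intros)
 thus ?case unfolding Dq_def divide_inverse .
qed

lemma Dq_cong_AE:
 assumes "AE x in lebesgue. f x = g x"
 shows "AE z in lebesgue. Dq a f z = Dq a g z"
 using AE_lebesgue_fst[OF assms] AE_lebesgue_snd[OF assms] by eventually_elim (simp add: Dq_def)

lemma X0_cong_AE:
 assumes a: "0 < a" "a < 1" and f: "f \<in> X0 \<Omega> a" and g: "g \<in> borel_measurable lebesgue" and e: "AE x in lebesgue. f x = g x"
 shows "g \<in> X0 \<Omega> a" "emb a g = emb a f"
proof -
 have D: "Dq a g \<in> sq" by (rule sq_cong_AE[OF X0_Dq[OF a f] Dq_measurable[OF g] Dq_cong_AE[OF e]])
 have "AE x in lebesgue. x \<notin> \<Omega> --> g x = 0" using X0_out[OF a f] e by eventually_elim auto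
 thus "g \<in> X0 \<Omega> a" unfolding X0_iff[OF a] using D sq_cong_AE[OF X0_sq[OF a f] g e] by blast
 show "emb a g = emb a f" unfolding emb_def
  by (rule mk_cong[OF X0_Dq[OF a f] D Dq_cong_AE[OF e], symmetric])
qed

text \<open>Iterated integrals are evaluated for Borel measurable integrands, so the Fubini
  arguments are carried out on a Borel representative.\<close>

lemma X0_borel_rep:
 fixes \<Omega> :: "'a::euclidean_space set"
 assumes a: "0 < a" "a < 1" and v: "v \<in> X0 \<Omega> a"
 obtains v' where "v' \<in> borel_measurable borel" "v' \<in> X0 \<Omega> a" "mk v' = mk v" "AE x in lborel. x \<notin> \<Omega> --> v' x = 0"
  "(\<integral>\<^sup>+x. ennreal ((v' x)^2) \<partial>lborel) = ennreal ((norm (mk v))^2)"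
  "(\<integral>\<^sup>+x. \<integral>\<^sup>+y. ennreal ((Dq a v' (x, y))^2) \<partial>lborel \<partial>lborel) = ennreal ((norm (emb a v))^2)"
  "!!x. (%y. ennreal ((Dq a v' (x, y))^2)) \<in> borel_measurable lborel"
  "(%x. \<integral>\<^sup>+y. ennreal ((Dq a v' (x, y))^2) \<partial>lborel) \<in> borel_measurable lborel"
proof -
 obtain v' where v': "v' \<in> borel_measurable borel" and ve: "AE x in lebesgue. v x = v' x"
  using lebesgue_borel_rep[OF sq_meas[OF X0_sq[OF a v]]] by blast
 have v'm: "v' \<in> borel_measurable lebesgue" by (rule measurable_completion) (use v' in simp)
 note vX = X0_cong_AE(1)[OF a v v'm ve] and eq = X0_cong_AE(2)[OF a v v'm ve]
 have meq: "mk v' = mk v" by (rule mk_cong[OF X0_sq[OF a v] X0_sq[OF a vX] ve, symmetric])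
 have D: "(%z. ennreal ((Dq a v' z)^2)) \<in> borel_measurable borel" using Dq_borel[OF v', of a] by simp
 show thesis
 proof (rule that[OF v' vX meq])
  show "AE x in lborel. x \<notin> \<Omega> --> v' x = 0" using X0_out[OF a vX] by (simp add: AE_completion_iff)
  show "(\<integral>\<^sup>+x. ennreal ((v' x)^2) \<partial>lborel) = ennreal ((norm (mk v))^2)"
   unfolding meq[symmetric] norm_mk_square[OF X0_sq[OF a vX]] nn_integral_completion[of lborel, symmetric]
   by (rule nn_integral_eq_integral[OF sq_int[OF X0_sq[OF a vX]]]) simp
  show "(\<integral>\<^sup>+x. \<integral>\<^sup>+y. ennreal ((Dq a v' (x, y))^2) \<partial>lborel \<partial>lborel) = ennreal ((norm (emb a v))^2)"
   unfolding nn_integral_lebesgue_prod[OF D, symmetric] eq[symmetric]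
   unfolding emb_def norm_mk_square[OF X0_Dq[OF a vX]]
   by (rule nn_integral_eq_integral[OF sq_int[OF X0_Dq[OF a vX]]]) simp
  show "(%y. ennreal ((Dq a v' (x, y))^2)) \<in> borel_measurable lborel" for x
   using measurable_compose[OF _ D, of "%y. (x, y)" lborel] by (simp add: borel_measurable_continuous_onI continuous_on_Pair)
  have "(%(x, y). ennreal ((Dq a v' (x, y))^2)) \<in> borel_measurable (lborel \<Otimes>\<^sub>M lborel)"
   unfolding lborel_prod using D by (simp add: case_prod_unfold)
  from lborel.borel_measurable_nn_integral[OF this]
  show "(%x. \<integral>\<^sup>+y. ennreal ((Dq a v' (x, y))^2) \<partial>lborel) \<in> borel_measurable lborel" .
 qed
qed

lemma X0_liminf_AE:
 assumes a: "0 < a" "a < 1" and f: "!!n. f n \<in> X0 \<Omega> a" and g: "g \<in> sq" and l: "AE x in lebesgue. (%n. f n x) ----> g x"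
  and b: "!!n. (norm (emb a (f n)))^2 <= B n" "B ----> c"
 shows "g \<in> X0 \<Omega> a" "(norm (emb a g))^2 <= c"
proof -
 have "AE x in lebesgue. ALL n. x \<notin> \<Omega> --> f n x = 0" unfolding AE_all_countable using X0_out[OF a f] by blast
 with l have out: "AE x in lebesgue. x \<notin> \<Omega> --> g x = 0"
  by eventually_elim (auto simp: LIMSEQ_const_iff)
 note * = sq_liminf[of "%n. Dq a (f n)", OF X0_Dq[OF a f] b(1)[unfolded emb_def] b(2) Dq_tendsto[OF l] Dq_measurable[OF sq_meas[OF g]]]
 show "g \<in> X0 \<Omega> a" unfolding X0_iff[OF a] using g *(1) out by blast
 show "(norm (emb a g))^2 <= c" using *(2) by (simp add: emb_def)
qed

lemma X0_liminf:
 assumes a: "0 < a" "a < 1" and f: "!!n. f n \<in> X0 \<Omega> a" and g: "g \<in> sq" and l: "(%n. mk (f n)) ----> mk g"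
  and b: "!!n. (norm (emb a (f n)))^2 <= B n" "B ----> c"
 shows "g \<in> X0 \<Omega> a" "(norm (emb a g))^2 <= c"
proof -
 obtain r :: "nat => nat" where r: "strict_mono r" "AE x in lebesgue. (%n. f (r n) x) ----> g x"
  using l2_AE_subsequence[of f g] X0_sq[OF a f] g l by blast
 have "(%n. B (r n)) ----> c" using LIMSEQ_subseq_LIMSEQ[OF b(2) r(1)] by (simp add: o_def)
 note * = X0_liminf_AE[of a "%n. f (r n)", OF a f g r(2) b(1) this]
 show "g \<in> X0 \<Omega> a" "(norm (emb a g))^2 <= c" using * by auto
qed

text \<open>Only pairs with \<open>y\<close> in a fixed unit ball off \<Omega> are kept in the
  double integral; there \<open>v y = 0\<close> and the kernel is bounded below, which leaves a
  multiple of the integral of the square of \<open>v\<close>.\<close>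

lemma X0_Poincare:
 fixes \<Omega> :: "'a::euclidean_space set"
 assumes a: "0 < a" "a < 1" and bd: "bounded \<Omega>"
 obtains K where "K > 0" "!!v. v \<in> X0 \<Omega> a ==> norm (mk v) <= K * norm (emb a v)"
proof -
 obtain R where R: "R > 0" "\<Omega> \<subseteq> ball 0 R" using bounded_subset_ballD[OF bd, of 0] by blast
 obtain e :: 'a where e: "norm e = 1" using vector_choose_size[of 1] by auto
 \<comment> \<open>The unit ball about \<open>p\<close> misses \<open>ball 0 R\<close>, and its
   points are at distance at most \<open>2 * R + 2\<close> from those of \<Omega>.\<close>
 define p where "p = (R + 1) *\<^sub>R e"
 have np: "norm p = R + 1" using e R by (simp add: p_def)
 define B where "B = ball p 1"
 define L where "L = 2 * R + 2"
 define q where "q = real DIM('a) + 2 * a"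
 have q: "q > 0" using a by (simp add: q_def)
 have yB: "y \<notin> \<Omega>" "norm (x - y) <= L" if "y \<in> B" "x \<in> \<Omega>" for x y
 proof -
  have "norm (p - y) < 1" using that by (simp add: B_def dist_norm)
  moreover have "norm p <= norm (p - y) + norm y" by norm
  ultimately have "norm y > R" using np by linarith
  thus "y \<notin> \<Omega>" using R(2) by (auto simp: subset_iff)
  have "norm y <= norm (p - y) + norm p" by norm
  moreover have "norm x < R" using that R(2) by auto
  moreover have "norm (x - y) <= norm x + norm y" by norm
  ultimately show "norm (x - y) <= L" using \<open>norm (p - y) < 1\<close> np unfolding L_def by linarith
 qed
 define c where "c = frac_const TYPE('a) a / 2"
 have c: "c > 0" using frac_const_pos[OF a, where 'a='a] by (simp add: c_def)
 define m where "m = measure lborel B"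
 have m: "m > 0" unfolding m_def B_def by (simp add: content_ball_pos)
 have em: "emeasure lborel B = ennreal m" unfolding m_def B_def by (rule emeasure_eq_ennreal_measure) (use emeasure_lborel_ball_finite[of p 1] in auto)
 define k where "k = c / L powr q"
 have L: "L > 0" using R by (simp add: L_def)
 have k: "k > 0" using c L by (simp add: k_def)
 have main: "k * m * (norm (mk v))^2 <= (norm (emb a v))^2" if v: "v \<in> X0 \<Omega> a" for v
 proof -
  obtain v' where v': "v' \<in> borel_measurable borel" and out: "AE x in lborel. x \<notin> \<Omega> --> v' x = 0"
   and I: "(\<integral>\<^sup>+x. ennreal ((v' x)^2) \<partial>lborel) = ennreal ((norm (mk v))^2)"
    "(\<integral>\<^sup>+x. \<integral>\<^sup>+y. ennreal ((Dq a v' (x, y))^2) \<partial>lborel \<partial>lborel) = ennreal ((norm (emb a v))^2)"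
   by (rule X0_borel_rep[OF a v]) (rule that; assumption)
  have Bs: "B \<in> sets borel" by (simp add: B_def)
  have "ennreal (k * m * (norm (mk v))^2) = (\<integral>\<^sup>+x. ennreal (k * m) * ennreal ((v' x)^2) \<partial>lborel)"
   using v' k m by (subst nn_integral_cmult) (auto simp: I(1) ennreal_mult)
  also have "... <= (\<integral>\<^sup>+x. \<integral>\<^sup>+y. ennreal ((Dq a v' (x, y))^2) \<partial>lborel \<partial>lborel)"
  proof (rule nn_integral_mono_AE)
   show "AE x in lborel. ennreal (k * m) * ennreal ((v' x)^2) <= (\<integral>\<^sup>+y. ennreal ((Dq a v' (x, y))^2) \<partial>lborel)"
    using out
   proof eventually_elim
    case (elim x)
    show ?case
    proof (cases "x \<in> \<Omega>")
     case True
     have "ennreal (k * m) * ennreal ((v' x)^2) = ennreal (k * (v' x)^2) * emeasure lborel B"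
      unfolding em using k m by (simp add: mult_ac flip: ennreal_mult)
     also have "... = (\<integral>\<^sup>+y. ennreal (k * (v' x)^2) * indicator B y \<partial>lborel)"
      using Bs by (simp add: nn_integral_cmult_indicator)
     also have "... <= (\<integral>\<^sup>+y. ennreal ((Dq a v' (x, y))^2) \<partial>lborel)"
     proof (rule nn_integral_mono_AE)
      show "AE y in lborel. ennreal (k * (v' x)^2) * indicator B y <= ennreal ((Dq a v' (x, y))^2)"
       using out
      proof eventually_elim
       case (elim y)
       show ?case
       proof (cases "y \<in> B")
        case yes: True
        have y: "v' y = 0" using elim yB(1)[OF yes True] by simp
        have xy: "norm (x - y) > 0" using yB(1)[OF yes True] True by auto
        have "(Dq a v' (x, y))^2 = c * (v' x)^2 / norm (x - y) powr q"
         unfolding Dq_square[OF a] gagliardo_def c_def q_def by (simp add: y power2_eq_square)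
        moreover have "k * (v' x)^2 <= c * (v' x)^2 / norm (x - y) powr q"
        proof -
         have "norm (x - y) powr q <= L powr q" using yB(2)[OF yes True] q by (intro powr_mono2) auto
         hence "c * (v' x)^2 / L powr q <= c * (v' x)^2 / norm (x - y) powr q"
          using c xy L by (intro divide_left_mono mult_pos_pos) auto
         thus ?thesis by (simp add: k_def)
        qed
        ultimately show ?thesis using yes by (simp add: ennreal_leI)
       qed simp
      qed
     qed
     finally show ?thesis .
    qed (use elim in simp)
   qed
  qed
  finally show ?thesis by (simp add: I(2) ennreal_le_iff)
 qed
 show thesis
 proof (rule that[of "1 / sqrt (k * m)"])
  show "0 < 1 / sqrt (k * m)" using k m by simp
  fix v assume v: "v \<in> X0 \<Omega> a"
  have "(norm (mk v))^2 <= (1 / sqrt (k * m) * norm (emb a v))^2"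
   using main[OF v] k m by (simp add: power_divide field_simps)
  thus "norm (mk v) <= 1 / sqrt (k * m) * norm (emb a v)" by (rule power2_le_imp_le) (use k m in simp)
 qed
qed

text \<open>By the Poincare inequality a Cauchy sequence of images has an L2 limit \<open>g\<close>
  of the functions. Fatou's lemma gives \<open>g \<in> X0 \<Omega> a\<close>, and almost everywhere
  convergence along a subsequence identifies the limit of the images with
  \<open>emb a g\<close>.\<close>

lemma X0_complete:
 fixes \<Omega> :: "'a::euclidean_space set"
 assumes a: "0 < a" "a < 1" and bd: "bounded \<Omega>"
 shows "subspace (emb a ` X0 \<Omega> a)" "closed (emb a ` X0 \<Omega> a)"
proof -
 show "subspace (emb a ` X0 \<Omega> a)"
 proof (rule subspaceI)
  have "emb a (%x::'a. 0) = 0" using X0_linear(2)[OF a X0_0[OF a, of \<Omega>] X0_0[OF a, of \<Omega>], of 0 0] by simp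
  thus "0 \<in> emb a ` X0 \<Omega> a" using X0_0[OF a, of \<Omega>] by (metis imageI)
  show "x + y \<in> emb a ` X0 \<Omega> a" if "x \<in> emb a ` X0 \<Omega> a" "y \<in> emb a ` X0 \<Omega> a" for x y
  proof -
   obtain u v where u: "u \<in> X0 \<Omega> a" "x = emb a u" and v: "v \<in> X0 \<Omega> a" "y = emb a v" using \<open>x \<in> _\<close> \<open>y \<in> _\<close> by auto
   have "x + y = emb a (%x. 1 * u x + 1 * v x)" using X0_linear(2)[OF a u(1) v(1), of 1 1] u v by simp
   thus ?thesis using X0_linear(1)[OF a u(1) v(1), of 1 1] by blast
  qed
  show "c *\<^sub>R x \<in> emb a ` X0 \<Omega> a" if "x \<in> emb a ` X0 \<Omega> a" for c x
  proof -
   obtain u where u: "u \<in> X0 \<Omega> a" "x = emb a u" using \<open>x \<in> _\<close> by auto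
   have "c *\<^sub>R x = emb a (%x. c * u x + 0 * u x)" using X0_linear(2)[OF a u(1) u(1), of c 0] u by simp
   thus ?thesis using X0_linear(1)[OF a u(1) u(1), of c 0] by blast
  qed
 qed
 show "closed (emb a ` X0 \<Omega> a)"
  unfolding closed_sequential_limits
 proof (intro allI impI)
  fix F l assume "(ALL n. F n \<in> emb a ` X0 \<Omega> a) & F ----> l"
  hence F: "ALL n. EX v. v \<in> X0 \<Omega> a & F n = emb a v" and l: "F ----> l" by auto
  then obtain v where v: "!!n. v n \<in> X0 \<Omega> a" and Fv: "!!n. F n = emb a (v n)" by metis
  obtain K where K: "K > 0" "!!v. v \<in> X0 \<Omega> a ==> norm (mk v) <= K * norm (emb a v)" using X0_Poincare[OF a bd] by blast
  have "Cauchy (%n. mk (v n))"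
  proof (rule metric_CauchyI)
   fix e :: real assume "e > 0"
   hence "e / K > 0" using K by simp
   then obtain N where N: "!!m n. m >= N ==> n >= N ==> dist (F m) (F n) < e / K"
    using metric_CauchyD[OF LIMSEQ_imp_Cauchy[OF l]] by blast
   have "dist (mk (v m)) (mk (v n)) < e" if "m >= N" "n >= N" for m n
   proof -
    have "dist (mk (v m)) (mk (v n)) <= K * dist (F m) (F n)"
     using K(2)[OF X0_diff(1)[OF a v v], of m n] by (simp add: dist_norm Fv X0_diff[OF a v v])
    also have "... < K * (e / K)" using N[OF that] K by (intro mult_strict_left_mono) auto
    finally show ?thesis using K by simp
   qed
   thus "EX M. \<forall>m\<ge>M. \<forall>n\<ge>M. dist (mk (v m)) (mk (v n)) < e" by blast
  qed
  then obtain G where G: "(%n. mk (v n)) ----> G" using Cauchy_convergent convergent_def by blast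
  obtain g where g: "g \<in> sq" "G = mk g" by (rule mk_cases)
  obtain r :: "nat => nat" where r: "strict_mono r" "AE x in lebesgue. (%n. v (r n) x) ----> g x"
   using l2_AE_subsequence[of v g] X0_sq[OF a v] g G by blast
  have lr: "(%n. F (r n)) ----> l" using LIMSEQ_subseq_LIMSEQ[OF l r(1)] by (simp add: o_def)
  have "(%n. (norm (F (r n)))^2) ----> (norm l)\<^sup>2" by (intro tendsto_intros lr)
  hence gX: "g \<in> X0 \<Omega> a"
   using X0_liminf_AE(1)[of a "%n. v (r n)" \<Omega> g "%n. (norm (F (r n)))^2"] a v g(1) r(2) by (simp add: Fv)
  obtain h where h: "h \<in> sq" "l = mk h" by (rule mk_cases)
  obtain r' :: "nat => nat" where r': "strict_mono r'" "AE z in lebesgue. (%n. Dq a (v (r (r' n))) z) ----> h z"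
   using l2_AE_subsequence[of "%n. Dq a (v (r n))" h] X0_Dq[OF a v] h lr unfolding Fv emb_def by blast
  have "AE z in lebesgue. Dq a g z = h z"
   using Dq_tendsto[OF r(2), of a] r'(2)
  proof eventually_elim
   case (elim z)
   from LIMSEQ_subseq_LIMSEQ[OF elim(1) r'(1)] elim(2) show ?case by (simp add: o_def LIMSEQ_unique)
  qed
  hence "l = emb a g" unfolding h(2) emb_def using mk_cong[OF X0_Dq[OF a gX] h(1)] by simp
  thus "l \<in> emb a ` X0 \<Omega> a" using gX by blast
 qed
qed

lemma ex_dyadic_large:
 assumes "1 <= (x::real)"
 shows "EX j::nat. 2^j <= x & x < 2 * 2^j"
proof -
 have ex: "EX m::nat. x < 2^m" using real_arch_pow[of 2 x] by auto
 define m where "m = (LEAST m. x < 2^m)"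
 have m: "x < 2^m" unfolding m_def by (rule LeastI_ex[OF ex])
 have "m \<noteq> 0" using m assms by (cases m) auto
 then obtain j where j: "m = Suc j" using not0_implies_Suc by blast
 have "\<not> x < 2^j" using not_less_Least[of j "%m. x < 2^m"] j by (simp add: m_def)
 thus ?thesis using m j by (intro exI[of _ j]) auto
qed

lemma power_powr_swap: "0 < (b::real) ==> (b ^ j) powr p = (b powr p) ^ j"
 by (simp add: powr_powr mult.commute flip: powr_realpow)

text \<open>The kernel is dominated by two series of multiples of indicators of balls with dyadic
  radii. Their integrals are geometric with ratios \<open>(1/2) powr (2 - 2 * a)\<close> near zero
  and \<open>2 powr (- (2 * a))\<close> at infinity, both below 1 because
  \<open>0 < a < 1\<close>.\<close>

lemma nn_integral_kernel_finite:
 assumes a: "0 < a" "a < 1"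
 shows "(\<integral>\<^sup>+z. ennreal (min 1 ((norm z)^2) / norm z powr (real DIM('a) + 2 * a)) \<partial>(lborel :: 'a::euclidean_space measure)) < \<infinity>"
proof -
 define N where "N = DIM('a)"
 define p where "p = real DIM('a) + 2 * a"
 have p: "p > 0" using a by (simp add: p_def)
 define k where "k z = min 1 ((norm z)^2) / norm z powr p" for z :: 'a
 define f where "f c r z = (\<Sum>j::nat. ennreal (c j) * indicator (ball 0 (r j)) z)" for c r and z :: 'a
 have fm: "f c r \<in> borel_measurable borel" for c r
  unfolding f_def[abs_def] by (auto intro!: borel_measurable_suminf_order borel_measurable_times_ennreal borel_measurable_indicator)
 have fin: "(\<integral>\<^sup>+z. f c r z \<partial>lborel) < \<infinity>"
  if c: "!!j. 0 <= c j" and r: "!!j. 0 <= r j" and e: "!!j. c j * r j ^ N = C * q ^ j" and q: "0 <= q" "q < 1" for c r C q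
 proof -
  define \<omega> where "\<omega> = unit_ball_vol (real DIM('a))"
  have \<omega>: "\<omega> >= 0" by (simp add: \<omega>_def)
  have "(\<integral>\<^sup>+z. f c r z \<partial>lborel) = (\<Sum>j. \<integral>\<^sup>+z. ennreal (c j) * indicator (ball 0 (r j)) z \<partial>(lborel :: 'a measure))"
   unfolding f_def by (intro nn_integral_suminf) (auto intro!: borel_measurable_times_ennreal borel_measurable_indicator)
  also have "... = (\<Sum>j. ennreal ((\<omega> * C) * q ^ j))"
  proof (rule suminf_cong)
   fix j
   have "(\<integral>\<^sup>+z. ennreal (c j) * indicator (ball 0 (r j)) z \<partial>(lborel :: 'a measure)) = ennreal (c j) * ennreal (\<omega> * r j ^ N)"
    by (simp add: nn_integral_cmult_indicator emeasure_ball[OF r] \<omega>_def N_def)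
   also have "... = ennreal (c j * (\<omega> * r j ^ N))" using c \<omega> r by (intro ennreal_mult[symmetric]) auto
   also have "c j * (\<omega> * r j ^ N) = (\<omega> * C) * q ^ j" by (simp only: mult.left_commute[of _ \<omega>] e mult.assoc)
   finally show "(\<integral>\<^sup>+z. ennreal (c j) * indicator (ball 0 (r j)) z \<partial>(lborel :: 'a measure)) = ennreal ((\<omega> * C) * q ^ j)" .
  qed
  also have "... = ennreal (\<Sum>j. (\<omega> * C) * q ^ j)"
  proof (rule suminf_ennreal2)
   have "0 <= \<omega> * (c j * r j ^ N)" for j using \<omega> c[of j] r[of j] by simp
   thus "0 <= \<omega> * C * q ^ j" for j unfolding e mult.assoc .
   show "summable (%j. \<omega> * C * q ^ j)" using q by (intro summable_mult summable_geometric) simp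
  qed
  finally show ?thesis by (simp add: less_top[symmetric])
 qed
 \<comment> \<open>\<open>A j\<close> bounds the kernel for \<open>norm z\<close> between half of
   \<open>(1/2)^j\<close> and \<open>(1/2)^j\<close>, \<open>B j\<close> for \<open>norm z\<close>
   beyond \<open>2^j\<close>; the open balls of radius \<open>r j\<close> and \<open>R j\<close>
   contain the respective dyadic shells.\<close>
 define A where "A j = ((1/2)^j)^2 / ((1/2)^j / 2) powr p" for j :: nat
 define B where "B j = 1 / (2^j) powr p" for j :: nat
 define r where "r j = 2 * (1/2::real)^j" for j :: nat
 define R where "R j = 2 * (2::real)^j" for j :: nat
 have sl: "g j <= (\<Sum>j. g j)" for g :: "nat => ennreal" and j using sum_le_suminf[of g "{j}"] by simp
 have up: "ennreal x <= f c \<rho> z" if "x <= c j" "norm z < \<rho> j" for x c j \<rho> z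
 proof -
  have "ennreal x <= ennreal (c j) * indicator (ball 0 (\<rho> j)) z" using that by (simp add: ennreal_leI)
  also have "... <= f c \<rho> z" unfolding f_def by (rule sl)
  finally show ?thesis .
 qed
 have pw: "ennreal (k z) <= f A r z + f B R z" for z
 proof -
  consider "z = 0" | "0 < norm z" "norm z < 1" | "1 <= norm z" by force
  thus ?thesis
  proof cases
   case 2
   hence "1 <= 1 / norm z" by simp
   then obtain j where j: "2^j <= 1 / norm z" "1 / norm z < 2 * 2^j" using ex_dyadic_large by blast
   hence j: "(1/2)^j / 2 <= norm z" "norm z <= (1/2)^j" using 2 by (simp_all add: field_simps)
   have "k z <= A j" unfolding k_def A_def
   proof (rule frac_le)
    show "min 1 ((norm z)^2) <= ((1/2)^j)^2" using j(2) by (intro min.coboundedI2 power_mono) auto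
    show "((1/2)^j / 2) powr p <= norm z powr p" using j(1) p by (intro powr_mono2) auto
   qed auto
   moreover have "norm z < r j" unfolding r_def using j(2) by (rule le_less_trans) simp
   ultimately show ?thesis by (intro add_increasing2 up) auto
  next
   case 3
   then obtain j where j: "2^j <= norm z" "norm z < 2 * 2^j" using ex_dyadic_large by blast
   have "k z <= B j" unfolding k_def B_def
    by (rule frac_le) (use j(1) p in \<open>auto intro: powr_mono2\<close>)
   thus ?thesis using j(2) by (intro add_increasing up) (auto simp: R_def)
  qed (simp add: k_def)
 qed
 have "(\<integral>\<^sup>+z. f A r z \<partial>lborel) < \<infinity>"
 proof (rule fin)
  show "A j * r j ^ N = (2 powr p * 2 ^ N) * ((1/2) powr (2 - 2 * a)) ^ j" for j
  proof -
   define h where "h = (1/2::real)^j"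
   have h: "h > 0" by (simp add: h_def)
   have "A j * r j ^ N = 2 powr p * 2 ^ N * (h powr 2 / h powr p * h powr real N)"
    unfolding A_def r_def h_def[symmetric] using h by (simp add: powr_realpow powr_numeral powr_divide power_mult_distrib)
   also have "h powr 2 / h powr p * h powr real N = h powr (2 - 2 * a)"
    unfolding p_def N_def by (simp flip: powr_diff powr_add)
   also have "... = ((1/2) powr (2 - 2 * a)) ^ j" unfolding h_def by (simp add: power_powr_swap)
   finally show ?thesis .
  qed
  show "(1/2::real) powr (2 - 2 * a) < 1" using a powr_less_mono2[of "2 - 2 * a" "1/2" 1] by simp
 qed (auto simp: A_def r_def)
 moreover have "(\<integral>\<^sup>+z. f B R z \<partial>lborel) < \<infinity>"
 proof (rule fin)
  show "B j * R j ^ N = 2 ^ N * (2 powr (- (2 * a))) ^ j" for j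
  proof -
   define h where "h = (2::real)^j"
   have h: "h > 0" by (simp add: h_def)
   have "B j * R j ^ N = 2 ^ N * (h powr real N / h powr p)"
    unfolding B_def R_def h_def[symmetric] using h by (simp add: powr_realpow power_mult_distrib)
   also have "h powr real N / h powr p = h powr (- (2 * a))" unfolding p_def N_def by (simp flip: powr_diff)
   also have "... = (2 powr (- (2 * a))) ^ j" unfolding h_def by (simp add: power_powr_swap)
   finally show ?thesis .
  qed
  show "(2::real) powr (- (2 * a)) < 1" using a powr_less_mono[of "- (2 * a)" 0 2] by simp
 qed (auto simp: B_def R_def)
 moreover have "(\<integral>\<^sup>+z. ennreal (k z) \<partial>lborel) <= (\<integral>\<^sup>+z. f A r z + f B R z \<partial>lborel)"
  by (intro nn_integral_mono pw)
 ultimately show ?thesis unfolding k_def p_def[symmetric] using fm by (simp add: nn_integral_add order_le_less_trans)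
qed

section \<open>Lipschitz test functions and the Ehrling inequality\<close>

lemma indicator_sq: "A \<in> lmeasurable ==> (indicator A :: 'a::euclidean_space => real) \<in> sq"
proof (rule sqI)
 assume A: "A \<in> lmeasurable"
 show "(indicator A :: 'a => real) \<in> borel_measurable lebesgue" using A by (simp add: fmeasurableD)
 have "(%x. (indicator A x :: real)^2) = indicator A" by (auto simp: indicator_def)
 moreover have "integrable lebesgue (indicator A :: 'a => real)"
  by (rule integrable_real_indicator) (use A in \<open>simp_all only: fmeasurable_def mem_Collect_eq infinity_ennreal_def\<close>)
 ultimately show "integrable lebesgue (%x. (indicator A x :: real)^2)" by simp
qed

text \<open>The squared difference is at most a constant times
  \<open>min 1 ((norm (x - y))^2)\<close> and vanishes unless \<open>x\<close> or \<open>y\<close>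
  lies in \<Omega>; each of the two cases contributes the measure of \<Omega> times the finite
  kernel integral.\<close>

lemma Lipschitz_in_X0:
 fixes \<phi> :: "'a::euclidean_space => real"
 assumes a: "0 < a" "a < 1" and \<Omega>: "open \<Omega>" "bounded \<Omega>"
  and lip: "!!x y. \<bar>\<phi> x - \<phi> y\<bar> <= L * norm (x - y)" and bd: "!!x. \<bar>\<phi> x\<bar> <= S" and out: "!!x. x \<notin> \<Omega> ==> \<phi> x = 0"
 shows "\<phi> \<in> X0 \<Omega> a"
proof -
 have L0: "L >= 0"
 proof -
  obtain e :: 'a where e: "norm e = 1" using vector_choose_size[of 1] by auto
  show ?thesis using lip[of e 0] e abs_ge_zero order_trans by fastforce
 qed
 have S0: "S >= 0" using bd[of 0] by linarith
 have "L-lipschitz_on UNIV \<phi>" using lip L0 by (auto simp: lipschitz_on_def dist_norm)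
 hence "continuous_on UNIV \<phi>" by (rule lipschitz_on_continuous_on)
 hence \<phi>b: "\<phi> \<in> borel_measurable borel" by (rule borel_measurable_continuous_onI)
 hence \<phi>m: "\<phi> \<in> borel_measurable lebesgue" by (intro measurable_completion) simp
 have \<Omega>m: "\<Omega> \<in> lmeasurable" using \<Omega> by (rule lmeasurable_open[rotated])
 have \<phi>sq: "\<phi> \<in> sq"
  by (rule sq_bound[OF sq_scale[OF indicator_sq[OF \<Omega>m], of S] \<phi>m]) (use bd S0 out in \<open>auto simp: indicator_def\<close>)
 define p where "p = real DIM('a) + 2 * a"
 define k where "k z = ennreal (min 1 ((norm z)^2) / norm z powr p)" for z :: 'a
 have km: "k \<in> borel_measurable borel" unfolding k_def[abs_def] by measurable
 define I where "I = (\<integral>\<^sup>+z. k z \<partial>lborel)"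
 have I: "I < \<infinity>" unfolding I_def k_def p_def by (rule nn_integral_kernel_finite[OF a])
 define c where "c = frac_const TYPE('a) a / 2"
 have c: "c > 0" using frac_const_pos[OF a, where 'a='a] by (simp add: c_def)
 define K where "K = c * (L^2 + 4 * S^2)"
 have K: "K >= 0" using c by (simp add: K_def)
 have ptw: "ennreal ((Dq a \<phi> (x, y))^2) <= ennreal K * (indicator \<Omega> x * k (x - y)) + ennreal K * (indicator \<Omega> y * k (x - y))" for x y
 proof (cases "x \<in> \<Omega> \<or> y \<in> \<Omega>")
  case True
  have "(\<phi> x - \<phi> y)^2 <= (L * norm (x - y))^2" using lip[of x y] L0 by (simp add: abs_le_square_iff[symmetric])
  hence 1: "(\<phi> x - \<phi> y)^2 <= L^2 * (norm (x - y))^2" by (simp add: power_mult_distrib)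
  have "\<bar>\<phi> x - \<phi> y\<bar> <= \<bar>2 * S\<bar>" using bd[of x] bd[of y] S0 by linarith
  hence "(\<phi> x - \<phi> y)^2 <= (2 * S)^2" by (simp only: abs_le_square_iff)
  hence 2: "(\<phi> x - \<phi> y)^2 <= 4 * S^2" by (simp add: power_mult_distrib)
  have "(\<phi> x - \<phi> y)^2 <= (L^2 + 4 * S^2) * min 1 ((norm (x - y))^2)"
  proof (cases "1 <= (norm (x - y))^2")
   case True
   thus ?thesis using 2 by (simp add: min_def add_increasing)
  next
   case False
   hence "min 1 ((norm (x - y))^2) = (norm (x - y))^2" by (simp add: min_def)
   thus ?thesis using 1 by (simp add: distrib_right add_increasing2)
  qed
  hence "c * (\<phi> x - \<phi> y)^2 / norm (x - y) powr p <= K * min 1 ((norm (x - y))^2) / norm (x - y) powr p"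
   using c by (intro divide_right_mono) (auto simp: K_def mult.assoc)
  moreover have "(Dq a \<phi> (x, y))^2 = c * (\<phi> x - \<phi> y)^2 / norm (x - y) powr p"
   unfolding Dq_square[OF a] gagliardo_def c_def p_def by (simp add: power2_eq_square)
  ultimately have "ennreal ((Dq a \<phi> (x, y))^2) <= ennreal K * k (x - y)"
   unfolding k_def using K by (simp add: ennreal_leI flip: ennreal_mult)
  also have "... <= ennreal K * (indicator \<Omega> x * k (x - y)) + ennreal K * (indicator \<Omega> y * k (x - y))"
   using True by (auto simp: indicator_def)
  finally show ?thesis .
 qed (use out in \<open>simp add: Dq_def\<close>)
 have \<Omega>b: "\<Omega> \<in> sets borel" using \<Omega> by simp
 have em: "emeasure lborel \<Omega> < \<infinity>" using \<Omega>(2) by (rule emeasure_bounded_finite)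
 have sym: "k (x - y) = k (y - x)" for x y by (simp add: k_def norm_minus_commute)
 have tr: "(\<integral>\<^sup>+y. k (y - x) \<partial>lborel) = I" for x
 proof -
  have "I = (\<integral>\<^sup>+z. k z \<partial>(distr lborel borel ((+) (- x))))" by (simp add: I_def lborel_distr_plus)
  also have "... = (\<integral>\<^sup>+y. k (- x + y) \<partial>lborel)" by (rule nn_integral_distr) (use km in auto)
  finally show ?thesis by simp
 qed
 have m2: "(%z. k (fst z - snd z)) \<in> borel_measurable (borel :: ('a \<times> 'a) measure)"
  by (rule measurable_compose[OF _ km]) (intro borel_measurable_continuous_onI continuous_intros)
 have m1: "(%z. indicator \<Omega> (fst z) :: ennreal) \<in> borel_measurable (borel :: ('a \<times> 'a) measure)"
  "(%z. indicator \<Omega> (snd z) :: ennreal) \<in> borel_measurable (borel :: ('a \<times> 'a) measure)"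
 proof -
  have "fst \<in> borel \<rightarrow>\<^sub>M (borel :: 'a measure)" "snd \<in> borel \<rightarrow>\<^sub>M (borel :: 'a measure)"
   by (simp_all add: borel_measurable_continuous_onI continuous_on_fst continuous_on_snd)
  thus "(%z. indicator \<Omega> (fst z) :: ennreal) \<in> borel_measurable (borel :: ('a \<times> 'a) measure)"
   "(%z. indicator \<Omega> (snd z) :: ennreal) \<in> borel_measurable (borel :: ('a \<times> 'a) measure)"
   using measurable_compose[OF _ borel_measurable_indicator[OF \<Omega>b]] by blast+
 qed
 have Ix: "(\<integral>\<^sup>+x. \<integral>\<^sup>+y. indicator \<Omega> x * k (x - y) \<partial>lborel \<partial>lborel) = emeasure lborel \<Omega> * I"
 proof -
  have kx: "(%y. k (y - x)) \<in> borel_measurable borel" for x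
   by (rule measurable_compose[OF _ km]) (intro borel_measurable_continuous_onI continuous_intros)
  have "(\<integral>\<^sup>+y. indicator \<Omega> x * k (x - y) \<partial>lborel) = indicator \<Omega> x * I" for x
   unfolding sym[of x] using kx by (subst nn_integral_cmult) (auto simp: tr)
  thus ?thesis using \<Omega>b by (simp add: nn_integral_multc)
 qed
 have Iy: "(\<integral>\<^sup>+x. \<integral>\<^sup>+y. indicator \<Omega> y * k (x - y) \<partial>lborel \<partial>lborel) = emeasure lborel \<Omega> * I"
 proof -
  have "(%(x, y). indicator \<Omega> y * k (x - y)) \<in> borel_measurable (lborel \<Otimes>\<^sub>M lborel :: ('a \<times> 'a) measure)"
   using m1(2) m2 unfolding lborel_prod case_prod_unfold by (intro borel_measurable_times_ennreal) auto
  from lborel_pair.Fubini'[OF this]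
  have "(\<integral>\<^sup>+x. \<integral>\<^sup>+y. indicator \<Omega> y * k (x - y) \<partial>lborel \<partial>lborel) = (\<integral>\<^sup>+y. \<integral>\<^sup>+x. indicator \<Omega> y * k (x - y) \<partial>lborel \<partial>lborel)" by simp
  also have "... = (\<integral>\<^sup>+y. \<integral>\<^sup>+x. indicator \<Omega> y * k (y - x) \<partial>lborel \<partial>lborel)" by (subst sym) (rule refl)
  finally show ?thesis by (simp only: Ix)
 qed
 have "(\<integral>\<^sup>+z. ennreal ((Dq a \<phi> z)^2) \<partial>lebesgue) <= (\<integral>\<^sup>+z. ennreal K * (indicator \<Omega> (fst z) * k (fst z - snd z)) + ennreal K * (indicator \<Omega> (snd z) * k (fst z - snd z)) \<partial>lebesgue)"
  using ptw by (intro nn_integral_mono) (metis prod.collapse)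
 also have "... = (\<integral>\<^sup>+z. ennreal K * (indicator \<Omega> (fst z) * k (fst z - snd z)) \<partial>lborel) + (\<integral>\<^sup>+z. ennreal K * (indicator \<Omega> (snd z) * k (fst z - snd z)) \<partial>lborel)"
  unfolding nn_integral_completion by (intro nn_integral_add) (use m1 m2 in auto)
 also have "... = ennreal K * (\<integral>\<^sup>+z. indicator \<Omega> (fst z) * k (fst z - snd z) \<partial>lebesgue) + ennreal K * (\<integral>\<^sup>+z. indicator \<Omega> (snd z) * k (fst z - snd z) \<partial>lebesgue)"
  unfolding nn_integral_completion using m1 m2 by (simp add: nn_integral_cmult)
 also have "(\<integral>\<^sup>+z. indicator \<Omega> (fst z) * k (fst z - snd z) \<partial>lebesgue) = emeasure lborel \<Omega> * I"
  using m1 m2 Ix by (subst nn_integral_lebesgue_prod) auto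
 also have "(\<integral>\<^sup>+z. indicator \<Omega> (snd z) * k (fst z - snd z) \<partial>lebesgue) = emeasure lborel \<Omega> * I"
  using m1 m2 Iy by (subst nn_integral_lebesgue_prod) auto
 also have "ennreal K * (emeasure lborel \<Omega> * I) + ennreal K * (emeasure lborel \<Omega> * I) < \<infinity>"
  using em I by (simp add: ennreal_mult_less_top)
 finally have fin: "(\<integral>\<^sup>+z. ennreal ((Dq a \<phi> z)^2) \<partial>lebesgue) < \<infinity>" .
 have "Dq a \<phi> \<in> sq"
  by (rule sqI[OF Dq_measurable[OF \<phi>m]], rule integrableI_bounded) (use Dq_measurable[OF \<phi>m] fin in auto)
 thus ?thesis unfolding X0_iff[OF a] using \<phi>sq out by auto
qed

text \<open>The approximants are truncated multiples of the distance to the complement of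
  \<open>G\<close>. Being Lipschitz they belong to \<open>X0 \<Omega> a\<close> for all orders at
  once, which links statements tested in order \<open>s\<close> with those tested in order
  \<sigma>.\<close>

lemma open_indicator_approx_X0:
 fixes \<Omega> :: "'a::euclidean_space set"
 assumes \<Omega>: "open \<Omega>" "bounded \<Omega>" and G: "open G" "G \<subseteq> \<Omega>"
 obtains \<phi> :: "nat => 'a => real" where "!!n a. 0 < a ==> a < 1 ==> \<phi> n \<in> X0 \<Omega> a" "(%n. mk (\<phi> n)) ----> mk (indicator G)"
proof -
 have Gm: "G \<in> lmeasurable" using G \<Omega>(2) by (intro lmeasurable_open) (auto intro: bounded_subset)
 have "G \<noteq> UNIV" using bounded_subset[OF \<Omega>(2) G(2)] not_bounded_UNIV by auto
 hence ne: "- G \<noteq> {}" by auto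
 define \<phi> where "\<phi> n x = min 1 (real n * infdist x (- G))" for n :: nat and x
 have b: "0 <= \<phi> n x" "\<phi> n x <= 1" for n x using infdist_nonneg[of x "- G"] by (auto simp: \<phi>_def)
 have lip: "\<bar>\<phi> n x - \<phi> n y\<bar> <= real n * norm (x - y)" for n x y
 proof -
  have "real n * \<bar>infdist x (- G) - infdist y (- G)\<bar> <= real n * norm (x - y)"
   using infdist_triangle_abs[of x "- G" y] unfolding dist_norm by (intro mult_left_mono) auto
  moreover have "\<bar>real n * infdist x (- G) - real n * infdist y (- G)\<bar> = real n * \<bar>infdist x (- G) - infdist y (- G)\<bar>"
   by (simp only: right_diff_distrib[symmetric] abs_mult abs_of_nat)
  ultimately show ?thesis unfolding \<phi>_def by linarith
 qed
 have out: "\<phi> n x = 0" if "x \<notin> G" for n x using that by (simp add: \<phi>_def)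
 have X: "\<phi> n \<in> X0 \<Omega> a" if "0 < a" "a < 1" for n a
  by (rule Lipschitz_in_X0[OF that \<Omega> lip, of n 1]) (simp add: b, use out G(2) in blast)
 have s: "\<phi> n \<in> sq" for n using X0_sq[OF _ _ X[of "1/2"]] by simp
 note d = sq_diff[OF s indicator_sq[OF Gm]]
 have "(%n. (LINT x|lebesgue. (\<phi> n x - indicator G x)^2)) ----> (LINT x|(lebesgue :: 'a measure). (0::real))"
 proof (rule integral_dominated_convergence[where w="indicator G"])
  show "(%x. (\<phi> n x - indicator G x)^2) \<in> borel_measurable lebesgue" for n using sq_meas[OF d[of n]] by simp
  show "integrable lebesgue (indicator G :: 'a => real)"
   by (rule integrable_real_indicator) (use Gm in \<open>simp_all only: fmeasurable_def mem_Collect_eq infinity_ennreal_def\<close>)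
  show "AE x in lebesgue. (%n. (\<phi> n x - indicator G x)^2) ----> 0"
  proof (rule AE_I2, rule tendsto_eventually)
   fix x
   show "eventually (%n. (\<phi> n x - indicator G x)^2 = 0) sequentially"
   proof (cases "x \<in> G")
    case True
    hence p: "infdist x (- G) > 0"
     using in_closed_iff_infdist_zero[of "- G" x] ne G(1) infdist_nonneg[of x "- G"] by (auto simp: less_le)
    have "eventually (%n. 1 / infdist x (- G) <= real n) sequentially" using filterlim_real_sequentially by (simp add: filterlim_at_top)
    thus ?thesis by eventually_elim (use True p in \<open>simp add: \<phi>_def pos_divide_le_eq\<close>)
   qed (simp add: out)
  qed
  show "AE x in lebesgue. norm ((\<phi> n x - indicator G x)^2) <= indicator G x" for n
  proof (rule AE_I2)
   fix x
   have "\<bar>\<phi> n x - 1\<bar> <= 1" using b[of n x] by simp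
   thus "norm ((\<phi> n x - indicator G x)^2) <= indicator G x" by (cases "x \<in> G") (simp_all add: out abs_square_le_1)
  qed
 qed simp
 hence "(%n. (norm (mk (\<phi> n) - mk (indicator G)))^2) ----> 0"
  unfolding mk_diff[OF s indicator_sq[OF Gm]] norm_mk_square[OF d] by simp
 from tendsto_real_sqrt[OF this] have "(%n. mk (\<phi> n)) ----> mk (indicator G)"
  by (simp add: LIM_zero_cancel[OF tendsto_norm_zero_cancel])
 with X show thesis by (rule that)
qed

text \<open>Orthogonality extends from Lipschitz test functions to indicators of open subsets, so
  \<open>f\<close> has zero integral over every box, and Lebesgue differentiation concludes. As
  \<open>orth\<close> concerns only functions lying in all the spaces at once, it can be met from
  either of the two orders.\<close>

lemma orthogonal_X0_imp_zero:
 fixes \<Omega> :: "'a::euclidean_space set"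
 assumes \<Omega>: "open \<Omega>" "bounded \<Omega>" and f: "f \<in> sq" and out: "AE x in lebesgue. x \<notin> \<Omega> --> f x = 0"
  and orth: "!!\<phi>. (!!a. 0 < a ==> a < 1 ==> \<phi> \<in> X0 \<Omega> a) ==> mk f \<bullet> mk \<phi> = 0"
 shows "AE x in lebesgue. f x = 0"
proof -
 have c: "f integrable_on cbox a b" "integral (cbox a b) f = 0" for a b
 proof -
  have G: "open (box a b \<inter> \<Omega>)" "box a b \<inter> \<Omega> \<subseteq> \<Omega>" using \<Omega>(1) by auto
  hence Gm: "box a b \<inter> \<Omega> \<in> lmeasurable" using \<Omega>(2) by (intro lmeasurable_open) (auto intro: bounded_subset)
  obtain \<phi> where \<phi>: "!!n::nat. !!a. 0 < a ==> a < 1 ==> \<phi> n \<in> X0 \<Omega> a" "(%n. mk (\<phi> n)) ----> mk (indicator (box a b \<inter> \<Omega>))"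
   using open_indicator_approx_X0[OF \<Omega> G] by metis
  have "(%n. mk f \<bullet> mk (\<phi> n)) ----> mk f \<bullet> mk (indicator (box a b \<inter> \<Omega>))" by (intro tendsto_intros \<phi>)
  moreover have "mk f \<bullet> mk (\<phi> n) = 0" for n by (rule orth[OF \<phi>(1)])
  ultimately have 0: "(LINT x|lebesgue. f x * indicator (box a b \<inter> \<Omega>) x) = 0"
   by (simp add: LIMSEQ_const_iff inner_mk[OF f indicator_sq[OF Gm]])
  have i: "integrable (lebesgue_on (cbox a b)) f"
   using sq_mult_integrable[OF f indicator_sq[OF lmeasurable_cbox[of a b]]] by (simp add: integrable_restrict_space mult.commute)
  have "AE x in lebesgue. x \<notin> cbox a b - box a b"
   by (rule AE_not_in) (use negligible_frontier_interval[of a b] in \<open>simp add: negligible_iff_null_sets\<close>)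
  hence "AE x in lebesgue. indicator (cbox a b) x *\<^sub>R f x = f x * indicator (box a b \<inter> \<Omega>) x"
   using out by eventually_elim (use box_subset_cbox[of a b] in \<open>auto simp: indicator_def\<close>)
  hence "(LINT x|lebesgue. indicator (cbox a b) x *\<^sub>R f x) = (LINT x|lebesgue. f x * indicator (box a b \<inter> \<Omega>) x)"
   using sq_meas[OF f] Gm by (intro integral_cong_AE borel_measurable_scaleR borel_measurable_times borel_measurable_indicator) auto
  hence "(LINT x|lebesgue_on (cbox a b). f x) = 0" using 0 by (simp add: integral_restrict_space)
  thus "f integrable_on cbox a b" "integral (cbox a b) f = 0"
   using has_integral_integral_lebesgue_on[OF i] by (auto simp: integral_unique)
 qed
 obtain N where N: "negligible N" "!!x e. x \<notin> N ==> 0 < e ==> \<exists>d>0. ALL h. 0 < h & h < d -->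
   norm (integral (cbox x (x + h *\<^sub>R One)) f /\<^sub>R h ^ DIM('a) - f x) < e"
  by (rule integrable_ccontinuous_explicit[OF c(1)]) (rule that)
 have "f x = 0" if x: "x \<notin> N" for x
 proof (rule ccontr)
  assume "f x \<noteq> 0"
  then obtain d :: real where "d > 0" "\<forall>h>0. \<not> h < d"
   using N(2)[OF x, of "norm (f x)"] unfolding c(2) by auto
  thus False using dense[of 0 d] by blast
 qed
 moreover have "AE x in lebesgue. x \<notin> N" using N(1) by (intro AE_not_in) (simp add: negligible_iff_null_sets)
 ultimately show ?thesis by (auto elim: eventually_mono)
qed

text \<open>On the ball of radius \<open>h\<close> about \<open>x\<close> the kernel is at least its
  value at distance \<open>h\<close>, so the Gagliardo integrand controls how far \<open>v x\<close>
  is from its average. Averages are written as inner products with indicators because these pass to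
  weak limits.\<close>

lemma ball_average_estimate:
 fixes \<Omega> :: "'a::euclidean_space set"
 assumes a: "0 < a" "a < 1" and \<Omega>: "open \<Omega>" "bounded \<Omega>" and v: "v \<in> X0 \<Omega> a" and h: "h > 0"
 shows "measure lborel (ball (0::'a) h) / 2 * (norm (mk v))^2
  <= h powr (real DIM('a) + 2 * a) / (frac_const TYPE('a) a / 2) * (norm (emb a v))^2
   + 2 / measure lborel (ball (0::'a) h) * (LINT x|lborel. indicator \<Omega> x * (mk v \<bullet> mk (indicator (ball x h)))^2)"
  "(%x. mk v \<bullet> mk (indicator (ball x h))) \<in> borel_measurable borel"
proof -
 obtain v' where v': "v' \<in> borel_measurable borel" and vX: "v' \<in> X0 \<Omega> a" and meq': "mk v' = mk v" and out: "AE x in lborel. x \<notin> \<Omega> --> v' x = 0"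
  and I: "(\<integral>\<^sup>+x. ennreal ((v' x)^2) \<partial>lborel) = ennreal ((norm (mk v))^2)"
   "(\<integral>\<^sup>+x. \<integral>\<^sup>+y. ennreal ((Dq a v' (x, y))^2) \<partial>lborel \<partial>lborel) = ennreal ((norm (emb a v))^2)"
  and Dm: "!!x. (%y. ennreal ((Dq a v' (x, y))^2)) \<in> borel_measurable lborel"
   "(%x. \<integral>\<^sup>+y. ennreal ((Dq a v' (x, y))^2) \<partial>lborel) \<in> borel_measurable lborel"
  by (rule X0_borel_rep[OF a v]) (rule that; assumption)
 have sv: "v' \<in> sq" by (rule X0_sq[OF a vX])
 note meq = meq'[symmetric]
 define p where "p = real DIM('a) + 2 * a"
 have p: "p > 0" using a by (simp add: p_def)
 define c where "c = frac_const TYPE('a) a / 2"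
 have c: "c > 0" using frac_const_pos[OF a, where 'a='a] by (simp add: c_def)
 define m where "m = measure lborel (ball (0::'a) h)"
 have m: "m > 0" unfolding m_def by (simp add: content_ball_pos h)
 have mb: "measure lborel (ball x h) = m" for x :: 'a using h by (simp add: m_def content_ball)
 have bm: "ball x h \<in> lmeasurable" for x :: 'a by (rule lmeasurable_ball)
 define F where "F x = mk v \<bullet> mk (indicator (ball x h))" for x :: 'a
 have vb: "(%y. v' y * indicator (ball x h) y) \<in> borel_measurable borel" for x
  by (intro borel_measurable_times v' borel_measurable_indicator) auto
 have Fint: "F x = (LINT y|lborel. v' y * indicator (ball x h) y)" for x
  unfolding F_def meq inner_mk[OF sv indicator_sq[OF bm]]
  by (rule integral_completion) (use vb in simp)
 have iv: "integrable lborel (%y. v' y * indicator (ball x h) y)" for x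
  using sq_mult_integrable[OF sv indicator_sq[OF bm, of x]] by (subst (asm) integrable_completion) (use vb in auto)
 have iv2: "integrable lborel (%y. (v' y)^2 * indicator (ball x h) y)" for x
 proof -
  have "integrable lborel (%y. (v' y)^2)" using sq_int[OF sv] by (subst (asm) integrable_completion) (use v' in auto)
  hence "integrable lborel (%y. indicator (ball x h) y *\<^sub>R (v' y)\<^sup>2)" by (intro integrable_mult_indicator) auto
  thus ?thesis by (simp add: mult.commute)
 qed
 have ib: "integrable lborel (indicator (ball x h) :: 'a => real)" for x
  by (rule integrable_real_indicator) (use emeasure_bounded_finite[OF bounded_ball] in auto)
 have mF: "F \<in> borel_measurable borel"
 proof -
  have "(%z::'a \<times> 'a. v' (snd z) * indicator {z. dist (fst z) (snd z) < h} z) \<in> borel_measurable borel"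
  proof -
   have "snd \<in> borel \<rightarrow>\<^sub>M (borel :: 'a measure)" by (simp add: borel_measurable_continuous_onI continuous_on_snd)
   hence 1: "(%z::'a \<times> 'a. v' (snd z)) \<in> borel_measurable borel" by (rule measurable_compose[OF _ v'])
   have "open {z::'a \<times> 'a. dist (fst z) (snd z) < h}" by (intro open_Collect_less continuous_intros)
   thus ?thesis using 1 by (intro borel_measurable_times borel_measurable_indicator) auto
  qed
  hence "(%(x, y). v' y * indicator (ball x h) y) \<in> borel_measurable (lborel \<Otimes>\<^sub>M lborel :: ('a \<times> 'a) measure)"
   unfolding lborel_prod by (simp add: case_prod_unfold indicator_def ball_def)
  from lborel.borel_measurable_lebesgue_integral[OF this] have "(%x. \<integral>y. v' y * indicator (ball x h) y \<partial>lborel) \<in> borel_measurable borel" by simp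
  moreover have "F = (%x. \<integral>y. v' y * indicator (ball x h) y \<partial>lborel)" by (rule ext) (rule Fint)
  ultimately show ?thesis by simp
 qed
 thus "(%x. mk v \<bullet> mk (indicator (ball x h))) \<in> borel_measurable borel" by (simp add: F_def[abs_def])
 have pt: "m / 2 * (v' x)^2 <= (LINT y|lborel. (v' x - v' y)^2 * indicator (ball x h) y) + 2 / m * (F x)^2"
  and ipt: "integrable lborel (%y. (v' x - v' y)^2 * indicator (ball x h) y)" for x
 proof -
  have e: "(%y. (v' x - v' y)^2 * indicator (ball x h) y) = (%y. (v' x)^2 * indicator (ball x h) y + (-2 * v' x) * (v' y * indicator (ball x h) y) + (v' y)^2 * indicator (ball x h) y)"
   by (auto simp: power2_diff algebra_simps)
  show "integrable lborel (%y. (v' x - v' y)^2 * indicator (ball x h) y)"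
   unfolding e by (intro Bochner_Integration.integrable_add integrable_mult_right iv iv2 ib)
  have "(LINT y|lborel. (v' x - v' y)^2 * indicator (ball x h) y) = (v' x)^2 * m + (-2 * v' x) * F x + (LINT y|lborel. (v' y)^2 * indicator (ball x h) y)"
   unfolding e by (subst Bochner_Integration.integral_add, (intro Bochner_Integration.integrable_add integrable_mult_right iv iv2 ib)+)
    (subst Bochner_Integration.integral_add, (intro Bochner_Integration.integrable_add integrable_mult_right iv iv2 ib)+, simp add: Fint mb iv ib)
  moreover have "0 <= (LINT y|lborel. (v' y)^2 * indicator (ball x h) y)" by (intro Bochner_Integration.integral_nonneg) auto
  \<comment> \<open>Expanding this square is the Young inequality that absorbs the mixed term
    \<open>2 * (v' x * F x)\<close>.\<close>
  moreover have "0 <= (m * v' x - 2 * F x)^2 / (2 * m)" using m by simp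
  moreover have "(m * v' x - 2 * F x)^2 / (2 * m) = m / 2 * (v' x)^2 - 2 * (v' x * F x) + 2 / m * (F x)^2"
   using m by (simp add: power2_eq_square field_simps)
  moreover have "m / 2 * V <= I + Fm" if "I = V * m + (-2 * v' x) * F x + S" "0 <= S" "0 <= R" "R = m / 2 * V - 2 * (v' x * F x) + Fm"
   for I V S R Fm :: real
   using that by (simp add: algebra_simps)
  ultimately show "m / 2 * (v' x)^2 <= (LINT y|lborel. (v' x - v' y)^2 * indicator (ball x h) y) + 2 / m * (F x)^2"
   by blast
 qed
 have dq: "(v' x - v' y)^2 * indicator (ball x h) y <= h powr p / c * (Dq a v' (x, y))^2" for x y
 proof (cases "y \<in> ball x h & x \<noteq> y")
  case True
  hence xy: "norm (x - y) > 0" "norm (x - y) <= h" by (auto simp: dist_norm)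
  have "(Dq a v' (x, y))^2 = c * (v' x - v' y)^2 / norm (x - y) powr p"
   unfolding Dq_square[OF a] gagliardo_def c_def p_def by (simp add: power2_eq_square)
  hence e: "h powr p / c * (Dq a v' (x, y))^2 = (v' x - v' y)^2 * (h powr p / norm (x - y) powr p)" using c by simp
  have "1 <= h powr p / norm (x - y) powr p"
   using xy p by (simp add: powr_mono2)
  from mult_left_mono[OF this zero_le_power2[of "v' x - v' y"]] True show ?thesis unfolding e by simp
 qed (use c in \<open>auto simp: indicator_def\<close>)
 have Fb: "\<bar>F x\<bar> <= norm (mk v) * sqrt m" for x
 proof -
  have "(norm (mk (indicator (ball x h) :: 'a => real)))^2 = m"
  proof -
   have "(norm (mk (indicator (ball x h) :: 'a => real)))^2 = (LINT y|lebesgue. indicator (ball x h) y)"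
    unfolding norm_mk_square[OF indicator_sq[OF bm]] by (rule Bochner_Integration.integral_cong) (auto simp: indicator_def)
   thus ?thesis using mb[of x] by simp
  qed
  hence "norm (mk (indicator (ball x h) :: 'a => real)) = sqrt m" by (metis norm_ge_zero real_sqrt_unique)
  thus ?thesis unfolding F_def using Cauchy_Schwarz_ineq2[of "mk v" "mk (indicator (ball x h))"] by simp
 qed
 have \<Omega>b: "\<Omega> \<in> sets borel" using \<Omega> by simp
 have i\<Omega>: "integrable lborel (%x. indicator \<Omega> x * (F x)^2)"
 proof (rule Bochner_Integration.integrable_bound[where f="%x. (norm (mk v) * sqrt m)^2 * indicator \<Omega> x"])
  show "integrable lborel (%x. (norm (mk v) * sqrt m)^2 * indicator \<Omega> x)"
   by (intro integrable_mult_right integrable_real_indicator) (use \<Omega>b emeasure_bounded_finite[OF \<Omega>(2)] in auto)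
  show "(%x. indicator \<Omega> x * (F x)^2) \<in> borel_measurable lborel" using \<Omega>b mF by auto
  have "(F x)^2 <= (norm (mk v) * sqrt m)^2" for x
   using power_mono[OF Fb[of x] abs_ge_zero, of 2] by simp
  thus "AE x in lborel. norm (indicator \<Omega> x * (F x)^2) <= norm ((norm (mk v) * sqrt m)^2 * indicator \<Omega> x)"
   by (intro AE_I2) (auto simp: indicator_def)
 qed
 let ?f = "%x. ennreal (2 / m * (indicator \<Omega> x * (F x)^2))"
 have "ennreal (m / 2 * (norm (mk v))^2) = (\<integral>\<^sup>+x. ennreal (m / 2) * ennreal ((v' x)^2) \<partial>lborel)"
  using v' m by (subst nn_integral_cmult) (auto simp: I(1) simp flip: ennreal_mult)
 also have "... <= (\<integral>\<^sup>+x. ennreal (h powr p / c) * (\<integral>\<^sup>+y. ennreal ((Dq a v' (x, y))^2) \<partial>lborel) + ?f x \<partial>lborel)"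
 proof (rule nn_integral_mono_AE)
  show "AE x in lborel. ennreal (m / 2) * ennreal ((v' x)^2) <= ennreal (h powr p / c) * (\<integral>\<^sup>+y. ennreal ((Dq a v' (x, y))^2) \<partial>lborel) + ?f x"
   using out
  proof eventually_elim
   case (elim x)
   show ?case
   proof (cases "x \<in> \<Omega>")
    case True
    have "ennreal (m / 2) * ennreal ((v' x)^2) <= ennreal ((LINT y|lborel. (v' x - v' y)^2 * indicator (ball x h) y) + 2 / m * (F x)^2)"
     using ennreal_leI[OF pt[of x]] m by (simp add: ennreal_mult[symmetric])
    also have "... = (\<integral>\<^sup>+y. ennreal ((v' x - v' y)^2 * indicator (ball x h) y) \<partial>lborel) + ennreal (2 / m * (F x)^2)"
     using m by (subst nn_integral_eq_integral[OF ipt]) (auto intro!: ennreal_plus Bochner_Integration.integral_nonneg)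
    also have "(\<integral>\<^sup>+y. ennreal ((v' x - v' y)^2 * indicator (ball x h) y) \<partial>lborel) <= (\<integral>\<^sup>+y. ennreal (h powr p / c) * ennreal ((Dq a v' (x, y))^2) \<partial>lborel)"
     using dq c by (intro nn_integral_mono) (simp add: ennreal_leI flip: ennreal_mult)
    finally show ?thesis using True by (simp add: nn_integral_cmult[OF Dm(1)])
   qed (use elim in simp)
  qed
 qed
 also have "... = ennreal (h powr p / c) * ennreal ((norm (emb a v))^2) + (\<integral>\<^sup>+x. ?f x \<partial>lborel)"
  using Dm(2) \<Omega>b mF by (simp add: nn_integral_add nn_integral_cmult I(2))
 also have "(\<integral>\<^sup>+x. ?f x \<partial>lborel) = ennreal (2 / m * (LINT x|lborel. indicator \<Omega> x * (F x)^2))"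
  by (subst nn_integral_eq_integral) (use i\<Omega> m in \<open>auto intro!: integrable_mult_right\<close>)
 also have "ennreal (h powr p / c) * ennreal ((norm (emb a v))^2) + ... = ennreal (h powr p / c * (norm (emb a v))^2 + 2 / m * (LINT x|lborel. indicator \<Omega> x * (F x)^2))"
  using c m by (subst ennreal_plus) (auto intro!: mult_nonneg_nonneg Bochner_Integration.integral_nonneg simp: ennreal_mult[symmetric])
 finally have "ennreal (m / 2 * (norm (mk v))^2) <= ennreal (h powr p / c * (norm (emb a v))^2 + 2 / m * (LINT x|lborel. indicator \<Omega> x * (F x)^2))" .
 moreover have "0 <= h powr p / c * (norm (emb a v))^2 + 2 / m * (LINT x|lborel. indicator \<Omega> x * (F x)^2)"
  using c m by (intro add_nonneg_nonneg mult_nonneg_nonneg Bochner_Integration.integral_nonneg) auto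
 ultimately have "m / 2 * (norm (mk v))^2 <= h powr p / c * (norm (emb a v))^2 + 2 / m * (LINT x|lborel. indicator \<Omega> x * (F x)^2)"
  by (simp add: ennreal_le_iff)
 thus "measure lborel (ball (0::'a) h) / 2 * (norm (mk v))^2
  <= h powr (real DIM('a) + 2 * a) / (frac_const TYPE('a) a / 2) * (norm (emb a v))^2
   + 2 / measure lborel (ball (0::'a) h) * (LINT x|lborel. indicator \<Omega> x * (mk v \<bullet> mk (indicator (ball x h)))^2)"
  unfolding m_def p_def c_def F_def .
qed

text \<open>By contradiction: along a normalized sequence violating this,
 ball averages tend to zero, while a function is close to its averages at small scales.\<close>
lemma Ehrling:
 fixes \<Omega> :: "'a::euclidean_space set"
 assumes s: "0 < s" "s < 1" and \<sigma>: "0 < \<sigma>" "\<sigma> < 1" and \<Omega>: "open \<Omega>" "bounded \<Omega>" and \<epsilon>: "\<epsilon> > 0"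
 obtains C where "C >= 0"
  "!!v U. v \<in> X0 \<Omega> \<sigma> ==> (!!\<phi>. \<phi> \<in> X0 \<Omega> s ==> U \<bullet> emb s \<phi> = mk v \<bullet> mk \<phi>) ==>
    (norm (mk v))^2 <= \<epsilon> * (norm (emb \<sigma> v))^2 + C * (norm U)^2"
proof (rule ccontr)
 assume contra: "\<not> thesis"
 have "EX v U. v \<in> X0 \<Omega> \<sigma> & (\<forall>\<phi>\<in>X0 \<Omega> s. U \<bullet> emb s \<phi> = mk v \<bullet> mk \<phi>) &
   \<epsilon> * (norm (emb \<sigma> v))^2 + real k * (norm U)^2 < (norm (mk v))^2" for k :: nat
  using contra that[of "real k"] by (force simp: not_le)
 then obtain v U where v: "!!k::nat. v k \<in> X0 \<Omega> \<sigma>" and U: "!!k \<phi>. \<phi> \<in> X0 \<Omega> s ==> U k \<bullet> emb s \<phi> = mk (v k) \<bullet> mk \<phi>"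
  and big: "!!k. \<epsilon> * (norm (emb \<sigma> (v k)))^2 + real k * (norm (U k))^2 < (norm (mk (v k)))^2" by metis
 define n where "n k = norm (mk (v k))" for k
 have n: "n k > 0" for k
 proof -
  have "0 <= \<epsilon> * (norm (emb \<sigma> (v k)))^2 + real k * (norm (U k))^2" using \<epsilon> by simp
  hence "0 < (n k)^2" using big[of k] unfolding n_def by linarith
  thus ?thesis by (simp add: n_def)
 qed
 define w where "w k x = (1 / n k) * v k x + 0 * v k x" for k x
 have w: "w k \<in> X0 \<Omega> \<sigma>" "emb \<sigma> (w k) = (1 / n k) *\<^sub>R emb \<sigma> (v k)" "mk (w k) = (1 / n k) *\<^sub>R mk (v k)" for k
  unfolding w_def[abs_def] using X0_linear[OF \<sigma> v[of k] v[of k], of "1 / n k" 0] by simp_all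
 have w1: "norm (mk (w k)) = 1" for k using n[of k] by (simp add: w n_def)
 have wb: "(norm (emb \<sigma> (w k)))^2 <= 1 / \<epsilon>" for k
 proof -
  have "0 <= real k * (norm (U k))^2" by simp
  hence "\<epsilon> * (norm (emb \<sigma> (v k)))^2 <= (n k)^2" using big[of k] unfolding n_def by linarith
  thus ?thesis using n[of k] \<epsilon> by (simp add: w power_divide field_simps)
 qed
 define U' where "U' k = (1 / n k) *\<^sub>R U k" for k
 have U'lim: "(%k. norm (U' k)) ----> 0"
 proof -
  have b: "(norm (U' k))^2 <= 1 / real k" if "k > 0" for k
  proof -
   have "0 <= \<epsilon> * (norm (emb \<sigma> (v k)))^2" using \<epsilon> by simp
   hence "real k * (norm (U k))^2 <= (n k)^2" using big[of k] unfolding n_def by linarith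
   thus ?thesis using n[of k] that by (simp add: U'_def power_divide field_simps)
  qed
  have "(%k. (norm (U' k))^2) ----> 0"
  proof (rule tendsto_sandwich[OF _ _ tendsto_const lim_1_over_n])
   show "\<forall>\<^sub>F k in sequentially. (norm (U' k))^2 <= 1 / real k" using eventually_gt_at_top[of 0] by eventually_elim (rule b)
  qed simp
  from tendsto_real_sqrt[OF this] show ?thesis by simp
 qed
 \<comment> \<open>The dual norms of \<open>w k\<close> tend to zero, and indicators of open subsets
   are L2 limits of functions in \<open>X0 \<Omega> s\<close>; the unit L2 norm of
   \<open>w k\<close> carries the convergence over to them.\<close>
 have ind: "(%k. mk (w k) \<bullet> mk (indicator A)) ----> 0" if A: "open A" "A \<subseteq> \<Omega>" for A
 proof (rule LIMSEQ_I)
  fix e :: real assume e: "e > 0"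
  obtain f where f: "!!n::nat. !!a. 0 < a ==> a < 1 ==> f n \<in> X0 \<Omega> a" "(%n. mk (f n)) ----> mk (indicator A)"
   using open_indicator_approx_X0[OF \<Omega> A] by metis
  obtain n where "norm (mk (f n) - mk (indicator A)) < e / 2" using LIMSEQ_D[OF f(2), of "e/2"] e by auto
  hence "norm (mk (indicator A) - mk (f n)) < e / 2" by (subst norm_minus_commute)
  then obtain \<phi> where \<phi>: "!!a. 0 < a ==> a < 1 ==> \<phi> \<in> X0 \<Omega> a" "norm (mk (indicator A) - mk \<phi>) < e / 2"
   using f(1)[of _ n] by blast
  have "(%k. norm (U' k) * norm (emb s \<phi>)) ----> 0 * norm (emb s \<phi>)" by (intro tendsto_intros U'lim)
  hence "eventually (%k. norm (U' k) * norm (emb s \<phi>) < e / 2) sequentially" using e by (intro order_tendstoD(2)) auto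
  then obtain N where N: "!!k. k >= N ==> norm (U' k) * norm (emb s \<phi>) < e / 2" unfolding eventually_sequentially by blast
  have "norm (mk (w k) \<bullet> mk (indicator A) - 0) < e" if "k >= N" for k
  proof -
   have "mk (w k) \<bullet> mk (indicator A) = mk (w k) \<bullet> (mk (indicator A) - mk \<phi>) + U' k \<bullet> emb s \<phi>"
    using U[OF \<phi>(1)[OF s], of k] by (simp add: inner_diff_right w(3) U'_def)
   moreover have "\<bar>mk (w k) \<bullet> (mk (indicator A) - mk \<phi>)\<bar> <= norm (mk (w k)) * norm (mk (indicator A) - mk \<phi>)" by (rule Cauchy_Schwarz_ineq2)
   moreover have "\<bar>U' k \<bullet> emb s \<phi>\<bar> <= norm (U' k) * norm (emb s \<phi>)" by (rule Cauchy_Schwarz_ineq2)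
   ultimately show ?thesis using N[OF that] \<phi>(2) unfolding w1 real_norm_def by linarith
  qed
  thus "EX N. \<forall>k\<ge>N. norm (mk (w k) \<bullet> mk (indicator A) - 0) < e" by blast
 qed
 define c where "c = frac_const TYPE('a) \<sigma> / 2"
 have c: "c > 0" using frac_const_pos[OF \<sigma>, where 'a='a] by (simp add: c_def)
 define p where "p = real DIM('a) + 2 * \<sigma>"
 have est: "measure lborel (ball (0::'a) h) / 2 <= h powr p / c * (1 / \<epsilon>)" if h: "h > 0" for h
 proof -
  define m where "m = measure lborel (ball (0::'a) h)"
  have m: "m > 0" unfolding m_def by (simp add: content_ball_pos h)
  define G where "G k x = indicator \<Omega> x * (mk (w k) \<bullet> mk (indicator (ball x h)))^2" for k x
  have G: "(%k. (LINT x|lborel. G k x)) ----> (LINT x|(lborel :: 'a measure). 0)"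
  proof (rule integral_dominated_convergence[where w="%x. m * indicator \<Omega> x"])
   show "G k \<in> borel_measurable lborel" for k
    unfolding G_def[abs_def] using ball_average_estimate(2)[OF \<sigma> \<Omega> w(1) h, of k] \<Omega> by auto
   show "integrable lborel (%x. m * indicator \<Omega> x)"
    by (intro integrable_mult_right integrable_real_indicator) (use \<Omega> emeasure_bounded_finite[OF \<Omega>(2)] in auto)
   \<comment> \<open>\<open>ind\<close> speaks of subsets of \<Omega>; the part of the ball outside
     contributes nothing, as \<open>w k\<close> vanishes there.\<close>
   have eqb: "mk (w k) \<bullet> mk (indicator (ball x h)) = mk (w k) \<bullet> mk (indicator (ball x h \<inter> \<Omega>))" for k x
   proof -
    have m1: "ball x h \<in> lmeasurable" by (rule lmeasurable_ball)
    have m2: "ball x h \<inter> \<Omega> \<in> lmeasurable" using m1 \<Omega> by (intro fmeasurable_Int_fmeasurable) auto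
    show ?thesis
     unfolding inner_mk[OF X0_sq[OF \<sigma> w(1)] indicator_sq[OF m1]] inner_mk[OF X0_sq[OF \<sigma> w(1)] indicator_sq[OF m2]]
    proof (rule integral_cong_AE)
     show "AE y in lebesgue. w k y * indicator (ball x h) y = w k y * indicator (ball x h \<inter> \<Omega>) y"
      using X0_out[OF \<sigma> w(1)[of k]] by eventually_elim (auto simp: indicator_def)
    qed (use sq_mult_meas[OF X0_sq[OF \<sigma> w(1)] indicator_sq[OF m1]] sq_mult_meas[OF X0_sq[OF \<sigma> w(1)] indicator_sq[OF m2]] in auto)
   qed
   show "AE x in lborel. (%k. G k x) ----> 0"
   proof (rule AE_I2)
    fix x
    have "(%k. mk (w k) \<bullet> mk (indicator (ball x h))) ----> 0"
     unfolding eqb by (rule ind) (use \<Omega> in auto)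
    hence "(%k. indicator \<Omega> x * (mk (w k) \<bullet> mk (indicator (ball x h)))^2) ----> indicator \<Omega> x * 0^2" by (intro tendsto_intros)
    thus "(%k. G k x) ----> 0" by (simp add: G_def)
   qed
   show "AE x in lborel. norm (G k x) <= m * indicator \<Omega> x" for k
   proof (rule AE_I2)
    fix x
    have "(norm (mk (indicator (ball x h) :: 'a => real)))^2 = (LINT y|lebesgue. indicator (ball x h) y)"
     unfolding norm_mk_square[OF indicator_sq[OF lmeasurable_ball]] by (rule Bochner_Integration.integral_cong) (auto simp: indicator_def)
    also have "... = m" using h by (simp add: m_def content_ball)
    finally have nm: "(norm (mk (indicator (ball x h) :: 'a => real)))^2 = m" .
    have "(mk (w k) \<bullet> mk (indicator (ball x h)))^2 <= (norm (mk (w k)))^2 * (norm (mk (indicator (ball x h) :: 'a => real)))^2"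
     using Cauchy_Schwarz_ineq[of "mk (w k)" "mk (indicator (ball x h))"] by (simp add: power2_norm_eq_inner)
    thus "norm (G k x) <= m * indicator \<Omega> x" unfolding w1 nm G_def by (simp add: indicator_def)
   qed
  qed simp
  have "m / 2 <= h powr p / c * (1 / \<epsilon>) + 2 / m * 0"
  proof (rule LIMSEQ_le_const)
   show "(%k. h powr p / c * (1 / \<epsilon>) + 2 / m * (LINT x|lborel. G k x)) ----> h powr p / c * (1 / \<epsilon>) + 2 / m * 0"
    using G by (intro tendsto_intros) simp
   have "m / 2 <= h powr p / c * (1 / \<epsilon>) + 2 / m * (LINT x|lborel. G k x)" for k
   proof -
    have "m / 2 * (norm (mk (w k)))^2 <= h powr p / c * (norm (emb \<sigma> (w k)))^2 + 2 / m * (LINT x|lborel. G k x)"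
     using ball_average_estimate(1)[OF \<sigma> \<Omega> w(1) h, of k] unfolding m_def p_def c_def G_def .
    also have "h powr p / c * (norm (emb \<sigma> (w k)))^2 <= h powr p / c * (1 / \<epsilon>)" using c wb by (intro mult_left_mono) auto
    finally show ?thesis by (simp add: w1)
   qed
   thus "EX N. \<forall>k\<ge>N. m / 2 <= h powr p / c * (1 / \<epsilon>) + 2 / m * (LINT x|lborel. G k x)" by blast
  qed
  thus ?thesis by (simp add: m_def)
 qed
 define \<omega> where "\<omega> = unit_ball_vol (real DIM('a))"
 have \<omega>: "\<omega> > 0" by (simp add: \<omega>_def unit_ball_vol_pos)
 \<comment> \<open>With this \<open>q\<close> the bound \<open>est\<close> at radius
   \<open>h\<close> has a right side equal to half of the left side.\<close>
 define q where "q = \<omega> * c * \<epsilon> / 4"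
 have q: "q > 0" using \<omega> c \<epsilon> by (simp add: q_def)
 define h where "h = q powr (1 / (2 * \<sigma>))"
 have h: "h > 0" using q by (simp add: h_def)
 have "h powr (2 * \<sigma>) = q" using \<sigma> q by (simp add: h_def powr_powr)
 have "\<omega> * h ^ DIM('a) / 2 <= h powr p / c * (1 / \<epsilon>)"
  using est[OF h] h by (simp add: content_ball \<omega>_def)
 also have "h powr p = h ^ DIM('a) * q"
  unfolding p_def powr_add \<open>h powr (2 * \<sigma>) = q\<close> using h by (simp add: powr_realpow)
 also have "h ^ DIM('a) * q / c * (1 / \<epsilon>) = h ^ DIM('a) * \<omega> / 4" using c \<epsilon> by (simp add: q_def)
 finally show False using \<omega> h by (simp add: field_simps)
qed

section \<open>The energy as a semiconvex functional on the dual space\<close>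

lemma sq_out_integral:
 assumes "f \<in> borel_measurable lebesgue" "\<Omega> \<in> sets lebesgue" "AE x in lebesgue. x \<notin> \<Omega> --> f x = (0::real)"
 shows "(LINT x|lebesgue_on \<Omega>. f x) = (LINT x|lebesgue. f x)"
  and "integrable (lebesgue_on \<Omega>) f \<longleftrightarrow> integrable lebesgue f"
proof -
 have ae: "AE x in lebesgue. indicator \<Omega> x *\<^sub>R f x = f x"
  using assms(3) by eventually_elim (auto simp: indicator_def)
 have m: "(%x. indicator \<Omega> x *\<^sub>R f x) \<in> borel_measurable lebesgue" using assms by (intro borel_measurable_scaleR borel_measurable_indicator) auto
 show "(LINT x|lebesgue_on \<Omega>. f x) = (LINT x|lebesgue. f x)"
 proof -
  have "(LINT x|lebesgue_on \<Omega>. f x) = (LINT x|lebesgue. indicator \<Omega> x *\<^sub>R f x)"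
   using assms(2) by (intro integral_restrict_space) auto
  also have "... = (LINT x|lebesgue. f x)" by (rule integral_cong_AE[OF m assms(1) ae])
  finally show ?thesis .
 qed
 show "integrable (lebesgue_on \<Omega>) f \<longleftrightarrow> integrable lebesgue f"
  using assms(2) integrable_cong_AE[OF m assms(1) ae] by (subst integrable_restrict_space) auto
qed

lemma L2_norm_mk:
 assumes "f \<in> sq" "\<Omega> \<in> sets lebesgue" "AE x in lebesgue. x \<notin> \<Omega> --> f x = 0"
 shows "L2_norm \<Omega> f = norm (mk f)"
proof -
 have "(LINT x|lebesgue_on \<Omega>. (f x)^2) = (LINT x|lebesgue. (f x)^2)"
 proof (rule sq_out_integral(1))
  show "(%x. (f x)^2) \<in> borel_measurable lebesgue" using sq_meas[OF assms(1)] by simp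
  show "AE x in lebesgue. x \<notin> \<Omega> --> (f x)^2 = 0" using assms(3) by eventually_elim auto
 qed (rule assms(2))
 thus ?thesis unfolding L2_norm_def by (simp add: norm_mk_square[OF assms(1), symmetric])
qed

lemma L2_embed_mk:
 assumes "f \<in> sq" "h \<in> sq" "\<Omega> \<in> sets lebesgue" "AE x in lebesgue. x \<notin> \<Omega> --> h x = 0"
 shows "L2_embed \<Omega> f h = mk f \<bullet> mk h"
 unfolding L2_embed_def inner_mk[OF assms(1,2)]
proof (rule sq_out_integral(1)[OF sq_mult_meas[OF assms(1,2)] assms(3)])
 show "AE x in lebesgue. x \<notin> \<Omega> --> f x * h x = 0" using assms(4) by eventually_elim auto
qed

lemma sq_L2: "f \<in> sq ==> \<Omega> \<in> sets lebesgue ==> f \<in> L2 \<Omega>"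
 unfolding L2_def
proof (intro CollectI conjI)
 assume f: "f \<in> sq" and \<Omega>: "\<Omega> \<in> sets lebesgue"
 show "f \<in> borel_measurable (lebesgue_on \<Omega>)" by (rule measurable_restrict_space1[OF sq_meas[OF f]])
 have "integrable lebesgue (%x. indicator \<Omega> x *\<^sub>R (f x)\<^sup>2)" using \<Omega> sq_int[OF f] by (rule integrable_mult_indicator)
 thus "integrable (lebesgue_on \<Omega>) (%x. (f x)^2)" using \<Omega> by (subst integrable_restrict_space) auto
qed

lemma sq_inner_dominated:
 assumes F: "F \<in> sq" and G: "G \<in> sq" and f: "!!n. f n \<in> borel_measurable lebesgue" and g: "g \<in> sq"
  and b: "!!n. AE x in lebesgue. \<bar>f n x\<bar> <= \<bar>G x\<bar>" and l: "AE x in lebesgue. (%n. f n x) ----> g x"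
 shows "!!n. f n \<in> sq" "(%n. mk F \<bullet> mk (f n)) ----> mk F \<bullet> mk g"
proof -
 show s: "f n \<in> sq" for n by (rule sq_bound[OF G f b])
 have G': "(%x. \<bar>G x\<bar>) \<in> sq" "(%x. \<bar>F x\<bar>) \<in> sq"
  by (rule sq_bound[OF G] sq_bound[OF F]; use sq_meas[OF G] sq_meas[OF F] in auto)+
 have "(%n. (LINT x|lebesgue. F x * f n x)) ----> (LINT x|lebesgue. F x * g x)"
 proof (rule integral_dominated_convergence[where w="%x. \<bar>F x\<bar> * \<bar>G x\<bar>"])
  show "integrable lebesgue (%x. \<bar>F x\<bar> * \<bar>G x\<bar>)" by (rule sq_mult_integrable[OF G'(2,1)])
  show "AE x in lebesgue. (%n. F x * f n x) ----> F x * g x" using l by eventually_elim (intro tendsto_intros)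
  show "AE x in lebesgue. norm (F x * f n x) <= \<bar>F x\<bar> * \<bar>G x\<bar>" for n
   using b[of n] by eventually_elim (simp add: abs_mult mult_left_mono)
 qed (use sq_mult_meas[OF F g] sq_mult_meas[OF F s] in auto)
 thus "(%n. mk F \<bullet> mk (f n)) ----> mk F \<bullet> mk g" by (simp add: inner_mk F s g)
qed

definition clip :: "real => real => real" where "clip k r = max (- k) (min k r)"

lemma clip_simps: "k >= 0 ==> \<bar>clip k r\<bar> <= k" "k >= 0 ==> \<bar>clip k r\<bar> <= \<bar>r\<bar>" "\<bar>r\<bar> <= k ==> clip k r = r"
 "k >= 0 ==> clip k 0 = 0" "\<bar>clip k r - clip k t\<bar> <= \<bar>r - t\<bar>" "r <= t ==> clip k r <= clip k t"
 "k >= 0 ==> 0 <= r ==> 0 <= clip k r & clip k r <= r" "k >= 0 ==> r <= 0 ==> clip k r <= 0 & r <= clip k r"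
 unfolding clip_def by arith+

lemma clip_lim: "(%n. clip (real n) r) ----> r"
proof (rule tendsto_eventually)
 have "eventually (%n. \<bar>r\<bar> <= real n) sequentially" using filterlim_real_sequentially by (simp add: filterlim_at_top)
 thus "eventually (%n. clip (real n) r = r) sequentially" by eventually_elim (rule clip_simps(3))
qed

lemma clip_cont: "continuous_on S (clip k)"
 unfolding clip_def[abs_def] by (intro continuous_intros)

locale cahn_hilliard =
 fixes \<Omega> :: "'a::euclidean_space set" and s \<sigma> lam \<kappa> :: real and g ghat \<beta> \<beta>hat :: "real => real"
 assumes \<Omega>: "open \<Omega>" "bounded \<Omega>"
  and s: "0 < s" "s < 1" and \<sigma>: "0 < \<sigma>" "\<sigma> < 1"
  and g_C1: "g C1_differentiable_on UNIV" and g0: "g 0 = 0" and lam: "0 <= lam" and g': "!!r. - lam <= deriv g r"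
  and \<kappa>: "\<kappa> > 0" "0 < Liminf at_infinity (%r. ereal (g r * r + (first_eigenvalue \<Omega> \<sigma> - \<kappa>) * r^2))"
  and ghat: "!!r. (ghat has_real_derivative g r) (at r)"
  and \<beta>: "!!r. \<beta> r = g r + lam * r" and \<beta>hat: "!!r. (\<beta>hat has_real_derivative \<beta> r) (at r)"
begin

lemma \<Omega>m: "\<Omega> \<in> lmeasurable" using \<Omega> by (rule lmeasurable_open[rotated])
lemma \<Omega>s: "\<Omega> \<in> sets lebesgue" using \<Omega>m by auto

lemma \<beta>0: "\<beta> 0 = 0" by (simp add: \<beta> g0)

lemma \<beta>_deriv: "EX D. (ALL r. (\<beta> has_real_derivative D r) (at r)) & (ALL r. D r >= 0) & continuous_on UNIV D"
proof -
 obtain D where D: "!!x. (g has_vector_derivative D x) (at x)" "continuous_on UNIV D"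
  using g_C1 unfolding C1_differentiable_on_def by auto
 have Dr: "(g has_real_derivative D x) (at x)" for x using D(1) by (simp add: has_real_derivative_iff_has_vector_derivative)
 have e: "\<beta> = (%r. g r + lam * r)" by (rule ext) (rule \<beta>)
 show ?thesis
 proof (intro exI[of _ "%r. D r + lam"] conjI allI)
  show "(\<beta> has_real_derivative D r + lam) (at r)" for r unfolding e by (auto intro!: derivative_eq_intros Dr)
  show "0 <= D r + lam" for r using g'[of r] DERIV_imp_deriv[OF Dr[of r]] by simp
  show "continuous_on UNIV (%r. D r + lam)" by (intro continuous_intros D(2))
 qed
qed

lemma \<beta>_mono: "x <= y ==> \<beta> x <= \<beta> y"
 using \<beta>_deriv by (meson DERIV_nonneg_imp_nondecreasing)

lemma \<beta>_cont: "continuous_on S \<beta>"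
 using \<beta>_deriv by (meson DERIV_isCont continuous_at_imp_continuous_on)

lemma g_cont: "continuous_on S g"
proof -
 have "g = (%r. \<beta> r - lam * r)" by (simp add: \<beta> fun_eq_iff)
 thus ?thesis by (simp add: continuous_intros \<beta>_cont)
qed

lemma \<beta>_lip:
 assumes R: "R >= 0"
 obtains L where "L > 0" "!!x y. \<bar>x\<bar> <= R ==> \<bar>y\<bar> <= R ==> \<bar>\<beta> x - \<beta> y\<bar> <= L * \<bar>x - y\<bar>"
proof -
 obtain D where D: "!!r. (\<beta> has_real_derivative D r) (at r)" "!!r. D r >= 0" "continuous_on UNIV D" using \<beta>_deriv by blast
 have "compact (D ` {-R..R})" by (intro compact_continuous_image continuous_on_subset[OF D(3)]) auto
 then obtain K where K: "K > 0" "!!x. x \<in> {-R..R} ==> norm (D x) <= K"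
  using compact_imp_bounded bounded_pos by (metis image_eqI)
 show thesis
 proof (rule that[OF K(1)])
  fix x y assume "\<bar>x\<bar> <= R" "\<bar>y\<bar> <= R"
  hence xy: "x \<in> {-R..R}" "y \<in> {-R..R}" by auto
  have "norm (\<beta> x - \<beta> y) <= K * norm (x - y)"
   by (rule field_differentiable_bound[of "{-R..R}" \<beta> D]) (use D(1) K xy in \<open>auto intro: has_field_derivative_at_within\<close>)
  thus "\<bar>\<beta> x - \<beta> y\<bar> <= K * \<bar>x - y\<bar>" by simp
 qed
qed

lemma \<beta>_sign: "0 <= r ==> 0 <= \<beta> r" "r <= 0 ==> \<beta> r <= 0"
 using \<beta>_mono[of 0 r] \<beta>_mono[of r 0] by (simp_all add: \<beta>0)

text \<open>Subtracting the value at zero makes this convex primitive nonnegative and lets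
  \<open>B (u x)\<close> vanish outside \<Omega>, so that integrals can be taken over the whole
  space.\<close>

definition B where "B r = \<beta>hat r - \<beta>hat 0"

lemma B_deriv: "(B has_real_derivative \<beta> r) (at r)"
 unfolding B_def[abs_def] by (auto intro!: derivative_eq_intros \<beta>hat)

lemma B_cont: "continuous_on S B"
 by (meson B_deriv DERIV_isCont continuous_at_imp_continuous_on)

lemma B_tangent: "B x + \<beta> x * (y - x) <= B y"
proof -
 define f where "f z = B z - B x - \<beta> x * (z - x)" for z
 have d: "(f has_real_derivative (\<beta> z - \<beta> x)) (at z)" for z
  unfolding f_def by (auto intro!: derivative_eq_intros B_deriv)
 have "f x <= f y"
 proof (cases "x <= y")
  case True
  show ?thesis by (rule DERIV_nonneg_imp_nondecreasing[OF True]) (use d \<beta>_mono in force)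
 next
  case False
  hence "y <= x" by simp
  thus ?thesis by (rule DERIV_nonpos_imp_nonincreasing) (use d \<beta>_mono in force)
 qed
 thus ?thesis by (simp add: f_def)
qed

lemma B_0: "B 0 = 0" by (simp add: B_def)

lemma B_nonneg: "0 <= B r"
 using B_tangent[of 0 r] by (simp add: B_0 \<beta>0)

lemma B_convex: "0 <= \<theta> ==> \<theta> <= 1 ==> B ((1 - \<theta>) * x + \<theta> * y) <= (1 - \<theta>) * B x + \<theta> * B y"
proof -
 assume th: "0 <= \<theta>" "\<theta> <= 1"
 define z where "z = (1 - \<theta>) * x + \<theta> * y"
 have "(1 - \<theta>) * (B z + \<beta> z * (x - z)) <= (1 - \<theta>) * B x" "\<theta> * (B z + \<beta> z * (y - z)) <= \<theta> * B y"
  using th by (auto intro!: mult_left_mono B_tangent)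
 moreover have "(1 - \<theta>) * (B z + \<beta> z * (x - z)) + \<theta> * (B z + \<beta> z * (y - z)) = B z + \<beta> z * ((1 - \<theta>) * x + \<theta> * y - z)"
  by (simp add: algebra_simps)
 ultimately show ?thesis unfolding z_def by simp
qed

lemma B_upper: "B y <= B x + \<beta> y * (y - x)"
 using B_tangent[of y x] by (simp add: algebra_simps)

lemma ghat_eq: "ghat r = B r - lam / 2 * r^2 + ghat 0"
proof -
 have "((%r. ghat r - (B r - lam / 2 * r^2)) has_real_derivative (g r - (\<beta> r - lam * r))) (at r)" for r
  by (auto intro!: derivative_eq_intros ghat B_deriv)
 hence "((%r. ghat r - (B r - lam / 2 * r^2)) has_real_derivative 0) (at r)" for r by (simp add: \<beta>)
 hence "ghat r - (B r - lam / 2 * r^2) = ghat 0 - (B 0 - lam / 2 * 0^2)" by (rule DERIV_isconst_all[rule_format])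
 thus ?thesis by (simp add: B_0)
qed

text \<open>By the liminf condition the derivative of \<open>ghat r + (first_eigenvalue \<Omega>
  \<sigma> - \<kappa>) / 2 * r^2\<close> has the sign of \<open>r\<close> for large
  \<open>\<bar>r\<bar>\<close>, so this function takes its minimum on a compact interval.\<close>

lemma ghat_lower: obtains c where "c >= 0" "!!r. - (first_eigenvalue \<Omega> \<sigma> - \<kappa>) / 2 * r^2 - c <= ghat r - ghat 0"
proof -
 define l where "l = first_eigenvalue \<Omega> \<sigma> - \<kappa>"
 define G where "G r = ghat r - ghat 0 + l / 2 * r^2" for r
 have Gd: "(G has_real_derivative (g r + l * r)) (at r)" for r
  unfolding G_def by (auto intro!: derivative_eq_intros ghat)
 have "eventually (%r. ereal 0 < ereal (g r * r + l * r^2)) at_infinity"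
  using \<kappa>(2) unfolding l_def zero_ereal_def[symmetric] by (rule less_LiminfD)
 then obtain R where R: "!!r. R <= norm r ==> 0 < g r * r + l * r^2"
  unfolding eventually_at_infinity by auto
 define R' where "R' = max R 1"
 have R'1: "R' >= 1" by (simp add: R'_def)
 have pos: "0 < (g r + l * r) * r" if "R' <= \<bar>r\<bar>" for r
  using R[of r] that by (simp add: R'_def power2_eq_square algebra_simps)
 have up: "G R' <= G r" if "R' <= r" for r
 proof (rule DERIV_nonneg_imp_nondecreasing[OF that])
  fix x assume "R' <= x"
  hence "0 < (g x + l * x) * x" "x > 0" using pos[of x] R'1 by auto
  hence "0 <= g x + l * x" by (simp add: zero_less_mult_iff)
  thus "EX y. (G has_real_derivative y) (at x) & 0 <= y" using Gd by blast
 qed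
 have dn: "G (- R') <= G r" if "r <= - R'" for r
 proof (rule DERIV_nonpos_imp_nonincreasing[OF that])
  fix x assume "x <= - R'"
  hence "0 < (g x + l * x) * x" "x < 0" using pos[of x] R'1 by auto
  hence "g x + l * x <= 0" by (simp add: zero_less_mult_iff)
  thus "EX y. (G has_real_derivative y) (at x) & y <= 0" using Gd by blast
 qed
 have "continuous_on {-R'..R'} G" by (meson Gd DERIV_isCont continuous_at_imp_continuous_on)
 then obtain x0 where x0: "x0 \<in> {-R'..R'}" "!!x. x \<in> {-R'..R'} ==> G x0 <= G x"
  using continuous_attains_inf[of "{-R'..R'}" G] R'1 by (metis atLeastatMost_empty_iff compact_Icc le_minus_iff neg_le_0_iff_le order_trans zero_le_one)
 have "G x0 <= G r" for r
 proof (cases "\<bar>r\<bar> <= R'")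
  case False
  thus ?thesis using up[of r] dn[of r] x0(2)[of R'] x0(2)[of "- R'"] R'1 by (cases "r >= 0") auto
 next
  case True
  hence "r \<in> {-R'..R'}" by auto
  thus ?thesis by (rule x0(2))
 qed
 hence G: "- \<bar>G x0\<bar> <= G r" for r using abs_ge_minus_self[of "G x0"] by (meson minus_le_iff order_trans)
 show thesis
 proof (rule that[of "\<bar>G x0\<bar>"])
  show "- (first_eigenvalue \<Omega> \<sigma> - \<kappa>) / 2 * r^2 - \<bar>G x0\<bar> <= ghat r - ghat 0" for r
  proof -
   have "- l / 2 * r^2 = - (l / 2 * r^2)" by simp
   thus ?thesis using G[of r] unfolding G_def[of r] l_def[symmetric] by linarith
  qed
 qed simp
qed

lemma eigen_lower:
 assumes v: "v \<in> X0 \<Omega> \<sigma>"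
 shows "first_eigenvalue \<Omega> \<sigma> * (norm (mk v))^2 <= (norm (emb \<sigma> v))^2"
proof (cases "AE x in lebesgue. v x = 0")
 case True
 hence "mk v = mk (%x. 0)" by (intro mk_cong X0_sq[OF \<sigma> v] sq_0)
 thus ?thesis by (simp add: mk_0)
next
 case False
 let ?S = "{v \<in> X0 \<Omega> \<sigma>. \<not> (AE x in lebesgue. v x = 0)}"
 have nz: "norm (mk v) > 0"
  using False mk_eq_iff[OF X0_sq[OF \<sigma> v] sq_0] by (auto simp: mk_0)
 have "first_eigenvalue \<Omega> \<sigma> <= (X0_norm \<sigma> v)^2 / (L2_norm \<Omega> v)^2"
  unfolding first_eigenvalue_def by (rule cINF_lower) (use False v in \<open>auto intro!: bdd_belowI[of _ 0]\<close>)
 also have "... = (norm (emb \<sigma> v))^2 / (norm (mk v))^2"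
  by (simp add: X0_norm_emb[OF \<sigma> v] L2_norm_mk[OF X0_sq[OF \<sigma> v] \<Omega>s X0_out[OF \<sigma> v]])
 finally show ?thesis using nz by (simp add: pos_le_divide_eq)
qed

lemma comp_meas:
 fixes h :: "real => real"
 assumes "continuous_on UNIV h" "u \<in> borel_measurable lebesgue"
 shows "(%x. h (u x)) \<in> borel_measurable lebesgue"
 by (rule measurable_compose[OF assms(2) borel_measurable_continuous_onI[OF assms(1)]])

text \<open>The energy without the constant \<open>ghat 0 * measure lebesgue \<Omega>\<close>, with
  the convex part and the concave quadratic separated. It is meaningful when \<open>B (u x)\<close>
  is integrable.\<close>

definition E0 where "E0 u = (norm (emb \<sigma> u))^2 / 2 + (LINT x|lebesgue. B (u x)) - lam / 2 * (norm (mk u))^2"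

lemma int_const_on: "integrable (lebesgue_on \<Omega>) (%x. c :: real)"
proof -
 have "integrable lebesgue (indicator \<Omega> :: 'a => real)"
  by (rule integrable_real_indicator) (use \<Omega>m in \<open>simp_all only: fmeasurable_def mem_Collect_eq infinity_ennreal_def\<close>)
 hence "integrable lebesgue (%x. indicator \<Omega> x *\<^sub>R c)" by (intro integrable_scaleR_left) auto
 thus ?thesis using \<Omega>s by (subst integrable_restrict_space) auto
qed

lemma B_out:
 assumes u: "u \<in> X0 \<Omega> \<sigma>"
 shows "(%x. B (u x)) \<in> borel_measurable lebesgue" "AE x in lebesgue. x \<notin> \<Omega> --> B (u x) = 0"
proof -
 show "(%x. B (u x)) \<in> borel_measurable lebesgue" by (rule comp_meas[OF B_cont sq_meas[OF X0_sq[OF \<sigma> u]]])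
 show "AE x in lebesgue. x \<notin> \<Omega> --> B (u x) = 0" using X0_out[OF \<sigma> u] by eventually_elim (simp add: B_0)
qed

lemma energy_eq:
 assumes u: "u \<in> X0 \<Omega> \<sigma>" and i: "integrable lebesgue (%x. B (u x))"
 shows "integrable (lebesgue_on \<Omega>) (%x. ghat (u x))" "energy \<Omega> \<sigma> ghat u = E0 u + ghat 0 * measure lebesgue \<Omega>"
proof -
 have iB: "integrable (lebesgue_on \<Omega>) (%x. B (u x))" using i sq_out_integral(2)[OF B_out(1)[OF u] \<Omega>s B_out(2)[OF u]] by simp
 have "(%x. (u x)^2) \<in> borel_measurable lebesgue" using sq_meas[OF X0_sq[OF \<sigma> u]] by simp
 moreover have "AE x in lebesgue. x \<notin> \<Omega> --> (u x)^2 = 0" using X0_out[OF \<sigma> u] by eventually_elim simp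
 ultimately have iu: "integrable (lebesgue_on \<Omega>) (%x. (u x)^2)"
  and eu: "(LINT x|lebesgue_on \<Omega>. (u x)^2) = (norm (mk u))^2"
  using sq_out_integral[of "%x. (u x)^2" \<Omega>] \<Omega>s sq_int[OF X0_sq[OF \<sigma> u]] norm_mk_square[OF X0_sq[OF \<sigma> u]] by auto
 have e: "(%x. ghat (u x)) = (%x. B (u x) - lam / 2 * (u x)^2 + ghat 0)" by (rule ext) (rule ghat_eq)
 show "integrable (lebesgue_on \<Omega>) (%x. ghat (u x))" unfolding e by (intro Bochner_Integration.integrable_add Bochner_Integration.integrable_diff integrable_mult_right iB iu int_const_on)
 have "(LINT x|lebesgue_on \<Omega>. ghat (u x)) = (LINT x|lebesgue_on \<Omega>. B (u x)) - lam / 2 * (norm (mk u))^2 + ghat 0 * measure lebesgue \<Omega>"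
  unfolding e using iB iu int_const_on \<Omega>s
  by (simp add: Bochner_Integration.integral_add Bochner_Integration.integral_diff eu measure_restrict_space)
 thus "energy \<Omega> \<sigma> ghat u = E0 u + ghat 0 * measure lebesgue \<Omega>"
  unfolding energy_def E0_def X0_norm_emb[OF \<sigma> u] using sq_out_integral(1)[OF B_out(1)[OF u] \<Omega>s B_out(2)[OF u]] by simp
qed

lemma integrable_\<beta>hat_iff:
 assumes u: "u \<in> X0 \<Omega> \<sigma>"
 shows "integrable (lebesgue_on \<Omega>) (%x. \<beta>hat (u x)) \<longleftrightarrow> integrable lebesgue (%x. B (u x))"
proof -
 have "integrable (lebesgue_on \<Omega>) (%x. \<beta>hat (u x)) \<longleftrightarrow> integrable (lebesgue_on \<Omega>) (%x. B (u x))"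
 proof
  assume "integrable (lebesgue_on \<Omega>) (%x. \<beta>hat (u x))"
  thus "integrable (lebesgue_on \<Omega>) (%x. B (u x))" unfolding B_def by (intro Bochner_Integration.integrable_diff int_const_on)
 next
  assume "integrable (lebesgue_on \<Omega>) (%x. B (u x))"
  hence "integrable (lebesgue_on \<Omega>) (%x. B (u x) + \<beta>hat 0)" by (intro Bochner_Integration.integrable_add int_const_on)
  thus "integrable (lebesgue_on \<Omega>) (%x. \<beta>hat (u x))" by (simp add: B_def)
 qed
 thus ?thesis using sq_out_integral(2)[OF B_out(1)[OF u] \<Omega>s B_out(2)[OF u]] by simp
qed

text \<open>A fraction \<open>t\<close> of the squared norm is kept, and the rest absorbs the
  negative quadratic term through the eigenvalue inequality. This works as long as
  \<open>t * first_eigenvalue \<Omega> \<sigma> <= \<kappa>\<close>, whence the definition of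
  \<open>t\<close> in the proof.\<close>

lemma E0_coercive: obtains t c where "t > 0" "c >= 0"
 "!!u. u \<in> X0 \<Omega> \<sigma> ==> integrable lebesgue (%x. B (u x)) ==> t * (norm (emb \<sigma> u))^2 - c <= E0 u"
proof -
 obtain c where c: "c >= 0" "!!r. - (first_eigenvalue \<Omega> \<sigma> - \<kappa>) / 2 * r^2 - c <= ghat r - ghat 0" using ghat_lower by blast
 define l where "l = first_eigenvalue \<Omega> \<sigma>"
 define t where "t = min 1 (\<kappa> / (\<bar>l\<bar> + 1))"
 have t: "t > 0" "t <= 1" "t * l <= \<kappa>"
 proof -
  show "t > 0" "t <= 1" using \<kappa>(1) by (auto simp: t_def)
  have "t * l <= t * (\<bar>l\<bar> + 1)" using \<open>t > 0\<close> by (intro mult_left_mono) auto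
  also have "... <= (\<kappa> / (\<bar>l\<bar> + 1)) * (\<bar>l\<bar> + 1)" unfolding t_def by (intro mult_right_mono) auto
  also have "... = \<kappa>" by simp
  finally show "t * l <= \<kappa>" .
 qed
 show thesis
 proof (rule that[of "t / 2" "c * measure lebesgue \<Omega>"])
  show "t / 2 > 0" "c * measure lebesgue \<Omega> >= 0" using t c by auto
  fix u assume u: "u \<in> X0 \<Omega> \<sigma>" and i: "integrable lebesgue (%x. B (u x))"
  have iu: "integrable lebesgue (%x. (u x)^2)" by (rule sq_int[OF X0_sq[OF \<sigma> u]])
  have i\<Omega>: "integrable lebesgue (indicator \<Omega> :: 'a => real)"
   by (rule integrable_real_indicator) (use \<Omega>m in \<open>simp_all only: fmeasurable_def mem_Collect_eq infinity_ennreal_def\<close>)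
  have "(LINT x|lebesgue. - (l - \<kappa>) / 2 * (u x)^2 - c * indicator \<Omega> x) <= (LINT x|lebesgue. B (u x) - lam / 2 * (u x)^2)"
  proof (rule integral_mono_AE)
   show "integrable lebesgue (%x. - (l - \<kappa>) / 2 * (u x)^2 - c * indicator \<Omega> x)"
    by (intro Bochner_Integration.integrable_diff integrable_mult_right iu i\<Omega>)
   show "integrable lebesgue (%x. B (u x) - lam / 2 * (u x)^2)" by (intro Bochner_Integration.integrable_diff integrable_mult_right iu i)
   show "AE x in lebesgue. - (l - \<kappa>) / 2 * (u x)^2 - c * indicator \<Omega> x <= B (u x) - lam / 2 * (u x)^2"
    using X0_out[OF \<sigma> u]
   proof eventually_elim
    case (elim x)
    show ?case
    proof (cases "x \<in> \<Omega>")
     case True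
     thus ?thesis using c(2)[of "u x"] ghat_eq[of "u x"] unfolding l_def by simp
    qed (use elim in \<open>simp add: B_0\<close>)
   qed
  qed
  also have "(LINT x|lebesgue. - (l - \<kappa>) / 2 * (u x)^2 - c * indicator \<Omega> x) = - (l - \<kappa>) / 2 * (norm (mk u))^2 - c * measure lebesgue \<Omega>"
   using iu i\<Omega> by (simp add: Bochner_Integration.integral_diff norm_mk_square[OF X0_sq[OF \<sigma> u]])
  also have "(LINT x|lebesgue. B (u x) - lam / 2 * (u x)^2) = (LINT x|lebesgue. B (u x)) - lam / 2 * (norm (mk u))^2"
   using iu i by (simp add: Bochner_Integration.integral_diff norm_mk_square[OF X0_sq[OF \<sigma> u]])
  finally have 1: "(norm (emb \<sigma> u))^2 / 2 - (l - \<kappa>) / 2 * (norm (mk u))^2 - c * measure lebesgue \<Omega> <= E0 u"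
   unfolding E0_def by (simp add: algebra_simps diff_divide_distrib)
  have 2: "(1 - t) * (l * (norm (mk u))^2) <= (1 - t) * (norm (emb \<sigma> u))^2"
   using eigen_lower[OF u] t unfolding l_def by (intro mult_left_mono) auto
  have 3: "(t * l) * (norm (mk u))^2 <= \<kappa> * (norm (mk u))^2" using t(3) by (intro mult_right_mono) auto
  have "t * (norm (emb \<sigma> u))^2 <= (norm (emb \<sigma> u))^2 - (l - \<kappa>) * (norm (mk u))^2"
   using 2 3 by (simp add: algebra_simps)
  moreover have "(l - \<kappa>) / 2 * (norm (mk u))^2 = ((l - \<kappa>) * (norm (mk u))^2) / 2"
   "t / 2 * (norm (emb \<sigma> u))^2 = (t * (norm (emb \<sigma> u))^2) / 2" by simp_all
  ultimately show "t / 2 * (norm (emb \<sigma> u))^2 - c * measure lebesgue \<Omega> <= E0 u" using 1 by linarith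
 qed
qed

end

lemma norm_square_convex_comb:
 fixes x y :: "'h::real_inner"
 shows "(norm ((1 - \<theta>) *\<^sub>R x + \<theta> *\<^sub>R y))^2 = (1 - \<theta>) * (norm x)^2 + \<theta> * (norm y)^2 - \<theta> * (1 - \<theta>) * (norm (x - y))^2"
proof -
 have e: "(1 - \<theta>) *\<^sub>R x + \<theta> *\<^sub>R y = x + \<theta> *\<^sub>R (y - x)" by (simp add: algebra_simps)
 have n: "(norm (y - x))^2 = (norm y)^2 - 2 * (x \<bullet> y) + (norm x)^2" "norm (x - y) = norm (y - x)"
  unfolding power2_norm_eq_inner by (simp_all add: inner_diff_left inner_diff_right inner_commute norm_minus_commute)
 show ?thesis unfolding e norm_add_scaleR_square n(2) n(1)
  by (simp add: inner_diff_right power2_norm_eq_inner algebra_simps power2_eq_square[of \<theta>])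
qed

section \<open>The energy in terms of Riesz representatives\<close>

context cahn_hilliard
begin

definition V0 where "V0 = emb s ` X0 \<Omega> s"

text \<open>\<open>U\<close> is the element of the isometric copy \<open>V0\<close> of
  \<open>X0 \<Omega> s\<close> that represents the functional given by \<open>u\<close> through the
  L2 product; its norm is the dual norm of \<open>u\<close>. It is a relation because
  \<open>u\<close> is a function, determined by \<open>U\<close> only almost everywhere.\<close>

definition rep :: "('a => real) => ('a \<times> 'a) l2 => bool" where
 "rep u U \<longleftrightarrow> u \<in> X0 \<Omega> \<sigma> & U \<in> V0 & (\<forall>\<phi>\<in>X0 \<Omega> s. U \<bullet> emb s \<phi> = mk u \<bullet> mk \<phi>)"

definition DD where "DD = {U. EX u. rep u U & integrable lebesgue (%x. B (u x))}"
text \<open>The choice is harmless: functions with the same representative agree almost everywhere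
  and have the same \<open>E0\<close>.\<close>

definition Phi where "Phi U = E0 (SOME u. rep u U)"

lemma V0: "subspace V0" "closed V0"
 unfolding V0_def by (rule X0_complete[OF s \<Omega>(2)])+

lemma Riesz_dual: "\<exists>U\<in>V0. \<forall>\<phi>\<in>X0 \<Omega> s. U \<bullet> emb s \<phi> = f \<bullet> mk \<phi>"
proof -
 obtain K where K: "K > 0" "!!v. v \<in> X0 \<Omega> s ==> norm (mk v) <= K * norm (emb s v)"
  using X0_Poincare[OF s \<Omega>(2)] by blast
 \<comment> \<open>Equal images under \<open>emb\<close> have equal L2 classes by the Poincare
   inequality; hence the functional defined on \<open>V0\<close> through the choice
   \<open>pre\<close> is linear.\<close>
 have inj: "mk \<phi> = mk \<psi>" if "\<phi> \<in> X0 \<Omega> s" "\<psi> \<in> X0 \<Omega> s" "emb s \<phi> = emb s \<psi>" for \<phi> \<psi>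
  using K(2)[OF X0_diff(1)[OF s that(1,2)]] that by (simp add: X0_diff[OF s that(1,2)])
 define pre where "pre F = (SOME \<phi>. \<phi> \<in> X0 \<Omega> s & emb s \<phi> = F)" for F
 have pre: "pre F \<in> X0 \<Omega> s" "emb s (pre F) = F" if "F \<in> V0" for F
  using someI_ex[of "%\<phi>. \<phi> \<in> X0 \<Omega> s & emb s \<phi> = F"] that unfolding pre_def V0_def by blast+
 obtain U where U: "U \<in> V0" "!!F. F \<in> V0 ==> f \<bullet> mk (pre F) = U \<bullet> F"
 proof (rule Riesz_representation_subspace[OF V0, of "%F. f \<bullet> mk (pre F)" "norm f * K"])
  fix F G b c assume F: "F \<in> V0" and G: "G \<in> V0"
  have "b *\<^sub>R F + c *\<^sub>R G \<in> V0" using F G V0(1) by (simp add: subspace_add subspace_mul)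
  note p = pre[OF this]
  note l = X0_linear[OF s pre(1)[OF F] pre(1)[OF G], of b c]
  have "mk (pre (b *\<^sub>R F + c *\<^sub>R G)) = mk (%x. b * pre F x + c * pre G x)"
   by (rule inj[OF p(1) l(1)]) (simp add: p(2) l(2) pre F G)
  thus "f \<bullet> mk (pre (b *\<^sub>R F + c *\<^sub>R G)) = b * (f \<bullet> mk (pre F)) + c * (f \<bullet> mk (pre G))"
   by (simp add: l(3) inner_add_right)
 next
  fix F assume F: "F \<in> V0"
  have "\<bar>f \<bullet> mk (pre F)\<bar> <= norm f * norm (mk (pre F))" by (rule Cauchy_Schwarz_ineq2)
  also have "... <= norm f * (K * norm F)" using K(2)[OF pre(1)[OF F]] pre(2)[OF F] by (intro mult_left_mono) auto
  finally show "\<bar>f \<bullet> mk (pre F)\<bar> <= norm f * K * norm F" by (simp add: mult.assoc)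
 qed blast
 have "U \<bullet> emb s \<phi> = f \<bullet> mk \<phi>" if \<phi>: "\<phi> \<in> X0 \<Omega> s" for \<phi>
 proof -
  have v: "emb s \<phi> \<in> V0" using \<phi> by (simp add: V0_def)
  have "mk (pre (emb s \<phi>)) = mk \<phi>" by (rule inj) (use pre[OF v] \<phi> in auto)
  thus ?thesis using U(2)[OF v] by simp
 qed
 thus ?thesis using U(1) by blast
qed

lemma rep_exists: "u \<in> X0 \<Omega> \<sigma> ==> EX U. rep u U"
 using Riesz_dual[of "mk u"] unfolding rep_def by blast

lemma rep_X0: "rep u U ==> u \<in> X0 \<Omega> \<sigma>" by (simp add: rep_def)

lemma rep_inner: "rep u U ==> \<phi> \<in> X0 \<Omega> s ==> U \<bullet> emb s \<phi> = mk u \<bullet> mk \<phi>" by (simp add: rep_def)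

lemma rep_linear: "rep u U ==> rep v V ==> rep (%x. b * u x + c * v x) (b *\<^sub>R U + c *\<^sub>R V)"
 unfolding rep_def using X0_linear[OF \<sigma>, of u \<Omega> v b c] V0(1)
 by (auto simp: inner_add_left subspace_add subspace_mul)

lemma rep_diff: "rep u U ==> rep v V ==> rep (%x. u x - v x) (U - V)"
 using rep_linear[of u U v V 1 "-1"] by simp

lemma rep_zero_AE:
 assumes "rep u 0"
 shows "AE x in lebesgue. u x = 0"
proof (rule orthogonal_X0_imp_zero[OF \<Omega> X0_sq[OF \<sigma> rep_X0[OF assms]] X0_out[OF \<sigma> rep_X0[OF assms]]])
 fix \<phi> :: "'a => real" assume "!!a. 0 < a ==> a < 1 ==> \<phi> \<in> X0 \<Omega> a"
 thus "mk u \<bullet> mk \<phi> = 0" using rep_inner[OF assms, of \<phi>] s by simp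
qed

lemma rep_unique: "rep u U ==> rep v U ==> AE x in lebesgue. u x = v x"
 using rep_zero_AE[of "%x. u x - v x"] rep_diff[of u U v U] by simp

lemma rep_cong:
 assumes "rep u U" "v \<in> borel_measurable lebesgue" "AE x in lebesgue. u x = v x"
 shows "rep v U"
proof -
 have v: "v \<in> X0 \<Omega> \<sigma>" by (rule X0_cong_AE(1)[OF \<sigma> rep_X0[OF assms(1)] assms(2,3)])
 have "mk v = mk u" by (rule mk_cong[OF X0_sq[OF \<sigma> rep_X0[OF assms(1)]] X0_sq[OF \<sigma> v] assms(3), symmetric])
 thus ?thesis using assms(1) v by (simp add: rep_def)
qed

lemma rep_functional: "rep u U ==> rep u U' ==> U = U'"
proof -
 assume "rep u U" "rep u U'"
 hence d: "U - U' \<in> V0" "!!\<phi>. \<phi> \<in> X0 \<Omega> s ==> (U - U') \<bullet> emb s \<phi> = 0"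
  using V0(1) by (auto simp: rep_def inner_diff_left subspace_diff)
 hence "(U - U') \<bullet> (U - U') = 0" unfolding V0_def by force
 thus ?thesis by simp
qed

lemma AE_eq_transfer:
 assumes u: "u \<in> X0 \<Omega> \<sigma>" and v: "v \<in> X0 \<Omega> \<sigma>" and e: "AE x in lebesgue. u x = v x"
 shows "mk u = mk v" "emb \<sigma> u = emb \<sigma> v" "E0 u = E0 v"
  "integrable lebesgue (%x. B (u x)) \<longleftrightarrow> integrable lebesgue (%x. B (v x))"
proof -
 show 1: "mk u = mk v" by (rule mk_cong[OF X0_sq[OF \<sigma> u] X0_sq[OF \<sigma> v] e])
 show 2: "emb \<sigma> u = emb \<sigma> v" by (rule X0_cong_AE(2)[OF \<sigma> u sq_meas[OF X0_sq[OF \<sigma> v]] e, symmetric])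
 have eB: "AE x in lebesgue. B (u x) = B (v x)" using e by eventually_elim simp
 have "(LINT x|lebesgue. B (u x)) = (LINT x|lebesgue. B (v x))"
  by (rule integral_cong_AE[OF B_out(1)[OF u] B_out(1)[OF v] eB])
 thus "E0 u = E0 v" unfolding E0_def 1 2 by simp
 show "integrable lebesgue (%x. B (u x)) \<longleftrightarrow> integrable lebesgue (%x. B (v x))"
  by (rule integrable_cong_AE[OF B_out(1)[OF u] B_out(1)[OF v] eB])
qed

lemma Phi_rep: "rep u U ==> Phi U = E0 u"
proof -
 assume r: "rep u U"
 have "rep (SOME u. rep u U) U" by (rule someI[of "%u. rep u U", OF r])
 thus ?thesis unfolding Phi_def using AE_eq_transfer(3) rep_unique[of _ U u] r rep_X0 by blast
qed

lemma DD_rep: "rep u U ==> U \<in> DD \<longleftrightarrow> integrable lebesgue (%x. B (u x))"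
 unfolding DD_def using AE_eq_transfer(4) rep_unique[of _ U u] rep_X0 by blast

text \<open>The Ehrling inequality with parameter \<open>1 / (2 * (lam + 1))\<close> pays for the
  concave term with half of the Dirichlet part of the energy; the other half, with coefficient 1/4,
  stays available as strong convexity.\<close>

lemma CC_ex: "\<exists>C\<ge>0. ALL v U. rep v U --> lam / 2 * (norm (mk v))^2 <= 1/4 * (norm (emb \<sigma> v))^2 + C / 2 * (norm U)^2"
proof -
 define e where "e = 1 / (2 * (lam + 1))"
 have e: "e > 0" using lam by (simp add: e_def)
 obtain C where C: "C >= 0" "!!v U. v \<in> X0 \<Omega> \<sigma> ==> (!!\<phi>. \<phi> \<in> X0 \<Omega> s ==> U \<bullet> emb s \<phi> = mk v \<bullet> mk \<phi>) ==>
    (norm (mk v))^2 <= e * (norm (emb \<sigma> v))^2 + C * (norm U)^2"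
  using Ehrling[OF s \<sigma> \<Omega> e] by blast
 have "lam / 2 * (norm (mk v))^2 <= 1/4 * (norm (emb \<sigma> v))^2 + (lam * C) / 2 * (norm U)^2" if r: "rep v U" for v U
 proof -
  have "lam / 2 * (norm (mk v))^2 <= lam / 2 * (e * (norm (emb \<sigma> v))^2 + C * (norm U)^2)"
   using C(2)[OF rep_X0[OF r], of U] rep_inner[OF r] lam by (intro mult_left_mono) auto
  also have "... = (lam / 2 * e) * (norm (emb \<sigma> v))^2 + (lam * C) / 2 * (norm U)^2" by (simp add: algebra_simps)
  also have "(lam / 2 * e) * (norm (emb \<sigma> v))^2 <= 1/4 * (norm (emb \<sigma> v))^2"
   using lam by (intro mult_right_mono) (auto simp: e_def field_simps)
  finally show ?thesis by simp
 qed
 thus ?thesis using C(1) lam by (intro exI[of _ "lam * C"]) auto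
qed

definition CC where "CC = (SOME C. C >= 0 & (ALL v U. rep v U --> lam / 2 * (norm (mk v))^2 <= 1/4 * (norm (emb \<sigma> v))^2 + C / 2 * (norm U)^2))"

lemma CC: "CC >= 0" "rep v U ==> lam / 2 * (norm (mk v))^2 <= 1/4 * (norm (emb \<sigma> v))^2 + CC / 2 * (norm U)^2"
 using someI_ex[of "%C. C >= 0 & (ALL v U. rep v U --> lam / 2 * (norm (mk v))^2 <= 1/4 * (norm (emb \<sigma> v))^2 + C / 2 * (norm U)^2)"] CC_ex
 unfolding CC_def by blast+

text \<open>Squared norms of convex combinations produce \<open>- \<theta> * (1 - \<theta>)\<close>
  times squared distances; the L2 distance comes with the wrong sign and is repaired by
  \<open>CC\<close>. The surplus in the last term goes beyond semiconvexity in the dual norm: it is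
  kept to prove strong continuity in \<open>X0 \<Omega> \<sigma>\<close>.\<close>

lemma strong_semiconvexity:
 assumes u: "rep u U" "integrable lebesgue (%x. B (u x))" and v: "rep v V" "integrable lebesgue (%x. B (v x))"
  and th: "0 <= \<theta>" "\<theta> <= 1"
 shows "rep (%x. (1 - \<theta>) * u x + \<theta> * v x) ((1 - \<theta>) *\<^sub>R U + \<theta> *\<^sub>R V)"
  "integrable lebesgue (%x. B ((1 - \<theta>) * u x + \<theta> * v x))"
  "E0 (%x. (1 - \<theta>) * u x + \<theta> * v x) <= (1 - \<theta>) * E0 u + \<theta> * E0 v + CC / 2 * \<theta> * (1 - \<theta>) * (norm (U - V))^2
    - 1/4 * \<theta> * (1 - \<theta>) * (norm (emb \<sigma> u - emb \<sigma> v))^2"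
proof -
 define z where "z = (%x. (1 - \<theta>) * u x + \<theta> * v x)"
 show r: "rep (%x. (1 - \<theta>) * u x + \<theta> * v x) ((1 - \<theta>) *\<^sub>R U + \<theta> *\<^sub>R V)" by (rule rep_linear[OF u(1) v(1)])
 have ib: "integrable lebesgue (%x. (1 - \<theta>) * B (u x) + \<theta> * B (v x))"
  by (intro Bochner_Integration.integrable_add integrable_mult_right u v)
 show iz: "integrable lebesgue (%x. B ((1 - \<theta>) * u x + \<theta> * v x))"
 proof (rule Bochner_Integration.integrable_bound[OF ib B_out(1)[OF rep_X0[OF r]]], rule AE_I2)
  fix x
  show "norm (B ((1 - \<theta>) * u x + \<theta> * v x)) <= norm ((1 - \<theta>) * B (u x) + \<theta> * B (v x))"
   using B_convex[OF th, of "u x" "v x"] B_nonneg[of "(1 - \<theta>) * u x + \<theta> * v x"] by simp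
 qed
 have "(LINT x|lebesgue. B ((1 - \<theta>) * u x + \<theta> * v x)) <= (LINT x|lebesgue. (1 - \<theta>) * B (u x) + \<theta> * B (v x))"
  by (rule integral_mono[OF iz ib]) (rule B_convex[OF th])
 also have "... = (1 - \<theta>) * (LINT x|lebesgue. B (u x)) + \<theta> * (LINT x|lebesgue. B (v x))"
  using u v by simp
 finally have 1: "(LINT x|lebesgue. B ((1 - \<theta>) * u x + \<theta> * v x)) <= (1 - \<theta>) * (LINT x|lebesgue. B (u x)) + \<theta> * (LINT x|lebesgue. B (v x))" .
 note lin = X0_linear[OF \<sigma> rep_X0[OF u(1)] rep_X0[OF v(1)], of "1 - \<theta>" \<theta>]
 note dif = X0_diff[OF \<sigma> rep_X0[OF u(1)] rep_X0[OF v(1)]]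
 have "lam / 2 * (norm (mk u - mk v))^2 <= 1/4 * (norm (emb \<sigma> u - emb \<sigma> v))^2 + CC / 2 * (norm (U - V))^2"
  using CC(2)[OF rep_diff[OF u(1) v(1)]] by (simp add: dif)
 hence "(\<theta> * (1 - \<theta>)) * (lam / 2 * (norm (mk u - mk v))^2) <= (\<theta> * (1 - \<theta>)) * (1/4 * (norm (emb \<sigma> u - emb \<sigma> v))^2 + CC / 2 * (norm (U - V))^2)"
  using th by (intro mult_left_mono) auto
 hence 2: "lam / 2 * (\<theta> * (1 - \<theta>) * (norm (mk u - mk v))^2) <= 1/4 * \<theta> * (1 - \<theta>) * (norm (emb \<sigma> u - emb \<sigma> v))^2 + CC / 2 * \<theta> * (1 - \<theta>) * (norm (U - V))^2"
  by (simp add: algebra_simps)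
 have aux: "a + I - (x - y) <= a + I' - x + r" if "I <= I'" "y <= r" for a I I' x y r :: real using that by linarith
 have "E0 (%x. (1 - \<theta>) * u x + \<theta> * v x) = ((1 - \<theta>) * (norm (emb \<sigma> u))^2 + \<theta> * (norm (emb \<sigma> v))^2 - \<theta> * (1 - \<theta>) * (norm (emb \<sigma> u - emb \<sigma> v))^2) / 2
   + (LINT x|lebesgue. B ((1 - \<theta>) * u x + \<theta> * v x))
   - lam / 2 * ((1 - \<theta>) * (norm (mk u))^2 + \<theta> * (norm (mk v))^2 - \<theta> * (1 - \<theta>) * (norm (mk u - mk v))^2)"
  unfolding E0_def lin norm_square_convex_comb by simp
 also have "... <= ((1 - \<theta>) * (norm (emb \<sigma> u))^2 + \<theta> * (norm (emb \<sigma> v))^2 - \<theta> * (1 - \<theta>) * (norm (emb \<sigma> u - emb \<sigma> v))^2) / 2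
   + ((1 - \<theta>) * (LINT x|lebesgue. B (u x)) + \<theta> * (LINT x|lebesgue. B (v x)))
   - lam / 2 * ((1 - \<theta>) * (norm (mk u))^2 + \<theta> * (norm (mk v))^2) + (1/4 * \<theta> * (1 - \<theta>) * (norm (emb \<sigma> u - emb \<sigma> v))^2 + CC / 2 * \<theta> * (1 - \<theta>) * (norm (U - V))^2)"
  unfolding right_diff_distrib[of "lam / 2" _ "\<theta> * (1 - \<theta>) * (norm (mk u - mk v))^2"] by (rule aux[OF 1 2])
 also have "... = (1 - \<theta>) * E0 u + \<theta> * E0 v + CC / 2 * \<theta> * (1 - \<theta>) * (norm (U - V))^2
    - 1/4 * \<theta> * (1 - \<theta>) * (norm (emb \<sigma> u - emb \<sigma> v))^2"
  unfolding E0_def by (simp add: field_simps)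
 finally show "E0 (%x. (1 - \<theta>) * u x + \<theta> * v x) <= (1 - \<theta>) * E0 u + \<theta> * E0 v + CC / 2 * \<theta> * (1 - \<theta>) * (norm (U - V))^2
    - 1/4 * \<theta> * (1 - \<theta>) * (norm (emb \<sigma> u - emb \<sigma> v))^2" .
qed

lemma Phi_lower_ex: "EX m. \<forall>U\<in>DD. m <= Phi U"
proof -
 obtain t c where tc: "t > 0" "c >= 0" "!!u. u \<in> X0 \<Omega> \<sigma> ==> integrable lebesgue (%x. B (u x)) ==> t * (norm (emb \<sigma> u))^2 - c <= E0 u"
  using E0_coercive by blast
 have "- c <= Phi U" if UD: "U \<in> DD" for U
 proof -
  obtain u where u: "rep u U" "integrable lebesgue (%x. B (u x))" using UD unfolding DD_def by blast
  have "0 <= t * (norm (emb \<sigma> u))^2" using tc(1) by simp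
  thus ?thesis using tc(3)[OF rep_X0[OF u(1)] u(2)] Phi_rep[OF u(1)] by linarith
 qed
 thus ?thesis by blast
qed

definition mm where "mm = (SOME m. \<forall>U\<in>DD. m <= Phi U)"

lemma mm: "U \<in> DD ==> mm <= Phi U"
 using someI_ex[OF Phi_lower_ex] unfolding mm_def by blast

text \<open>The compactness step: applied to differences, the Ehrling inequality turns dual
  convergence together with a bound in \<open>X0 \<Omega> \<sigma>\<close> into convergence of the
  L2 classes.\<close>

lemma bounded_rep_Cauchy:
 assumes r: "!!n::nat. rep (u n) (U n)" and b: "!!n. norm (emb \<sigma> (u n)) <= M" and U: "U ----> L"
 obtains v where "rep v L" "(%n. mk (u n)) ----> mk v"
proof -
 have M: "M >= 0" using b norm_ge_zero order_trans by blast
 have "Cauchy (%n. mk (u n))"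
 proof (rule metric_CauchyI)
  fix e :: real assume e: "e > 0"
  \<comment> \<open>Each term of the Ehrling inequality gets half of \<open>e^2\<close>: \<epsilon>
    handles the bound \<open>2 * M\<close> on the differences, \<open>d\<close> the dual
    distances.\<close>
  define \<epsilon> where "\<epsilon> = e^2 / (8 * (M^2 + 1))"
  have "M^2 + 1 > 0" by (simp add: add_nonneg_pos)
  hence \<epsilon>: "\<epsilon> > 0" "\<epsilon> * (4 * M^2) <= e^2 / 2"
   using e by (auto simp: \<epsilon>_def field_simps)
  obtain C where C: "C >= 0" "!!v U. v \<in> X0 \<Omega> \<sigma> ==> (!!\<phi>. \<phi> \<in> X0 \<Omega> s ==> U \<bullet> emb s \<phi> = mk v \<bullet> mk \<phi>) ==>
    (norm (mk v))^2 <= \<epsilon> * (norm (emb \<sigma> v))^2 + C * (norm U)^2"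
   using Ehrling[OF s \<sigma> \<Omega> \<epsilon>(1)] by blast
  define d where "d = e / (2 * sqrt (C + 1))"
  have d: "d > 0" "C * d^2 < e^2 / 2"
  proof -
   show "d > 0" using e C by (simp add: d_def)
   have "d^2 = e^2 / (4 * (C + 1))" using C by (simp add: d_def power_divide power_mult_distrib)
   hence "C * d^2 = e^2 / 4 * (C / (C + 1))" by simp
   also have "... <= e^2 / 4 * 1" using C by (intro mult_left_mono) auto
   also have "... < e^2 / 2" using e by simp
   finally show "C * d^2 < e^2 / 2" .
  qed
  obtain N where N: "!!m n. m >= N ==> n >= N ==> dist (U m) (U n) < d"
   using metric_CauchyD[OF LIMSEQ_imp_Cauchy[OF U] d(1)] by blast
  have "dist (mk (u m)) (mk (u n)) < e" if mn: "m >= N" "n >= N" for m n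
  proof -
   note rd = rep_diff[OF r[of m] r[of n]]
   note dif = X0_diff[OF \<sigma> rep_X0[OF r[of m]] rep_X0[OF r[of n]]]
   have "(norm (mk (u m) - mk (u n)))^2 <= \<epsilon> * (norm (emb \<sigma> (u m) - emb \<sigma> (u n)))^2 + C * (norm (U m - U n))^2"
    using C(2)[OF rep_X0[OF rd] rep_inner[OF rd]] unfolding dif by simp
   also have "\<epsilon> * (norm (emb \<sigma> (u m) - emb \<sigma> (u n)))^2 <= \<epsilon> * (4 * M^2)"
   proof (intro mult_left_mono)
    have "norm (emb \<sigma> (u m) - emb \<sigma> (u n)) <= 2 * M"
     using norm_triangle_ineq4[of "emb \<sigma> (u m)" "emb \<sigma> (u n)"] b[of m] b[of n] by linarith
    hence "(norm (emb \<sigma> (u m) - emb \<sigma> (u n)))^2 <= (2 * M)^2" by (intro power_mono) auto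
    thus "(norm (emb \<sigma> (u m) - emb \<sigma> (u n)))^2 <= 4 * M^2" by (simp add: power_mult_distrib)
   qed (use \<epsilon> in simp)
   also have "C * (norm (U m - U n))^2 <= C * d^2"
    using N[OF mn] C(1) by (intro mult_left_mono power_mono) (auto simp: dist_norm)
   finally have "(norm (mk (u m) - mk (u n)))^2 < e^2" using \<epsilon>(2) d(2) by simp
   thus ?thesis unfolding dist_norm by (rule power2_less_imp_less) (use e in simp)
  qed
  thus "EX N. \<forall>m\<ge>N. \<forall>n\<ge>N. dist (mk (u m)) (mk (u n)) < e" by blast
 qed
 then obtain G where G: "(%n. mk (u n)) ----> G" using Cauchy_convergent convergent_def by blast
 obtain v where v: "v \<in> sq" "G = mk v" by (rule mk_cases)
 have vX: "v \<in> X0 \<Omega> \<sigma>"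
  by (rule X0_liminf(1)[OF \<sigma> rep_X0[OF r] v(1) G[unfolded v(2)], of "%_. M^2" "M^2"]) (auto intro: power_mono b)
 have "L \<in> V0" using closed_sequentially[OF V0(2) _ U] r by (auto simp: rep_def)
 moreover have "L \<bullet> emb s \<phi> = mk v \<bullet> mk \<phi>" if \<phi>: "\<phi> \<in> X0 \<Omega> s" for \<phi>
 proof (rule LIMSEQ_unique)
  show "(%n. U n \<bullet> emb s \<phi>) ----> L \<bullet> emb s \<phi>" by (intro tendsto_intros U)
  show "(%n. U n \<bullet> emb s \<phi>) ----> mk v \<bullet> mk \<phi>" unfolding rep_inner[OF r \<phi>] by (intro tendsto_intros G[unfolded v(2)])
 qed
 ultimately have "rep v L" using vX by (simp add: rep_def)
 thus thesis using that G v(2) by blast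
qed

text \<open>The Dirichlet term and the convex integral are lower semicontinuous by Fatou's lemma.
  The concave quadratic is not, but it converges, because coercivity bounds the sequence and dual
  convergence then becomes L2 convergence.\<close>

lemma DD_closed:
 assumes X: "!!n::nat. X n \<in> DD" and l: "X ----> l" and c: "!!n. Phi (X n) <= c"
 shows "l \<in> DD & Phi l <= c"
proof -
 obtain t c0 where tc: "t > 0" "c0 >= 0" "!!u. u \<in> X0 \<Omega> \<sigma> ==> integrable lebesgue (%x. B (u x)) ==> t * (norm (emb \<sigma> u))^2 - c0 <= E0 u"
  using E0_coercive by blast
 have "ALL n. EX u. rep u (X n) & integrable lebesgue (%x. B (u x))" using X unfolding DD_def by blast
 then obtain u where u: "!!n. rep (u n) (X n)" "!!n. integrable lebesgue (%x. B (u n x))" by metis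
 have uX: "u n \<in> X0 \<Omega> \<sigma>" for n by (rule rep_X0[OF u(1)])
 have E: "E0 (u n) <= c" for n using c[of n] Phi_rep[OF u(1)[of n]] by simp
 define M where "M = sqrt ((c + c0) / t)"
 have b2: "(norm (emb \<sigma> (u n)))^2 <= (c + c0) / t" for n
  using tc(3)[OF uX u(2), of n] E[of n] tc(1) by (simp add: pos_le_divide_eq mult.commute)
 hence b: "norm (emb \<sigma> (u n)) <= M" for n unfolding M_def by (rule real_le_rsqrt)
 obtain v where v: "rep v l" "(%n. mk (u n)) ----> mk v" using bounded_rep_Cauchy[OF u(1) b l] by blast
 have vs: "v \<in> sq" by (rule X0_sq[OF \<sigma> rep_X0[OF v(1)]])
 \<comment> \<open>Fixing a limit \<alpha> of the squared norms along a subsequence lets Fatou's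
   lemma be applied to the convex integral alone: its upper bounds then converge, to
   \<gamma>.\<close>
 have "bounded (range (%n. (norm (emb \<sigma> (u n)))^2))"
  using b2 by (intro boundedI[of _ "(c + c0) / t"]) auto
 then obtain \<alpha> r where r: "strict_mono (r :: nat => nat)" "((%n. (norm (emb \<sigma> (u n)))^2) \<circ> r) ----> \<alpha>"
  using bounded_imp_convergent_subsequence by blast
 have "(%n. mk (u (r n))) ----> mk v" using LIMSEQ_subseq_LIMSEQ[OF v(2) r(1)] by (simp add: o_def)
 then obtain q :: "nat => nat" where q: "strict_mono q" "AE x in lebesgue. (%n. u (r (q n)) x) ----> v x"
  using l2_AE_subsequence[of "%n. u (r n)" v] X0_sq[OF \<sigma> uX] vs by blast
 define w where "w n = u (r (q n))" for n
 have wX: "w n \<in> X0 \<Omega> \<sigma>" for n by (simp add: w_def uX)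
 have a: "(%n. (norm (emb \<sigma> (w n)))^2) ----> \<alpha>"
  using LIMSEQ_subseq_LIMSEQ[OF r(2) q(1)] by (simp add: o_def w_def)
 have m: "(%n. mk (w n)) ----> mk v"
  using LIMSEQ_subseq_LIMSEQ[OF \<open>(%n. mk (u (r n))) ----> mk v\<close> q(1)] by (simp add: o_def w_def)
 have ae: "AE x in lebesgue. (%n. w n x) ----> v x" using q(2) by (simp add: w_def)
 have e2: "(norm (emb \<sigma> v))^2 <= \<alpha>"
  by (rule X0_liminf_AE(2)[OF \<sigma> wX vs ae order_refl a])
 define \<gamma> where "\<gamma> = c + lam / 2 * (norm (mk v))^2 - \<alpha> / 2"
 have Bw: "(LINT x|lebesgue. B (w n x)) <= c + lam / 2 * (norm (mk (w n)))^2 - (norm (emb \<sigma> (w n)))^2 / 2" for n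
  using E[of "r (q n)"] unfolding E0_def w_def by linarith
 have Blim: "(%n. c + lam / 2 * (norm (mk (w n)))^2 - (norm (emb \<sigma> (w n)))^2 / 2) ----> \<gamma>"
  unfolding \<gamma>_def by (intro tendsto_intros m a) auto
 \<comment> \<open>\<open>sq_liminf\<close> concerns squares, hence the root of the nonnegative
   \<open>B\<close>.\<close>
 have sB: "(%x. sqrt (B (w n x))) \<in> sq" for n
 proof (rule sqI)
  show "(%x. sqrt (B (w n x))) \<in> borel_measurable lebesgue" using B_out(1)[OF wX] by simp
  show "integrable lebesgue (%x. (sqrt (B (w n x)))^2)" using u(2)[of "r (q n)"] B_nonneg by (simp add: w_def)
 qed
 have nB: "(norm (mk (%x. sqrt (B (w n x)))))^2 = (LINT x|lebesgue. B (w n x))" for n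
  unfolding norm_mk_square[OF sB] using B_nonneg by simp
 have aeB: "AE x in lebesgue. (%n. sqrt (B (w n x))) ----> sqrt (B (v x))"
  using ae
 proof eventually_elim
  case (elim x)
  have "isCont B (v x)" using B_deriv DERIV_isCont by blast
  hence "(%n. B (w n x)) ----> B (v x)" using elim by (rule isCont_tendsto_compose)
  thus ?case by (rule tendsto_real_sqrt)
 qed
 have mv: "(%x. sqrt (B (v x))) \<in> borel_measurable lebesgue" using B_out(1)[OF rep_X0[OF v(1)]] by simp
 note F = sq_liminf[of "%n x. sqrt (B (w n x))", OF sB _ Blim aeB mv, unfolded nB, OF Bw]
 have iv: "integrable lebesgue (%x. B (v x))" using sq_int[OF F(1)] B_nonneg by simp
 have "(LINT x|lebesgue. B (v x)) <= \<gamma>" using F(2) unfolding norm_mk_square[OF F(1)] using B_nonneg by simp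
 hence "E0 v <= c" using e2 unfolding E0_def \<gamma>_def by linarith
 thus ?thesis using DD_rep[OF v(1)] iv Phi_rep[OF v(1)] by simp
qed

end

section \<open>Subgradients and the Euler equation\<close>

context cahn_hilliard
begin

abbreviation "subgrad \<equiv> subgradient V0 DD Phi CC"

lemma subgrad_rep: "subgrad U W ==> EX u. rep u U & integrable lebesgue (%x. B (u x))"
 unfolding subgradient_def DD_def by blast

lemma subgrad_emb: "subgrad U W ==> EX w. w \<in> X0 \<Omega> s & W = emb s w"
 unfolding subgradient_def V0_def by blast

text \<open>The subgradient inequality in direction \<psi>, with the quadratic terms collected in
  \<open>K\<close>; the L2 square is dropped by its sign. The step \<open>h\<close> may be negative,
  so that equations can be obtained from it.\<close>

lemma subgrad_variation:
 assumes sg: "subgrad U (emb s w)" and w: "w \<in> X0 \<Omega> s" and u: "rep u U" and \<psi>: "\<psi> \<in> X0 \<Omega> \<sigma>"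
 shows "EX K. ALL h. integrable lebesgue (%x. B (u x + h * \<psi> x)) -->
  h * ((mk w + lam *\<^sub>R mk u) \<bullet> mk \<psi> - emb \<sigma> u \<bullet> emb \<sigma> \<psi>) - h^2 * K
   <= (LINT x|lebesgue. B (u x + h * \<psi> x)) - (LINT x|lebesgue. B (u x))"
proof -
 obtain \<Psi> where \<Psi>: "rep \<psi> \<Psi>" using rep_exists[OF \<psi>] by blast
 define K where "K = CC / 2 * (norm \<Psi>)^2 + (norm (emb \<sigma> \<psi>))^2 / 2"
 have "h * ((mk w + lam *\<^sub>R mk u) \<bullet> mk \<psi> - emb \<sigma> u \<bullet> emb \<sigma> \<psi>) - h^2 * K
   <= (LINT x|lebesgue. B (u x + h * \<psi> x)) - (LINT x|lebesgue. B (u x))"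
  if i: "integrable lebesgue (%x. B (u x + h * \<psi> x))" for h
 proof -
  have r: "rep (%x. u x + h * \<psi> x) (U + h *\<^sub>R \<Psi>)" using rep_linear[OF u \<Psi>, of 1 h] by simp
  hence D: "U + h *\<^sub>R \<Psi> \<in> DD" using DD_rep[OF r] i by simp
  have W: "emb s w \<bullet> \<Psi> = mk w \<bullet> mk \<psi>" using rep_inner[OF \<Psi> w] by (simp add: inner_commute)
  have "Phi U + emb s w \<bullet> (U + h *\<^sub>R \<Psi> - U) - CC / 2 * (norm (U + h *\<^sub>R \<Psi> - U))^2 <= Phi (U + h *\<^sub>R \<Psi>)"
   using sg D unfolding subgradient_def by blast
  hence 1: "E0 u + h * (mk w \<bullet> mk \<psi>) - h^2 * (CC / 2 * (norm \<Psi>)^2) <= E0 (%x. u x + h * \<psi> x)"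
   unfolding Phi_rep[OF u] Phi_rep[OF r] by (simp add: W power_mult_distrib mult.left_commute)
  note lin = X0_linear[OF \<sigma> rep_X0[OF u] \<psi>, of 1 h, simplified]
  have e: "(norm (emb \<sigma> (%x. u x + h * \<psi> x)))^2 = (norm (emb \<sigma> u))^2 + 2 * h * (emb \<sigma> u \<bullet> emb \<sigma> \<psi>) + h^2 * (norm (emb \<sigma> \<psi>))^2"
   unfolding lin norm_add_scaleR_square by simp
  have m: "(norm (mk (%x. u x + h * \<psi> x)))^2 = (norm (mk u))^2 + 2 * h * (mk u \<bullet> mk \<psi>) + h^2 * (norm (mk \<psi>))^2"
   unfolding lin norm_add_scaleR_square by simp
  have p: "0 <= lam * (h^2 * (norm (mk \<psi>))^2)" using lam by simp
  define I J where "I = (LINT x|lebesgue. B (u x + h * \<psi> x))" and "J = (LINT x|lebesgue. B (u x))"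
  have "E0 (%x. u x + h * \<psi> x) - E0 u = h * (emb \<sigma> u \<bullet> emb \<sigma> \<psi>) + h^2 * ((norm (emb \<sigma> \<psi>))^2 / 2) + I - J
    - h * (lam * (mk u \<bullet> mk \<psi>)) - lam * (h^2 * (norm (mk \<psi>))^2) / 2"
   unfolding E0_def e m I_def J_def by (simp add: algebra_simps add_divide_distrib)
  moreover have "h * ((mk w + lam *\<^sub>R mk u) \<bullet> mk \<psi> - emb \<sigma> u \<bullet> emb \<sigma> \<psi>) - h^2 * K
   = h * (mk w \<bullet> mk \<psi>) + h * (lam * (mk u \<bullet> mk \<psi>)) - h * (emb \<sigma> u \<bullet> emb \<sigma> \<psi>) - h^2 * (CC / 2 * (norm \<Psi>)^2) - h^2 * ((norm (emb \<sigma> \<psi>))^2 / 2)"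
   unfolding K_def by (simp only: inner_add_left inner_scaleR_left distrib_left right_diff_distrib)
  ultimately show ?thesis using 1 p unfolding I_def[symmetric] J_def[symmetric] by linarith
 qed
 thus ?thesis by blast
qed

lemma beta_clip_X0:
 assumes u: "u \<in> X0 \<Omega> \<sigma>" and k: "0 <= k"
 shows "(%x. \<beta> (clip k (u x))) \<in> X0 \<Omega> \<sigma>"
proof -
 obtain L where L: "L > 0" "!!x y. \<bar>x\<bar> <= k ==> \<bar>y\<bar> <= k ==> \<bar>\<beta> x - \<beta> y\<bar> <= L * \<bar>x - y\<bar>"
  using \<beta>_lip[OF k] by auto
 have Lc: "\<bar>\<beta> (clip k x) - \<beta> (clip k y)\<bar> <= L * \<bar>x - y\<bar>" for x y
 proof -
  have "\<bar>\<beta> (clip k x) - \<beta> (clip k y)\<bar> <= L * \<bar>clip k x - clip k y\<bar>" by (rule L(2)) (auto intro: clip_simps k)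
  also have "... <= L * \<bar>x - y\<bar>" using L(1) clip_simps(5) by (intro mult_left_mono) auto
  finally show ?thesis .
 qed
 have m: "(%x. \<beta> (clip k (u x))) \<in> borel_measurable lebesgue"
  by (rule comp_meas[of "%r. \<beta> (clip k r)", OF continuous_on_compose2[OF \<beta>_cont clip_cont] sq_meas[OF X0_sq[OF \<sigma> u]]]) auto
 show ?thesis
 proof (rule X0_bound(1)[OF \<sigma> u u, where b=L and c=0])
  show "(%x. \<beta> (clip k (u x))) \<in> sq"
   by (rule sq_bound[OF sq_scale[OF X0_sq[OF \<sigma> u], of L] m])
     (use Lc[of _ 0] L(1) in \<open>auto simp: clip_simps(4)[OF k] \<beta>0 abs_mult\<close>)
  show "AE x in lebesgue. x \<notin> \<Omega> --> \<beta> (clip k (u x)) = 0"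
   using X0_out[OF \<sigma> u] by eventually_elim (simp add: clip_simps(4)[OF k] \<beta>0)
 qed (use Lc L(1) in auto)
qed

text \<open>The bound on differences, uniform in \<open>n\<close>, is a square integrable majorant
  of the difference quotients; so the pairings with \<open>u\<close> converge, although convergence
  of the \<psi> in norm is not claimed.\<close>

lemma dominated_test_limit:
 assumes u: "u \<in> X0 \<Omega> \<sigma>" and \<phi>: "\<phi> \<in> X0 \<Omega> \<sigma>"
  and \<psi>: "!!n::nat. \<psi> n \<in> X0 \<Omega> \<sigma>" "!!n x. \<bar>\<psi> n x\<bar> <= \<bar>\<phi> x\<bar>" "!!x. (%n. \<psi> n x) ----> \<phi> x"
  and le: "!!n x y. \<bar>\<psi> n x - \<psi> n y\<bar> <= 1 * \<bar>\<phi> x - \<phi> y\<bar> + M * \<bar>u x - u y\<bar>"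
 shows "b \<in> sq ==> (%n. mk b \<bullet> mk (\<psi> n)) ----> mk b \<bullet> mk \<phi>"
  and "(%n. emb \<sigma> u \<bullet> emb \<sigma> (\<psi> n)) ----> emb \<sigma> u \<bullet> emb \<sigma> \<phi>"
proof -
 note s1 = X0_sq[OF \<sigma> \<phi>] X0_Dq[OF \<sigma> \<phi>] X0_Dq[OF \<sigma> u]
 have ae: "AE x in lebesgue. (%n. \<psi> n x) ----> \<phi> x" using \<psi>(3) by simp
 have ab: "AE x in lebesgue. \<bar>\<psi> n x\<bar> <= \<bar>\<phi> x\<bar>" for n using \<psi>(2) by simp
 have mm: "\<psi> n \<in> borel_measurable lebesgue" for n by (rule sq_meas[OF X0_sq[OF \<sigma> \<psi>(1)]])
 show "(%n. mk b \<bullet> mk (\<psi> n)) ----> mk b \<bullet> mk \<phi>" if "b \<in> sq" by (rule sq_inner_dominated(2)[OF that s1(1) mm s1(1) ab ae])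
 have sqabs: "(%z. \<bar>f z\<bar>) \<in> sq" if "f \<in> sq" for f :: "'b::euclidean_space => real"
  by (rule sq_bound[OF that]) (use sq_meas[OF that] in auto)
 have G: "(%z. 1 * \<bar>Dq \<sigma> \<phi> z\<bar> + M * \<bar>Dq \<sigma> u z\<bar>) \<in> sq" by (intro sq_add sq_scale sqabs s1)
 have d: "AE z in lebesgue. \<bar>Dq \<sigma> (\<psi> n) z\<bar> <= \<bar>1 * \<bar>Dq \<sigma> \<phi> z\<bar> + M * \<bar>Dq \<sigma> u z\<bar>\<bar>" for n
  using Dq_mono[of "\<psi> n" _ 1 \<phi> M u \<sigma>, OF le] by (intro AE_I2) (meson abs_ge_self order_trans)
 show "(%n. emb \<sigma> u \<bullet> emb \<sigma> (\<psi> n)) ----> emb \<sigma> u \<bullet> emb \<sigma> \<phi>"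
  unfolding emb_def by (rule sq_inner_dominated(2)[OF s1(3) G Dq_measurable[OF mm] s1(2) d Dq_tendsto[OF ae]])
qed

text \<open>Equal to 1 up to \<open>k\<close> and to 0 beyond \<open>k + 1\<close>. Multiplied by
  it, a test function lives where \<open>u\<close> is bounded, and on bounded sets \<beta> is
  Lipschitz.\<close>

definition "cutoff k r = max 0 (min 1 (real k + 1 - \<bar>r\<bar>))" for k :: nat and r :: real

lemma cutoff: "0 <= cutoff k r" "cutoff k r <= 1" "\<bar>cutoff k r - cutoff k t\<bar> <= \<bar>r - t\<bar>" "cutoff k r \<noteq> 0 ==> \<bar>r\<bar> <= real k + 1"
 unfolding cutoff_def by arith+

lemma cutoff_test:
 assumes u: "u \<in> X0 \<Omega> \<sigma>" and \<phi>: "\<phi> \<in> X0 \<Omega> \<sigma>" and M: "!!x. \<bar>\<phi> x\<bar> <= M"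
 shows "(%x. \<phi> x * cutoff k (u x)) \<in> X0 \<Omega> \<sigma>"
  and "b \<in> sq ==> (%k. mk b \<bullet> mk (%x. \<phi> x * cutoff k (u x))) ----> mk b \<bullet> mk \<phi>"
  and "(%k. emb \<sigma> u \<bullet> emb \<sigma> (%x. \<phi> x * cutoff k (u x))) ----> emb \<sigma> u \<bullet> emb \<sigma> \<phi>"
  and "\<bar>\<phi> x * cutoff k (u x)\<bar> <= M"
proof -
 have M0: "M >= 0" using M abs_ge_zero order_trans by blast
 define \<psi> where "\<psi> k x = \<phi> x * cutoff k (u x)" for k x
 have \<psi>b: "\<bar>\<psi> k x\<bar> <= \<bar>\<phi> x\<bar>" for k x unfolding \<psi>_def abs_mult using cutoff(1,2)[of k "u x"] by (simp add: mult_left_le)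
 have le: "\<bar>\<psi> k x - \<psi> k y\<bar> <= 1 * \<bar>\<phi> x - \<phi> y\<bar> + M * \<bar>u x - u y\<bar>" for k x y
 proof -
  have "\<psi> k x - \<psi> k y = (\<phi> x - \<phi> y) * cutoff k (u x) + \<phi> y * (cutoff k (u x) - cutoff k (u y))" by (simp add: \<psi>_def algebra_simps)
  hence "\<bar>\<psi> k x - \<psi> k y\<bar> <= \<bar>\<phi> x - \<phi> y\<bar> * \<bar>cutoff k (u x)\<bar> + \<bar>\<phi> y\<bar> * \<bar>cutoff k (u x) - cutoff k (u y)\<bar>"
   using abs_triangle_ineq by (simp add: abs_mult[symmetric])
  also have "... <= \<bar>\<phi> x - \<phi> y\<bar> * 1 + M * \<bar>u x - u y\<bar>"
   using M[of y] cutoff[of k "u x"] cutoff(3)[of k "u x" "u y"] by (intro add_mono mult_mono) auto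
  finally show ?thesis by simp
 qed
 have "continuous_on UNIV (cutoff k)" for k unfolding cutoff_def[abs_def] by (intro continuous_intros)
 from comp_meas[OF this sq_meas[OF X0_sq[OF \<sigma> u]]] have m: "\<psi> k \<in> borel_measurable lebesgue" for k
  unfolding \<psi>_def[abs_def] using sq_meas[OF X0_sq[OF \<sigma> \<phi>]] by (intro borel_measurable_times)
 have \<psi>X: "\<psi> k \<in> X0 \<Omega> \<sigma>" for k
 proof (rule X0_bound(1)[OF \<sigma> \<phi> u _ _ le])
  show "\<psi> k \<in> sq" by (rule sq_bound[OF X0_sq[OF \<sigma> \<phi>] m]) (use \<psi>b in auto)
  show "AE x in lebesgue. x \<notin> \<Omega> --> \<psi> k x = 0" using X0_out[OF \<sigma> \<phi>] by eventually_elim (simp add: \<psi>_def)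
 qed (use M0 in auto)
 have "(%k. \<psi> k x) ----> \<phi> x" for x
 proof (rule tendsto_eventually)
  have "eventually (%k. \<bar>u x\<bar> <= real k) sequentially" using filterlim_real_sequentially by (simp add: filterlim_at_top)
  thus "eventually (%k. \<psi> k x = \<phi> x) sequentially" by eventually_elim (simp add: \<psi>_def cutoff_def)
 qed
 note D = dominated_test_limit[OF u \<phi> \<psi>X \<psi>b this le]
 show "\<bar>\<phi> x * cutoff k (u x)\<bar> <= M" by (rule order_trans[OF \<psi>b[of k x, unfolded \<psi>_def] M])
 show "(%x. \<phi> x * cutoff k (u x)) \<in> X0 \<Omega> \<sigma>" using \<psi>X by (simp add: \<psi>_def[abs_def])
 show "(%k. mk b \<bullet> mk (%x. \<phi> x * cutoff k (u x))) ----> mk b \<bullet> mk \<phi>" if "b \<in> sq"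
  using D(1)[OF that] by (simp add: \<psi>_def[abs_def])
 show "(%k. emb \<sigma> u \<bullet> emb \<sigma> (%x. \<phi> x * cutoff k (u x))) ----> emb \<sigma> u \<bullet> emb \<sigma> \<phi>"
  using D(2) by (simp add: \<psi>_def[abs_def])
qed

context
 fixes U w u
 assumes sg: "subgrad U (emb s w)" and w: "w \<in> X0 \<Omega> s" and u: "rep u U" "integrable lebesgue (%x. B (u x))"
begin

text \<open>Where \<psi> is nonzero, \<open>u\<close> and \<open>u + h * \<psi>\<close> stay in an
  interval on which \<beta> is Lipschitz; this gives integrability and a quadratic expansion of
  \<open>B\<close>. Both signs of \<open>h\<close> turn the variational inequality into an equation.
  Clipping changes nothing there but makes the second factor square integrable.\<close>

lemma subgrad_Euler_truncated:
 assumes \<psi>: "\<psi> \<in> X0 \<Omega> \<sigma>" and M: "!!x. \<bar>\<psi> x\<bar> <= M" and R: "0 <= R" "!!x. \<psi> x \<noteq> 0 ==> \<bar>u x\<bar> <= R"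
 shows "(mk w + lam *\<^sub>R mk u) \<bullet> mk \<psi> = emb \<sigma> u \<bullet> emb \<sigma> \<psi> + mk (%x. \<beta> (clip R (u x))) \<bullet> mk \<psi>"
proof -
 define F where "F = mk w + lam *\<^sub>R mk u"
 have uX: "u \<in> X0 \<Omega> \<sigma>" by (rule rep_X0[OF u(1)])
 have M0: "M >= 0" using M abs_ge_zero order_trans by blast
 define b where "b x = \<beta> (clip R (u x))" for x
 have bs: "b \<in> sq" unfolding b_def[abs_def] by (rule X0_sq[OF \<sigma> beta_clip_X0[OF uX R(1)]])
 note \<psi>s = X0_sq[OF \<sigma> \<psi>]
 obtain K where K: "!!h. integrable lebesgue (%x. B (u x + h * \<psi> x)) ==>
  h * (F \<bullet> mk \<psi> - emb \<sigma> u \<bullet> emb \<sigma> \<psi>) - h^2 * K <= (LINT x|lebesgue. B (u x + h * \<psi> x)) - (LINT x|lebesgue. B (u x))"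
  using subgrad_variation[OF sg w u(1) \<psi>] unfolding F_def by blast
 obtain L where L: "L > 0" "!!x y. \<bar>x\<bar> <= R + M ==> \<bar>y\<bar> <= R + M ==> \<bar>\<beta> x - \<beta> y\<bar> <= L * \<bar>x - y\<bar>"
  using \<beta>_lip[of "R + M"] M0 R(1) by auto
 have pw: "B (u x + h * \<psi> x) <= B (u x) + h * (b x * \<psi> x) + L * h^2 * (\<psi> x)^2" if h: "\<bar>h\<bar> <= 1" for h x
 proof (cases "\<psi> x = 0")
  case False
  define d where "d = h * \<psi> x"
  have bu: "b x = \<beta> (u x)" using R(2)[OF False] by (simp add: b_def clip_simps(3))
  have "\<bar>d\<bar> <= 1 * M" unfolding d_def abs_mult using h M[of x] by (intro mult_mono) auto
  hence "\<bar>\<beta> (u x + d) - \<beta> (u x)\<bar> <= L * \<bar>d\<bar>" using L(2)[of "u x + d" "u x"] R(2)[OF False] M0 by simp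
  from mult_right_mono[OF this abs_ge_zero[of d]] have "(\<beta> (u x + d) - \<beta> (u x)) * d <= L * d^2"
   using abs_ge_self[of "(\<beta> (u x + d) - \<beta> (u x)) * d"] by (simp add: abs_mult power2_eq_square)
  thus ?thesis using B_upper[of "u x + d" "u x"] unfolding bu d_def by (simp add: power_mult_distrib algebra_simps)
 qed simp
 have ineq: "h * (F \<bullet> mk \<psi> - emb \<sigma> u \<bullet> emb \<sigma> \<psi>) - h^2 * K <= h * (mk b \<bullet> mk \<psi>) + L * h^2 * (norm (mk \<psi>))^2" if h: "\<bar>h\<bar> <= 1" for h
 proof -
  have ib: "integrable lebesgue (%x. B (u x) + h * (b x * \<psi> x) + L * h^2 * (\<psi> x)^2)"
   by (intro Bochner_Integration.integrable_add integrable_mult_right u(2) sq_int[OF \<psi>s] sq_mult_integrable[OF bs \<psi>s])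
  have mX: "(%x. u x + h * \<psi> x) \<in> X0 \<Omega> \<sigma>" using X0_linear(1)[OF \<sigma> uX \<psi>, of 1 h] by simp
  have i: "integrable lebesgue (%x. B (u x + h * \<psi> x))"
   by (rule Bochner_Integration.integrable_bound[OF ib B_out(1)[OF mX]], rule AE_I2)
     (simp add: order_trans[OF pw[OF h] abs_ge_self] B_nonneg)
  have "(LINT x|lebesgue. B (u x + h * \<psi> x)) <= (LINT x|lebesgue. B (u x) + h * (b x * \<psi> x) + L * h^2 * (\<psi> x)^2)"
   by (rule integral_mono[OF i ib pw[OF h]])
  also have "... = (LINT x|lebesgue. B (u x)) + h * (mk b \<bullet> mk \<psi>) + L * h^2 * (norm (mk \<psi>))^2"
   using u(2) sq_int[OF \<psi>s] sq_mult_integrable[OF bs \<psi>s]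
   by (simp add: Bochner_Integration.integral_add norm_mk_square[OF \<psi>s] inner_mk[OF bs \<psi>s])
  finally show ?thesis using K[OF i] by simp
 qed
 define X where "X = mk b \<bullet> mk \<psi> - F \<bullet> mk \<psi> + emb \<sigma> u \<bullet> emb \<sigma> \<psi>"
 define N where "N = L * (norm (mk \<psi>))^2 + K"
 have "0 <= c * X" if c: "c = 1 \<or> c = -1" for c
 proof (rule affine_nonneg_at_0[of _ N])
  fix \<theta> :: real assume t: "0 < \<theta>" "\<theta> <= 1"
  have "0 <= \<theta> * (c * X + \<theta> * N)" using ineq[of "c * \<theta>"] t c unfolding X_def N_def by (auto simp: power2_eq_square algebra_simps)
  thus "0 <= c * X + \<theta> * N" using t by (simp add: zero_le_mult_iff)
 qed
 from this[of 1] this[of "-1"] show ?thesis by (simp add: X_def F_def b_def[abs_def])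
qed

text \<open>The equation is tested with \<open>b n\<close>, a truncation of \<beta> composed with
  \<open>u\<close>: monotonicity makes the Dirichlet term nonnegative, and Cauchy-Schwarz bounds the
  norm of \<open>b n\<close> independently of \<open>n\<close>. As \<open>b n\<close> need not
  vanish where \<open>u\<close> is large, a cutoff in \<open>u\<close> is inserted and removed
  first.\<close>

lemma subgrad_beta_square: "(%x. \<beta> (u x)) \<in> sq" "norm (mk (%x. \<beta> (u x))) <= norm (mk w + lam *\<^sub>R mk u)"
proof -
 define F where "F = mk w + lam *\<^sub>R mk u"
 have uX: "u \<in> X0 \<Omega> \<sigma>" by (rule rep_X0[OF u(1)])
 note usq = X0_sq[OF \<sigma> uX]
 define b where "b n x = \<beta> (clip (real n) (u x))" for n x
 have bX: "b n \<in> X0 \<Omega> \<sigma>" for n unfolding b_def[abs_def] by (rule beta_clip_X0[OF uX]) simp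
 note bs = X0_sq[OF \<sigma> bX]
 have main: "norm (mk (b n)) <= norm F" for n
 proof -
  have pos: "0 <= emb \<sigma> u \<bullet> emb \<sigma> (b n)"
   unfolding emb_def inner_mk[OF X0_Dq[OF \<sigma> uX] X0_Dq[OF \<sigma> bX]]
  proof (rule integral_nonneg_AE, rule AE_I2)
   fix z :: "'a \<times> 'a"
   have "0 <= (u (fst z) - u (snd z)) * (b n (fst z) - b n (snd z))"
    using \<beta>_mono[OF clip_simps(6), of "u (fst z)" "u (snd z)" "real n"] \<beta>_mono[OF clip_simps(6), of "u (snd z)" "u (fst z)" "real n"]
    unfolding b_def by (cases "u (fst z) <= u (snd z)") (auto intro: mult_nonpos_nonpos mult_nonneg_nonneg)
   thus "0 <= Dq \<sigma> u z * Dq \<sigma> (b n) z"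
    unfolding Dq_mult[OF \<sigma>] gagliardo_def using frac_const_pos[OF \<sigma>, where 'a='a] by (auto simp: case_prod_beta intro!: mult_nonneg_nonneg divide_nonneg_nonneg)
  qed
  have M: "\<bar>b n x\<bar> <= \<bar>\<beta> (real n)\<bar> + \<bar>\<beta> (- real n)\<bar>" for x
   using \<beta>_mono[of "clip (real n) (u x)" "real n"] \<beta>_mono[of "- real n" "clip (real n) (u x)"] clip_simps(1)[of "real n" "u x"]
   unfolding b_def abs_le_iff by (intro conjI; linarith)
  note c = cutoff_test[OF uX bX[of n] M]
  let ?c = "%k x. b n x * cutoff k (u x)"
  have "mk (b n) \<bullet> mk (b n) <= F \<bullet> mk (b n) - emb \<sigma> u \<bullet> emb \<sigma> (b n)"
  proof (rule LIMSEQ_le[OF c(2)[OF bs]])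
   show "(%k. F \<bullet> mk (?c k) - emb \<sigma> u \<bullet> emb \<sigma> (?c k)) ----> F \<bullet> mk (b n) - emb \<sigma> u \<bullet> emb \<sigma> (b n)"
    unfolding F_def inner_add_left inner_scaleR_left by (intro tendsto_intros c(2,3) usq X0_sq[OF s w])
   have "mk (b n) \<bullet> mk (?c k) <= F \<bullet> mk (?c k) - emb \<sigma> u \<bullet> emb \<sigma> (?c k)" if k: "n <= k" for k
   proof -
    \<comment> \<open>The support of \<open>cutoff k\<close> reaches up to \<open>k + 1\<close>,
      hence the clipping level \<open>Suc k\<close>.\<close>
    have e: "F \<bullet> mk (?c k) - emb \<sigma> u \<bullet> emb \<sigma> (?c k) = mk (b (Suc k)) \<bullet> mk (?c k)"
     using subgrad_Euler_truncated[OF c(1,4), of "real (Suc k)" k] cutoff(4)[of k] unfolding F_def b_def[of "Suc k", abs_def] by (simp add: add.commute)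
    have "(LINT x|lebesgue. b n x * ?c k x) <= (LINT x|lebesgue. b (Suc k) x * ?c k x)"
    proof (rule integral_mono[OF sq_mult_integrable[OF bs X0_sq[OF \<sigma> c(1)]] sq_mult_integrable[OF bs X0_sq[OF \<sigma> c(1)]]])
     fix x
     \<comment> \<open>Clipping at a higher level moves the value away from zero without changing
       its sign.\<close>
     have "0 <= (b (Suc k) x - b n x) * b n x"
     proof (cases "0 <= u x")
      case True
      hence "0 <= clip (real n) (u x)" "clip (real n) (u x) <= clip (real (Suc k)) (u x)" using k by (auto simp: clip_def)
      thus ?thesis using \<beta>_mono \<beta>_sign(1) by (simp add: b_def)
     next
      case False
      hence "clip (real n) (u x) <= 0" "clip (real (Suc k)) (u x) <= clip (real n) (u x)" using k by (auto simp: clip_def)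
      thus ?thesis using \<beta>_mono \<beta>_sign(2) unfolding b_def by (intro mult_nonpos_nonpos) auto
     qed
     from mult_right_mono[OF this cutoff(1)[of k "u x"]] show "b n x * ?c k x <= b (Suc k) x * ?c k x"
      by (simp add: algebra_simps)
    qed
    thus ?thesis unfolding e by (simp add: inner_mk[OF bs X0_sq[OF \<sigma> c(1)]])
   qed
   thus "EX N. \<forall>k\<ge>N. mk (b n) \<bullet> mk (?c k) <= F \<bullet> mk (?c k) - emb \<sigma> u \<bullet> emb \<sigma> (?c k)" by blast
  qed
  hence "(norm (mk (b n)))^2 <= norm F * norm (mk (b n))"
   using norm_cauchy_schwarz[of F "mk (b n)"] pos by (simp add: power2_norm_eq_inner)
  thus ?thesis by (rule le_of_square_le_mult) auto
 qed
 have lim: "AE x in lebesgue. (%n. b n x) ----> \<beta> (u x)"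
 proof (rule AE_I2)
  fix x
  have "isCont \<beta> (u x)" using \<beta>_cont[of UNIV] by (simp add: continuous_on_eq_continuous_at)
  thus "(%n. b n x) ----> \<beta> (u x)" unfolding b_def using clip_lim by (rule isCont_tendsto_compose)
 qed
 have bd: "(norm (mk (b n)))^2 <= (norm F)^2" for n using main by (intro power_mono) auto
 note S = sq_liminf[of b, OF bs bd tendsto_const lim comp_meas[OF \<beta>_cont sq_meas[OF usq]]]
 show "(%x. \<beta> (u x)) \<in> sq" by (rule S(1))
 from S(2) show "norm (mk (%x. \<beta> (u x))) <= norm (mk w + lam *\<^sub>R mk u)" unfolding F_def by (rule power2_le_imp_le) simp
qed

text \<open>Two limits: the cutoff in \<open>u\<close> is removed for bounded test functions, now
  that \<beta> composed with \<open>u\<close> is square integrable, and then a general \<phi> is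
  approximated by its truncations.\<close>

lemma subgrad_Euler:
 assumes \<phi>: "\<phi> \<in> X0 \<Omega> \<sigma>"
 shows "(mk w + lam *\<^sub>R mk u) \<bullet> mk \<phi> = emb \<sigma> u \<bullet> emb \<sigma> \<phi> + mk (%x. \<beta> (u x)) \<bullet> mk \<phi>"
proof -
 have uX: "u \<in> X0 \<Omega> \<sigma>" by (rule rep_X0[OF u(1)])
 note bs = subgrad_beta_square(1) and us = X0_sq[OF \<sigma> uX] X0_sq[OF s w]
 have bounded: "(mk w + lam *\<^sub>R mk u) \<bullet> mk \<phi> = emb \<sigma> u \<bullet> emb \<sigma> \<phi> + mk (%x. \<beta> (u x)) \<bullet> mk \<phi>"
  if \<phi>: "\<phi> \<in> X0 \<Omega> \<sigma>" and M: "!!x. \<bar>\<phi> x\<bar> <= M" for \<phi> M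
 proof -
  note c = cutoff_test[OF uX \<phi> M]
  let ?c = "%k x. \<phi> x * cutoff k (u x)"
  have e: "(mk w + lam *\<^sub>R mk u) \<bullet> mk (?c k) = emb \<sigma> u \<bullet> emb \<sigma> (?c k) + mk (%x. \<beta> (u x)) \<bullet> mk (?c k)" for k
  proof -
   note cs = X0_sq[OF \<sigma> c(1)[of k]]
   have "mk (%x. \<beta> (clip (real k + 1) (u x))) \<bullet> mk (?c k) = mk (%x. \<beta> (u x)) \<bullet> mk (?c k)"
    unfolding inner_mk[OF X0_sq[OF \<sigma> beta_clip_X0[OF uX]] cs, of "real k + 1", simplified] inner_mk[OF bs cs]
    by (rule Bochner_Integration.integral_cong[OF refl], case_tac "cutoff k (u x) = 0") (simp_all add: clip_simps(3)[OF cutoff(4)])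
   thus ?thesis using subgrad_Euler_truncated[OF c(1,4), of "real k + 1" k] cutoff(4)[of k] by simp
  qed
  have "(%k. (mk w + lam *\<^sub>R mk u) \<bullet> mk (?c k)) ----> (mk w + lam *\<^sub>R mk u) \<bullet> mk \<phi>"
   unfolding inner_add_left inner_scaleR_left by (intro tendsto_intros c(2) us)
  thus ?thesis unfolding e by (rule LIMSEQ_unique) (intro tendsto_add c(2,3) bs)
 qed
 define \<xi> where "\<xi> n x = clip (real n) (\<phi> x)" for n x
 have \<xi>X: "\<xi> n \<in> X0 \<Omega> \<sigma>" for n
 proof (rule X0_bound(1)[OF \<sigma> \<phi> uX, where b=1 and c=0])
  show "\<xi> n \<in> sq" unfolding \<xi>_def[abs_def]
   by (rule sq_bound[OF X0_sq[OF \<sigma> \<phi>] comp_meas[OF clip_cont sq_meas[OF X0_sq[OF \<sigma> \<phi>]]]]) (simp add: clip_simps(2))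
  show "AE x in lebesgue. x \<notin> \<Omega> --> \<xi> n x = 0" using X0_out[OF \<sigma> \<phi>] by eventually_elim (simp add: \<xi>_def clip_simps(4))
 qed (simp_all add: \<xi>_def clip_simps(5))
 have e: "(mk w + lam *\<^sub>R mk u) \<bullet> mk (\<xi> n) = emb \<sigma> u \<bullet> emb \<sigma> (\<xi> n) + mk (%x. \<beta> (u x)) \<bullet> mk (\<xi> n)" for n
  by (rule bounded[OF \<xi>X, of _ "real n"]) (simp add: \<xi>_def clip_simps(1))
 have "\<bar>\<xi> n x\<bar> <= \<bar>\<phi> x\<bar>" "(%n. \<xi> n x) ----> \<phi> x" "\<bar>\<xi> n x - \<xi> n y\<bar> <= 1 * \<bar>\<phi> x - \<phi> y\<bar> + 0 * \<bar>u x - u y\<bar>" for n x y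
  unfolding \<xi>_def using clip_lim by (simp_all add: clip_simps(2,5))
 note D = dominated_test_limit[OF uX \<phi> \<xi>X this]
 have "(%n. (mk w + lam *\<^sub>R mk u) \<bullet> mk (\<xi> n)) ----> (mk w + lam *\<^sub>R mk u) \<bullet> mk \<phi>"
  unfolding inner_add_left inner_scaleR_left by (intro tendsto_intros D(1) us)
 thus ?thesis unfolding e by (rule LIMSEQ_unique) (intro tendsto_add D bs)
qed

end

lemma subgrad_characterization:
 assumes sg: "subgrad U (emb s w)" and w: "w \<in> X0 \<Omega> s" and u: "rep u U" "integrable lebesgue (%x. B (u x))"
 shows "(%x. g (u x)) \<in> sq"
  and "\<phi> \<in> X0 \<Omega> \<sigma> ==> mk w \<bullet> mk \<phi> = emb \<sigma> u \<bullet> emb \<sigma> \<phi> + mk (%x. g (u x)) \<bullet> mk \<phi>"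
proof -
 have e: "(%x. g (u x)) = (%x. \<beta> (u x) - lam * u x)" by (simp add: \<beta>)
 note usq = X0_sq[OF \<sigma> rep_X0[OF u(1)]]
 note bs = subgrad_beta_square(1)[OF sg w u]
 show "(%x. g (u x)) \<in> sq" unfolding e by (intro sq_diff sq_scale usq bs)
 have "mk (%x. g (u x)) = mk (%x. \<beta> (u x)) - lam *\<^sub>R mk u"
  unfolding e by (simp add: mk_scaleR[OF usq] mk_diff[OF bs sq_scale[OF usq]])
 thus "mk w \<bullet> mk \<phi> = emb \<sigma> u \<bullet> emb \<sigma> \<phi> + mk (%x. g (u x)) \<bullet> mk \<phi>" if "\<phi> \<in> X0 \<Omega> \<sigma>"
  using subgrad_Euler[OF sg w u that] by (simp add: inner_add_left inner_diff_left)
qed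

lemma L2_eq_by_X0:
 assumes w: "w \<in> X0 \<Omega> s" and z: "z \<in> X0 \<Omega> s" and e: "!!\<phi>. \<phi> \<in> X0 \<Omega> \<sigma> ==> mk w \<bullet> mk \<phi> = mk z \<bullet> mk \<phi>"
 shows "AE x in lebesgue. w x = z x" "emb s w = emb s z"
proof -
 note d = X0_diff[OF s w z]
 have "AE x in lebesgue. w x - z x = 0"
 proof (rule orthogonal_X0_imp_zero[OF \<Omega> X0_sq[OF s d(1)] X0_out[OF s d(1)]])
  fix \<phi> :: "'a => real" assume "!!a. 0 < a ==> a < 1 ==> \<phi> \<in> X0 \<Omega> a"
  thus "mk (%x. w x - z x) \<bullet> mk \<phi> = 0" using e[of \<phi>] \<sigma> by (simp add: d inner_diff_left)
 qed
 thus ae: "AE x in lebesgue. w x = z x" by simp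
 show "emb s w = emb s z" by (rule X0_cong_AE(2)[OF s w sq_meas[OF X0_sq[OF s z]] ae, symmetric])
qed

text \<open>The Euler equation prescribes the L2 products of a subgradient with all of
  \<open>X0 \<Omega> \<sigma>\<close>, and these already determine it by density of the test
  functions.\<close>

lemma subgrad_unique:
 assumes "subgrad U W" "subgrad U W'"
 shows "W = W'"
proof -
 obtain u where u: "rep u U" "integrable lebesgue (%x. B (u x))" using subgrad_rep[OF assms(1)] by blast
 obtain w where w: "w \<in> X0 \<Omega> s" "W = emb s w" using subgrad_emb[OF assms(1)] by blast
 obtain z where z: "z \<in> X0 \<Omega> s" "W' = emb s z" using subgrad_emb[OF assms(2)] by blast
 show ?thesis unfolding w(2) z(2)
 proof (rule L2_eq_by_X0(2)[OF w(1) z(1)])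
  fix \<phi> assume p: "\<phi> \<in> X0 \<Omega> \<sigma>"
  show "mk w \<bullet> mk \<phi> = mk z \<bullet> mk \<phi>"
   using subgrad_characterization(2)[OF assms(1)[unfolded w(2)] w(1) u p] subgrad_characterization(2)[OF assms(2)[unfolded z(2)] z(1) u p] by simp
 qed
qed

lemma DD_0: "0 \<in> DD"
proof -
 have "rep (%x. 0) 0" unfolding rep_def using X0_0[OF \<sigma>] V0(1) by (simp add: mk_0 subspace_0)
 thus ?thesis using DD_rep[of "%x. 0" 0] by (simp add: B_0)
qed

lemma gradient_flow: "gradient_flow V0 DD Phi CC mm"
proof
 show "subspace V0" "closed V0" by (rule V0)+
 show "DD \<subseteq> V0" by (auto simp: DD_def rep_def)
 show "0 <= CC" by (rule CC(1))
 show "DD \<noteq> {}" using DD_0 by blast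
 show "mm <= Phi x" if "x \<in> DD" for x by (rule mm[OF that])
 show "l \<in> DD & Phi l <= c" if "!!n::nat. X n \<in> DD" "X ----> l" "!!n. Phi (X n) <= c" for X l c by (rule DD_closed[OF that])
 show "W = W'" if "subgrad U W" "subgrad U W'" for U W W' by (rule subgrad_unique[OF that])
 fix U V \<theta> assume U: "U \<in> DD" and V: "V \<in> DD" and th: "0 <= \<theta>" "\<theta> <= (1::real)"
 obtain u where u: "rep u U" "integrable lebesgue (%x. B (u x))" using U unfolding DD_def by blast
 obtain v where v: "rep v V" "integrable lebesgue (%x. B (v x))" using V unfolding DD_def by blast
 note sc = strong_semiconvexity[OF u v th]
 have "0 <= 1/4 * \<theta> * (1 - \<theta>) * (norm (emb \<sigma> u - emb \<sigma> v))^2" using th by simp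
 thus "(1 - \<theta>) *\<^sub>R U + \<theta> *\<^sub>R V \<in> DD &
   Phi ((1 - \<theta>) *\<^sub>R U + \<theta> *\<^sub>R V) <= (1 - \<theta>) * Phi U + \<theta> * Phi V + CC / 2 * \<theta> * (1 - \<theta>) * (norm (U - V))^2"
  using sc(2,3) unfolding DD_rep[OF sc(1)] Phi_rep[OF sc(1)] Phi_rep[OF u(1)] Phi_rep[OF v(1)] by linarith
qed

end

section \<open>Smooth step functions and weak derivatives in time\<close>

lemma Ck_SucE:
 fixes f :: "real => real"
 assumes "Ck (Suc k) f"
 obtains f' where "!!x. (f has_real_derivative f' x) (at x)" "Ck k f'"
proof -
 define f' where "f' x = frechet_derivative f (at x) 1" for x
 have "(f has_real_derivative f' x) (at x)" for x
 proof -
  have d: "(f has_derivative frechet_derivative f (at x)) (at x)" using assms by (simp add: frechet_derivative_works)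
  have "frechet_derivative f (at x) h = f' x * h" for h
   using linear_cmul[OF has_derivative_linear[OF d], of h 1] by (simp add: f'_def)
  thus ?thesis using d unfolding has_field_derivative_def by (simp add: fun_eq_iff has_derivative_eq_rhs)
 qed
 moreover have "Ck k f'" using assms unfolding f'_def[abs_def] by simp
 ultimately show thesis by (rule that)
qed

lemma frechet_derivative_real: "(f has_real_derivative d) (at x) ==> frechet_derivative f (at x) h = d * h"
 unfolding has_field_derivative_def using frechet_derivative_at by metis

text \<open>\<open>Ck (Suc k)\<close> quantifies over directions, and in direction \<open>h\<close>
  the derivative is \<open>f' x * h\<close>: this factor has to be handled before \<open>Ck\<close>
  can be reduced to iterated real derivatives.\<close>

lemma Ck_scale: "Ck k f ==> Ck k (%x::real. f x * c)"
proof (induction k arbitrary: f c)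
 case 0 thus ?case by (auto intro: continuous_intros)
next
 case (Suc k)
 obtain f' where f': "!!x. (f has_real_derivative f' x) (at x)" "Ck k f'" using Suc.prems by (rule Ck_SucE) blast
 have d: "((%x. f x * c) has_real_derivative f' x * c) (at x)" for x by (auto intro!: derivative_eq_intros f')
 have "Ck k (%x. f' x * (c * h))" for h by (rule Suc.IH[OF f'(2)])
 moreover have "(%x. f x * c) differentiable (at x)" for x using d[of x] real_differentiable_def by blast
 ultimately show ?case by (simp add: frechet_derivative_real[OF d] mult.assoc)
qed

lemma Ck_SucI:
 assumes "!!x. (f has_real_derivative f' x) (at x)" "Ck k f'"
 shows "Ck (Suc k) f"
proof -
 have "f differentiable (at x)" for x using assms(1)[of x] real_differentiable_def by blast
 thus ?thesis using Ck_scale[OF assms(2)] by (simp add: frechet_derivative_real[OF assms(1)])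
qed

lemma Ck_add: "Ck k f ==> Ck k g ==> Ck k (%x::real. f x + g x)"
proof (induction k arbitrary: f g)
 case 0 thus ?case by (auto intro: continuous_intros)
next
 case (Suc k)
 obtain f' where f': "!!x. (f has_real_derivative f' x) (at x)" "Ck k f'" using Suc.prems(1) by (rule Ck_SucE) blast
 obtain g' where g': "!!x. (g has_real_derivative g' x) (at x)" "Ck k g'" using Suc.prems(2) by (rule Ck_SucE) blast
 show ?case by (rule Ck_SucI[OF DERIV_add[OF f'(1) g'(1)] Suc.IH[OF f'(2) g'(2)]])
qed

lemma Ck_decrease: "Ck (Suc k) f ==> Ck k f" for f :: "real => real"
proof (induction k arbitrary: f)
 case 0
 then obtain f' where f': "!!x. (f has_real_derivative f' x) (at x)" by (rule Ck_SucE) blast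
 thus ?case by (auto intro!: continuous_at_imp_continuous_on DERIV_isCont)
next
 case (Suc k)
 obtain f' where f': "!!x. (f has_real_derivative f' x) (at x)" "Ck (Suc k) f'" using Suc.prems by (rule Ck_SucE) blast
 show ?case by (rule Ck_SucI[OF f'(1) Suc.IH[OF f'(2)]])
qed

lemma Ck_mult: "Ck k f ==> Ck k g ==> Ck k (%x::real. f x * g x)"
proof (induction k arbitrary: f g)
 case 0 thus ?case by (auto intro: continuous_intros)
next
 case (Suc k)
 obtain f' where f': "!!x. (f has_real_derivative f' x) (at x)" "Ck k f'" using Suc.prems(1) by (rule Ck_SucE) blast
 obtain g' where g': "!!x. (g has_real_derivative g' x) (at x)" "Ck k g'" using Suc.prems(2) by (rule Ck_SucE) blast
 show ?case
  by (rule Ck_SucI[OF DERIV_mult[OF f'(1) g'(1)]])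
    (intro Ck_add Suc.IH f' g' Ck_decrease[OF Suc.prems(1)] Ck_decrease[OF Suc.prems(2)])
qed

lemma Ck_affine: "Ck k f ==> Ck k (%x::real. f (a * x + b))"
proof (induction k arbitrary: f)
 case 0 thus ?case by (auto intro!: continuous_intros continuous_on_compose2[of UNIV f])
next
 case (Suc k)
 obtain f' where f': "!!x. (f has_real_derivative f' x) (at x)" "Ck k f'" using Suc.prems by (rule Ck_SucE) blast
 have "((%x. f (a * x + b)) has_real_derivative f' (a * x + b) * a) (at x)" for x
  by (rule DERIV_chain2[OF f'(1)]) (auto intro!: derivative_eq_intros)
 thus ?case by (rule Ck_SucI) (intro Ck_scale Suc.IH f')
qed

text \<open>The derivative of each member of this family is a linear combination of two others, so
  all are smooth by induction; \<open>flat 0\<close> is the standard smooth function vanishing on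
  the negative half-line.\<close>

definition flat :: "nat => real => real" where
 "flat n x = (if x > 0 then (1 / x) ^ n * exp (- (1 / x)) else 0)"

lemma flat_tendsto_0: "(flat n \<longlongrightarrow> 0) (at 0)"
proof (rule filterlim_split_at)
 have "eventually (%x::real. x < 0) (at_left 0)" by (rule eventually_at_leftI[of "-1"]) auto
 hence "eventually (%x. flat n x = 0) (at_left 0)" by eventually_elim (simp add: flat_def)
 thus "(flat n \<longlongrightarrow> 0) (at_left 0)" by (rule tendsto_eventually)
 have "((%x. (inverse x) ^ n / exp (inverse x)) \<longlongrightarrow> 0) (at_right (0::real))"
  by (rule filterlim_compose[OF tendsto_power_div_exp_0 filterlim_inverse_at_top_right])
 moreover have "eventually (%x. (inverse x) ^ n / exp (inverse x) = flat n x) (at_right 0)"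
  using eventually_at_right_less[of "0::real"] by eventually_elim (simp add: flat_def exp_minus divide_inverse)
 ultimately show "(flat n \<longlongrightarrow> 0) (at_right 0)" by (rule Lim_transform_eventually)
qed

lemma flat_deriv: "(flat n has_real_derivative flat (n + 2) x + flat (n + 1) x * (- real n)) (at x)"
proof -
 consider "x < 0" | "x = 0" | "x > 0" by linarith
 thus ?thesis
 proof cases
  case 1
  have "((%x. 0) has_real_derivative 0) (at x)" by simp
  hence "(flat n has_real_derivative 0) (at x)"
   by (rule has_field_derivative_transform_within_open[of _ _ _ "{..<0}"]) (use 1 in \<open>auto simp: flat_def\<close>)
  thus ?thesis using 1 by (simp add: flat_def)
 next
  case 2
  have e: "(flat n y - flat n 0) / (y - 0) = flat (n + 1) y" for y by (simp add: flat_def)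
  have "(flat n has_real_derivative 0) (at 0)"
   unfolding has_field_derivative_iff e by (rule flat_tendsto_0)
  thus ?thesis using 2 by (simp add: flat_def)
 next
  case 3
  have i: "((%x. 1 / x) has_real_derivative - (1 / x)\<^sup>2) (at x)"
   using 3 by (auto intro!: derivative_eq_intros simp: power2_eq_square)
  have p: "((%x. (1 / x) ^ n) has_real_derivative real n * (- (1 / x)\<^sup>2 * (1 / x) ^ (n - Suc 0))) (at x)"
   by (rule DERIV_power[OF i])
  have ee: "((%x. exp (- (1 / x))) has_real_derivative exp (- (1 / x)) * - (- (1 / x)\<^sup>2)) (at x)"
   by (rule DERIV_chain2[OF DERIV_exp DERIV_minus[OF i]])
  have pn: "real n * (- (1 / x)\<^sup>2 * (1 / x) ^ (n - Suc 0)) = (1 / x) ^ (n + 1) * (- real n)"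
   by (cases n) (use 3 in \<open>simp_all add: power2_eq_square field_simps\<close>)
  have "((%x. (1 / x) ^ n * exp (- (1 / x))) has_real_derivative
    (real n * (- (1 / x)\<^sup>2 * (1 / x) ^ (n - Suc 0))) * exp (- (1 / x)) + exp (- (1 / x)) * - (- (1 / x)\<^sup>2) * (1 / x) ^ n) (at x)"
   by (rule DERIV_mult[OF p ee])
  hence "(flat n has_real_derivative
    (real n * (- (1 / x)\<^sup>2 * (1 / x) ^ (n - Suc 0))) * exp (- (1 / x)) + exp (- (1 / x)) * - (- (1 / x)\<^sup>2) * (1 / x) ^ n) (at x)"
   by (rule has_field_derivative_transform_within_open[of _ _ _ "{0<..}"]) (use 3 in \<open>auto simp: flat_def\<close>)
  moreover have "(real n * (- (1 / x)\<^sup>2 * (1 / x) ^ (n - Suc 0))) * exp (- (1 / x)) + exp (- (1 / x)) * - (- (1 / x)\<^sup>2) * (1 / x) ^ n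
    = flat (n + 2) x + flat (n + 1) x * (- real n)"
   unfolding pn using 3 by (simp add: flat_def power_add power2_eq_square mult.commute mult.left_commute)
  ultimately show ?thesis by simp
 qed
qed

lemma Ck_flat: "Ck k (flat n)"
proof (induction k arbitrary: n)
 case 0
 have "isCont (flat n) x" for x by (rule DERIV_isCont[OF flat_deriv])
 thus ?case by (simp add: continuous_at_imp_continuous_on)
next
 case (Suc k)
 show ?case by (rule Ck_SucI[OF flat_deriv]) (intro Ck_add Ck_scale Suc)
qed

text \<open>The normalized primitive of a bump supported in the unit interval.\<close>

lemma smooth_step:
 obtains S S' :: "real => real" where "smooth S" "!!x. (S has_real_derivative S' x) (at x)" "continuous_on UNIV S'"
  "!!x. 0 <= S' x" "!!x. x \<notin> {0..1} ==> S' x = 0" "!!x. x <= 0 ==> S x = 0" "!!x. 1 <= x ==> S x = 1"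
proof -
 define b where "b x = flat 0 x * flat 0 (1 - x)" for x
 have bC: "Ck k b" for k
 proof -
  have "Ck k (%x. flat 0 x * flat 0 ((-1) * x + 1))" by (intro Ck_mult Ck_flat Ck_affine)
  thus ?thesis by (simp add: b_def[abs_def])
 qed
 have b0: "b x = 0" if "x <= 0 \<or> 1 <= x" for x using that by (auto simp: b_def flat_def)
 have bp: "b x > 0" if "0 < x" "x < 1" for x using that by (simp add: b_def flat_def)
 have bn: "b x >= 0" for x by (simp add: b_def flat_def)
 have bc: "continuous_on UNIV b" using bC[of 0] by simp
 obtain F where F: "!!x. (F has_real_derivative b x) (at x)"
  using einterval_antiderivative[of "-\<infinity>" "\<infinity>" b] bc
  by (auto simp: continuous_on_eq_continuous_at has_real_derivative_iff_has_vector_derivative)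
 have Fc: "continuous_on A F" for A using F by (meson DERIV_isCont continuous_at_imp_continuous_on)
 have F01: "F 0 < F 1" by (rule DERIV_pos_imp_increasing_open[of 0 1 F]) (use F bp Fc in \<open>auto intro: exI\<close>)
 define S where "S x = (F x - F 0) * (1 / (F 1 - F 0))" for x
 define S' where "S' x = b x * (1 / (F 1 - F 0))" for x
 have d: "(S has_real_derivative S' x) (at x)" for x
  unfolding S_def S'_def by (rule DERIV_cmult_right) (use DERIV_diff[OF F DERIV_const] in simp)
 show thesis
 proof (rule that[of S S'])
  have "Ck k S" for k
  proof (rule Ck_decrease, rule Ck_SucI[OF d])
   show "Ck k S'" unfolding S'_def[abs_def] by (rule Ck_scale[OF bC])
  qed
  thus "smooth S" by (simp add: smooth_def)
  show "(S has_real_derivative S' x) (at x)" for x by (rule d)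
  show "continuous_on UNIV S'" unfolding S'_def[abs_def] by (intro continuous_intros bc)
  show "0 <= S' x" for x using bn F01 by (simp add: S'_def)
  show "S' x = 0" if "x \<notin> {0..1}" for x using b0[of x] that by (auto simp: S'_def)
  show "S x = 0" if "x <= 0" for x
  proof -
   have "F x = F 0"
   proof (cases "x = 0")
    case False
    hence "x < 0" using that by simp
    thus ?thesis
     using DERIV_isconst_end[of x 0 F] Fc F b0 by (metis less_eq_real_def)
   qed simp
   thus ?thesis by (simp add: S_def)
  qed
  show "S x = 1" if "1 <= x" for x
  proof -
   have "F x = F 1"
   proof (cases "x = 1")
    case False
    hence "1 < x" using that by simp
    thus ?thesis
     using DERIV_isconst_end[of 1 x F] Fc F b0 by (metis less_eq_real_def)
   qed simp
   thus ?thesis using F01 by (simp add: S_def)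
  qed
 qed
qed

lemma lebesgue_on_cong:
 fixes g :: "'b::euclidean_space => real"
 assumes "S \<in> sets lebesgue" "T \<in> sets lebesgue" "!!x. x \<in> T ==> x \<notin> S ==> g x = 0" "!!x. x \<in> S ==> x \<notin> T ==> g x = 0"
 shows "(LINT x|lebesgue_on S. g x) = (LINT x|lebesgue_on T. g x)"
  and "integrable (lebesgue_on S) g \<longleftrightarrow> integrable (lebesgue_on T) g"
proof -
 have e: "(%x. indicator S x *\<^sub>R g x) = (%x. indicator T x *\<^sub>R g x)"
  using assms(3,4) by (auto simp: fun_eq_iff indicator_def)
 show "(LINT x|lebesgue_on S. g x) = (LINT x|lebesgue_on T. g x)"
  using assms(1,2) by (simp add: integral_restrict_space e del: real_scaleR_def)
 show "integrable (lebesgue_on S) g \<longleftrightarrow> integrable (lebesgue_on T) g"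
  using assms(1,2) by (simp add: integrable_restrict_space e del: real_scaleR_def)
qed

lemma lebesgue_on_indicator:
 fixes g :: "'b::euclidean_space => real"
 assumes "S \<in> sets lebesgue" "T \<in> sets lebesgue" "T \<subseteq> S"
 shows "(LINT x|lebesgue_on S. indicator T x * g x) = (LINT x|lebesgue_on T. g x)"
proof -
 have "(LINT x|lebesgue_on S. indicator T x * g x) = (LINT x|lebesgue_on T. indicator T x * g x)"
  by (rule lebesgue_on_cong(1)) (use assms in auto)
 also have "... = (LINT x|lebesgue_on T. g x)" by (rule Bochner_Integration.integral_cong) auto
 finally show ?thesis .
qed

text \<open>The test functions approximate the indicator of \<open>{\<tau><..t}\<close> by a rising
  step just after \<tau> and a falling step just after \<open>t\<close>. The derivatives of the
  steps are unit masses concentrating from the right at points where \<open>f\<close> is continuous;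
  the integral of \<open>q\<close> converges by domination.\<close>

lemma weak_derivative_FTC:
 fixes f q :: "real => real"
 assumes f: "continuous_on {0..} f" and q: "!!R. integrable (lebesgue_on {0<..<R}) q"
  and weak: "!!\<phi>. test_function {0<..} \<phi> ==>
   (LINT t|lebesgue_on {0<..}. deriv \<phi> t * f t) = - (LINT t|lebesgue_on {0<..}. \<phi> t * q t)"
  and \<tau>t: "0 <= \<tau>" "\<tau> <= t"
 shows "f t - f \<tau> = (LINT r|lebesgue_on {\<tau><..t}. q r)"
proof -
 obtain S S' :: "real => real" where S: "smooth S" "!!x. (S has_real_derivative S' x) (at x)" "continuous_on UNIV S'"
  "!!x. 0 <= S' x" "!!x. x \<notin> {0..1} ==> S' x = 0" "!!x. x <= 0 ==> S x = 0" "!!x. 1 <= x ==> S x = 1"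
  using smooth_step by blast
 have Smono: "S x <= S y" if "x <= y" for x y by (rule DERIV_nonneg_imp_nondecreasing[OF that]) (use S(2,4) in blast)
 have S01: "0 <= S x" "S x <= 1" for x using Smono[of 0 x] Smono[of x 1] S(6)[of x] S(6)[of 0] S(7)[of x] S(7)[of 1] by (cases "x <= 0"; cases "1 <= x"; simp)+
 define N where "N n = real (Suc n)" for n
 have N: "N n >= 1" for n by (simp add: N_def)
 have Nev: "eventually (%n. 2 <= N n * e) sequentially" if "e > 0" for e
 proof -
  have "filterlim N at_top sequentially" unfolding N_def by (rule filterlim_compose[OF filterlim_real_sequentially filterlim_Suc])
  hence "eventually (%n. 2 / e <= N n) sequentially" by (simp add: filterlim_at_top)
  thus ?thesis by eventually_elim (use that in \<open>simp add: pos_divide_le_eq\<close>)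
 qed
 \<comment> \<open>The step from 0 to 1 takes place between \<open>c + 1 / N n\<close> and
   \<open>c + 2 / N n\<close>. The gap \<open>1 / N n\<close> keeps the support inside the open
   half-line even for \<open>c = 0\<close>.\<close>
 define K where "K c n x = S (N n * x + (- (N n * c) - 1))" for c n x
 define k where "k c n x = S' (N n * x + (- (N n * c) - 1)) * N n" for c n x
 have ck: "continuous_on A (k c n)" for A c n
  unfolding k_def[abs_def] by (intro continuous_intros continuous_on_compose2[OF S(3)]) auto
 have Kd: "(K c n has_real_derivative k c n x) (at x)" for c n x
  unfolding k_def K_def[abs_def] by (rule DERIV_chain2[OF S(2)]) (auto intro!: derivative_eq_intros)
 have kn: "0 <= k c n x" for c n x using S(4) N[of n] by (simp add: k_def)
 have S'0: "k c n x = 0" if "N n * x < N n * c + 1 \<or> N n * c + 2 < N n * x" for c n x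
  unfolding k_def using S(5)[of "N n * x + (- (N n * c) - 1)"] that unfolding atLeastAtMost_iff by fastforce
 have K0: "K c n x = 0" "k c n x = 0" if "x <= c" for c n x
 proof -
  have "N n * x <= N n * c" using that N[of n] by (intro mult_left_mono) auto
  thus "K c n x = 0" "k c n x = 0" unfolding K_def by (intro S(6) S'0; linarith)+
 qed
 have K1: "K c n x = 1" "k c n x = 0" if "2 < N n * (x - c)" for c n x
  using that unfolding K_def right_diff_distrib by (intro S(7) S'0; linarith)+
 have Kc2: "K c n x = 1" "k c n x = 0" if "c + 2 < x" for c n x
 proof -
  have "2 < 1 * (x - c)" using that by simp
  also have "... <= N n * (x - c)" using that by (intro mult_right_mono N) auto
  finally show "K c n x = 1" "k c n x = 0" by (rule K1)+
 qed
 have ki: "integrable (lebesgue_on {0<..}) (%x. k c n x * f x)"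
  and lim: "(%n. (LINT x|lebesgue_on {0<..}. k c n x * f x)) ----> f c" if c: "c >= 0" for c n
 proof -
  have fc: "continuous_on {c..c+2} f" by (rule continuous_on_subset[OF f]) (use c in auto)
  have ci: "continuous_on {c..c+2} (%x. k c n x * f x)" for n by (intro continuous_intros ck fc)
  have ii: "integrable (lebesgue_on {c..c+2}) (%x. k c n x * f x)" for n by (rule continuous_imp_integrable_real[OF ci])
  have z: "k c n x = 0" if "x \<notin> {c<..c+2}" for n x using that K0(2)[of x c n] Kc2(2)[of c x n] by force
  show "integrable (lebesgue_on {0<..}) (%x. k c n x * f x)"
   by (subst lebesgue_on_cong(2)[of "{0<..}" "{c..c+2}"]) (use ii z c in auto)
  have e: "(LINT x|lebesgue_on {0<..}. k c n x * f x) = integral {c..c+2} (%x. k c n x * f x)" for n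
   unfolding lebesgue_integral_eq_integral[OF ii, symmetric, simplified] by (rule lebesgue_on_cong(1)) (use z c in auto)
  have one: "(k c n has_integral 1) {c..c+2}" for n
  proof -
   have "(k c n has_integral (K c n (c+2) - K c n c)) {c..c+2}"
    by (rule fundamental_theorem_of_calculus)
      (auto intro: has_field_derivative_at_within[OF Kd] simp flip: has_real_derivative_iff_has_vector_derivative)
   thus ?thesis using N[of n] S(6,7) by (simp add: K_def algebra_simps)
  qed
  show "(%n. (LINT x|lebesgue_on {0<..}. k c n x * f x)) ----> f c"
   unfolding e
  proof (rule LIMSEQ_I)
   fix e :: real assume e: "e > 0"
   have "continuous (at c within {c..c+2}) f" using fc by (simp add: continuous_on_eq_continuous_within)
   then obtain d where d: "d > 0" "!!x. x \<in> {c..c+2} ==> dist x c < d ==> dist (f x) (f c) < e / 2"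
    unfolding continuous_within_eps_delta using e by (metis half_gt_zero)
   from Nev[of "d / 2"] d(1) obtain n0 where n0: "!!n. n >= n0 ==> 2 <= N n * (d / 2)" by (auto simp: eventually_sequentially)
   show "EX n0. \<forall>n\<ge>n0. norm (integral {c..c+2} (%x. k c n x * f x) - f c) < e"
   proof (intro exI allI impI)
    fix n assume n: "n >= n0"
    have near: "k c n x * (f c - e / 2) <= k c n x * f x & k c n x * f x <= k c n x * (f c + e / 2)" if x: "x \<in> {c..c+2}" for x
    proof (cases "dist x c < d")
     case True
     thus ?thesis using d(2)[OF x True, unfolded dist_real_def abs_less_iff] kn[of c n x] by (intro conjI mult_left_mono) auto
    next
     case False
     hence "N n * d <= N n * (x - c)" using x N[of n] by (intro mult_left_mono) (auto simp: dist_real_def)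
     thus ?thesis using n0[OF n] K1(2)[of n x c] by simp
    qed
    let ?I = "integral {c..c+2} (%x. k c n x * f x)"
    have i1: "((%x. k c n x * f x) has_integral ?I) {c..c+2}"
     by (intro integrable_integral integrable_continuous_real ci)
    have i2: "((%x. k c n x * a) has_integral a) {c..c+2}" for a using has_integral_mult_left[OF one] by simp
    have "f c - e / 2 <= ?I" by (rule has_integral_le[OF i2 i1]) (use near in blast)
    moreover have "?I <= f c + e / 2" by (rule has_integral_le[OF i1 i2]) (use near in blast)
    ultimately show "norm (?I - f c) < e" using e by (simp add: abs_less_iff)
   qed
  qed
 qed
 define \<phi> where "\<phi> n x = K \<tau> n x + K t n x * (-1)" for n x
 have \<phi>d: "(\<phi> n has_real_derivative k \<tau> n x - k t n x) (at x)" for n x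
  unfolding \<phi>_def[abs_def] by (auto intro!: derivative_eq_intros Kd)
 have \<phi>0: "\<phi> n x = 0" if "x \<notin> {\<tau> + 1 / N n..t + 2}" for n x
 proof (cases "x < \<tau> + 1 / N n")
  case True
  hence "N n * x <= N n * (\<tau> + 1 / N n)" using N[of n] by (intro mult_left_mono) auto
  also have "... = N n * \<tau> + 1" using N[of n] by (simp add: distrib_left)
  finally have "N n * x <= N n * \<tau> + 1" .
  moreover have "N n * \<tau> <= N n * t" using N[of n] \<tau>t by (intro mult_left_mono) auto
  ultimately show ?thesis by (simp add: \<phi>_def K_def S(6))
 next
  case False
  thus ?thesis using Kc2(1)[of \<tau> x n] Kc2(1)[of t x n] that \<tau>t by (simp add: \<phi>_def)
 qed
 have tf: "test_function {0<..} (\<phi> n)" for n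
 proof -
  have "smooth (\<phi> n)" using S(1) unfolding smooth_def \<phi>_def[abs_def] K_def by (intro allI Ck_add Ck_scale Ck_affine) auto
  moreover have "0 < \<tau> + 1 / N n" using \<tau>t by (intro add_nonneg_pos) (auto simp: N_def)
  hence "{\<tau> + 1 / N n..t + 2} \<subseteq> {0<..}" by auto
  ultimately show ?thesis unfolding test_function_def using \<phi>0[of _ n] by (intro conjI exI[of _ "{\<tau> + 1 / N n..t + 2}"]) auto
 qed
 have "(%n. (LINT x|lebesgue_on {0<..}. deriv (\<phi> n) x * f x)) ----> f \<tau> - f t"
  unfolding DERIV_imp_deriv[OF \<phi>d] left_diff_distrib using \<tau>t ki
  by (subst Bochner_Integration.integral_diff) (auto intro!: tendsto_diff lim)
 hence l1: "(%n. (LINT x|lebesgue_on {0<..}. \<phi> n x * q x)) ----> f t - f \<tau>"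
  unfolding weak[OF tf] using tendsto_minus by fastforce
 let ?M = "lebesgue_on {0<..<t+3}"
 have R: "(LINT x|lebesgue_on {0<..}. \<phi> n x * q x) = (LINT x|?M. \<phi> n x * q x)" for n
  by (rule lebesgue_on_cong(1)) (use \<phi>0[of _ n] in auto)
 have qm: "q \<in> borel_measurable ?M" using q by (rule borel_measurable_integrable)
 have m: "g \<in> borel_measurable borel ==> g \<in> borel_measurable ?M" for g :: "real => real"
  by (rule measurable_restrict_space1, rule measurable_completion) simp
 have "(%n. (LINT x|?M. \<phi> n x * q x)) ----> (LINT x|?M. indicator {\<tau><..t} x * q x)"
 proof (rule integral_dominated_convergence[where w="%x. \<bar>q x\<bar>"])
  show "(%x. indicator {\<tau><..t} x * q x) \<in> borel_measurable ?M" by (intro borel_measurable_times qm m) simp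
  show "(%x. \<phi> n x * q x) \<in> borel_measurable ?M" for n
   by (intro borel_measurable_times qm m borel_measurable_continuous_onI continuous_at_imp_continuous_on ballI DERIV_isCont[OF \<phi>d])
  show "integrable ?M (%x. \<bar>q x\<bar>)" using q by (rule Bochner_Integration.integrable_abs)
  show "AE x in ?M. (%n. \<phi> n x * q x) ----> indicator {\<tau><..t} x * q x"
  proof (rule AE_I2, rule tendsto_eventually)
   fix x
   have ev: "eventually (%n. K a n x = indicator {a<..} x) sequentially" for a
   proof (cases "x <= a")
    case False
    hence "eventually (%n. 2 <= N n * (x - a)) sequentially" by (intro Nev) auto
    thus ?thesis by eventually_elim (use False in \<open>simp add: K_def S(7) right_diff_distrib\<close>)
   qed (simp add: K0)
   show "eventually (%n. \<phi> n x * q x = indicator {\<tau><..t} x * q x) sequentially"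
    using ev[of \<tau>] ev[of t] by eventually_elim (use \<tau>t in \<open>auto simp: \<phi>_def indicator_def\<close>)
  qed
  have "\<bar>\<phi> n x\<bar> <= 1" for n x using S01[of "N n * x + (- (N n * \<tau>) - 1)"] S01[of "N n * x + (- (N n * t) - 1)"] unfolding \<phi>_def K_def by linarith
  thus "AE x in ?M. norm (\<phi> n x * q x) <= \<bar>q x\<bar>" for n
   by (intro AE_I2) (simp add: abs_mult mult_left_le_one_le)
 qed
 moreover have "(LINT x|?M. indicator {\<tau><..t} x * q x) = (LINT r|lebesgue_on {\<tau><..t}. q r)"
  by (rule lebesgue_on_indicator) (use \<tau>t in auto)
 ultimately show ?thesis using LIMSEQ_unique[OF l1[unfolded R]] by simp
qed

text \<open>The next point to the right of \<open>t\<close> on the grid of mesh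
  \<open>1 / m\<close>, capped at \<open>K + 1\<close> so that finitely many values occur. Points
  strictly to the right are taken because right-continuity is the strong continuity in time known of
  \<open>w\<close>.\<close>

definition sample :: "nat => nat => real => real" where
 "sample m K t = min (real K + 1) ((real_of_int \<lfloor>real m * t\<rfloor> + 1) / real m)"

lemma sample:
 assumes "m > 0" "t > 0"
 shows "sample m K t > 0" "t <= real K ==> t < sample m K t" "sample m K t <= t + 1 / real m"
proof -
 have f: "real m * t < real_of_int \<lfloor>real m * t\<rfloor> + 1" "real_of_int \<lfloor>real m * t\<rfloor> <= real m * t" by linarith+
 have l: "t < (real_of_int \<lfloor>real m * t\<rfloor> + 1) / real m" using f(1) assms by (simp add: pos_less_divide_eq mult.commute)
 show "sample m K t > 0" unfolding sample_def using l assms by simp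
 show "t < sample m K t" if "t <= real K" unfolding sample_def using l that by simp
 have "(real_of_int \<lfloor>real m * t\<rfloor> + 1) / real m <= (real m * t + 1) / real m" using f(2) assms by (intro divide_right_mono) auto
 also have "... = t + 1 / real m" using assms by (simp add: add_divide_distrib)
 finally show "sample m K t <= t + 1 / real m" unfolding sample_def by simp
qed

lemma sample_simple:
 assumes m: "m > 0" and I: "I \<in> sets lebesgue" "I \<subseteq> {0<..}"
 shows "simple_function (lebesgue_on I) (sample m K)"
proof (rule simple_function_borel_measurable)
 have "sample m K \<in> borel_measurable borel" unfolding sample_def[abs_def] by measurable
 thus "sample m K \<in> borel_measurable (lebesgue_on I)"
  by (intro measurable_restrict_space1 measurable_completion) simp
 have "sample m K ` I \<subseteq> insert (real K + 1) ((%j. real j / real m) ` {..m * (K + 1)})"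
 proof (rule image_subsetI)
  fix t assume "t \<in> I"
  hence t: "t > 0" using I by auto
  show "sample m K t \<in> insert (real K + 1) ((%j. real j / real m) ` {..m * (K + 1)})"
  proof (cases "sample m K t = real K + 1")
   case False
   hence e: "sample m K t = (real_of_int \<lfloor>real m * t\<rfloor> + 1) / real m" "(real_of_int \<lfloor>real m * t\<rfloor> + 1) / real m < real K + 1"
    unfolding sample_def by (simp_all add: min_def split: if_splits)
   have "0 <= \<lfloor>real m * t\<rfloor>" using t by simp
   hence j: "real (nat \<lfloor>real m * t\<rfloor> + 1) = real_of_int \<lfloor>real m * t\<rfloor> + 1" by simp
   have "real (nat \<lfloor>real m * t\<rfloor> + 1) < real (m * (K + 1))"
    using e(2) m unfolding j[symmetric] by (simp add: pos_divide_less_eq algebra_simps)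
   hence "nat \<lfloor>real m * t\<rfloor> + 1 \<in> {..m * (K + 1)}" by (simp only: of_nat_less_iff atMost_iff)
   thus ?thesis unfolding e(1) j[symmetric] by blast
  qed simp
 qed
 thus "finite (sample m K ` space (lebesgue_on I))" by (simp add: finite_subset)
qed

text \<open>Both the sampled function and the mesh may depend on \<open>n\<close>, which covers
  approximations whose modulus of continuity degrades with \<open>n\<close>.\<close>

lemma bochner_measurable_sampling:
 assumes I: "I \<in> sets lebesgue" "I \<subseteq> {0<..}" and F: "!!n t. 0 < t ==> F n t \<in> X" and m: "!!n. m n > 0"
  and l: "!!t. t \<in> I ==> (%n. nrm (%x. F n (sample (m n) n t) x - f t x)) ----> 0"
 shows "bochner_measurable X nrm I f"
 unfolding bochner_measurable_def
proof (intro exI[of _ "%n t. F n (sample (m n) n t)"] conjI allI)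
 show "simple_function (lebesgue_on I) (%t. F n (sample (m n) n t))" for n
  by (rule simple_function_compose1[OF sample_simple[OF m I]])
 show "(%t. F n (sample (m n) n t)) ` I \<subseteq> X" for n
  using F sample(1)[OF m] I(2) by blast
 show "AE t in lebesgue_on I. (%n. nrm (%x. F n (sample (m n) n t) x - f t x)) ----> 0"
  by (rule AE_I2) (use l in simp)
qed

lemma bochner_measurable_right_continuous:
 assumes I: "I \<in> sets lebesgue" "I \<subseteq> {0<..}" and f: "!!t. 0 < t ==> f t \<in> X"
  and l: "!!t. t \<in> I ==> ((%r. nrm (%x. f r x - f t x)) \<longlongrightarrow> 0) (at_right t)"
 shows "bochner_measurable X nrm I f"
proof (rule bochner_measurable_sampling[OF I, of "%n. f" X Suc])
 fix t assume t: "t \<in> I"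
 hence t0: "t > 0" using I by auto
 have "eventually (%n. t <= real n) sequentially" using filterlim_real_sequentially by (simp add: filterlim_at_top)
 hence "eventually (%n. sample (Suc n) n t \<in> {t<..} & sample (Suc n) n t \<noteq> t) sequentially"
  by eventually_elim (metis greaterThan_iff less_irrefl sample(2)[OF zero_less_Suc t0])
 moreover have "(%n. sample (Suc n) n t) ----> t"
 proof (rule tendsto_sandwich[of "%n. t" _ _ "%n. t + 1 / real (Suc n)"])
  show "eventually (%n. t <= sample (Suc n) n t) sequentially"
   using \<open>eventually (%n. t <= real n) sequentially\<close> by eventually_elim (use sample(2)[OF _ t0] in \<open>simp add: less_imp_le\<close>)
  show "eventually (%n. sample (Suc n) n t <= t + 1 / real (Suc n)) sequentially"
   by (intro always_eventually allI sample(3) t0) simp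
  have "(%n. t + 1 / real (Suc n)) ----> t + 0" by (intro tendsto_add tendsto_const lim_1_over_n[THEN LIMSEQ_Suc])
  thus "(%n. t + 1 / real (Suc n)) ----> t" by simp
 qed simp
 ultimately have "filterlim (%n. sample (Suc n) n t) (at_right t) sequentially"
  unfolding filterlim_at by (auto elim: eventually_mono)
 from filterlim_compose[OF l[OF t] this]
 show "(%n. nrm (%x. f (sample (Suc n) n t) x - f t x)) ----> 0" .
qed (use f in auto)

lemma borel_measurable_lebesgue_on_AE_limit:
 fixes g :: "nat => real => real"
 assumes I: "I \<in> sets lebesgue" and g: "!!n. g n \<in> borel_measurable (lebesgue_on I)"
  and l: "AE t in lebesgue_on I. (%n. g n t) ----> f t"
 shows "f \<in> borel_measurable (lebesgue_on I)"
proof -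
 define G where "G n t = (if t \<in> I then g n t else 0)" for n t
 have G: "G n \<in> borel_measurable lebesgue" for n
  unfolding G_def[abs_def] by (rule borel_measurable_if_I[OF g I])
 have "(%t. lim (%n. G n t)) \<in> borel_measurable lebesgue" using G by (rule borel_measurable_lim_metric)
 moreover have "AE t in lebesgue. lim (%n. G n t) = (if t \<in> I then f t else 0)"
 proof -
  have "AE t in lebesgue. t \<in> I --> (%n. g n t) ----> f t" using l I by (simp add: AE_restrict_space_iff)
  thus ?thesis by eventually_elim (auto simp: G_def intro: limI)
 qed
 ultimately have "(%t. if t \<in> I then f t else 0) \<in> borel_measurable lebesgue" by (rule borel_measurable_AE)
 thus ?thesis by (rule borel_measurable_if_D)
qed

text \<open>Only a Lipschitz bound at the values of \<open>f\<close> is asked of \<open>c\<close>,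
  which covers norms as well as evaluations at a test function.\<close>

lemma bochner_measurable_functional:
 assumes "bochner_measurable X nrm I f" "I \<in> sets lebesgue"
  and "AE t in lebesgue_on I. \<forall>\<phi>\<in>X. \<bar>c \<phi> - c (f t)\<bar> <= nrm (%x. \<phi> x - f t x) * K"
 shows "(%t. c (f t)) \<in> borel_measurable (lebesgue_on I)"
proof -
 obtain \<phi> where \<phi>: "!!n::nat. simple_function (lebesgue_on I) (\<phi> n)" "!!n. \<phi> n ` I \<subseteq> X"
  "AE t in lebesgue_on I. (%n. nrm (%x. \<phi> n t x - f t x)) ----> 0"
  using assms(1) unfolding bochner_measurable_def by blast
 show ?thesis
 proof (rule borel_measurable_lebesgue_on_AE_limit[OF assms(2)])
  show "(%t. c (\<phi> n t)) \<in> borel_measurable (lebesgue_on I)" for n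
   by (rule borel_measurable_simple_function[OF simple_function_compose1[OF \<phi>(1)]])
  show "AE t in lebesgue_on I. (%n. c (\<phi> n t)) ----> c (f t)"
   using \<phi>(3) assms(3) AE_space
  proof eventually_elim
   case (elim t)
   hence "\<phi> n t \<in> X" for n using \<phi>(2) by auto
   hence b: "norm (c (\<phi> n t) - c (f t)) <= norm (nrm (%x. \<phi> n t x - f t x)) * \<bar>K\<bar>" for n
    using elim(2) by (auto simp flip: abs_mult intro: order_trans[OF _ abs_ge_self])
   have "(%n. c (\<phi> n t) - c (f t)) ----> 0"
    by (rule tendsto_0_le[OF elim(1), of _ "\<bar>K\<bar>"]) (use b in simp)
   thus ?case by (simp add: LIM_zero_iff)
  qed
 qed
qed

text \<open>Bisecting at the midpoint of the values of \<open>M\<close> halves the bound on the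
  increment of \<open>G\<close> each time, so a bound of second order forces monotonicity. This
  takes the place of differentiating the squared distance of two solutions.\<close>

lemma quadratic_increment_antimono:
 fixes G M :: "real => real"
 assumes M: "continuous_on {0..} M" "!!a b. 0 <= a ==> a <= b ==> M a <= M b"
  and G: "!!a b. 0 <= a ==> a <= b ==> G b - G a <= c * (M b - M a)^2" and ab: "0 <= a" "a <= b"
 shows "G b <= G a"
proof -
 have "G b - G a <= c * (M b - M a)^2 / 2 ^ n" if "0 <= a" "a <= b" for n a b
  using that
 proof (induction n arbitrary: a b)
  case 0 thus ?case using G by simp
 next
  case (Suc n)
  have Mc: "continuous_on {a..b} M" by (rule continuous_on_subset[OF M(1)]) (use Suc.prems in auto)
  have "M a <= (M a + M b) / 2" "(M a + M b) / 2 <= M b" using M(2)[OF Suc.prems] by auto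
  then obtain e where e: "a <= e" "e <= b" "M e = (M a + M b) / 2"
   using IVT'[of M a "(M a + M b) / 2" b, OF _ _ Suc.prems(2) Mc] by blast
  have 1: "M b - M e = (M b - M a) / 2" "M e - M a = (M b - M a) / 2" using e(3) by (simp_all add: field_simps)
  have "G b - G a = (G b - G e) + (G e - G a)" by simp
  also have "... <= c * (M b - M e)^2 / 2 ^ n + c * (M e - M a)^2 / 2 ^ n"
   by (intro add_mono Suc.IH) (use e Suc.prems in linarith)+
  also have "... = c * (M b - M a)^2 / 2 ^ Suc n" unfolding 1 by (simp add: power_divide field_simps)
  finally show ?case .
 qed
 hence le: "G b - G a <= c * (M b - M a)^2 / 2 ^ n" for n using ab by blast
 have "(%n. c * (M b - M a)^2 * (1 / 2) ^ n) ----> c * (M b - M a)^2 * 0"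
  by (intro tendsto_mult tendsto_const LIMSEQ_power_zero) simp
 hence "(%n. c * (M b - M a)^2 / 2 ^ n) ----> 0" by (simp add: power_one_over)
 hence "G b - G a <= 0" by (rule LIMSEQ_le_const) (use le in blast)
 thus ?thesis by simp
qed

lemma Gronwall_zero:
 fixes N :: "real => real"
 assumes N: "continuous_on {0..T} N" "!!t. t \<in> {0..T} ==> 0 <= N t"
  and le: "!!t. t \<in> {0..T} ==> N t <= K * integral {0..t} N" and t: "t \<in> {0..T}"
 shows "N t = 0"
proof (cases "t = 0")
 case True thus ?thesis using le[OF t] N(2)[OF t] by simp
next
 case False
 hence t0: "0 < t" "t <= T" using t by auto
 define Y where "Y r = integral {0..r} N" for r
 have Yc: "continuous_on {0..t} Y"
  unfolding Y_def by (rule indefinite_integral_continuous_1, rule integrable_continuous_real, rule continuous_on_subset[OF N(1)]) (use t0 in auto)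
 have Yd: "(Y has_real_derivative N r) (at r)" if r: "0 < r" "r < t" for r
 proof -
  have "(Y has_real_derivative N r) (at r within {0..T})"
   unfolding Y_def has_real_derivative_iff_has_vector_derivative
   by (rule integral_has_vector_derivative[OF N(1)]) (use r t0 in auto)
  moreover have "at r within {0..T} = at r" by (rule at_within_interior) (use r t0 in simp)
  ultimately show ?thesis by simp
 qed
 have Zd: "((%r. exp (- K * r) * Y r) has_real_derivative (exp (- K * r) * (- K)) * Y r + N r * exp (- K * r)) (at r)" if "0 < r" "r < t" for r
  by (rule DERIV_mult[OF _ Yd[OF that]]) (auto intro!: derivative_eq_intros)
 have "exp (- K * t) * Y t <= exp (- K * 0) * Y 0"
 proof (rule DERIV_nonpos_imp_decreasing_open[of 0 t "%r. exp (- K * r) * Y r"])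
  show "continuous_on {0..t} (%r. exp (- K * r) * Y r)" by (intro continuous_intros Yc)
  fix r assume r: "0 < r" "r < t"
  have "N r <= K * Y r" using le[of r] r t0 by (simp add: Y_def)
  hence "exp (- K * r) * (N r - K * Y r) <= 0" by (intro mult_nonneg_nonpos) auto
  hence "(exp (- K * r) * (- K)) * Y r + N r * exp (- K * r) <= 0" by (simp add: algebra_simps)
  thus "EX y. ((%r. exp (- K * r) * Y r) has_real_derivative y) (at r) & y <= 0" using Zd[OF r] by blast
 qed (use t0 in simp)
 hence "Y t <= 0" by (simp add: Y_def mult_le_0_iff)
 moreover have "0 <= Y t"
  unfolding Y_def by (rule integral_nonneg[OF integrable_continuous_real[OF continuous_on_subset[OF N(1)]]]) (use N(2) t0 in auto)
 ultimately have "Y t = 0" by simp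
 thus ?thesis using le[OF t] N(2)[OF t] unfolding Y_def by simp
qed

lemma integrable_lebesgue_on_subset:
 fixes f :: "'b::euclidean_space => real"
 assumes "integrable (lebesgue_on S) f" "S \<in> sets lebesgue" "T \<in> sets lebesgue" "T \<subseteq> S"
 shows "integrable (lebesgue_on T) f"
proof -
 have "set_integrable lebesgue S f" using assms(1,2) by (simp add: set_integrable_def integrable_restrict_space)
 hence "set_integrable lebesgue T f" by (rule set_integrable_subset) (use assms in auto)
 thus ?thesis using assms(3) by (simp add: set_integrable_def integrable_restrict_space)
qed

lemma AE_lebesgue_on_subset:
 assumes "AE t in lebesgue_on S. P t" "S \<in> sets lebesgue" "T \<in> sets lebesgue" "T \<subseteq> S"
 shows "AE t in lebesgue_on T. P t"
 using assms by (auto simp: AE_restrict_space_iff elim: AE_mp)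

lemma X0_norm_minus:
 assumes a: "0 < a" "a < 1" and "u \<in> X0 \<Omega> a" "v \<in> X0 \<Omega> a"
 shows "X0_norm a (%x. u x - v x) = norm (emb a u - emb a v)"
 using X0_norm_emb[OF a X0_diff(1)[OF a assms(3,4)]] X0_diff(2)[OF a assms(3,4)] by simp

lemma bochner_L2_inner_integrable:
 assumes a: "0 < a" "a < 1" and z: "bochner_L2 (X0 \<Omega> a) (X0_norm a) {0<..} z"
 shows "(%t. emb a (z t) \<bullet> h) \<in> borel_measurable (lebesgue_on {0<..})"
  and "(%t. (norm (emb a (z t)))^2) \<in> borel_measurable (lebesgue_on {0<..})"
  and "integrable (lebesgue_on {0<..}) (%t. (norm (emb a (z t)))^2)"
  and "integrable (lebesgue_on {0<..<R}) (%t. emb a (z t) \<bullet> h)"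
  and "integrable (lebesgue_on {0<..<R}) (%t. norm (emb a (z t)))"
proof -
 have zX: "AE t in lebesgue_on {0<..}. z t \<in> X0 \<Omega> a" and zm: "bochner_measurable (X0 \<Omega> a) (X0_norm a) {0<..} z"
  and zi: "integrable (lebesgue_on {0<..}) (%t. (X0_norm a (z t))^2)"
  using z unfolding bochner_L2_def by auto
 have "AE t in lebesgue_on {0<..}. \<forall>\<phi>\<in>X0 \<Omega> a. \<bar>emb a \<phi> \<bullet> h - emb a (z t) \<bullet> h\<bar> <= X0_norm a (%x. \<phi> x - z t x) * norm h"
  using zX by eventually_elim (auto simp: X0_norm_minus[OF a, of _ \<Omega>] inner_diff_left[symmetric] intro: Cauchy_Schwarz_ineq2)
 from bochner_measurable_functional[OF zm _ this]
 show m1: "(%t. emb a (z t) \<bullet> h) \<in> borel_measurable (lebesgue_on {0<..})" by simp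
 have "AE t in lebesgue_on {0<..}. \<forall>\<phi>\<in>X0 \<Omega> a. \<bar>norm (emb a \<phi>) - norm (emb a (z t))\<bar> <= X0_norm a (%x. \<phi> x - z t x) * 1"
  using zX by eventually_elim (auto simp: X0_norm_minus[OF a, of _ \<Omega>] norm_triangle_ineq3)
 from bochner_measurable_functional[OF zm _ this]
 have m2: "(%t. norm (emb a (z t))) \<in> borel_measurable (lebesgue_on {0<..})" by simp
 thus m3: "(%t. (norm (emb a (z t)))^2) \<in> borel_measurable (lebesgue_on {0<..})" by measurable
 have "AE t in lebesgue_on {0<..}. (X0_norm a (z t))^2 = (norm (emb a (z t)))^2"
  using zX by eventually_elim (simp add: X0_norm_emb[OF a])
 from integrable_cong_AE_imp[OF zi m3] this
 show i: "integrable (lebesgue_on {0<..}) (%t. (norm (emb a (z t)))^2)" by auto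
 have sub: "{0<..<R} \<in> sets lebesgue" "{0<..<R} \<subseteq> {0<..}" by auto
 have iR: "integrable (lebesgue_on {0<..<R}) (%t. (norm (emb a (z t)))^2 + c)" for c
 proof (rule Bochner_Integration.integrable_add)
  show "integrable (lebesgue_on {0<..<R}) (%t. (norm (emb a (z t)))^2)"
   by (rule integrable_lebesgue_on_subset[OF i]) auto
  have "integrable (lebesgue_on {0..R}) (%t. c)" by (rule continuous_imp_integrable_real) auto
  thus "integrable (lebesgue_on {0<..<R}) (%t. c)" by (rule integrable_lebesgue_on_subset) auto
 qed
 have sq: "x * y <= x^2 + y^2" for x y :: real
  using sum_squares_bound[of x y] zero_le_power2[of x] zero_le_power2[of y] by linarith
 have mr: "f \<in> borel_measurable (lebesgue_on {0<..}) ==> f \<in> borel_measurable (lebesgue_on {0<..<R})" for f :: "real => real"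
  by (rule measurable_restrict_mono) auto
 show "integrable (lebesgue_on {0<..<R}) (%t. emb a (z t) \<bullet> h)"
 proof (rule Bochner_Integration.integrable_bound[OF iR[of "(norm h)^2"] mr[OF m1]], rule AE_I2)
  fix t
  have "\<bar>emb a (z t) \<bullet> h\<bar> <= norm (emb a (z t)) * norm h" by (rule Cauchy_Schwarz_ineq2)
  also have "... <= (norm (emb a (z t)))^2 + (norm h)^2" by (rule sq)
  finally show "norm (emb a (z t) \<bullet> h) <= norm ((norm (emb a (z t)))^2 + (norm h)^2)" by simp
 qed
 show "integrable (lebesgue_on {0<..<R}) (%t. norm (emb a (z t)))"
 proof (rule Bochner_Integration.integrable_bound[OF iR[of "1^2"] mr[OF m2]], rule AE_I2)
  fix t show "norm (norm (emb a (z t))) <= norm ((norm (emb a (z t)))^2 + 1^2)"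
   using sq[of "norm (emb a (z t))" 1] by simp
 qed
qed

abbreviation "X0_dual \<Omega> a \<equiv> dual_space (X0 \<Omega> a) (X0_norm a)"
abbreviation "X0_dual_norm \<Omega> a \<equiv> dual_norm (X0 \<Omega> a) (X0_norm a)"

lemma dual_spaceI:
 assumes a: "0 < a" "a < 1" and F: "!!v. v \<in> X0 \<Omega> a ==> F v = Z \<bullet> emb a v"
 shows "F \<in> X0_dual \<Omega> a"
 unfolding dual_space_def
proof (intro CollectI conjI ballI allI exI[of _ "norm Z"])
 show "F (%x. b * u x + c * v x) = b * F u + c * F v" if "u \<in> X0 \<Omega> a" "v \<in> X0 \<Omega> a" for u v b c
  using X0_linear[OF a that, of b c] by (simp add: F that inner_add_right)
 show "\<bar>F v\<bar> <= norm Z * X0_norm a v" if "v \<in> X0 \<Omega> a" for v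
  using Cauchy_Schwarz_ineq2[of Z "emb a v"] that by (simp add: F X0_norm_emb[OF a])
qed

lemma dual_norm_representation:
 assumes a: "0 < a" "a < 1" and F: "!!v. v \<in> X0 \<Omega> a ==> F v = Z \<bullet> emb a v" and z: "z \<in> X0 \<Omega> a" "Z = emb a z"
 shows "X0_dual_norm \<Omega> a F = norm Z"
proof -
 let ?S = "{v \<in> X0 \<Omega> a. X0_norm a v <= 1}"
 have le: "\<bar>F v\<bar> <= norm Z" if "v \<in> ?S" for v
 proof -
  have "\<bar>F v\<bar> <= norm Z * norm (emb a v)" using that Cauchy_Schwarz_ineq2[of Z "emb a v"] by (simp add: F)
  also have "... <= norm Z * 1" using that by (intro mult_left_mono) (auto simp: X0_norm_emb[OF a])
  finally show ?thesis by simp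
 qed
 have "(%x. 0) \<in> ?S" using X0_0[OF a, of \<Omega>] by (simp add: X0_norm_def split_def)
 hence ne: "?S \<noteq> {}" by blast
 have bdd: "bdd_above ((%v. \<bar>F v\<bar>) ` ?S)" using le by (intro bdd_aboveI2) auto
 have "norm Z <= (SUP v\<in>?S. \<bar>F v\<bar>)"
 proof (cases "Z = 0")
  case True
  thus ?thesis using cSUP_upper[OF \<open>(%x. 0) \<in> ?S\<close> bdd] by (simp add: order_trans[OF abs_ge_zero])
 next
  case False
  define v where "v x = (1 / norm Z) * z x + 0 * z x" for x
  note l = X0_linear[OF a z(1) z(1), of "1 / norm Z" 0, folded v_def]
  have ev: "emb a v = (1 / norm Z) *\<^sub>R Z" using l(2) by (simp add: z(2))
  have vS: "v \<in> ?S" using l(1) False by (simp add: X0_norm_emb[OF a l(1)] ev)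
  have "F v = norm Z" using False F[OF l(1)] by (simp add: ev dot_square_norm power2_eq_square)
  thus ?thesis using cSUP_upper[OF vS bdd] by simp
 qed
 thus ?thesis unfolding dual_norm_def by (intro antisym cSUP_least ne le) auto
qed

lemma dual_norm_bound:
 assumes a: "0 < a" "a < 1" and F: "F \<in> X0_dual \<Omega> a" and v: "v \<in> X0 \<Omega> a"
 shows "\<bar>F v\<bar> <= X0_dual_norm \<Omega> a F * X0_norm a v"
proof -
 let ?S = "{v \<in> X0 \<Omega> a. X0_norm a v <= 1}"
 obtain C where C: "!!v. v \<in> X0 \<Omega> a ==> \<bar>F v\<bar> <= C * X0_norm a v" using F unfolding dual_space_def by blast
 have lin: "F (%x. b * u x + c * w x) = b * F u + c * F w" if "u \<in> X0 \<Omega> a" "w \<in> X0 \<Omega> a" for u w b c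
  using F that unfolding dual_space_def by blast
 have n0: "0 <= X0_norm a v" if "v \<in> X0 \<Omega> a" for v using that by (simp add: X0_norm_emb[OF a])
 have bdd: "bdd_above ((%v. \<bar>F v\<bar>) ` ?S)"
 proof (rule bdd_aboveI2)
  fix v assume v: "v \<in> ?S"
  have "\<bar>F v\<bar> <= C * X0_norm a v" using C v by blast
  also have "... <= \<bar>C\<bar> * 1" using v n0 by (intro mult_mono) auto
  finally show "\<bar>F v\<bar> <= \<bar>C\<bar> * 1" .
 qed
 show ?thesis
 proof (cases "X0_norm a v = 0")
  case True
  thus ?thesis using C[OF v] by simp
 next
  case False
  hence p: "X0_norm a v > 0" using n0[OF v] by simp
  define k where "k x = (1 / X0_norm a v) * v x + 0 * v x" for x
  note l = X0_linear[OF a v v, of "1 / X0_norm a v" 0, folded k_def]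
  have "X0_norm a k = 1" using l(2) p by (simp add: X0_norm_emb[OF a l(1)] X0_norm_emb[OF a v])
  hence kS: "k \<in> ?S" using l(1) by simp
  have "F k = 1 / X0_norm a v * F v + 0 * F v" unfolding k_def by (rule lin[OF v v])
  hence "F k = F v / X0_norm a v" by simp
  hence "\<bar>F v\<bar> / X0_norm a v = \<bar>F k\<bar>" using p by simp
  also have "... <= X0_dual_norm \<Omega> a F" unfolding dual_norm_def by (rule cSUP_upper[OF kS bdd])
  finally show ?thesis using p by (simp add: pos_divide_le_eq)
 qed
qed

lemma dual_space_diff:
 assumes F: "F \<in> dual_space X n" and G: "G \<in> dual_space X n"
 shows "(%v. F v - G v) \<in> dual_space X n"
proof -
 obtain C D where CD: "!!v. v \<in> X ==> \<bar>F v\<bar> <= C * n v" "!!v. v \<in> X ==> \<bar>G v\<bar> <= D * n v"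
  using F G unfolding dual_space_def by blast
 have "\<bar>F v - G v\<bar> <= (C + D) * n v" if "v \<in> X" for v
  using CD[OF that] abs_triangle_ineq4[of "F v" "G v"] unfolding distrib_right by linarith
 moreover have "F (%x. a * u x + b * v x) - G (%x. a * u x + b * v x) = a * (F u - G u) + b * (F v - G v)"
  if "u \<in> X" "v \<in> X" for u v a b
 proof -
  have "F (%x. a * u x + b * v x) = a * F u + b * F v" "G (%x. a * u x + b * v x) = a * G u + b * G v"
   using F G that unfolding dual_space_def by blast+
  thus ?thesis by (simp add: algebra_simps)
 qed
 ultimately show ?thesis unfolding dual_space_def by blast
qed

lemma dual_difference:
 assumes a: "0 < a" "a < 1" and F: "F \<in> X0_dual \<Omega> a" and u: "u \<in> X0 \<Omega> a" and v: "v \<in> X0 \<Omega> a"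
 shows "\<bar>F u - F v\<bar> <= X0_dual_norm \<Omega> a F * norm (emb a u - emb a v)"
proof -
 have "F (%x. 1 * u x + (-1) * v x) = 1 * F u + (-1) * F v"
  using F u v unfolding dual_space_def by blast
 hence e: "F u - F v = F (%x. u x - v x)" by simp
 show ?thesis unfolding e X0_norm_minus[OF a u v, symmetric] by (rule dual_norm_bound[OF a F X0_diff(1)[OF a u v]])
qed

lemma continuous_on_dist_le:
 assumes "continuous_on S f" "!!x y. x \<in> S ==> y \<in> S ==> dist (g x) (g y) <= K * dist (f x) (f y)"
 shows "continuous_on S g"
 unfolding continuous_on_def
proof
 fix x assume x: "x \<in> S"
 have "((%y. K * dist (f y) (f x)) \<longlongrightarrow> K * dist (f x) (f x)) (at x within S)"
  using assms(1) x by (intro tendsto_intros) (simp add: continuous_on_def)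
 hence "((%y. K * dist (f y) (f x)) \<longlongrightarrow> 0) (at x within S)" by simp
 thus "(g \<longlongrightarrow> g x) (at x within S)"
  by (subst tendsto_dist_iff, rule Lim_null_comparison[rotated]) (use assms(2) x in \<open>simp add: eventually_at_topological\<close>, blast)
qed

text \<open>The assumptions do not mention how the flow was constructed, and they survive replacing
  each \<open>u t\<close> by an almost everywhere equal measurable function. So every weak solution
  satisfies them, with the same \<open>w\<close> and \<open>U\<close>, once uniqueness is
  known.\<close>

locale cahn_hilliard_flow = cahn_hilliard +
 fixes u w :: "real => 'a => real" and U :: "real => ('a \<times> 'a) l2"
 assumes uU: "!!t. 0 <= t ==> rep (u t) (U t)" and uB: "!!t. 0 <= t ==> integrable lebesgue (%x. B (u t x))"
  and wX: "!!t. w t \<in> X0 \<Omega> s" and sg: "!!t. 0 < t ==> subgrad (U t) (emb s (w t))"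
  and Uc: "continuous_on {0..} U"
  and Ud: "!!t h. 0 < t ==> ((%r. U r \<bullet> h) has_real_derivative - (emb s (w t) \<bullet> h)) (at t)"
  and Wr: "!!t. 0 < t ==> ((%r. emb s (w r)) \<longlongrightarrow> emb s (w t)) (at_right t)"
  and Wexp: "!!r t. 0 < r ==> r <= t ==> norm (emb s (w t)) <= exp (4 * CC * (t - r)) * norm (emb s (w r))"
  and Ec: "continuous_on {0..} (%t. E0 (u t))"
  and Ei: "!!\<tau> t. 0 <= \<tau> ==> \<tau> <= t ==> ((%r. (norm (emb s (w r)))^2) has_integral (E0 (u \<tau>) - E0 (u t))) {\<tau>..t}"

lemma (in cahn_hilliard) flow_exists:
 assumes u0: "u0 \<in> X0 \<Omega> \<sigma>" "integrable lebesgue (%x. B (u0 x))"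
 obtains u w U where "cahn_hilliard_flow \<Omega> s \<sigma> lam \<kappa> g ghat \<beta> \<beta>hat u w U" "u 0 = u0"
proof -
 interpret gradient_flow V0 DD Phi CC mm by (rule gradient_flow)
 obtain U0 where U0: "rep u0 U0" using rep_exists[OF u0(1)] by blast
 hence D0: "U0 \<in> DD" using DD_rep u0(2) by blast
 obtain U W where F: "U 0 = U0" "continuous_on {0..} U" "!!t. t >= 0 ==> U t \<in> DD"
  "!!t. t > 0 ==> subgrad (U t) (W t)"
  "!!t h. t > 0 ==> ((%r. U r \<bullet> h) has_real_derivative - (W t \<bullet> h)) (at t)"
  "!!t. t > 0 ==> (W \<longlongrightarrow> W t) (at_right t)"
  "!!r t. 0 < r ==> r <= t ==> norm (W t) <= exp (4 * CC * (t - r)) * norm (W r)"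
  "continuous_on {0..} (%t. Phi (U t))"
  "!!\<tau> t. 0 <= \<tau> ==> \<tau> <= t ==> ((%r. (norm (W r))^2) has_integral (Phi (U \<tau>) - Phi (U t))) {\<tau>..t}"
  by (rule gradient_flow_exists[OF D0]) (rule that; assumption)
 have "ALL t. EX v. 0 <= t --> rep v (U t) & integrable lebesgue (%x. B (v x))" using F(3) unfolding DD_def by blast
 then obtain v where v: "!!t. 0 <= t ==> rep (v t) (U t)" "!!t. 0 <= t ==> integrable lebesgue (%x. B (v t x))" by metis
 have "ALL t. \<exists>z\<in>X0 \<Omega> s. 0 < t --> W t = emb s z"
 proof
  fix t show "\<exists>z\<in>X0 \<Omega> s. 0 < t --> W t = emb s z"
   using subgrad_emb[OF F(4), of t] X0_0[OF s, of \<Omega>] by (cases "0 < t") auto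
 qed
 then obtain w where w: "!!t. w t \<in> X0 \<Omega> s" "!!t. 0 < t ==> W t = emb s (w t)" by metis
 \<comment> \<open>The function chosen at time zero agrees with \<open>u0\<close> only almost
   everywhere and is replaced by \<open>u0\<close> itself.\<close>
 define u where "u t = (if t = 0 then u0 else v t)" for t
 have uU: "rep (u t) (U t)" if "0 <= t" for t using v(1)[OF that] U0 F(1) by (simp add: u_def)
 have Pu: "Phi (U t) = E0 (u t)" if "0 <= t" for t by (rule Phi_rep[OF uU[OF that]])
 have "cahn_hilliard_flow \<Omega> s \<sigma> lam \<kappa> g ghat \<beta> \<beta>hat u w U"
 proof (intro cahn_hilliard_flow.intro cahn_hilliard_flow_axioms.intro cahn_hilliard_axioms)
  show "rep (u t) (U t)" if "0 <= t" for t by (rule uU[OF that])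
  show "integrable lebesgue (%x. B (u t x))" if "0 <= t" for t using v(2)[OF that] u0(2) by (simp add: u_def)
  show "w t \<in> X0 \<Omega> s" for t by (rule w)
  show "subgrad (U t) (emb s (w t))" if "0 < t" for t using F(4)[OF that] w(2)[OF that] by simp
  show "continuous_on {0..} U" by (rule F(2))
  show "((%r. U r \<bullet> h) has_real_derivative - (emb s (w t) \<bullet> h)) (at t)" if "0 < t" for t h using F(5)[OF that] w(2)[OF that] by simp
  show "((%r. emb s (w r)) \<longlongrightarrow> emb s (w t)) (at_right t)" if t: "0 < t" for t
  proof (rule Lim_transform_eventually)
   show "(W \<longlongrightarrow> emb s (w t)) (at_right t)" using F(6)[OF t] w(2)[OF t] by simp
   show "eventually (%r. W r = emb s (w r)) (at_right t)"
    using eventually_at_right_less[of t] by eventually_elim (use t w(2) in auto)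
  qed
  show "norm (emb s (w t)) <= exp (4 * CC * (t - r)) * norm (emb s (w r))" if "0 < r" "r <= t" for r t
   using F(7)[OF that] w(2)[of t] w(2)[of r] that by simp
  show "continuous_on {0..} (%t. E0 (u t))" by (rule continuous_on_eq[OF F(8)]) (use Pu in auto)
  show "((%r. (norm (emb s (w r)))^2) has_integral (E0 (u \<tau>) - E0 (u t))) {\<tau>..t}" if "0 <= \<tau>" "\<tau> <= t" for \<tau> t
  proof (rule has_integral_spike_finite)
   show "((%r. (norm (W r))^2) has_integral (E0 (u \<tau>) - E0 (u t))) {\<tau>..t}" using F(9)[OF that] Pu that by simp
   show "(norm (emb s (w r)))^2 = (norm (W r))^2" if "r \<in> {\<tau>..t} - {0}" for r
    using w(2)[of r] that \<open>0 <= \<tau>\<close> by auto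
  qed simp
 qed
 thus thesis by (rule that) (simp add: u_def)
qed

context cahn_hilliard_flow
begin

abbreviation "W t \<equiv> emb s (w t)"

lemma uX: "0 <= t ==> u t \<in> X0 \<Omega> \<sigma>" by (rule rep_X0[OF uU])

text \<open>Strong convexity at the midpoint of \<open>U t\<close> and \<open>U (x n)\<close> bounds
  a sixteenth of the squared distance in \<open>X0 \<Omega> \<sigma>\<close> by the gap between the
  averaged energies and the energy of the midpoint, up to a term vanishing with the dual distance.
  Continuity of the energy and lower semicontinuity at the midpoints close this gap.\<close>

lemma emb_continuous: "continuous_on {0..} (%t. emb \<sigma> (u t))"
 unfolding continuous_on_sequentially
proof (intro ballI allI impI, elim conjE)
 interpret gradient_flow V0 DD Phi CC mm by (rule gradient_flow)
 fix x :: "nat => real" and t assume t: "t \<in> {0..}" and x: "ALL n. x n \<in> {0..}" and xt: "x ----> t"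
 hence t: "t >= 0" and x: "!!n. x n >= 0" by auto
 have Ux: "(%n. U (x n)) ----> U t" and Ex: "(%n. E0 (u (x n))) ----> E0 (u t)"
  using Uc Ec xt x t unfolding continuous_on_sequentially by (auto simp: o_def)
 define X where "X n = (1 - 1/2) *\<^sub>R U t + (1/2) *\<^sub>R U (x n)" for n
 have "(0::real) <= 1/2" "(1/2::real) <= 1" by auto
 note sc = strong_semiconvexity[OF uU[OF t] uB[OF t] uU[OF x] uB[OF x] this]
 define a where "a n = (1 - 1/2) * E0 (u t) + 1/2 * E0 (u (x n)) + CC / 2 * (1/2) * (1 - 1/2) * (norm (U t - U (x n)))^2" for n
 define q where "q n = (norm (emb \<sigma> (u t) - emb \<sigma> (u (x n))))^2" for n
 have qa: "q n / 16 <= a n - Phi (X n)" for n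
  using sc(3)[of n] unfolding X_def Phi_rep[OF sc(1)[of n]] a_def q_def by simp
 have "X ----> (1 - 1/2) *\<^sub>R U t + (1/2) *\<^sub>R U t" unfolding X_def by (intro tendsto_intros Ux)
 hence Xl: "X ----> U t" by (simp flip: scaleR_add_left)
 have "a ----> (1 - 1/2) * E0 (u t) + 1/2 * E0 (u t) + CC / 2 * (1/2) * (1 - 1/2) * (norm (U t - U t))^2"
  unfolding a_def by (intro tendsto_intros Ux Ex)
 hence al: "a ----> Phi (U t)" by (simp add: Phi_rep[OF uU[OF t]])
 have "q ----> 0"
 proof (rule order_tendstoI)
  show "eventually (%n. b < q n) sequentially" if "b < 0" for b
   using less_le_trans[OF that zero_le_power2] by (simp add: q_def)
  show "eventually (%n. q n < b) sequentially" if b: "0 < b" for b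
  proof -
   have "X n \<in> DD" for n unfolding X_def using sc(2)[of n] DD_rep[OF sc(1)[of n]] by simp
   from lsc_eventually[OF this Xl, of "Phi (U t) - b / 32"] have "eventually (%n. Phi (U t) - b / 32 < Phi (X n)) sequentially" using b by simp
   moreover have "eventually (%n. a n < Phi (U t) + b / 32) sequentially" using order_tendstoD(2)[OF al] b by simp
   ultimately show ?thesis
   proof eventually_elim
    case (elim n)
    thus ?case using qa[of n] by simp
   qed
  qed
 qed
 from tendsto_real_sqrt[OF this] have "(%n. norm (emb \<sigma> (u (x n)) - emb \<sigma> (u t))) ----> 0"
  by (simp add: q_def norm_minus_commute)
 thus "((%t. emb \<sigma> (u t)) \<circ> x) ----> emb \<sigma> (u t)" unfolding o_def by (rule LIM_zero_cancel[OF tendsto_norm_zero_cancel])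
qed

lemma mk_continuous: "continuous_on {0..} (%t. mk (u t))"
proof -
 obtain K where K: "K > 0" "!!v. v \<in> X0 \<Omega> \<sigma> ==> norm (mk v) <= K * norm (emb \<sigma> v)"
  using X0_Poincare[OF \<sigma> \<Omega>(2)] by blast
 show ?thesis
 proof (rule continuous_on_dist_le[OF emb_continuous])
  fix r t :: real assume "r \<in> {0..}" "t \<in> {0..}"
  hence "u r \<in> X0 \<Omega> \<sigma>" "u t \<in> X0 \<Omega> \<sigma>" using uX by auto
  note f = X0_diff[OF \<sigma> this]
  show "dist (mk (u r)) (mk (u t)) <= K * dist (emb \<sigma> (u r)) (emb \<sigma> (u t))"
   using K(2)[OF f(1)] by (simp add: f dist_norm)
 qed
qed

lemma E0_antimono: "0 <= \<tau> ==> \<tau> <= t ==> E0 (u t) <= E0 (u \<tau>)"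
 using has_integral_nonneg[OF Ei[of \<tau> t]] by simp

lemma emb_bounded: "EX S. \<forall>t\<ge>0. norm (emb \<sigma> (u t)) <= S"
proof -
 obtain k c where kc: "k > 0" "c >= 0" "!!u. u \<in> X0 \<Omega> \<sigma> ==> integrable lebesgue (%x. B (u x)) ==> k * (norm (emb \<sigma> u))^2 - c <= E0 u"
  using E0_coercive by blast
 have "norm (emb \<sigma> (u t)) <= sqrt ((E0 (u 0) + c) / k)" if t: "t >= 0" for t
 proof (rule real_le_rsqrt)
  have "k * (norm (emb \<sigma> (u t)))^2 <= E0 (u 0) + c" using kc(3)[OF uX[OF t] uB[OF t]] E0_antimono[of 0 t] t by simp
  thus "(norm (emb \<sigma> (u t)))^2 <= (E0 (u 0) + c) / k" using kc(1) by (simp add: pos_le_divide_eq mult.commute)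
 qed
 thus ?thesis by blast
qed

text \<open>The total dissipation is finite because the energy is bounded below; monotone
  convergence passes to the half-line.\<close>

lemma W_square_integrable: "integrable (lebesgue_on {0..}) (%r. (norm (W r))^2)"
proof -
 define h where "h r = (norm (W r))^2" for r
 define f where "f n r = (if r \<in> {0..real n} then h r else 0)" for n :: nat and r
 have fi: "(f n has_integral (E0 (u 0) - E0 (u (real n)))) {0..}" for n
  unfolding f_def[abs_def] using Ei[of 0 "real n"] by (subst has_integral_restrict) (auto simp: h_def[abs_def])
 have lower: "mm <= E0 (u t)" if "t >= 0" for t using mm[of "U t"] DD_rep[OF uU[OF that]] uB[OF that] Phi_rep[OF uU[OF that]] by simp
 have "h integrable_on {0..} & (%n. integral {0..} (f n)) ----> integral {0..} h"
 proof (rule monotone_convergence_increasing)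
  show "f n integrable_on {0..}" for n using fi by blast
  show "f n r <= f (Suc n) r" for n r by (auto simp: f_def h_def)
  show "(%n. f n r) ----> h r" if "r \<in> {0..}" for r
  proof (rule tendsto_eventually)
   have "eventually (%n. r <= real n) sequentially" using filterlim_real_sequentially by (simp add: filterlim_at_top)
   thus "eventually (%n. f n r = h r) sequentially" by eventually_elim (use that in \<open>simp add: f_def\<close>)
  qed
  have "\<bar>integral {0..} (f n)\<bar> <= E0 (u 0) - mm" for n
   using integral_unique[OF fi[of n]] lower[of "real n"] E0_antimono[of 0 "real n"] by simp
  thus "bounded (range (%n. integral {0..} (f n)))" by (intro boundedI[of _ "E0 (u 0) - mm"]) auto
 qed
 hence "h absolutely_integrable_on {0..}" by (intro nonnegative_absolutely_integrable_1) (auto simp: h_def)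
 hence "integrable (lebesgue_on {0..}) h" by (simp add: set_integrable_def integrable_restrict_space)
 thus ?thesis by (simp add: h_def[abs_def])
qed

lemma W_square_integral:
 assumes "0 <= \<tau>" "\<tau> <= t"
 shows "(LINT r|lebesgue_on {\<tau>..t}. (norm (W r))^2) = E0 (u \<tau>) - E0 (u t)"
proof -
 have "integrable (lebesgue_on {\<tau>..t}) (%r. (norm (W r))^2)"
  by (rule integrable_lebesgue_on_subset[OF W_square_integrable]) (use assms in auto)
 from lebesgue_integral_eq_integral[OF this] show ?thesis using integral_unique[OF Ei[OF assms]] by simp
qed

lemma w_bochner_L2: "bochner_L2 (X0 \<Omega> s) (X0_norm s) {0<..} w"
 unfolding bochner_L2_def
proof (intro conjI)
 show "AE t in lebesgue_on {0<..}. w t \<in> X0 \<Omega> s" using wX by simp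
 show "bochner_measurable (X0 \<Omega> s) (X0_norm s) {0<..} w"
 proof (rule bochner_measurable_right_continuous)
  fix t :: real assume "t \<in> {0<..}"
  hence "((%r. norm (W r - W t)) \<longlongrightarrow> 0) (at_right t)"
   by (intro tendsto_norm_zero LIM_zero Wr) simp
  thus "((%r. X0_norm s (%x. w r x - w t x)) \<longlongrightarrow> 0) (at_right t)"
   by (simp add: X0_norm_minus[OF s wX wX])
 qed (use wX in auto)
 show "integrable (lebesgue_on {0<..}) (%t. (X0_norm s (w t))^2)"
  unfolding X0_norm_emb[OF s wX] by (rule integrable_lebesgue_on_subset[OF W_square_integrable]) auto
qed

lemma u_weakly_continuous: "weakly_continuous_on (X0 \<Omega> \<sigma>) (X0_norm \<sigma>) {0..} u"
 unfolding weakly_continuous_on_def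
proof (intro conjI ballI)
 show "u t \<in> X0 \<Omega> \<sigma>" if "t \<in> {0..}" for t using uX that by simp
 fix F assume F: "F \<in> X0_dual \<Omega> \<sigma>"
 show "continuous_on {0..} (%t. F (u t))"
  by (rule continuous_on_dist_le[OF emb_continuous]) (use dual_difference[OF \<sigma> F uX uX] in \<open>simp add: dist_norm\<close>)
qed

end

section \<open>The constructed flow is a weak solution\<close>

context cahn_hilliard_flow
begin

lemma L2_embed_u: "0 <= t ==> v \<in> X0 \<Omega> s ==> L2_embed \<Omega> (u t) v = U t \<bullet> emb s v"
 using L2_embed_mk[OF X0_sq[OF \<sigma> uX] X0_sq[OF s] \<Omega>s X0_out[OF s], of t v \<Omega>] rep_inner[OF uU] by simp

definition ut :: "real => ('a => real) => real" where "ut t v = - frac_op s (w t) v"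

lemma ut: "v \<in> X0 \<Omega> s ==> ut t v = - W t \<bullet> emb s v"
 unfolding ut_def using frac_op_emb[OF s wX] by simp

lemma ut_bochner_L2: "bochner_L2 (X0_dual \<Omega> s) (X0_dual_norm \<Omega> s) {0<..} ut"
 unfolding bochner_L2_def
proof (intro conjI)
 have d: "ut t \<in> X0_dual \<Omega> s" for t by (rule dual_spaceI[OF s ut])
 show "AE t in lebesgue_on {0<..}. ut t \<in> X0_dual \<Omega> s" using d by simp
 have n: "X0_dual_norm \<Omega> s (%v. ut r v - ut t v) = norm (W r - W t)" for r t
 proof -
  note f = X0_diff[OF s wX wX, of t r]
  have "X0_dual_norm \<Omega> s (%v. ut r v - ut t v) = norm (W t - W r)"
   by (rule dual_norm_representation[OF s _ f(1) f(2)[symmetric]]) (simp add: ut inner_diff_left)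
  thus ?thesis by (simp add: norm_minus_commute)
 qed
 show "bochner_measurable (X0_dual \<Omega> s) (X0_dual_norm \<Omega> s) {0<..} ut"
 proof (rule bochner_measurable_right_continuous)
  fix t :: real assume "t \<in> {0<..}"
  hence "((%r. norm (W r - W t)) \<longlongrightarrow> 0) (at_right t)"
   by (intro tendsto_norm_zero LIM_zero Wr) simp
  thus "((%r. X0_dual_norm \<Omega> s (%x. ut r x - ut t x)) \<longlongrightarrow> 0) (at_right t)" by (simp add: n)
 qed (use d in auto)
 have "X0_dual_norm \<Omega> s (ut t) = norm (W t)" for t
 proof -
  note f = X0_linear[OF s wX wX, of "-1" t 0 t, simplified]
  have "X0_dual_norm \<Omega> s (ut t) = norm (- W t)"
   by (rule dual_norm_representation[OF s _ f(1) f(2)[symmetric]]) (simp add: ut)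
  thus ?thesis by simp
 qed
 thus "integrable (lebesgue_on {0<..}) (%t. (X0_dual_norm \<Omega> s (ut t))^2)"
  by (simp, intro integrable_lebesgue_on_subset[OF W_square_integrable]) auto
qed

lemma ut_weak_derivative: "weak_time_derivative \<Omega> s {0<..} u ut"
 unfolding weak_time_derivative_def
proof (intro allI impI ballI)
 fix \<phi> v assume \<phi>: "test_function {0<..} \<phi>" and v: "v \<in> X0 \<Omega> s"
 define h where "h = emb s v"
 obtain K where K: "compact K" "K \<subseteq> {0<..}" "!!t. t \<notin> K ==> \<phi> t = 0" and sm: "smooth \<phi>"
  using \<phi> unfolding test_function_def by blast
 obtain B where B: "!!x. x \<in> K ==> norm x <= B" using compact_imp_bounded[OF K(1)] unfolding bounded_iff by blast
 define b where "b = \<bar>B\<bar> + 1"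
 have b: "0 < b" by (simp add: b_def)
 have Kb: "K \<subseteq> {0<..<b}" using B K(2) by (force simp: b_def)
 have "Ck (Suc 0) \<phi>" using sm unfolding smooth_def by blast
 then obtain \<phi>' where \<phi>': "!!x. (\<phi> has_real_derivative \<phi>' x) (at x)" "continuous_on UNIV \<phi>'"
  by (rule Ck_SucE) (rule that; simp)
 have \<phi>c: "continuous_on A \<phi>" for A using \<phi>'(1) by (meson DERIV_isCont continuous_at_imp_continuous_on)
 have z: "\<phi> t = 0" "\<phi>' t = 0" if "t \<notin> {0<..<b}" for t
 proof -
  have t: "t \<notin> K" using that Kb by auto
  thus "\<phi> t = 0" by (rule K(3))
  have "((%x. 0) has_real_derivative 0) (at t)" by simp
  hence "(\<phi> has_real_derivative 0) (at t)"
   by (rule has_field_derivative_transform_within_open[of _ _ _ "- K"]) (use K t in \<open>auto simp: compact_imp_closed open_Compl\<close>)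
  thus "\<phi>' t = 0" using DERIV_unique \<phi>'(1) by blast
 qed
 let ?p = "%r. \<phi>' r * (U r \<bullet> h)" and ?w = "%r. \<phi> r * - (W r \<bullet> h)"
 have yc: "continuous_on {0..b} (%r. U r \<bullet> h)" using continuous_on_subset[OF Uc] by (intro continuous_intros) auto
 have pi: "integrable (lebesgue_on {0..b}) ?p"
  by (intro continuous_imp_integrable_real continuous_intros yc continuous_on_subset[OF \<phi>'(2)]) auto
 have wi: "integrable (lebesgue_on {0..b}) ?w"
 proof -
  have "integrable (lebesgue_on {0<..<b+1}) (%r. - (W r \<bullet> h))"
   using bochner_L2_inner_integrable(4)[OF s w_bochner_L2] by simp
  hence "integrable (lebesgue_on {0<..b}) (%r. - (W r \<bullet> h))" by (rule integrable_lebesgue_on_subset) auto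
  hence "(%r. - (W r \<bullet> h)) absolutely_integrable_on {0<..b}" by (simp add: set_integrable_def integrable_restrict_space)
  moreover have "\<phi> \<in> borel_measurable (lebesgue_on {0<..b})"
   by (rule measurable_restrict_space1, rule measurable_completion) (simp add: borel_measurable_continuous_onI[OF \<phi>c])
  moreover have "bounded (\<phi> ` {0<..b})"
   by (rule bounded_subset[OF compact_imp_bounded[OF compact_continuous_image[OF \<phi>c compact_Icc[of 0 b]]]]) auto
  ultimately have "?w absolutely_integrable_on {0<..b}" by (intro absolutely_integrable_bounded_measurable_product_real) auto
  hence "integrable (lebesgue_on {0<..b}) ?w" by (simp add: set_integrable_def integrable_restrict_space)
  thus ?thesis by (subst lebesgue_on_cong(2)[of _ "{0<..b}"]) (use z in auto)
 qed
 have "((%r. ?p r + ?w r) has_integral (\<phi> b * (U b \<bullet> h) - \<phi> 0 * (U 0 \<bullet> h))) {0..b}"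
 proof (rule fundamental_theorem_of_calculus_interior)
  show "continuous_on {0..b} (%r. \<phi> r * (U r \<bullet> h))" by (intro continuous_intros \<phi>c yc)
  fix r assume "r \<in> {0<..<b}"
  thus "((%r. \<phi> r * (U r \<bullet> h)) has_vector_derivative (?p r + ?w r)) (at r)"
   using DERIV_mult[OF \<phi>'(1) Ud, of r h] by (simp add: has_real_derivative_iff_has_vector_derivative mult.commute)
 qed (use b in simp)
 moreover have "\<phi> b = 0" "\<phi> 0 = 0" by (rule z; simp)+
 ultimately have "(LINT r|lebesgue_on {0..b}. ?p r) + (LINT r|lebesgue_on {0..b}. ?w r) = 0"
  using has_integral_add[OF has_integral_integral_lebesgue_on[OF pi] has_integral_integral_lebesgue_on[OF wi]] by (auto dest: has_integral_unique)
 moreover have "(LINT t|lebesgue_on {0<..}. deriv \<phi> t * L2_embed \<Omega> (u t) v) = (LINT t|lebesgue_on {0<..}. ?p t)"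
  by (rule Bochner_Integration.integral_cong) (use L2_embed_u[OF _ v] in \<open>auto simp: DERIV_imp_deriv[OF \<phi>'(1)] h_def\<close>)
 moreover have "(LINT t|lebesgue_on {0<..}. ?p t) = (LINT t|lebesgue_on {0..b}. ?p t)"
  by (rule lebesgue_on_cong(1)) (use z in auto)
 moreover have "(LINT t|lebesgue_on {0<..}. \<phi> t * ut t v) = (LINT t|lebesgue_on {0<..}. ?w t)"
  by (rule Bochner_Integration.integral_cong) (simp_all add: ut[OF v] h_def)
 moreover have "(LINT t|lebesgue_on {0<..}. ?w t) = (LINT t|lebesgue_on {0..b}. ?w t)"
  by (rule lebesgue_on_cong(1)) (use z in auto)
 ultimately show "(LINT t|lebesgue_on {0<..}. deriv \<phi> t * L2_embed \<Omega> (u t) v) = - (LINT t|lebesgue_on {0<..}. \<phi> t * ut t v)"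
  by simp
qed

lemma \<beta>_sq: "0 < t ==> (%x. \<beta> (u t x)) \<in> sq"
 using subgrad_beta_square(1)[OF sg wX uU uB, of t] by simp

text \<open>\<open>subgrad_beta_square\<close> controls \<beta> by \<open>w\<close> and
  \<open>lam\<close> times \<open>u\<close>; the Poincare inequality bounds \<open>w\<close> by
  \<open>W\<close>, and coercivity bounds \<open>u\<close> uniformly in time. The summand
  \<open>lam * norm (mk (u t))\<close> on the left lets the bound cover \<open>g\<close> as well as
  \<beta>.\<close>

lemma reaction_bound: "EX a b. 0 <= a & 0 <= b & (\<forall>t>0. (norm (mk (%x. \<beta> (u t x))) + lam * norm (mk (u t)))^2 <= a * (norm (W t))^2 + b)"
proof -
 obtain K where K: "K > 0" "!!v. v \<in> X0 \<Omega> \<sigma> ==> norm (mk v) <= K * norm (emb \<sigma> v)" using X0_Poincare[OF \<sigma> \<Omega>(2)] by blast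
 obtain K' where K': "K' > 0" "!!v. v \<in> X0 \<Omega> s ==> norm (mk v) <= K' * norm (emb s v)" using X0_Poincare[OF s \<Omega>(2)] by blast
 obtain S where S: "!!t. t >= 0 ==> norm (emb \<sigma> (u t)) <= S" using emb_bounded by blast
 have "(norm (mk (%x. \<beta> (u t x))) + lam * norm (mk (u t)))^2 <= (2 * K'^2) * (norm (W t))^2 + 2 * (2 * lam * (K * S))^2" if t: "t > 0" for t
 proof -
  have t0: "t >= 0" using t by simp
  have u: "norm (mk (u t)) <= K * S"
   using K(2)[OF uX[OF t0]] mult_left_mono[OF S[OF t0], of K] K(1) by linarith
  have "norm (mk (%x. \<beta> (u t x))) <= norm (mk (w t) + lam *\<^sub>R mk (u t))" by (rule subgrad_beta_square(2)[OF sg[OF t] wX uU[OF t0] uB[OF t0]])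
  also have "... <= norm (mk (w t)) + lam * norm (mk (u t))" using norm_triangle_ineq[of "mk (w t)" "lam *\<^sub>R mk (u t)"] lam by simp
  finally have "norm (mk (%x. \<beta> (u t x))) + lam * norm (mk (u t)) <= norm (mk (w t)) + 2 * lam * norm (mk (u t))" by simp
  also have "... <= K' * norm (W t) + 2 * lam * (K * S)"
   using K'(2)[OF wX[of t]] lam u by (intro add_mono mult_left_mono) auto
  finally have "(norm (mk (%x. \<beta> (u t x))) + lam * norm (mk (u t)))^2 <= (K' * norm (W t) + 2 * lam * (K * S))^2"
   using lam by (intro power_mono) auto
  also have "... <= 2 * (K' * norm (W t))^2 + 2 * (2 * lam * (K * S))^2"
   using zero_le_power2[of "K' * norm (W t) - 2 * lam * (K * S)"] unfolding power2_sum power2_diff by linarith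
  finally show ?thesis by (simp add: power_mult_distrib)
 qed
 thus ?thesis by (intro exI[of _ "2 * K'^2"] exI[of _ "2 * (2 * lam * (K * S))^2"]) auto
qed

text \<open>For an \<open>h\<close> without growth bound the map from \<open>t\<close> to the
  composition of \<open>h\<close> with \<open>u t\<close> is not known to be continuous in L2.
  Compositions with clipped arguments are Lipschitz in \<open>u\<close>, hence continuous in time,
  and converge for each \<open>t\<close>; sampling them on a grid gives measurability. The abstract
  \<open>h\<close> stands for \<open>g\<close> and \<beta>.\<close>

lemma composition_bochner_L2:
 assumes h0: "h 0 = 0" and hc: "continuous_on UNIV h"
  and hl: "!!R. 0 <= R ==> \<exists>L>0. ALL x y. \<bar>x\<bar> <= R --> \<bar>y\<bar> <= R --> \<bar>h x - h y\<bar> <= L * \<bar>x - y\<bar>"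
  and hb: "!!r k. 0 <= k ==> \<bar>h (clip k r)\<bar> <= \<bar>\<beta> r\<bar> + lam * \<bar>r\<bar>"
  and I: "I \<in> sets lebesgue" "I \<subseteq> {0<..<R}"
 shows "bochner_L2 (L2 \<Omega>) (L2_norm \<Omega>) I (%t x. h (u t x))"
proof -
 have I0: "I \<subseteq> {0<..}" using I(2) by auto
 have usq: "u t \<in> sq" if "0 <= t" for t by (rule X0_sq[OF \<sigma> uX[OF that]])
 define G where "G t x = \<bar>\<beta> (u t x)\<bar> + lam * \<bar>u t x\<bar>" for t x
 have sqabs: "(%z. \<bar>f z\<bar>) \<in> sq" "norm (mk (%z. \<bar>f z\<bar>)) = norm (mk f)" if "f \<in> sq" for f :: "'a => real"
 proof -
  show s: "(%z. \<bar>f z\<bar>) \<in> sq" by (rule sq_bound[OF that]) (use sq_meas[OF that] in auto)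
  show "norm (mk (%z. \<bar>f z\<bar>)) = norm (mk f)" by (intro antisym norm_mk_mono s that) auto
 qed
 have Gs: "G t \<in> sq" if "0 < t" for t
  unfolding G_def[abs_def] by (intro sq_add sq_scale sqabs \<beta>_sq usq) (use that in auto)
 have hG: "\<bar>h (u t x)\<bar> <= \<bar>G t x\<bar>" for t x
 proof -
  have "clip \<bar>u t x\<bar> (u t x) = u t x" by (rule clip_simps(3)) simp
  thus ?thesis using hb[of "\<bar>u t x\<bar>" "u t x"] by (simp add: G_def)
 qed
 have hm: "(%x. h (u t x)) \<in> borel_measurable lebesgue" if "0 <= t" for t by (rule comp_meas[OF hc sq_meas[OF usq[OF that]]])
 have hs: "(%x. h (u t x)) \<in> sq" if "0 < t" for t
  by (rule sq_bound[OF Gs[OF that] hm]) (use that hG in auto)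
 have nh: "norm (mk (%x. h (u t x))) <= norm (mk (%x. \<beta> (u t x))) + lam * norm (mk (u t))" if t: "0 < t" for t
 proof -
  have "norm (mk (%x. h (u t x))) <= norm (mk (G t))" by (rule norm_mk_mono[OF hs[OF t] Gs[OF t]]) (use hG in auto)
  also have "mk (G t) = mk (%x. \<bar>\<beta> (u t x)\<bar>) + lam *\<^sub>R mk (%x. \<bar>u t x\<bar>)"
   unfolding G_def[abs_def] using t by (simp add: mk_scaleR mk_add sqabs sq_scale \<beta>_sq usq)
  also have "norm ... <= norm (mk (%x. \<bar>\<beta> (u t x)\<bar>)) + norm (lam *\<^sub>R mk (%x. \<bar>u t x\<bar>))" by (rule norm_triangle_ineq)
  also have "... = norm (mk (%x. \<beta> (u t x))) + lam * norm (mk (u t))" using t lam by (simp add: sqabs \<beta>_sq usq)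
  finally show ?thesis .
 qed
 \<comment> \<open>Among functions vanishing outside \<Omega> the norm of \<open>L2 \<Omega>\<close>
   is the norm of the class on the whole space.\<close>
 define X where "X = {f \<in> sq. AE x in lebesgue. x \<notin> \<Omega> --> f x = 0}"
 have XL2: "X \<subseteq> L2 \<Omega>" unfolding X_def using sq_L2[OF _ \<Omega>s] by blast
 have Xn: "L2_norm \<Omega> f = norm (mk f)" if "f \<in> X" for f using that L2_norm_mk[OF _ \<Omega>s] unfolding X_def by blast
 have Xd: "(%x. f x - k x) \<in> X" "L2_norm \<Omega> (%x. f x - k x) = norm (mk f - mk k)" if "f \<in> X" "k \<in> X" for f k
 proof -
  have "AE x in lebesgue. x \<notin> \<Omega> --> f x = 0" "AE x in lebesgue. x \<notin> \<Omega> --> k x = 0" using that by (auto simp: X_def)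
  hence "AE x in lebesgue. x \<notin> \<Omega> --> f x - k x = 0" by eventually_elim auto
  thus x: "(%x. f x - k x) \<in> X" using that by (auto simp: X_def sq_diff)
  show "L2_norm \<Omega> (%x. f x - k x) = norm (mk f - mk k)" unfolding Xn[OF x] using that by (simp add: X_def mk_diff)
 qed
 have hX: "(%x. h (u t x)) \<in> X" if "0 < t" for t
 proof -
  have "AE x in lebesgue. x \<notin> \<Omega> --> h (u t x) = 0" using X0_out[OF \<sigma> uX, of t] that by (auto elim!: eventually_mono simp: h0)
  thus ?thesis using hs[OF that] by (simp add: X_def)
 qed
 define F where "F n t x = h (clip (real n) (u t x))" for n :: nat and t x
 have "ALL n. \<exists>L>0. ALL x y. \<bar>x\<bar> <= real n --> \<bar>y\<bar> <= real n --> \<bar>h x - h y\<bar> <= L * \<bar>x - y\<bar>" using hl by simp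
 then obtain L where L: "!!n. L n > 0" "!!n x y. \<bar>x\<bar> <= real n ==> \<bar>y\<bar> <= real n ==> \<bar>h x - h y\<bar> <= L n * \<bar>x - y\<bar>" by metis
 have Lc: "\<bar>h (clip (real n) x) - h (clip (real n) y)\<bar> <= L n * \<bar>x - y\<bar>" for n x y
 proof -
  have "\<bar>h (clip (real n) x) - h (clip (real n) y)\<bar> <= L n * \<bar>clip (real n) x - clip (real n) y\<bar>" by (rule L(2)) (auto intro: clip_simps)
  also have "... <= L n * \<bar>x - y\<bar>" using L(1)[of n] clip_simps(5) by (intro mult_left_mono) auto
  finally show ?thesis .
 qed
 have Fm: "F n t \<in> borel_measurable lebesgue" if "0 <= t" for n t
  unfolding F_def[abs_def] by (rule comp_meas[of "%r. h (clip (real n) r)", OF continuous_on_compose2[OF hc clip_cont] sq_meas[OF usq[OF that]]]) auto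
 have FX: "F n t \<in> X" if "0 <= t" for n t
 proof -
  have "F n t \<in> sq"
  proof (rule sq_bound[OF sq_scale[OF usq[OF that], of "L n"] Fm[OF that]], rule AE_I2)
   show "\<bar>F n t x\<bar> <= \<bar>L n * u t x\<bar>" for x
    using Lc[of n "u t x" 0] L(1)[of n] by (simp add: F_def clip_simps(4) h0 abs_mult)
  qed
  moreover have "AE x in lebesgue. x \<notin> \<Omega> --> F n t x = 0"
   using X0_out[OF \<sigma> uX[OF that]] by eventually_elim (simp add: F_def clip_simps(4) h0)
  ultimately show ?thesis by (simp add: X_def)
 qed
 have FL: "norm (mk (F n r) - mk (F n t)) <= L n * norm (mk (u r) - mk (u t))" if "0 <= r" "0 <= t" for n r t
 proof -
  have s: "F n r \<in> sq" "F n t \<in> sq" using FX that by (auto simp: X_def)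
  have d: "(%x. u r x - u t x) \<in> sq" by (intro sq_diff usq that)
  have "norm (mk (%x. F n r x - F n t x)) <= norm (mk (%x. L n * (u r x - u t x)))"
   by (rule norm_mk_mono[OF sq_diff[OF s] sq_scale[OF d]])
     (use Lc L(1)[of n] in \<open>simp add: F_def abs_mult\<close>)
  thus ?thesis using L(1)[of n] by (simp add: mk_diff[OF s] mk_diff[OF usq[OF that(1)] usq[OF that(2)]] mk_scaleR[OF d, symmetric])
 qed
 have Fl: "(%n. norm (mk (F n t) - mk (%x. h (u t x)))) ----> 0" if t: "0 < t" for t
 proof -
  have t0: "0 <= t" using t by simp
  have s: "F n t \<in> sq" for n using FX[OF t0] by (auto simp: X_def)
  have "(%n. (LINT x|lebesgue. (F n t x - h (u t x))^2)) ----> (LINT x|(lebesgue :: 'a measure). (0::real))"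
  proof (rule integral_dominated_convergence[where w="%x. 4 * (G t x)^2"])
   show "integrable lebesgue (%x. 4 * (G t x)^2)" by (intro integrable_mult_right sq_int[OF Gs[OF t]])
   show "(%x. (F n t x - h (u t x))^2) \<in> borel_measurable lebesgue" for n using Fm[OF t0] hm[OF t0] by measurable
   show "AE x in lebesgue. (%n. (F n t x - h (u t x))^2) ----> 0"
   proof (rule AE_I2)
    fix x
    have "isCont h (u t x)" using hc by (simp add: continuous_on_eq_continuous_at)
    hence "(%n. F n t x) ----> h (u t x)" unfolding F_def using clip_lim by (rule isCont_tendsto_compose)
    hence "(%n. (F n t x - h (u t x))^2) ----> (h (u t x) - h (u t x))\<^sup>2" by (intro tendsto_intros)
    thus "(%n. (F n t x - h (u t x))^2) ----> 0" by simp
   qed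
   show "AE x in lebesgue. norm ((F n t x - h (u t x))^2) <= 4 * (G t x)^2" for n
   proof (rule AE_I2)
    fix x
    have "\<bar>F n t x\<bar> <= \<bar>G t x\<bar>" using hb[of "real n" "u t x"] unfolding F_def G_def by simp
    hence "\<bar>F n t x - h (u t x)\<bar> <= 2 * \<bar>G t x\<bar>" using hG[of t x] abs_triangle_ineq4[of "F n t x" "h (u t x)"] by linarith
    hence "\<bar>F n t x - h (u t x)\<bar>\<^sup>2 <= (2 * \<bar>G t x\<bar>)^2" by (intro power_mono) auto
    thus "norm ((F n t x - h (u t x))^2) <= 4 * (G t x)^2" by (simp add: power_mult_distrib)
   qed
  qed simp_all
  hence "(%n. (norm (mk (F n t) - mk (%x. h (u t x))))^2) ----> 0"
   by (simp add: mk_diff[OF s hs[OF t]] norm_mk_square[OF sq_diff[OF s hs[OF t]]])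
  from tendsto_real_sqrt[OF this] show ?thesis by simp
 qed
 \<comment> \<open>The mesh belonging to \<open>n\<close> comes from uniform continuity on
   \<open>{0..real n + 1}\<close>, the interval containing the samples at level
   \<open>n\<close>.\<close>
 have "\<exists>m>0. \<forall>r\<in>{0..real n + 1}. \<forall>t\<in>{0..real n + 1}. \<bar>r - t\<bar> <= 1 / real m --> norm (mk (F n r) - mk (F n t)) <= 1 / real (Suc n)" for n
 proof -
  have "continuous_on {0..} (%t. mk (F n t))"
   by (rule continuous_on_dist_le[OF mk_continuous, of _ "L n"]) (use FL in \<open>simp add: dist_norm\<close>)
  hence "uniformly_continuous_on {0..real n + 1} (%t. mk (F n t))"
   by (intro compact_uniformly_continuous) (auto elim: continuous_on_subset)
  moreover have "1 / real (Suc n) > 0" by simp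
  ultimately obtain d where d: "d > 0" "!!t r. t \<in> {0..real n + 1} ==> r \<in> {0..real n + 1} ==> dist r t < d ==> dist (mk (F n r)) (mk (F n t)) < 1 / real (Suc n)"
   unfolding uniformly_continuous_on_def by blast
  obtain m where m: "inverse (real (Suc m)) < d" using reals_Archimedean[OF d(1)] by blast
  have "norm (mk (F n r) - mk (F n t)) <= 1 / real (Suc n)"
   if "r \<in> {0..real n + 1}" "t \<in> {0..real n + 1}" "\<bar>r - t\<bar> <= 1 / real (Suc m)" for r t
   using d(2)[OF that(2,1)] that(3) m by (simp add: dist_norm inverse_eq_divide)
  thus ?thesis by (intro exI[of _ "Suc m"]) auto
 qed
 then obtain m where m: "!!n. m n > 0" "!!n r t. r \<in> {0..real n + 1} ==> t \<in> {0..real n + 1} ==> \<bar>r - t\<bar> <= 1 / real (m n) ==> norm (mk (F n r) - mk (F n t)) <= 1 / real (Suc n)"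
  by metis
 have bX: "bochner_measurable X (L2_norm \<Omega>) I (%t x. h (u t x))"
 proof (rule bochner_measurable_sampling[OF I(1) I0, where F=F and m=m])
  show "F n t \<in> X" if "0 < t" for n t using FX that by simp
  show "m n > 0" for n by (rule m(1))
  fix t assume "t \<in> I"
  hence t: "0 < t" using I0 by auto
  show "(%n. L2_norm \<Omega> (%x. F n (sample (m n) n t) x - h (u t x))) ----> 0"
  proof (rule tendsto_sandwich[OF _ _ tendsto_const])
   have "(%n. 1 / real (Suc n) + norm (mk (F n t) - mk (%x. h (u t x)))) ----> 0 + 0"
    by (intro tendsto_add lim_1_over_n[THEN LIMSEQ_Suc] Fl t)
   thus "(%n. 1 / real (Suc n) + norm (mk (F n t) - mk (%x. h (u t x)))) ----> 0" by simp
   have e: "L2_norm \<Omega> (%x. F n (sample (m n) n t) x - h (u t x)) = norm (mk (F n (sample (m n) n t)) - mk (%x. h (u t x)))" for n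
    by (rule Xd(2)[OF FX hX[OF t]]) (use sample(1)[OF m(1) t] less_imp_le in blast)
   show "eventually (%n. 0 <= L2_norm \<Omega> (%x. F n (sample (m n) n t) x - h (u t x))) sequentially"
    unfolding e by simp
   have "eventually (%n. t <= real n) sequentially" using filterlim_real_sequentially by (simp add: filterlim_at_top)
   thus "eventually (%n. L2_norm \<Omega> (%x. F n (sample (m n) n t) x - h (u t x)) <= 1 / real (Suc n) + norm (mk (F n t) - mk (%x. h (u t x)))) sequentially"
   proof eventually_elim
    case (elim n)
    define r where "r = sample (m n) n t"
    have r: "0 < r" "t < r" "r <= t + 1 / real (m n)" "r <= real n + 1"
     unfolding r_def using sample[OF m(1) t, of n n] elim by (auto simp: sample_def)
    have "norm (mk (F n r) - mk (F n t)) <= 1 / real (Suc n)" by (rule m(2)) (use r t elim in auto)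
    moreover have "norm (mk (F n r) - mk (%x. h (u t x))) <= norm (mk (F n r) - mk (F n t)) + norm (mk (F n t) - mk (%x. h (u t x)))"
     using norm_triangle_ineq[of "mk (F n r) - mk (F n t)" "mk (F n t) - mk (%x. h (u t x))"] by simp
    ultimately show ?case unfolding e unfolding r_def[symmetric] by linarith
   qed
  qed
 qed
 have "AE t in lebesgue_on I. \<forall>\<phi>\<in>X. \<bar>L2_norm \<Omega> \<phi> - L2_norm \<Omega> (%x. h (u t x))\<bar> <= L2_norm \<Omega> (%x. \<phi> x - h (u t x)) * 1"
 proof (rule AE_I2, rule ballI)
  fix t \<phi> assume t: "t \<in> space (lebesgue_on I)" and p: "\<phi> \<in> X"
  hence "0 < t" using I0 by auto
  thus "\<bar>L2_norm \<Omega> \<phi> - L2_norm \<Omega> (%x. h (u t x))\<bar> <= L2_norm \<Omega> (%x. \<phi> x - h (u t x)) * 1"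
   using Xd(2)[OF p hX] Xn[OF p] Xn[OF hX] by (simp add: norm_triangle_ineq3)
 qed
 from bochner_measurable_functional[OF bX I(1) this]
 have nm: "(%t. L2_norm \<Omega> (%x. h (u t x))) \<in> borel_measurable (lebesgue_on I)" .
 obtain a b where ab: "0 <= a" "0 <= b" "!!t. t > 0 ==> (norm (mk (%x. \<beta> (u t x))) + lam * norm (mk (u t)))^2 <= a * (norm (W t))^2 + b"
  using reaction_bound by blast
 show "bochner_L2 (L2 \<Omega>) (L2_norm \<Omega>) I (%t x. h (u t x))"
  unfolding bochner_L2_def
 proof (intro conjI)
  show "AE t in lebesgue_on I. (%x. h (u t x)) \<in> L2 \<Omega>"
   by (rule AE_I2) (use hX XL2 I0 in auto)
  show "bochner_measurable (L2 \<Omega>) (L2_norm \<Omega>) I (%t x. h (u t x))"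
   using bX XL2 unfolding bochner_measurable_def by (meson subset_trans)
  have ib: "integrable (lebesgue_on I) (%t. a * (norm (W t))^2 + b)"
  proof (intro Bochner_Integration.integrable_add integrable_mult_right)
   show "integrable (lebesgue_on I) (%t. (norm (W t))^2)"
    by (rule integrable_lebesgue_on_subset[OF W_square_integrable]) (use I I0 in auto)
   have "integrable (lebesgue_on {0..R}) (%t. b)" by (rule continuous_imp_integrable_real) auto
   thus "integrable (lebesgue_on I) (%t. b)" by (rule integrable_lebesgue_on_subset) (use I in auto)
  qed
  show "integrable (lebesgue_on I) (%t. (L2_norm \<Omega> (%x. h (u t x)))^2)"
  proof (rule Bochner_Integration.integrable_bound[OF ib])
   show "(%t. (L2_norm \<Omega> (%x. h (u t x)))^2) \<in> borel_measurable (lebesgue_on I)" using nm by measurable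
   show "AE t in lebesgue_on I. norm ((L2_norm \<Omega> (%x. h (u t x)))^2) <= norm (a * (norm (W t))^2 + b)"
   proof (rule AE_I2)
    fix t assume "t \<in> space (lebesgue_on I)"
    hence t: "0 < t" using I0 by auto
    have "(norm (mk (%x. h (u t x))))^2 <= (norm (mk (%x. \<beta> (u t x))) + lam * norm (mk (u t)))^2"
     by (rule power_mono[OF nh[OF t]]) simp
    thus "norm ((L2_norm \<Omega> (%x. h (u t x)))^2) <= norm (a * (norm (W t))^2 + b)"
     using ab(3)[OF t] unfolding Xn[OF hX[OF t]] by simp
   qed
  qed
 qed
qed

lemma g_lip: "0 <= R ==> \<exists>L>0. ALL x y. \<bar>x\<bar> <= R --> \<bar>y\<bar> <= R --> \<bar>g x - g y\<bar> <= L * \<bar>x - y\<bar>"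
proof -
 assume "0 <= R"
 then obtain L where L: "L > 0" "!!x y. \<bar>x\<bar> <= R ==> \<bar>y\<bar> <= R ==> \<bar>\<beta> x - \<beta> y\<bar> <= L * \<bar>x - y\<bar>" using \<beta>_lip by blast
 have "\<bar>g x - g y\<bar> <= (L + lam) * \<bar>x - y\<bar>" if "\<bar>x\<bar> <= R" "\<bar>y\<bar> <= R" for x y
 proof -
  have "g x - g y = (\<beta> x - \<beta> y) - lam * (x - y)" by (simp add: \<beta> algebra_simps)
  hence "\<bar>g x - g y\<bar> <= \<bar>\<beta> x - \<beta> y\<bar> + \<bar>lam * (x - y)\<bar>" using abs_triangle_ineq4 by metis
  thus ?thesis using L(2)[OF that] lam by (simp add: abs_mult distrib_right)
 qed
 thus ?thesis using L(1) lam by (intro exI[of _ "L + lam"]) auto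
qed

lemma \<beta>_clip: "0 <= k ==> \<bar>\<beta> (clip k r)\<bar> <= \<bar>\<beta> r\<bar>"
proof (cases "0 <= r")
 case True
 assume k: "0 <= k"
 have "0 <= \<beta> (clip k r)" "\<beta> (clip k r) <= \<beta> r" using clip_simps(7)[OF k True] \<beta>_sign(1) \<beta>_mono by auto
 thus ?thesis by simp
next
 case False
 assume k: "0 <= k"
 have "\<beta> (clip k r) <= 0" "\<beta> r <= \<beta> (clip k r)" using clip_simps(8)[OF k, of r] False \<beta>_sign(2) \<beta>_mono by auto
 thus ?thesis by simp
qed

lemma g_clip: "0 <= k ==> \<bar>g (clip k r)\<bar> <= \<bar>\<beta> r\<bar> + lam * \<bar>r\<bar>"
proof -
 assume k: "0 <= k"
 have "\<bar>g (clip k r)\<bar> <= \<bar>\<beta> (clip k r)\<bar> + lam * \<bar>clip k r\<bar>"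
  using abs_triangle_ineq4[of "\<beta> (clip k r)" "lam * clip k r"] lam by (simp add: \<beta> abs_mult)
 also have "... <= \<bar>\<beta> r\<bar> + lam * \<bar>r\<bar>" using \<beta>_clip[OF k] clip_simps(2)[OF k] lam by (intro add_mono mult_left_mono) auto
 finally show ?thesis .
qed

lemma \<beta>_bochner_L2:
 assumes "I \<in> sets lebesgue" "I \<subseteq> {0<..<R}"
 shows "bochner_L2 (L2 \<Omega>) (L2_norm \<Omega>) I (%t x. \<beta> (u t x))"
proof (rule composition_bochner_L2[OF \<beta>0 \<beta>_cont _ _ assms])
 show "\<exists>L>0. ALL x y. \<bar>x\<bar> <= R --> \<bar>y\<bar> <= R --> \<bar>\<beta> x - \<beta> y\<bar> <= L * \<bar>x - y\<bar>" if R: "0 <= R" for R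
 proof -
  obtain L where "L > 0" "!!x y. \<bar>x\<bar> <= R ==> \<bar>y\<bar> <= R ==> \<bar>\<beta> x - \<beta> y\<bar> <= L * \<bar>x - y\<bar>" using \<beta>_lip[OF R] by blast
  thus ?thesis by blast
 qed
 show "\<bar>\<beta> (clip k r)\<bar> <= \<bar>\<beta> r\<bar> + lam * \<bar>r\<bar>" if "0 <= k" for r k using \<beta>_clip[OF that, of r] lam by (simp add: add_increasing2)
qed

lemma g_bochner_L2:
 assumes "I \<in> sets lebesgue" "I \<subseteq> {0<..<R}"
 shows "bochner_L2 (L2 \<Omega>) (L2_norm \<Omega>) I (%t x. g (u t x))"
 by (rule composition_bochner_L2[OF g0 g_cont g_lip g_clip assms])

lemma flow_weak_solution: "weak_solution_from \<Omega> s \<sigma> g \<infinity> (u 0) u w"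
proof -
 have itv: "open_itv 0 \<infinity> = {0<..}" "right_open_itv 0 \<infinity> = {0..}" by (auto simp: open_itv_def right_open_itv_def)
 have eq: "L2_embed \<Omega> (w t) v = frac_op \<sigma> (u t) v + L2_embed \<Omega> (%x. g (u t x)) v" if t: "0 < t" and v: "v \<in> X0 \<Omega> \<sigma>" for t v
 proof -
  have t0: "0 <= t" using t by simp
  note c = subgrad_characterization[OF sg[OF t] wX uU[OF t0] uB[OF t0]]
  note e = L2_embed_mk[OF _ X0_sq[OF \<sigma> v] \<Omega>s X0_out[OF \<sigma> v]]
  show ?thesis unfolding e[OF X0_sq[OF s wX]] e[OF c(1)] frac_op_emb[OF \<sigma> uX[OF t0] v] by (rule c(2)[OF v])
 qed
 have "weak_solution \<Omega> s \<sigma> g 0 \<infinity> u w"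
  unfolding weak_solution_def itv
 proof (intro conjI exI[of _ ut])
  show "weakly_continuous_on (X0 \<Omega> \<sigma>) (X0_norm \<sigma>) {0..} u" by (rule u_weakly_continuous)
  show "bochner_L2 (X0 \<Omega> s) (X0_norm s) {0<..} w" by (rule w_bochner_L2)
  show "bochner_L2_loc (L2 \<Omega>) (L2_norm \<Omega>) 0 \<infinity> (%t x. g (u t x))"
   unfolding bochner_L2_loc_def by (auto intro!: g_bochner_L2)
  show "L2_time_derivative \<Omega> s {0<..} u ut"
   unfolding L2_time_derivative_def using ut_bochner_L2 ut_weak_derivative by blast
  show "AE t in lebesgue_on {0<..}. (\<forall>v\<in>X0 \<Omega> s. ut t v + frac_op s (w t) v = 0) &
    (\<forall>v\<in>X0 \<Omega> \<sigma>. L2_embed \<Omega> (w t) v = frac_op \<sigma> (u t) v + L2_embed \<Omega> (%x. g (u t x)) v)"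
   by (rule AE_I2) (use eq in \<open>auto simp: ut_def\<close>)
 qed
 thus ?thesis unfolding weak_solution_from_def by simp
qed

end

lemma lebesgue_on_Ioc_integral:
 fixes f :: "real => real"
 assumes "integrable (lebesgue_on {0<..<R}) f" "0 <= a" "a <= b" "b < R"
 shows "integrable (lebesgue_on {a<..b}) f" "f integrable_on {a..b}" "(LINT r|lebesgue_on {a<..b}. f r) = integral {a..b} f"
proof -
 show i: "integrable (lebesgue_on {a<..b}) f" by (rule integrable_lebesgue_on_subset[OF assms(1)]) (use assms in auto)
 have "(f has_integral (LINT r|lebesgue_on {a<..b}. f r)) {a<..b}" by (rule has_integral_integral_lebesgue_on[OF i]) simp
 moreover have "(f has_integral y) {a<..b} \<longleftrightarrow> (f has_integral y) {a..b}" for y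
  by (rule has_integral_spike_set_eq) (auto intro: negligible_subset[of "{a}"])
 ultimately have "(f has_integral (LINT r|lebesgue_on {a<..b}. f r)) {a..b}" by blast
 thus "f integrable_on {a..b}" "(LINT r|lebesgue_on {a<..b}. f r) = integral {a..b} f"
  by (auto simp: integral_unique)
qed

lemma AE_zero_by_interval_integrals:
 fixes k :: "real => real"
 assumes k: "!!R. integrable (lebesgue_on {0<..<R}) k" and z: "!!t. 0 <= t ==> (LINT r|lebesgue_on {0<..t}. k r) = 0"
 shows "AE t in lebesgue_on {0<..}. k t = 0"
proof -
 have L: "k integrable_on {0..b}" "integral {0..b} k = 0" if "0 <= b" for b
  using lebesgue_on_Ioc_integral[OF k order_refl that, of "b + 1"] z[OF that] by auto
 have "{0..} \<inter> cbox a b = {max 0 a..b}" for a b :: real by auto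
 hence i: "(%t. if t \<in> {0..} then k t else 0) integrable_on cbox a b" for a b
  unfolding integrable_restrict_Int using integrable_subinterval_real[OF L(1)[of b], of "max 0 a" b] by (cases "0 <= b") auto
 obtain N where N: "negligible N" "!!x e. x \<notin> N ==> 0 < e ==> \<exists>d>0. ALL h. 0 < h & h < d -->
   norm (integral (cbox x (x + h *\<^sub>R One)) (%t. if t \<in> {0..} then k t else 0) /\<^sub>R h ^ DIM(real) - (if x \<in> {0..} then k x else 0)) < e"
  by (rule integrable_ccontinuous_explicit[OF i]) (rule that)
 have "k x = 0" if x: "x \<notin> N" "0 < x" for x
 proof (rule ccontr)
  assume "k x \<noteq> 0"
  then obtain d where d: "d > 0" "!!h. 0 < h ==> h < d ==> norm (integral {x..x + h} (%t. if t \<in> {0..} then k t else 0) /\<^sub>R h - k x) < norm (k x)"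
   using N(2)[OF x(1), of "norm (k x)"] x(2) by auto
  have "integral {x..x + d/2} (%t. if t \<in> {0..} then k t else 0) = integral {x..x + d/2} k"
   by (rule Henstock_Kurzweil_Integration.integral_cong) (use x in auto)
  also have "... = integral {0..x + d/2} k - integral {0..x} k"
   using Henstock_Kurzweil_Integration.integral_combine[of 0 x "x + d/2" k] L(1)[of "x + d/2"] x d(1) by simp
  also have "... = 0" using L(2)[of x] L(2)[of "x + d/2"] x d(1) by simp
  finally show False using d(2)[of "d/2"] d(1) by simp
 qed
 moreover have "AE x in lebesgue. x \<notin> N" using N(1) by (intro AE_not_in) (simp add: negligible_iff_null_sets)
 ultimately have "AE x in lebesgue. x \<in> {0<..} --> k x = 0" by (auto elim: eventually_mono)
 thus ?thesis by (simp add: AE_restrict_space_iff)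
qed

section \<open>Uniqueness of weak solutions\<close>

context cahn_hilliard
begin

lemma L2_embed_dual: "\<phi> \<in> X0 \<Omega> s ==> (%f. L2_embed \<Omega> f \<phi>) \<in> X0_dual \<Omega> \<sigma>"
proof -
 assume p: "\<phi> \<in> X0 \<Omega> s"
 obtain K where K: "K > 0" "!!v. v \<in> X0 \<Omega> \<sigma> ==> norm (mk v) <= K * norm (emb \<sigma> v)" using X0_Poincare[OF \<sigma> \<Omega>(2)] by blast
 have e: "L2_embed \<Omega> f \<phi> = mk f \<bullet> mk \<phi>" if "f \<in> X0 \<Omega> \<sigma>" for f
  by (rule L2_embed_mk[OF X0_sq[OF \<sigma> that] X0_sq[OF s p] \<Omega>s X0_out[OF s p]])
 show ?thesis unfolding dual_space_def
 proof (intro CollectI conjI ballI allI exI[of _ "K * norm (mk \<phi>)"])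
  show "L2_embed \<Omega> (%x. a * u x + b * v x) \<phi> = a * L2_embed \<Omega> u \<phi> + b * L2_embed \<Omega> v \<phi>"
   if "u \<in> X0 \<Omega> \<sigma>" "v \<in> X0 \<Omega> \<sigma>" for u v a b
   using X0_linear[OF \<sigma> that, of a b] that by (simp add: e inner_add_left)
  show "\<bar>L2_embed \<Omega> v \<phi>\<bar> <= K * norm (mk \<phi>) * X0_norm \<sigma> v" if v: "v \<in> X0 \<Omega> \<sigma>" for v
  proof -
   have "\<bar>L2_embed \<Omega> v \<phi>\<bar> <= norm (mk v) * norm (mk \<phi>)" unfolding e[OF v] by (rule Cauchy_Schwarz_ineq2)
   also have "... <= (K * norm (emb \<sigma> v)) * norm (mk \<phi>)" using K(2)[OF v] by (intro mult_right_mono) auto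
   finally show ?thesis unfolding X0_norm_emb[OF \<sigma> v] by (simp add: ac_simps)
  qed
 qed
qed

text \<open>Weak continuity makes the pairings with a fixed \<phi> continuous scalar functions, so
  the distributional derivative integrates to differences at all times, including zero, and not just
  at almost all.\<close>

lemma time_derivative_integral:
 assumes wc: "weakly_continuous_on (X0 \<Omega> \<sigma>) (X0_norm \<sigma>) {0..} v" and vt: "L2_time_derivative \<Omega> s {0<..} v v'" and \<phi>: "\<phi> \<in> X0 \<Omega> s"
 shows "integrable (lebesgue_on {0<..<R}) (%t. v' t \<phi>)"
  and "(%t. v' t \<phi>) \<in> borel_measurable (lebesgue_on {0<..})"
  and "0 <= \<tau> ==> \<tau> <= t ==> L2_embed \<Omega> (v t) \<phi> - L2_embed \<Omega> (v \<tau>) \<phi> = (LINT r|lebesgue_on {\<tau><..t}. v' r \<phi>)"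
proof -
 let ?D = "X0_dual \<Omega> s" and ?n = "X0_dual_norm \<Omega> s"
 have D: "AE t in lebesgue_on {0<..}. v' t \<in> ?D" and m: "bochner_measurable ?D ?n {0<..} v'"
  and i: "integrable (lebesgue_on {0<..}) (%t. (?n (v' t))^2)" and wd: "weak_time_derivative \<Omega> s {0<..} v v'"
  using vt unfolding L2_time_derivative_def bochner_L2_def by auto
 have "AE t in lebesgue_on {0<..}. \<forall>F\<in>?D. \<bar>F \<phi> - v' t \<phi>\<bar> <= ?n (%v. F v - v' t v) * X0_norm s \<phi>"
  using D by eventually_elim (auto intro: dual_norm_bound[OF s dual_space_diff \<phi>])
 from bochner_measurable_functional[where c="%F. F \<phi>", OF m _ this]
 show mm: "(%t. v' t \<phi>) \<in> borel_measurable (lebesgue_on {0<..})" by simp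
 show ii: "integrable (lebesgue_on {0<..<R}) (%t. v' t \<phi>)" for R
 proof (rule Bochner_Integration.integrable_bound)
  have "integrable (lebesgue_on {0..R}) (%t. (X0_norm s \<phi>)^2)" by (rule continuous_imp_integrable_real) auto
  hence "integrable (lebesgue_on {0<..<R}) (%t. (X0_norm s \<phi>)^2)" by (rule integrable_lebesgue_on_subset) auto
  moreover have "integrable (lebesgue_on {0<..<R}) (%t. (?n (v' t))^2)" by (rule integrable_lebesgue_on_subset[OF i]) auto
  ultimately show "integrable (lebesgue_on {0<..<R}) (%t. (?n (v' t))^2 + (X0_norm s \<phi>)^2)" by (rule Bochner_Integration.integrable_add[rotated])
  show "(%t. v' t \<phi>) \<in> borel_measurable (lebesgue_on {0<..<R})" using mm by (rule measurable_restrict_mono) auto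
  have "AE t in lebesgue_on {0<..<R}. v' t \<in> ?D" by (rule AE_lebesgue_on_subset[OF D]) auto
  thus "AE t in lebesgue_on {0<..<R}. norm (v' t \<phi>) <= norm ((?n (v' t))^2 + (X0_norm s \<phi>)^2)"
  proof eventually_elim
   case (elim t)
   have "x * y <= x^2 + y^2" for x y :: real
    using sum_squares_bound[of x y] zero_le_power2[of x] zero_le_power2[of y] by linarith
   thus ?case using dual_norm_bound[OF s elim \<phi>] using elim by (metis abs_of_nonneg add_nonneg_nonneg order_trans real_norm_def zero_le_power2)
  qed
 qed
 have c: "continuous_on {0..} (%t. L2_embed \<Omega> (v t) \<phi>)"
  using bspec[OF conjunct2[OF wc[unfolded weakly_continuous_on_def]] L2_embed_dual[OF \<phi>]] by simp
 show "L2_embed \<Omega> (v t) \<phi> - L2_embed \<Omega> (v \<tau>) \<phi> = (LINT r|lebesgue_on {\<tau><..t}. v' r \<phi>)" if "0 <= \<tau>" "\<tau> <= t"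
  by (rule weak_derivative_FTC[OF c ii _ that]) (use wd \<phi> in \<open>auto simp: weak_time_derivative_def\<close>)
qed

end

context cahn_hilliard_flow
begin

lemma itv: "open_itv 0 \<infinity> = {0<..}" "right_open_itv 0 \<infinity> = {0..}"
 by (auto simp: open_itv_def right_open_itv_def)

text \<open>Only pairings of \<open>d\<close>, the difference of the representatives, with fixed
  elements are known to be integrals in time, so its squared norm \<open>N\<close> is handled by
  increments. \<open>N b - N a\<close> is the pairing of \<open>d b - d a\<close> with
  \<open>d a + d b\<close>, and replacing this sum by twice \<open>d r\<close> costs a square of the
  increment of \<open>M\<close>. Hence \<open>N\<close> minus its Gronwall term does not
  increase.\<close>

lemma weak_solution_unique:
 assumes "weak_solution_from \<Omega> s \<sigma> g \<infinity> (u 0) v z"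
 shows "0 <= t ==> v t \<in> X0 \<Omega> \<sigma>" and "0 <= t ==> AE x in lebesgue. v t x = u t x"
  and "AE t in lebesgue_on {0<..}. z t \<in> X0 \<Omega> s & (AE x in lebesgue. z t x = w t x)"
proof -
 have ws: "weak_solution \<Omega> s \<sigma> g 0 \<infinity> v z" and init: "AE x in lebesgue. v 0 x = u 0 x"
  using assms by (auto simp: weak_solution_from_def)
 have wc: "weakly_continuous_on (X0 \<Omega> \<sigma>) (X0_norm \<sigma>) {0..} v"
  and zL: "bochner_L2 (X0 \<Omega> s) (X0_norm s) {0<..} z"
  and gL: "bochner_L2_loc (L2 \<Omega>) (L2_norm \<Omega>) 0 \<infinity> (%t x. g (v t x))"
  using ws unfolding weak_solution_def itv by auto
 obtain v' where v': "L2_time_derivative \<Omega> s {0<..} v v'"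
  and eqs: "AE t in lebesgue_on {0<..}. (\<forall>\<phi>\<in>X0 \<Omega> s. v' t \<phi> + frac_op s (z t) \<phi> = 0) &
   (\<forall>\<phi>\<in>X0 \<Omega> \<sigma>. L2_embed \<Omega> (z t) \<phi> = frac_op \<sigma> (v t) \<phi> + L2_embed \<Omega> (%x. g (v t x)) \<phi>)"
  using ws unfolding weak_solution_def itv by blast
 show vX: "v t \<in> X0 \<Omega> \<sigma>" if "0 <= t" for t using wc that by (simp add: weakly_continuous_on_def)
 have zX: "AE t in lebesgue_on {0<..}. z t \<in> X0 \<Omega> s" using zL by (simp add: bochner_L2_def)
 \<comment> \<open>Square integrability in time is local, so membership in
   \<open>L2 \<Omega>\<close> is collected over countably many bounded intervals.\<close>
 have gn: "AE t in lebesgue_on {0<..<real (Suc n)}. (%x. g (v t x)) \<in> L2 \<Omega>" for n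
  using gL by (simp add: bochner_L2_loc_def bochner_L2_def)
 have "AE t in lebesgue. ALL n. t \<in> {0<..<real (Suc n)} --> (%x. g (v t x)) \<in> L2 \<Omega>"
  unfolding AE_all_countable using gn by (simp add: AE_restrict_space_iff)
 hence "AE t in lebesgue. t \<in> {0<..} --> (%x. g (v t x)) \<in> L2 \<Omega>"
 proof eventually_elim
  case (elim t)
  obtain n :: nat where "t < real n" using reals_Archimedean2 by blast
  thus ?case using elim[THEN spec, of n] by auto
 qed
 hence gl: "AE t in lebesgue_on {0<..}. (%x. g (v t x)) \<in> L2 \<Omega>" by (simp add: AE_restrict_space_iff)
 have "ALL t. EX V. 0 <= t --> rep (v t) V" using rep_exists[OF vX] by blast
 then obtain V where V: "!!t. 0 <= t ==> rep (v t) (V t)" by metis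
 define d where "d t = U t - V t" for t
 define e where "e t = W t - emb s (z t)" for t
 define m where "m t = norm (W t) + norm (emb s (z t))" for t
 have dV: "d t \<in> V0" if "0 <= t" for t using rep_diff[OF uU[OF that] V[OF that]] by (simp add: rep_def d_def)
 have d0: "d 0 = 0"
 proof -
  have "rep (v 0) (U 0)"
   by (rule rep_cong[OF uU sq_meas[OF X0_sq[OF \<sigma> vX]]]) (use init in \<open>auto elim: eventually_mono\<close>)
  hence "U 0 = V 0" by (rule rep_functional) (use V in simp)
  thus ?thesis by (simp add: d_def)
 qed
 have Ri: "integrable (lebesgue_on {0<..<R}) (%r. e r \<bullet> h)" for R h
  unfolding e_def inner_diff_left
  by (intro Bochner_Integration.integrable_diff bochner_L2_inner_integrable(4)[OF s w_bochner_L2] bochner_L2_inner_integrable(4)[OF s zL])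
 have mi: "integrable (lebesgue_on {0<..<R}) m" for R
  unfolding m_def[abs_def]
  by (intro Bochner_Integration.integrable_add bochner_L2_inner_integrable(5)[OF s w_bochner_L2] bochner_L2_inner_integrable(5)[OF s zL])
 have em: "norm (e r) <= m r" for r unfolding e_def m_def by (rule norm_triangle_ineq4)
 have incr: "(d b - d a) \<bullet> h = (LINT r|lebesgue_on {a<..b}. - (e r \<bullet> h))" if ab: "0 <= a" "a <= b" and h: "h \<in> V0" for a b h
 proof -
  obtain \<phi> where \<phi>: "\<phi> \<in> X0 \<Omega> s" "h = emb s \<phi>" using h by (auto simp: V0_def)
  note I = lebesgue_on_Ioc_integral(1)[OF _ ab, of "b + 1"]
  have b: "0 <= b" using ab by simp
  have ut': "L2_time_derivative \<Omega> s {0<..} u ut" unfolding L2_time_derivative_def using ut_bochner_L2 ut_weak_derivative by blast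
  have 1: "U b \<bullet> h - U a \<bullet> h = (LINT r|lebesgue_on {a<..b}. ut r \<phi>)"
   using time_derivative_integral(3)[OF u_weakly_continuous ut' \<phi>(1) ab] L2_embed_u[OF _ \<phi>(1)] ab b by (simp add: \<phi>(2))
  have ve: "L2_embed \<Omega> (v t) \<phi> = V t \<bullet> h" if "0 <= t" for t
   using L2_embed_mk[OF X0_sq[OF \<sigma> vX[OF that]] X0_sq[OF s \<phi>(1)] \<Omega>s X0_out[OF s \<phi>(1)]] rep_inner[OF V[OF that] \<phi>(1)] by (simp add: \<phi>(2))
  have 2: "V b \<bullet> h - V a \<bullet> h = (LINT r|lebesgue_on {a<..b}. v' r \<phi>)"
   using time_derivative_integral(3)[OF wc v' \<phi>(1) ab] ve ab b by simp
  have iu: "integrable (lebesgue_on {a<..b}) (%r. ut r \<phi>)" and iv: "integrable (lebesgue_on {a<..b}) (%r. v' r \<phi>)"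
   by (rule I[OF time_derivative_integral(1)[OF u_weakly_continuous ut' \<phi>(1)]], simp,
     rule I[OF time_derivative_integral(1)[OF wc v' \<phi>(1)]], simp)
  have "(d b - d a) \<bullet> h = (U b \<bullet> h - U a \<bullet> h) - (V b \<bullet> h - V a \<bullet> h)" by (simp add: d_def inner_diff_left)
  also have "... = (LINT r|lebesgue_on {a<..b}. ut r \<phi> - v' r \<phi>)" unfolding 1 2 using iu iv by simp
  also have "... = (LINT r|lebesgue_on {a<..b}. - (e r \<bullet> h))"
  proof (rule integral_cong_AE)
   show "(%r. ut r \<phi> - v' r \<phi>) \<in> borel_measurable (lebesgue_on {a<..b})" using iu iv by (intro borel_measurable_diff borel_measurable_integrable)
   show "(%r. - (e r \<bullet> h)) \<in> borel_measurable (lebesgue_on {a<..b})" using borel_measurable_integrable[OF I[OF Ri, of h]] by simp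
   have "AE r in lebesgue_on {0<..}. ut r \<phi> - v' r \<phi> = - (e r \<bullet> h)"
    using eqs zX
   proof eventually_elim
    case (elim r)
    hence "v' r \<phi> = - (emb s (z r) \<bullet> h)" using \<phi> frac_op_emb[OF s elim(2) \<phi>(1)] by (metis add_eq_0_iff2)
    thus ?case by (simp add: ut[OF \<phi>(1)] e_def inner_diff_left \<phi>(2))
   qed
   thus "AE r in lebesgue_on {a<..b}. ut r \<phi> - v' r \<phi> = - (e r \<bullet> h)"
    by (rule AE_lebesgue_on_subset) (use ab in auto)
  qed
  finally show ?thesis .
 qed
 \<comment> \<open>The difference of the two equations is tested with \<open>u r - v r\<close>:
   \<beta> is monotone, and \<open>CC\<close> takes care of the remaining \<open>lam\<close> term.
   The test is carried out for almost every \<open>r\<close>, where \<open>g\<close> composed with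
   \<open>v r\<close> is square integrable.\<close>
 have key: "AE r in lebesgue_on {0<..}. - CC * (norm (d r))^2 <= e r \<bullet> d r &
   (\<forall>\<phi>\<in>X0 \<Omega> \<sigma>. mk (z r) \<bullet> mk \<phi> = emb \<sigma> (v r) \<bullet> emb \<sigma> \<phi> + mk (%x. g (v r x)) \<bullet> mk \<phi>)"
  using eqs zX gl AE_space
 proof eventually_elim
  case (elim r)
  hence r: "0 < r" "0 <= r" by auto
  note u1 = uX[OF r(2)] and v1 = vX[OF r(2)]
  note cu = subgrad_characterization[OF sg[OF r(1)] wX uU[OF r(2)] uB[OF r(2)]]
  have gm: "(%x. g (v r x)) \<in> borel_measurable lebesgue" by (rule comp_meas[OF g_cont sq_meas[OF X0_sq[OF \<sigma> v1]]])
  have go: "AE x in lebesgue. x \<notin> \<Omega> --> (g (v r x))^2 = 0" using X0_out[OF \<sigma> v1] by eventually_elim (simp add: g0)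
  have gs: "(%x. g (v r x)) \<in> sq"
   using elim(3) sq_out_integral(2)[OF _ \<Omega>s go] gm by (intro sqI) (auto simp: L2_def)
  have cv: "mk (z r) \<bullet> mk \<phi> = emb \<sigma> (v r) \<bullet> emb \<sigma> \<phi> + mk (%x. g (v r x)) \<bullet> mk \<phi>" if p: "\<phi> \<in> X0 \<Omega> \<sigma>" for \<phi>
  proof -
   note ee = L2_embed_mk[OF _ X0_sq[OF \<sigma> p] \<Omega>s X0_out[OF \<sigma> p]]
   show ?thesis using elim(1) p ee[OF X0_sq[OF s elim(2)]] ee[OF gs] frac_op_emb[OF \<sigma> v1 p] by auto
  qed
  note D = X0_diff[OF \<sigma> u1 v1] and F = X0_diff[OF s wX[of r] elim(2)]
  have "e r \<bullet> d r = (mk (u r) - mk (v r)) \<bullet> (mk (w r) - mk (z r))"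
   using rep_inner[OF rep_diff[OF uU[OF r(2)] V[OF r(2)]] F(1)] by (simp add: e_def d_def F D inner_commute)
  also have "... = (mk (w r) - mk (z r)) \<bullet> mk (%x. u r x - v r x)" by (simp add: D inner_commute)
  also have "... = (emb \<sigma> (u r) - emb \<sigma> (v r)) \<bullet> emb \<sigma> (%x. u r x - v r x) + (mk (%x. g (u r x)) - mk (%x. g (v r x))) \<bullet> mk (%x. u r x - v r x)"
   using cu(2)[OF D(1)] cv[OF D(1)] by (simp add: inner_diff_left)
  also have "... = (norm (emb \<sigma> (u r) - emb \<sigma> (v r)))^2 + (LINT x|lebesgue. (g (u r x) - g (v r x)) * (u r x - v r x))"
   unfolding D(2) mk_diff[OF cu(1) gs] inner_mk[OF sq_diff[OF cu(1) gs] X0_sq[OF \<sigma> D(1)]] by (simp add: power2_norm_eq_inner)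
  finally have ed: "e r \<bullet> d r = (norm (emb \<sigma> (u r) - emb \<sigma> (v r)))^2 + (LINT x|lebesgue. (g (u r x) - g (v r x)) * (u r x - v r x))" .
  have "(LINT x|lebesgue. - lam * (u r x - v r x)^2) <= (LINT x|lebesgue. (g (u r x) - g (v r x)) * (u r x - v r x))"
  proof (rule integral_mono)
   show "integrable lebesgue (%x. - lam * (u r x - v r x)^2)" by (intro integrable_mult_right sq_int[OF X0_sq[OF \<sigma> D(1)]])
   show "integrable lebesgue (%x. (g (u r x) - g (v r x)) * (u r x - v r x))"
    by (rule sq_mult_integrable[OF sq_diff[OF cu(1) gs] X0_sq[OF \<sigma> D(1)]])
   show "- lam * (u r x - v r x)^2 <= (g (u r x) - g (v r x)) * (u r x - v r x)" for x
   proof -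
    have "0 <= (\<beta> (u r x) - \<beta> (v r x)) * (u r x - v r x)"
     using \<beta>_mono[of "u r x" "v r x"] \<beta>_mono[of "v r x" "u r x"]
     by (cases "u r x <= v r x") (auto intro: mult_nonpos_nonpos mult_nonneg_nonneg)
    thus ?thesis by (simp add: \<beta> power2_eq_square algebra_simps)
   qed
  qed
  hence "- lam * (norm (mk (u r) - mk (v r)))^2 <= (LINT x|lebesgue. (g (u r x) - g (v r x)) * (u r x - v r x))"
   unfolding D(3)[symmetric] norm_mk_square[OF X0_sq[OF \<sigma> D(1)]] by simp
  moreover have "lam * (norm (mk (u r) - mk (v r)))^2 <= 1/2 * (norm (emb \<sigma> (u r) - emb \<sigma> (v r)))^2 + CC * (norm (d r))^2"
   using CC(2)[OF rep_diff[OF uU[OF r(2)] V[OF r(2)]]] unfolding D d_def by simp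
  moreover have "0 <= (norm (emb \<sigma> (u r) - emb \<sigma> (v r)))^2" by simp
  ultimately have "- CC * (norm (d r))^2 <= e r \<bullet> d r" unfolding ed mult_minus_left by linarith
  thus ?case using cv by blast
 qed
 \<comment> \<open>\<open>M\<close> measures time by the speeds of both solutions: it is continuous
   and dominates the increments of \<open>d\<close>.\<close>
 define M where "M t = integral {0..t} m" for t
 have m0: "0 <= m r" for r by (simp add: m_def)
 have mI: "m integrable_on {a..b}" "integral {a..b} m = M b - M a" "(LINT r|lebesgue_on {a<..b}. m r) = M b - M a" if "0 <= a" "a <= b" for a b
 proof -
  show "m integrable_on {a..b}" by (rule lebesgue_on_Ioc_integral(2)[OF mi[of "b + 1"]]) (use that in auto)
  have "m integrable_on {0..b}" by (rule lebesgue_on_Ioc_integral(2)[OF mi[of "b + 1"]]) (use that in auto)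
  from Henstock_Kurzweil_Integration.integral_combine[OF that this] show 1: "integral {a..b} m = M b - M a" by (simp add: M_def)
  show "(LINT r|lebesgue_on {a<..b}. m r) = M b - M a"
   unfolding 1[symmetric] by (rule lebesgue_on_Ioc_integral(3)[OF mi[of "b + 1"]]) (use that in auto)
 qed
 have Mmono: "M a <= M b" if "0 <= a" "a <= b" for a b
  using mI(2)[OF that] integral_nonneg[OF mI(1)[OF that]] m0 by simp
 have Mc: "continuous_on {0..} M"
 proof (rule continuous_on_atLeast_0I)
  show "continuous_on {0..T} M" if "0 <= T" for T
   unfolding M_def by (rule indefinite_integral_continuous_1[OF mI(1)]) (use that in auto)
 qed
 have dist: "norm (d b - d a) <= M b - M a" if ab: "0 <= a" "a <= b" for a b
 proof -
  define h where "h = d b - d a"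
  have hV: "h \<in> V0" unfolding h_def using dV ab V0(1) by (intro subspace_diff) auto
  have "norm h * norm h = (LINT r|lebesgue_on {a<..b}. - (e r \<bullet> h))"
   using incr[OF ab hV] unfolding h_def[symmetric] by (simp add: dot_square_norm power2_eq_square)
  also have "... <= (LINT r|lebesgue_on {a<..b}. m r * norm h)"
  proof (rule integral_mono)
   show "integrable (lebesgue_on {a<..b}) (%r. - (e r \<bullet> h))"
    using lebesgue_on_Ioc_integral(1)[OF Ri ab, of "b + 1" h] by simp
   show "integrable (lebesgue_on {a<..b}) (%r. m r * norm h)"
    using lebesgue_on_Ioc_integral(1)[OF mi ab, of "b + 1"] by simp
   fix r
   have "- (e r \<bullet> h) <= norm (e r) * norm h" using Cauchy_Schwarz_ineq2[of "e r" h] by linarith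
   also have "... <= m r * norm h" by (intro mult_right_mono em) auto
   finally show "- (e r \<bullet> h) <= m r * norm h" .
  qed
  also have "... = (M b - M a) * norm h" using mI(3)[OF ab] by simp
  finally have "norm h * norm h <= (M b - M a) * norm h" .
  hence "norm h <= M b - M a"
   unfolding power2_eq_square[symmetric] by (rule le_of_square_le_mult) (use Mmono[OF ab] in auto)
  thus ?thesis by (simp add: h_def)
 qed
 have dc: "continuous_on {0..} d"
 proof (rule continuous_on_dist_le[OF Mc])
  show "dist (d r) (d t) <= 1 * dist (M r) (M t)" if "r \<in> {0..}" "t \<in> {0..}" for r t
   using dist[of r t] dist[of t r] that by (cases "r <= t") (auto simp: dist_norm norm_minus_commute)
 qed
 define N where "N t = (norm (d t))^2" for t
 have Nc: "continuous_on {0..} N" unfolding N_def by (intro continuous_intros dc)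
 have NI: "N integrable_on {a..b}" "integrable (lebesgue_on {a<..b}) N" "(LINT r|lebesgue_on {a<..b}. N r) = integral {a..b} N" if "0 <= a" "a <= b" for a b
 proof -
  have "continuous_on {0..b+1} N" by (rule continuous_on_subset[OF Nc]) auto
  from continuous_imp_integrable_real[OF this] have "integrable (lebesgue_on {0<..<b+1}) N" by (rule integrable_lebesgue_on_subset) auto
  note L = lebesgue_on_Ioc_integral[OF this that]
  show "N integrable_on {a..b}" "integrable (lebesgue_on {a<..b}) N" "(LINT r|lebesgue_on {a<..b}. N r) = integral {a..b} N" using L by auto
 qed
 define G where "G t = N t - 2 * CC * integral {0..t} N" for t
 have Ginc: "G b - G a <= 1 * (M b - M a)^2" if ab: "0 <= a" "a <= b" for a b
 proof -
  define h where "h = d a + d b"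
  have b: "0 <= b" using ab by simp
  have hV: "h \<in> V0" unfolding h_def using dV[OF ab(1)] dV[OF b] V0(1) by (intro subspace_add) auto
  have "N b - N a = (d b - d a) \<bullet> h"
   unfolding N_def h_def power2_norm_eq_inner using inner_commute[of "d a" "d b"] by (simp only: inner_diff_left inner_add_right)
  also have "... = (LINT r|lebesgue_on {a<..b}. - (e r \<bullet> h))" by (rule incr[OF ab hV])
  also have "... <= (LINT r|lebesgue_on {a<..b}. 2 * CC * N r + m r * (M b - M a))"
  proof (rule integral_mono_AE)
   show "integrable (lebesgue_on {a<..b}) (%r. - (e r \<bullet> h))"
    using lebesgue_on_Ioc_integral(1)[OF Ri ab, of "b + 1" h] by simp
   show "integrable (lebesgue_on {a<..b}) (%r. 2 * CC * N r + m r * (M b - M a))"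
    using lebesgue_on_Ioc_integral(1)[OF mi ab, of "b + 1"] NI(2)[OF ab] by simp
   have "AE r in lebesgue_on {a<..b}. - CC * (norm (d r))^2 <= e r \<bullet> d r &
     (\<forall>\<phi>\<in>X0 \<Omega> \<sigma>. mk (z r) \<bullet> mk \<phi> = emb \<sigma> (v r) \<bullet> emb \<sigma> \<phi> + mk (%x. g (v r x)) \<bullet> mk \<phi>)"
    by (rule AE_lebesgue_on_subset[OF key]) (use ab in auto)
   thus "AE r in lebesgue_on {a<..b}. - (e r \<bullet> h) <= 2 * CC * N r + m r * (M b - M a)"
    using AE_space
   proof eventually_elim
    case (elim r)
    hence r: "a <= r" "r <= b" "0 <= r" using ab by auto
    have "norm (2 *\<^sub>R d r - h) <= norm (d r - d a) + norm (d b - d r)"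
     using norm_triangle_ineq4[of "d r - d a" "d b - d r"] by (simp add: h_def scaleR_2 algebra_simps)
    also have "... <= M b - M a" using dist[OF ab(1) r(1)] dist[OF r(3,2)] by simp
    finally have q: "norm (2 *\<^sub>R d r - h) <= M b - M a" .
    have "e r \<bullet> (2 *\<^sub>R d r - h) <= norm (e r) * norm (2 *\<^sub>R d r - h)" by (rule norm_cauchy_schwarz)
    also have "... <= m r * (M b - M a)" using q em m0 by (intro mult_mono) auto
    finally have "- (e r \<bullet> h) <= m r * (M b - M a) - 2 * (e r \<bullet> d r)" by (simp add: inner_diff_right)
    thus ?case using elim(1) unfolding N_def by linarith
   qed
  qed
  also have "... = 2 * CC * (LINT r|lebesgue_on {a<..b}. N r) + (LINT r|lebesgue_on {a<..b}. m r) * (M b - M a)"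
   using lebesgue_on_Ioc_integral(1)[OF mi ab, of "b + 1"] NI(2)[OF ab] by (simp add: Bochner_Integration.integral_add)
  also have "... = 2 * CC * integral {a..b} N + (M b - M a)^2" unfolding NI(3)[OF ab] mI(3)[OF ab] by (simp add: power2_eq_square)
  also have "integral {a..b} N = integral {0..b} N - integral {0..a} N"
   using Henstock_Kurzweil_Integration.integral_combine[OF ab NI(1)[OF order_refl b]] by simp
  finally show ?thesis unfolding G_def by (simp add: algebra_simps)
 qed
 have N0: "N t = 0" if t: "0 <= t" for t
 proof (rule Gronwall_zero[of t N "2 * CC"])
  show "continuous_on {0..t} N" by (rule continuous_on_subset[OF Nc]) auto
  show "N r <= 2 * CC * integral {0..r} N" if "r \<in> {0..t}" for r
   using quadratic_increment_antimono[OF Mc Mmono Ginc, of 0 r] that d0 by (simp add: G_def N_def)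
 qed (use t in \<open>auto simp: N_def\<close>)
 have UV: "U t = V t" if "0 <= t" for t using N0[OF that] by (simp add: N_def d_def)
 show uv: "AE x in lebesgue. v t x = u t x" if "0 <= t" for t
  by (rule rep_unique[OF V[OF that]]) (use uU[OF that] UV[OF that] in simp)
 \<comment> \<open>With \<open>u\<close> and \<open>v\<close> identified, the two Euler equations
   have the same right side, which determines \<open>w\<close> and \<open>z\<close> almost
   everywhere.\<close>
 show "AE t in lebesgue_on {0<..}. z t \<in> X0 \<Omega> s & (AE x in lebesgue. z t x = w t x)"
  using key zX gl AE_space
 proof eventually_elim
  case (elim r)
  hence r: "0 < r" "0 <= r" by auto
  note u1 = uX[OF r(2)] and v1 = vX[OF r(2)]
  note cu = subgrad_characterization[OF sg[OF r(1)] wX uU[OF r(2)] uB[OF r(2)]]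
  have e1: "emb \<sigma> (v r) = emb \<sigma> (u r)" by (rule AE_eq_transfer(2)[OF v1 u1 uv[OF r(2)]])
  have ge: "AE x in lebesgue. g (u r x) = g (v r x)" using uv[OF r(2)] by eventually_elim simp
  have gm: "(%x. g (v r x)) \<in> borel_measurable lebesgue" by (rule comp_meas[OF g_cont sq_meas[OF X0_sq[OF \<sigma> v1]]])
  have e2: "mk (%x. g (u r x)) = mk (%x. g (v r x))" by (rule mk_cong[OF cu(1) sq_cong_AE[OF cu(1) gm ge] ge])
  have "AE x in lebesgue. z r x = w r x"
  proof (rule L2_eq_by_X0(1)[OF elim(2) wX])
   fix \<phi> assume "\<phi> \<in> X0 \<Omega> \<sigma>"
   thus "mk (z r) \<bullet> mk \<phi> = mk (w r) \<bullet> mk \<phi>" using elim(1) cu(2) by (simp add: e1 e2)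
  qed
  thus ?case using elim(2) by blast
 qed
qed

end

section \<open>Energy inequalities for arbitrary weak solutions\<close>

context cahn_hilliard_flow
begin

text \<open>With an exponential weight the norm of \<open>W\<close> is decreasing, so it has at most
  countably many discontinuities; at all other times the integral of its square is
  differentiable.\<close>

lemma E0_derivative: "AE t in lebesgue_on {0<..}. ((%r. E0 (u r)) has_real_derivative - (norm (W t))\<^sup>2) (at t)"
proof -
 define n where "n r = exp (- 4 * CC * r) * norm (W r)" for r
 have "mono_on {0<..} (%r. - n r)"
 proof (rule mono_onI)
  fix r t :: real assume rt: "r \<in> {0<..}" "t \<in> {0<..}" "r <= t"
  have "exp (- 4 * CC * t) * norm (W t) <= exp (- 4 * CC * t) * (exp (4 * CC * (t - r)) * norm (W r))"
   using Wexp[of r t] rt by (intro mult_left_mono) auto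
  also have "... = n r" unfolding n_def mult.assoc[symmetric] exp_add[symmetric] by (simp add: algebra_simps)
  finally show "- n r <= - n t" unfolding n_def by simp
 qed
 hence c: "countable {t \<in> {0<..}. \<not> isCont (%r. - n r) t}" by (intro mono_on_ctble_discont_open) auto
 have D: "((%r. E0 (u r)) has_real_derivative - (norm (W t))\<^sup>2) (at t)" if t: "0 < t" and ct: "isCont (%r. - n r) t" for t
 proof -
  have "isCont (%r. (exp (4 * CC * r) * (- (- n r)))^2) t" by (intro continuous_intros ct)
  moreover have "(%r. (exp (4 * CC * r) * (- (- n r)))^2) = (%r. (norm (W r))^2)"
   by (simp add: n_def fun_eq_iff exp_minus field_simps)
  ultimately have hc: "isCont (%r. (norm (W r))^2) t" by simp
  have "((%r. integral {0..r} (%r. (norm (W r))^2)) has_vector_derivative (norm (W t))\<^sup>2) (at t within {0..t+1} - {})"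
   by (rule integral_has_vector_derivative_continuous_at)
     (use Ei[of 0 "t + 1"] t hc in \<open>auto intro: continuous_at_imp_continuous_at_within\<close>)
  hence "((%r. integral {0..r} (%r. (norm (W r))^2)) has_vector_derivative (norm (W t))\<^sup>2) (at t within {0<..<t+1})"
   by (rule has_vector_derivative_within_subset) auto
  hence d: "((%r. integral {0..r} (%r. (norm (W r))^2)) has_real_derivative (norm (W t))\<^sup>2) (at t)"
   using t by (simp add: has_real_derivative_iff_has_vector_derivative at_within_open[of t "{0<..<t+1}"])
  have "((%r. E0 (u 0) - integral {0..r} (%r. (norm (W r))^2)) has_real_derivative - (norm (W t))\<^sup>2) (at t)"
   using DERIV_diff[OF DERIV_const d, of "E0 (u 0)"] by simp
  thus ?thesis
   by (rule has_field_derivative_transform_within_open[of _ _ _ "{0<..}"]) (use t integral_unique[OF Ei[of 0]] in auto)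
 qed
 have "{t \<in> {0<..}. \<not> isCont (%r. - n r) t} \<in> null_sets lebesgue"
  by (rule null_sets_completionI[OF countable_imp_null_set_lborel[OF c]])
 hence "AE t in lebesgue. t \<notin> {t \<in> {0<..}. \<not> isCont (%r. - n r) t}" by (rule AE_not_in)
 hence "AE t in lebesgue. t \<in> {0<..} --> ((%r. E0 (u r)) has_real_derivative - (norm (W t))\<^sup>2) (at t)"
  by eventually_elim (use D in auto)
 thus ?thesis by (simp add: AE_restrict_space_iff)
qed

text \<open>All ingredients depend on \<open>u t\<close> only up to null sets. The companion
  \<open>z\<close> is not put in place of \<open>w\<close>: the two agree only for almost every
  time, whereas the flow makes statements for every positive time.\<close>

lemma weak_solution_flow:
 assumes ws: "weak_solution_from \<Omega> s \<sigma> g \<infinity> (u 0) v z"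
 shows "cahn_hilliard_flow \<Omega> s \<sigma> lam \<kappa> g ghat \<beta> \<beta>hat v w U"
proof (intro cahn_hilliard_flow.intro cahn_hilliard_flow_axioms.intro cahn_hilliard_axioms)
 note uniq = weak_solution_unique[OF ws]
 have tr: "E0 (v t) = E0 (u t)" "integrable lebesgue (%x. B (v t x))" if "t >= 0" for t
  using AE_eq_transfer[OF uniq(1)[OF that] uX[OF that] uniq(2)[OF that]] uB[OF that] by auto
 show "rep (v t) (U t)" if "t >= 0" for t
  by (rule rep_cong[OF uU[OF that] sq_meas[OF X0_sq[OF \<sigma> uniq(1)[OF that]]]]) (use uniq(2)[OF that] in \<open>auto elim: eventually_mono\<close>)
 show "integrable lebesgue (%x. B (v t x))" if "t >= 0" for t by (rule tr(2)[OF that])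
 show "continuous_on {0..} (%t. E0 (v t))" by (rule continuous_on_eq[OF Ec]) (simp add: tr)
 show "((%r. (norm (W r))^2) has_integral (E0 (v \<tau>) - E0 (v t))) {\<tau>..t}" if "0 <= \<tau>" "\<tau> <= t" for \<tau> t
  using Ei[OF that] tr that by simp
qed (use wX sg Uc Ud Wr Wexp in auto)

text \<open>\<open>z\<close> stands for the second component of a weak solution, to which integrals
  and almost everywhere statements are transferred from \<open>w\<close>. In the second energy
  inequality \<open>v'\<close> is an arbitrary time derivative and has to be compared with
  \<open>ut\<close>.\<close>

lemma flow_properties:
 assumes zw: "AE t in lebesgue_on {0<..}. z t \<in> X0 \<Omega> s & (AE x in lebesgue. z t x = w t x)"
 shows "t >= 0 ==> integrable (lebesgue_on \<Omega>) (%x. ghat (u t x))"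
  and "antimono_on {0..} (%t. energy \<Omega> \<sigma> ghat (u t))"
  and "t >= 0 ==> continuous (at_right t) (%r. energy \<Omega> \<sigma> ghat (u r))"
  and "AE t in lebesgue_on {0<..}. (%r. energy \<Omega> \<sigma> ghat (u r)) differentiable (at t)"
  and "t >= 0 ==> ((%r. X0_norm \<sigma> (%x. u r x - u t x)) \<longlongrightarrow> 0) (at_right t)"
  and "AE t in lebesgue_on {0<..}. (X0_norm s (z t))^2 + deriv (%r. energy \<Omega> \<sigma> ghat (u r)) t <= 0"
  and "L2_time_derivative \<Omega> s {0<..} u v' ==>
   AE t in lebesgue_on {0<..}. v' t (z t) >= deriv (%r. energy \<Omega> \<sigma> ghat (u r)) t"
  and "0 <= \<tau> ==> \<tau> <= t ==> (LINT r|lebesgue_on {\<tau>..t}. (X0_norm s (z r))^2) + energy \<Omega> \<sigma> ghat (u t) <= energy \<Omega> \<sigma> ghat (u \<tau>)"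
  and "T > 0 ==> \<exists>C>0. \<forall>t\<ge>0. bochner_L2 (L2 \<Omega>) (L2_norm \<Omega>) {t<..<t + T} (%\<tau> x. \<beta> (u \<tau> x)) &
   (LINT \<tau>|lebesgue_on {t<..<t + T}. (L2_norm \<Omega> (%x. \<beta> (u \<tau> x)))^2) <= C"
proof -
 define e0 where "e0 = ghat 0 * measure lebesgue \<Omega>"
 have en: "energy \<Omega> \<sigma> ghat (u t) = E0 (u t) + e0" if "t >= 0" for t
  using energy_eq(2)[OF uX[OF that] uB[OF that]] by (simp add: e0_def)
 show "integrable (lebesgue_on \<Omega>) (%x. ghat (u t x))" if "t >= 0" for t
  by (rule energy_eq(1)[OF uX[OF that] uB[OF that]])
 show "antimono_on {0..} (%t. energy \<Omega> \<sigma> ghat (u t))"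
  by (rule monotone_onI) (use E0_antimono in \<open>auto simp: en\<close>)
 show "continuous (at_right t) (%r. energy \<Omega> \<sigma> ghat (u r))" if t: "t >= 0" for t
 proof -
  have "((%r. E0 (u r)) \<longlongrightarrow> E0 (u t)) (at t within {0..})" using Ec t by (simp add: continuous_on_def)
  hence "((%r. E0 (u r)) \<longlongrightarrow> E0 (u t)) (at_right t)" by (rule tendsto_within_subset) (use t in auto)
  hence "((%r. E0 (u r) + e0) \<longlongrightarrow> energy \<Omega> \<sigma> ghat (u t)) (at_right t)" unfolding en[OF t] by (intro tendsto_intros)
  moreover have "eventually (%r. E0 (u r) + e0 = energy \<Omega> \<sigma> ghat (u r)) (at_right t)"
   using eventually_at_right_less[of t] by eventually_elim (use t en in auto)
  ultimately show ?thesis unfolding continuous_within by (rule Lim_transform_eventually)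
 qed
 have der: "AE t in lebesgue_on {0<..}. ((%r. energy \<Omega> \<sigma> ghat (u r)) has_real_derivative - (norm (W t))\<^sup>2) (at t)"
  using E0_derivative AE_space
 proof eventually_elim
  case (elim t)
  hence "((%r. E0 (u r) + e0) has_real_derivative - (norm (W t))\<^sup>2 + 0) (at t)" by (intro DERIV_add DERIV_const)
  hence "((%r. energy \<Omega> \<sigma> ghat (u r)) has_real_derivative - (norm (W t))\<^sup>2 + 0) (at t)"
   by (rule has_field_derivative_transform_within_open[of _ _ _ "{0<..}"]) (use elim en in auto)
  thus ?case by simp
 qed
 thus "AE t in lebesgue_on {0<..}. (%r. energy \<Omega> \<sigma> ghat (u r)) differentiable (at t)"
  by eventually_elim (use real_differentiable_def in blast)
 show "((%r. X0_norm \<sigma> (%x. u r x - u t x)) \<longlongrightarrow> 0) (at_right t)" if t: "t >= 0" for t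
 proof (rule Lim_transform_eventually)
  have "((%r. emb \<sigma> (u r)) \<longlongrightarrow> emb \<sigma> (u t)) (at t within {0..})" using emb_continuous t by (simp add: continuous_on_def)
  hence "((%r. emb \<sigma> (u r)) \<longlongrightarrow> emb \<sigma> (u t)) (at_right t)" by (rule tendsto_within_subset) (use t in auto)
  thus "((%r. norm (emb \<sigma> (u r) - emb \<sigma> (u t))) \<longlongrightarrow> 0) (at_right t)" by (intro tendsto_norm_zero LIM_zero)
  show "eventually (%r. norm (emb \<sigma> (u r) - emb \<sigma> (u t)) = X0_norm \<sigma> (%x. u r x - u t x)) (at_right t)"
   using eventually_at_right_less[of t]
  proof eventually_elim
   case (elim r)
   hence r: "r >= 0" using t by simp
   show ?case using X0_norm_minus[OF \<sigma> uX[OF r] uX[OF t]] by simp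
  qed
 qed
 have zw: "AE t in lebesgue_on {0<..}. z t \<in> X0 \<Omega> s & emb s (z t) = W t"
  using zw by eventually_elim (auto dest: X0_cong_AE(2)[OF s _ sq_meas[OF X0_sq[OF s wX]], of _ \<Omega>])
 show "AE t in lebesgue_on {0<..}. (X0_norm s (z t))^2 + deriv (%r. energy \<Omega> \<sigma> ghat (u r)) t <= 0"
  using zw der by eventually_elim (auto simp: X0_norm_emb[OF s] DERIV_imp_deriv)
 show "AE t in lebesgue_on {0<..}. v' t (z t) >= deriv (%r. energy \<Omega> \<sigma> ghat (u r)) t"
  if v': "L2_time_derivative \<Omega> s {0<..} u v'"
 proof -
  have ut': "L2_time_derivative \<Omega> s {0<..} u ut" unfolding L2_time_derivative_def using ut_bochner_L2 ut_weak_derivative by blast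
  have D: "AE t in lebesgue_on {0<..}. v' t \<in> X0_dual \<Omega> s"
   using v' unfolding L2_time_derivative_def bochner_L2_def by auto
  have eq: "AE t in lebesgue_on {0<..}. v' t \<phi> = - W t \<bullet> emb s \<phi>" if p: "\<phi> \<in> X0 \<Omega> s" for \<phi>
  proof -
   note I = time_derivative_integral[OF u_weakly_continuous v' p] time_derivative_integral[OF u_weakly_continuous ut' p]
   have "AE t in lebesgue_on {0<..}. v' t \<phi> - ut t \<phi> = 0"
   proof (rule AE_zero_by_interval_integrals)
    show "integrable (lebesgue_on {0<..<R}) (%t. v' t \<phi> - ut t \<phi>)" for R by (intro Bochner_Integration.integrable_diff I)
    fix t :: real assume t: "0 <= t"
    have i: "integrable (lebesgue_on {0<..t}) (%t. v' t \<phi>)" "integrable (lebesgue_on {0<..t}) (%t. ut t \<phi>)"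
     by (rule lebesgue_on_Ioc_integral(1)[OF I(1), where R="t + 1"]; use t in simp)
       (rule lebesgue_on_Ioc_integral(1)[OF I(4), where R="t + 1"]; use t in simp)
    show "(LINT r|lebesgue_on {0<..t}. v' r \<phi> - ut r \<phi>) = 0"
     using I(3)[of 0 t] I(6)[of 0 t] t i by simp
   qed
   thus ?thesis by eventually_elim (simp add: ut[OF p])
  qed
  \<comment> \<open>The exceptional null set in \<open>eq\<close> depends on the test function. A
    common one exists for the countably many values of \<open>w\<close> at rational times;
    right-continuity of \<open>W\<close> and boundedness of \<open>v' t\<close> then reach
    \<open>w t\<close> itself.\<close>
  have "AE t in lebesgue_on {0<..}. ALL q::rat. v' t (w (of_rat q)) = - W t \<bullet> W (of_rat q)"
   unfolding AE_all_countable using eq[OF wX] by blast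
  thus ?thesis using der zw D AE_space
  proof eventually_elim
   case (elim t)
   hence t: "t > 0" and zt: "z t \<in> X0 \<Omega> s" "emb s (z t) = W t" by auto
   define C where "C = \<bar>X0_dual_norm \<Omega> s (v' t)\<bar>"
   have diff: "\<bar>v' t f - v' t k\<bar> <= C * norm (emb s f - emb s k)" if "f \<in> X0 \<Omega> s" "k \<in> X0 \<Omega> s" for f k
    by (rule order_trans[OF dual_difference[OF s elim(4) that] mult_right_mono]) (auto simp: C_def)
   have z: "v' t (z t) = v' t (w t)" using diff[OF zt(1) wX[of t]] zt(2) by simp
   have small: "\<bar>v' t (w t) + (norm (W t))^2\<bar> <= 0 + \<epsilon>" if \<epsilon>: "\<epsilon> > 0" for \<epsilon>
   proof -
    define \<delta> where "\<delta> = \<epsilon> / (C + norm (W t) + 1)"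
    have C0: "0 < C + norm (W t) + 1" by (simp add: C_def add_nonneg_pos)
    hence "\<delta> > 0" using \<epsilon> by (simp add: \<delta>_def)
    hence "eventually (%r. dist (W r) (W t) < \<delta>) (at_right t)" using Wr[OF t] by (rule tendstoD[rotated])
    then obtain b where b: "b > t" "!!r. t < r ==> r < b ==> dist (W r) (W t) < \<delta>"
     unfolding eventually_at_right_field by blast
    obtain q where q: "t < of_rat q" "of_rat q < b" using of_rat_dense[OF b(1)] by blast
    have n: "norm (W (of_rat q) - W t) < \<delta>" using b(2)[OF q] by (simp add: dist_norm)
    have "v' t (w t) + (norm (W t))^2 = (v' t (w t) - v' t (w (of_rat q))) + W t \<bullet> (W t - W (of_rat q))"
     using elim(1) by (simp add: inner_diff_right power2_norm_eq_inner)
    also have "\<bar>...\<bar> <= C * norm (W t - W (of_rat q)) + norm (W t) * norm (W t - W (of_rat q))"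
     by (rule order_trans[OF abs_triangle_ineq add_mono[OF diff[OF wX wX] Cauchy_Schwarz_ineq2]])
    also have "... = (C + norm (W t)) * norm (W (of_rat q) - W t)" by (simp add: distrib_right norm_minus_commute)
    also have "... <= (C + norm (W t) + 1) * \<delta>"
     using n C0 \<open>\<delta> > 0\<close> by (intro mult_mono) (auto simp: C_def)
    also have "... = \<epsilon>" using C0 by (simp add: \<delta>_def)
    finally show ?thesis by simp
   qed
   have "\<bar>v' t (w t) + (norm (W t))^2\<bar> <= 0" by (rule field_le_epsilon) (rule small)
   thus ?case using DERIV_imp_deriv[OF elim(2)] by (simp add: z)
  qed
 qed
 show "(LINT r|lebesgue_on {\<tau>..t}. (X0_norm s (z r))^2) + energy \<Omega> \<sigma> ghat (u t) <= energy \<Omega> \<sigma> ghat (u \<tau>)"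
  if \<tau>t: "0 <= \<tau>" "\<tau> <= t" for \<tau> t
 proof -
  have "AE r in lebesgue. r \<in> {0<..} --> (X0_norm s (z r))^2 = (norm (W r))^2"
  proof -
   have "AE r in lebesgue. r \<in> {0<..} --> z r \<in> X0 \<Omega> s & emb s (z r) = W r"
    by (rule iffD1[OF AE_restrict_space_iff], simp, rule zw)
   thus ?thesis by eventually_elim (auto simp: X0_norm_emb[OF s, of _ \<Omega>])
  qed
  \<comment> \<open>Nothing is known of \<open>z 0\<close>, and 0 may be the left end of the
    interval.\<close>
  moreover have "AE r in lebesgue. r \<noteq> (0::real)"
   using AE_not_in[of "{0::real}" lebesgue] by simp
  ultimately have "AE r in lebesgue. r \<in> {\<tau>..t} --> (norm (W r))^2 = (X0_norm s (z r))^2"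
   by eventually_elim (use \<tau>t in auto)
  hence ae: "AE r in lebesgue_on {\<tau>..t}. (norm (W r))^2 = (X0_norm s (z r))^2" by (simp add: AE_restrict_space_iff)
  have "integrable (lebesgue_on {\<tau>..t}) (%r. (norm (W r))^2)"
   by (rule integrable_lebesgue_on_subset[OF W_square_integrable]) (use \<tau>t in auto)
  hence m: "(%r. (norm (W r))^2) \<in> borel_measurable (lebesgue_on {\<tau>..t})" by (rule borel_measurable_integrable)
  \<comment> \<open>The squared norm of \<open>z\<close> inherits measurability from that of
    \<open>W\<close> as the almost everywhere limit of a constant sequence.\<close>
  have "AE r in lebesgue_on {\<tau>..t}. (%n::nat. (norm (W r))^2) ----> (X0_norm s (z r))\<^sup>2"
   using ae by eventually_elim simp
  from borel_measurable_lebesgue_on_AE_limit[OF _ m this] have m': "(%r. (X0_norm s (z r))^2) \<in> borel_measurable (lebesgue_on {\<tau>..t})" by simp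
  have "(LINT r|lebesgue_on {\<tau>..t}. (X0_norm s (z r))^2) = E0 (u \<tau>) - E0 (u t)"
   using integral_cong_AE[OF m m' ae] W_square_integral[OF \<tau>t] by simp
  thus ?thesis using en \<tau>t by simp
 qed
 show "\<exists>C>0. \<forall>t\<ge>0. bochner_L2 (L2 \<Omega>) (L2_norm \<Omega>) {t<..<t + T} (%\<tau> x. \<beta> (u \<tau> x)) &
   (LINT \<tau>|lebesgue_on {t<..<t + T}. (L2_norm \<Omega> (%x. \<beta> (u \<tau> x)))^2) <= C" if T: "T > 0"
 proof -
  obtain a b where ab: "0 <= a" "0 <= b" "!!t. t > 0 ==> (norm (mk (%x. \<beta> (u t x))) + lam * norm (mk (u t)))^2 <= a * (norm (W t))^2 + b"
   using reaction_bound by blast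
  define H where "H = (LINT r|lebesgue_on {0..}. (norm (W r))^2)"
  have H0: "0 <= H" unfolding H_def by simp
  \<comment> \<open>\<open>H\<close> is the total dissipation, so the bound does not depend on
    \<open>t\<close>; the summand 1 makes \<open>C\<close> positive.\<close>
  define C where "C = a * H + b * T + 1"
  have "bochner_L2 (L2 \<Omega>) (L2_norm \<Omega>) {t<..<t + T} (%\<tau> x. \<beta> (u \<tau> x)) &
   (LINT \<tau>|lebesgue_on {t<..<t + T}. (L2_norm \<Omega> (%x. \<beta> (u \<tau> x)))^2) <= C" if t: "t >= 0" for t
  proof -
   let ?I = "{t<..<t + T}"
   have bu: "bochner_L2 (L2 \<Omega>) (L2_norm \<Omega>) ?I (%\<tau> x. \<beta> (u \<tau> x))"
    by (rule \<beta>_bochner_L2[of _ "t + T"]) (use t in auto)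
   have wi: "integrable (lebesgue_on ?I) (%r. (norm (W r))^2)"
    by (rule integrable_lebesgue_on_subset[OF W_square_integrable]) (use t in auto)
   have "integrable (lebesgue_on {t..t+T}) (%t. b)" by (rule continuous_imp_integrable_real) auto
   hence bi: "integrable (lebesgue_on ?I) (%t. b)" by (rule integrable_lebesgue_on_subset) auto
   have "(LINT r|lebesgue_on ?I. (L2_norm \<Omega> (%x. \<beta> (u r x)))^2) <= (LINT r|lebesgue_on ?I. a * (norm (W r))^2 + b)"
   proof (rule integral_mono)
    show "integrable (lebesgue_on ?I) (%r. (L2_norm \<Omega> (%x. \<beta> (u r x)))^2)" using bu by (simp add: bochner_L2_def)
    show "integrable (lebesgue_on ?I) (%r. a * (norm (W r))^2 + b)" using wi bi by simp
    fix r assume "r \<in> space (lebesgue_on ?I)"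
    hence r: "r > 0" using t by auto
    have "AE x in lebesgue. x \<notin> \<Omega> --> \<beta> (u r x) = 0" using X0_out[OF \<sigma> uX, of r] r by (auto elim!: eventually_mono simp: \<beta>0)
    hence "L2_norm \<Omega> (%x. \<beta> (u r x)) = norm (mk (%x. \<beta> (u r x)))" by (rule L2_norm_mk[OF \<beta>_sq[OF r] \<Omega>s])
    moreover have "(norm (mk (%x. \<beta> (u r x))))^2 <= (norm (mk (%x. \<beta> (u r x))) + lam * norm (mk (u r)))^2"
     using lam by (intro power_mono) auto
    ultimately show "(L2_norm \<Omega> (%x. \<beta> (u r x)))^2 <= a * (norm (W r))^2 + b" using ab(3)[OF r] by simp
   qed
   also have "... = a * (LINT r|lebesgue_on ?I. (norm (W r))^2) + b * T"
    using wi bi T by (simp add: Bochner_Integration.integral_add measure_restrict_space)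
   also have "(LINT r|lebesgue_on ?I. (norm (W r))^2) = (LINT r|lebesgue_on {0..}. indicator ?I r * (norm (W r))^2)"
    by (rule lebesgue_on_indicator[symmetric]) (use t in auto)
   also have "... <= H" unfolding H_def
    by (rule integral_mono_AE') (use W_square_integrable in \<open>auto simp: indicator_def\<close>)
   finally show ?thesis using bu ab(1) by (simp add: C_def mult_left_mono)
  qed
  moreover have "C > 0" using ab H0 T by (simp add: C_def add_nonneg_pos)
  ultimately show ?thesis by blast
 qed
qed

end

theorem theorem1:
  fixes \<Omega> :: "'a::euclidean_space set"
    and s \<sigma> lam :: real
    and g ghat \<beta> \<beta>hat :: "real \<Rightarrow> real"
    and u0 :: "'a \<Rightarrow> real"
  assumes "bounded_smooth_domain \<Omega>"
    and "0 < s" "s < 1" "0 < \<sigma>" "\<sigma> < 1"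
    and "g C1_differentiable_on UNIV" and "g 0 = 0"
    and "0 \<le> lam" and "\<forall>r. - lam \<le> deriv g r"
    and "\<exists>\<kappa>>0. 0 < Liminf at_infinity
           (\<lambda>r. ereal (g r * r + (first_eigenvalue \<Omega> \<sigma> - \<kappa>) * r\<^sup>2))"
    and "\<forall>r. (ghat has_real_derivative g r) (at r)"
    and "\<forall>r. \<beta> r = g r + lam * r"
    and "\<forall>r. (\<beta>hat has_real_derivative \<beta> r) (at r)"
    and "u0 \<in> X0 \<Omega> \<sigma>"
    and "integrable (lebesgue_on \<Omega>) (\<lambda>x. \<beta>hat (u0 x))"
  shows "(\<exists>u w. weak_solution_from \<Omega> s \<sigma> g \<infinity> u0 u w) \<and>
    (\<forall>u w v z. weak_solution_from \<Omega> s \<sigma> g \<infinity> u0 u w \<and> weak_solution_from \<Omega> s \<sigma> g \<infinity> u0 v z \<longrightarrow>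
       (\<forall>t\<ge>0. AE x in lebesgue. u t x = v t x) \<and>
       (AE t in lebesgue_on {0<..}. AE x in lebesgue. w t x = z t x)) \<and>
    (\<forall>u w. weak_solution_from \<Omega> s \<sigma> g \<infinity> u0 u w \<longrightarrow>
       (\<forall>t\<ge>0. integrable (lebesgue_on \<Omega>) (\<lambda>x. ghat (u t x))) \<and>
       antimono_on {0..} (\<lambda>t. energy \<Omega> \<sigma> ghat (u t)) \<and>
       (\<forall>t\<ge>0. continuous (at_right t) (\<lambda>r. energy \<Omega> \<sigma> ghat (u r))) \<and>
       (AE t in lebesgue_on {0<..}. (\<lambda>r. energy \<Omega> \<sigma> ghat (u r)) differentiable (at t)) \<and>
       (\<forall>t\<ge>0. ((\<lambda>r. X0_norm \<sigma> (\<lambda>x. u r x - u t x)) \<longlongrightarrow> 0) (at_right t)) \<and>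
       (AE t in lebesgue_on {0<..}.
          (X0_norm s (w t))\<^sup>2 + deriv (\<lambda>r. energy \<Omega> \<sigma> ghat (u r)) t \<le> 0) \<and>
       (\<forall>u'. L2_time_derivative \<Omega> s {0<..} u u' \<longrightarrow>
          (AE t in lebesgue_on {0<..}. u' t (w t) \<ge> deriv (\<lambda>r. energy \<Omega> \<sigma> ghat (u r)) t)) \<and>
       (\<forall>\<tau> t. 0 \<le> \<tau> \<and> \<tau> \<le> t \<longrightarrow>
          (\<integral>r. (X0_norm s (w r))\<^sup>2 \<partial>lebesgue_on {\<tau>..t}) + energy \<Omega> \<sigma> ghat (u t)
            \<le> energy \<Omega> \<sigma> ghat (u \<tau>)) \<and>
       (\<forall>T>0. \<exists>C>0. \<forall>t\<ge>0.
          bochner_L2 (L2 \<Omega>) (L2_norm \<Omega>) {t<..<t + T} (\<lambda>\<tau> x. \<beta> (u \<tau> x)) \<and>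
          (\<integral>\<tau>. (L2_norm \<Omega> (\<lambda>x. \<beta> (u \<tau> x)))\<^sup>2 \<partial>lebesgue_on {t<..<t + T}) \<le> C))"
proof -
 obtain \<kappa> where \<kappa>: "\<kappa> > 0" "0 < Liminf at_infinity (%r. ereal (g r * r + (first_eigenvalue \<Omega> \<sigma> - \<kappa>) * r^2))"
  using assms(10) by blast
 interpret cahn_hilliard \<Omega> s \<sigma> lam \<kappa> g ghat \<beta> \<beta>hat
  using assms \<kappa> by unfold_locales (auto simp: bounded_smooth_domain_def)
 have "integrable lebesgue (%x. B (u0 x))" using integrable_\<beta>hat_iff[OF assms(14)] assms(15) by blast
 then obtain u w U where flow: "cahn_hilliard_flow \<Omega> s \<sigma> lam \<kappa> g ghat \<beta> \<beta>hat u w U" and init: "u 0 = u0"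
  by (rule flow_exists[OF assms(14)])
 interpret cahn_hilliard_flow \<Omega> s \<sigma> lam \<kappa> g ghat \<beta> \<beta>hat u w U by (rule flow)
 have ex: "weak_solution_from \<Omega> s \<sigma> g \<infinity> u0 u w" using flow_weak_solution by (simp add: init)
 have uniq: "(\<forall>t\<ge>0. AE x in lebesgue. v t x = v2 t x) & (AE t in lebesgue_on {0<..}. AE x in lebesgue. z t x = z2 t x)"
  if "weak_solution_from \<Omega> s \<sigma> g \<infinity> u0 v z" "weak_solution_from \<Omega> s \<sigma> g \<infinity> u0 v2 z2" for v z v2 z2
 proof (intro conjI allI impI)
  note U1 = weak_solution_unique[OF that(1)[folded init]] and U2 = weak_solution_unique[OF that(2)[folded init]]
  show "AE x in lebesgue. v t x = v2 t x" if "0 <= t" for t using U1(2)[OF that] U2(2)[OF that] by eventually_elim simp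
  show "AE t in lebesgue_on {0<..}. AE x in lebesgue. z t x = z2 t x"
   using U1(3) U2(3)
  proof eventually_elim
   case (elim t)
   hence "AE x in lebesgue. z t x = w t x" "AE x in lebesgue. z2 t x = w t x" by auto
   thus ?case by eventually_elim simp
  qed
 qed
 \<comment> \<open>An arbitrary weak solution carries the structure of the flow with the same
   \<open>w\<close>, and its own second component agrees with \<open>w\<close> almost everywhere; so
   the properties hold for it and not only for the constructed solution.\<close>
 note props = cahn_hilliard_flow.flow_properties[OF weak_solution_flow weak_solution_unique(3), unfolded init]
 show ?thesis
 proof (intro conjI allI impI, goal_cases)
  case 1 show ?case using ex by blast
 next
  case (2 v z v2 z2 t) thus ?case using uniq by blast
 next
  case (3 v z v2 z2) thus ?case using uniq by blast
 next
  case (4 v z t) show ?case by (rule props(1)[OF 4(1) 4(1) 4(2)])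
 next
  case (5 v z) show ?case by (rule props(2)[OF 5 5])
 next
  case (6 v z t) show ?case by (rule props(3)[OF 6(1) 6(1) 6(2)])
 next
  case (7 v z) show ?case by (rule props(4)[OF 7 7])
 next
  case (8 v z t) show ?case by (rule props(5)[OF 8(1) 8(1) 8(2)])
 next
  case (9 v z) show ?case by (rule props(6)[OF 9 9])
 next
  case (10 v z v') show ?case by (rule props(7)[OF 10(1) 10(1) 10(2)])
 next
  case (11 v z \<tau> t) thus ?case using props(8)[OF 11(1) 11(1)] by blast
 next
  case (12 v z T) show ?case by (rule props(9)[OF 12(1) 12(1) 12(2)])
 qed
qed

end
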